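(* Let $0<T\le\infty$. Suppose $w_1$ and $w_2$ are respectively a weak sub-solution and a weak super-solution in $\Omega\times(0,T)$ of the evolution equation $$w_t-\Delta_p w+\alpha(x,w)=0,$$ with $w_1\le w_2$ on the parabolic boundary $(\bar\Omega\times\{0\})\cup(\partial\Omega\times(0,T))$. Then $w_1\le w_2$ in $\Omega\times(0,T)$.
   Context: Let $1<p<\infty$, let $\Omega\subset\mathbb{R}^n$ be a bounded smooth domain, and $\Delta_p w=\operatorname{div}(|\nabla w|^{p-2}\nabla w)$ (derivatives in $x$). The function $\alpha$ is continuous and there is a constant $K\ge 0$ such that $0\le\alpha(x,w)\le Kw$ for all $x\in\Omega$, $w\ge 0$, and $|\alpha(x,r_2)-\alpha(x,r_1)|\le K|r_2-r_1|$ for all $x\in\Omega$, $r_1,r_2\in\mathbb{R}$. Weak sub-solution: $w\in L^2(0,T;W^{1,p}(\Omega))$ such that for every region $V\subset\subset\Omega$, all times $0\le t_1<t_2\le T$, and every test function $\varphi\in L^2(0,T;W^{1,p}(\Omega))$ with $\varphi_t\in L^2(\Omega\times(0,T))$, $\varphi\ge 0$, and $\varphi$ vanishing outside $V$, $$\int_V w\varphi\Big|_{t_1}^{t_2}+\int_{t_1}^{t_2}\int_V -w\varphi_t+|\nabla w|^{p-2}\nabla w\cdot\nabla\varphi+\alpha(x,w)\varphi\le 0,$$ and in particular $$\int_0^T\int_\Omega -w\varphi_t+|\nabla w|^{p-2}\nabla w\cdot\nabla\varphi+\alpha(x,w)\varphi\le 0$$ for every $\varphi\in L^2_0(0,T;W^{1,p}(\Omega))$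 with $\varphi_t\in L^2(\Omega\times(0,T))$ and $\varphi\ge0$, where $L^2_0(0,T;W^{1,p}(\Omega))$ is the set of functions in $L^2(0,T;W^{1,p}(\Omega))$ that equal zero on the boundary of $\Omega\times[0,T]$. A weak super-solution is defined with the reversed inequalities. If $T=\infty$, these notions are understood on every finite time interval. *)

theory Defs
  imports "HOL-Analysis.Analysis"
begin

text \<open>Elements of Lebesgue and Sobolev spaces are represented by Borel functions. Weak derivatives
  are handled relationally (``\<open>g\<close> is a weak derivative of \<open>f\<close>''); they are unique up to null sets.
  A function on space-time takes arguments \<open>(x, t)\<close> with \<open>x\<close> in the space \<open>'a\<close> of dimension
  \<open>n = DIM('a)\<close>.\<close>

subsection \<open>Smooth functions and smooth domains\<close>

primrec Ck_on :: "nat \<Rightarrow> 'a::euclidean_space set \<Rightarrow> ('a \<Rightarrow> real) \<Rightarrow> bool" where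
  "Ck_on 0 U f \<longleftrightarrow> continuous_on U f"
| "Ck_on (Suc k) U f \<longleftrightarrow>
     (\<forall>x\<in>U. f differentiable (at x)) \<and> (\<forall>v. Ck_on k U (\<lambda>x. frechet_derivative f (at x) v))"

definition smooth_on :: "'a::euclidean_space set \<Rightarrow> ('a \<Rightarrow> real) \<Rightarrow> bool" where
  "smooth_on U f \<longleftrightarrow> (\<forall>k. Ck_on k U f)"

definition gradient :: "('a::euclidean_space \<Rightarrow> real) \<Rightarrow> 'a \<Rightarrow> 'a" where
  "gradient f x = (\<Sum>i\<in>Basis. frechet_derivative f (at x) i *\<^sub>R i)"

definition bounded_smooth_domain :: "'a::euclidean_space set \<Rightarrow> bool" where
  "bounded_smooth_domain \<Omega> \<longleftrightarrow>
     open \<Omega> \<and> connected \<Omega> \<and> \<Omega> \<noteq> {} \<and> bounded \<Omega> \<and>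
     (\<forall>x\<in>frontier \<Omega>. \<exists>U \<rho>. open U \<and> x \<in> U \<and> smooth_on U \<rho> \<and> (\<forall>y\<in>U. gradient \<rho> y \<noteq> 0) \<and>
        \<Omega> \<inter> U = {y\<in>U. \<rho> y < 0} \<and> frontier \<Omega> \<inter> U = {y\<in>U. \<rho> y = 0})"

definition test_smooth :: "'a::euclidean_space set \<Rightarrow> ('a \<Rightarrow> real) \<Rightarrow> bool" where
  "test_smooth U \<zeta> \<longleftrightarrow>
     smooth_on UNIV \<zeta> \<and> compact (closure {x. \<zeta> x \<noteq> 0}) \<and> closure {x. \<zeta> x \<noteq> 0} \<subseteq> U"

subsection \<open>Lebesgue and Sobolev spaces\<close>

definition Lp_on :: "real \<Rightarrow> 'a::euclidean_space set \<Rightarrow> ('a \<Rightarrow> 'b::euclidean_space) \<Rightarrow> bool" where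
  "Lp_on p U f \<longleftrightarrow>
     set_borel_measurable lborel U f \<and> set_integrable lborel U (\<lambda>x. norm (f x) powr p)"

definition weak_deriv ::
  "'a::euclidean_space set \<Rightarrow> 'a \<Rightarrow> ('a \<Rightarrow> real) \<Rightarrow> ('a \<Rightarrow> real) \<Rightarrow> bool" where
  "weak_deriv U v f g \<longleftrightarrow>
     (\<forall>C. compact C \<and> C \<subseteq> U \<longrightarrow> set_integrable lborel C f \<and> set_integrable lborel C g) \<and>
     (\<forall>\<zeta>. test_smooth U \<zeta> \<longrightarrow>
        (LINT x:U|lborel. f x * frechet_derivative \<zeta> (at x) v) = - (LINT x:U|lborel. g x * \<zeta> x))"

text \<open>\<open>u\<close> belongs to $W^{1,p}(\Omega)$ and \<open>Du\<close> is its weak gradient.\<close>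

definition W1p ::
  "real \<Rightarrow> 'a::euclidean_space set \<Rightarrow> ('a \<Rightarrow> real) \<Rightarrow> ('a \<Rightarrow> 'a) \<Rightarrow> bool" where
  "W1p p \<Omega> u Du \<longleftrightarrow>
     Lp_on p \<Omega> u \<and> Lp_on p \<Omega> Du \<and> (\<forall>i\<in>Basis. weak_deriv \<Omega> i u (\<lambda>x. Du x \<bullet> i))"

definition W1p_norm ::
  "real \<Rightarrow> 'a::euclidean_space set \<Rightarrow> ('a \<Rightarrow> real) \<Rightarrow> ('a \<Rightarrow> 'a) \<Rightarrow> real" where
  "W1p_norm p \<Omega> u Du =
     ((LINT x:\<Omega>|lborel. \<bar>u x\<bar> powr p) + (LINT x:\<Omega>|lborel. norm (Du x) powr p)) powr (1 / p)"

text \<open>Vanishing on the boundary is membership in $W^{1,p}_0(\Omega)$, the closure of the smooth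
  functions with compact support in \<open>\<Omega>\<close>.\<close>

definition W1p_0 ::
  "real \<Rightarrow> 'a::euclidean_space set \<Rightarrow> ('a \<Rightarrow> real) \<Rightarrow> ('a \<Rightarrow> 'a) \<Rightarrow> bool" where
  "W1p_0 p \<Omega> u Du \<longleftrightarrow>
     W1p p \<Omega> u Du \<and>
     (\<exists>\<zeta>. (\<forall>k::nat. test_smooth \<Omega> (\<zeta> k)) \<and>
        (\<lambda>k. W1p_norm p \<Omega> (\<lambda>x. u x - \<zeta> k x) (\<lambda>x. Du x - gradient (\<zeta> k) x)) \<longlonglongrightarrow> 0)"

text \<open>\<open>u\<close> belongs to $L^2(0,T;W^{1,p}(\Omega))$ and \<open>Du\<close> is its weak gradient in \<open>x\<close>. The times \<open>0\<close> and
  \<open>T\<close> are included in the measurability of \<open>u\<close> because its values there are used below.\<close>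

definition L2_W1p ::
  "real \<Rightarrow> 'a::euclidean_space set \<Rightarrow> real \<Rightarrow> ('a \<times> real \<Rightarrow> real) \<Rightarrow> ('a \<times> real \<Rightarrow> 'a) \<Rightarrow> bool" where
  "L2_W1p p \<Omega> T u Du \<longleftrightarrow>
     set_borel_measurable lborel (\<Omega> \<times> {0..T}) u \<and>
     set_borel_measurable lborel (\<Omega> \<times> {0<..<T}) Du \<and>
     (AE t in lborel. t \<in> {0<..<T} \<longrightarrow> W1p p \<Omega> (\<lambda>x. u (x, t)) (\<lambda>x. Du (x, t))) \<and>
     set_integrable lborel {0<..<T} (\<lambda>t. (W1p_norm p \<Omega> (\<lambda>x. u (x, t)) (\<lambda>x. Du (x, t)))\<^sup>2)"

subsection \<open>Weak sub- and super-solutions\<close>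

text \<open>Nonnegative \<open>\<phi>\<close> in $L^2(0,T;W^{1,p}(\Omega))$ with weak gradient \<open>D\<phi>\<close> in \<open>x\<close> and weak time derivative
  \<open>\<phi>t\<close> in $L^2(\Omega\times(0,T))$. Such a function has a unique representative that is continuous in
  time with values in $L^1(\Omega)$; the last two conditions select it, so that \<open>\<phi>\<close> can be evaluated
  at each single time.\<close>

definition test_function ::
  "real \<Rightarrow> 'a::euclidean_space set \<Rightarrow> real \<Rightarrow> ('a \<times> real \<Rightarrow> real) \<Rightarrow> ('a \<times> real \<Rightarrow> 'a) \<Rightarrow>
     ('a \<times> real \<Rightarrow> real) \<Rightarrow> bool" where
  "test_function p \<Omega> T \<phi> D\<phi> \<phi>t \<longleftrightarrow>
     L2_W1p p \<Omega> T \<phi> D\<phi> \<and>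
     weak_deriv (\<Omega> \<times> {0<..<T}) (0, 1) \<phi> \<phi>t \<and> Lp_on 2 (\<Omega> \<times> {0<..<T}) \<phi>t \<and>
     (\<forall>x\<in>\<Omega>. \<forall>t\<in>{0..T}. 0 \<le> \<phi> (x, t)) \<and>
     (\<forall>t\<in>{0..T}. set_integrable lborel \<Omega> (\<lambda>x. \<phi> (x, t))) \<and>
     (\<forall>s\<in>{0..T}. ((\<lambda>t. LINT x:\<Omega>|lborel. \<bar>\<phi> (x, t) - \<phi> (x, s)\<bar>) \<longlongrightarrow> 0) (at s within {0..T}))"

text \<open>\<open>\<phi>\<close> vanishes on the whole boundary of \<open>\<Omega> \<times> [0, T]\<close>, top and bottom included.\<close>

definition zero_on_boundary ::
  "real \<Rightarrow> 'a::euclidean_space set \<Rightarrow> real \<Rightarrow> ('a \<times> real \<Rightarrow> real) \<Rightarrow> ('a \<times> real \<Rightarrow> 'a) \<Rightarrow> bool" where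
  "zero_on_boundary p \<Omega> T \<phi> D\<phi> \<longleftrightarrow>
     (AE t in lborel. t \<in> {0<..<T} \<longrightarrow> W1p_0 p \<Omega> (\<lambda>x. \<phi> (x, t)) (\<lambda>x. D\<phi> (x, t))) \<and>
     (AE x in lborel. x \<in> \<Omega> \<longrightarrow> \<phi> (x, 0) = 0 \<and> \<phi> (x, T) = 0)"

definition weak_integrand ::
  "real \<Rightarrow> ('a::euclidean_space \<Rightarrow> real \<Rightarrow> real) \<Rightarrow> ('a \<times> real \<Rightarrow> real) \<Rightarrow> ('a \<times> real \<Rightarrow> 'a) \<Rightarrow>
     ('a \<times> real \<Rightarrow> real) \<Rightarrow> ('a \<times> real \<Rightarrow> 'a) \<Rightarrow> ('a \<times> real \<Rightarrow> real) \<Rightarrow> 'a \<times> real \<Rightarrow> real" where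
  "weak_integrand p \<alpha> w Dw \<phi> D\<phi> \<phi>t z =
     - w z * \<phi>t z + ((norm (Dw z) powr (p - 2)) *\<^sub>R Dw z) \<bullet> D\<phi> z + \<alpha> (fst z) (w z) * \<phi> z"

text \<open>\<open>R\<close> is \<open>\<le>\<close> for sub-solutions and \<open>\<ge>\<close> for super-solutions. That an integral inequality holds
  includes that its integrals exist: for \<open>p\<close> greater than \<open>2\<close> or close to \<open>1\<close> this does not follow
  from the membership of \<open>w\<close> and \<open>\<phi>\<close> in $L^2(0,T;W^{1,p}(\Omega))$, and nonexistent integrals are \<open>0\<close> by
  convention in HOL.\<close>

definition weak_ineq ::
  "(real \<Rightarrow> real \<Rightarrow> bool) \<Rightarrow> real \<Rightarrow> ('a::euclidean_space \<Rightarrow> real \<Rightarrow> real) \<Rightarrow> 'a set \<Rightarrow> real \<Rightarrow>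
     ('a \<times> real \<Rightarrow> real) \<Rightarrow> bool" where
  "weak_ineq R p \<alpha> \<Omega> T w \<longleftrightarrow>
     (\<exists>Dw. L2_W1p p \<Omega> T w Dw \<and>
       (\<forall>V t\<^sub>1 t\<^sub>2 \<phi> D\<phi> \<phi>t.
          open V \<and> connected V \<and> compact (closure V) \<and> closure V \<subseteq> \<Omega> \<and>
          0 \<le> t\<^sub>1 \<and> t\<^sub>1 < t\<^sub>2 \<and> t\<^sub>2 \<le> T \<and>
          test_function p \<Omega> T \<phi> D\<phi> \<phi>t \<and> (\<forall>x\<in>\<Omega> - V. \<forall>t\<in>{0..T}. \<phi> (x, t) = 0) \<longrightarrow>
          set_integrable lborel V (\<lambda>x. w (x, t\<^sub>1) * \<phi> (x, t\<^sub>1)) \<and>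
          set_integrable lborel V (\<lambda>x. w (x, t\<^sub>2) * \<phi> (x, t\<^sub>2)) \<and>
          set_integrable lborel (V \<times> {t\<^sub>1<..<t\<^sub>2}) (weak_integrand p \<alpha> w Dw \<phi> D\<phi> \<phi>t) \<and>
          R ((LINT x:V|lborel. w (x, t\<^sub>2) * \<phi> (x, t\<^sub>2)) - (LINT x:V|lborel. w (x, t\<^sub>1) * \<phi> (x, t\<^sub>1))
             + (LINT z:V \<times> {t\<^sub>1<..<t\<^sub>2}|lborel. weak_integrand p \<alpha> w Dw \<phi> D\<phi> \<phi>t z)) 0) \<and>
       (\<forall>\<phi> D\<phi> \<phi>t.
          test_function p \<Omega> T \<phi> D\<phi> \<phi>t \<and> zero_on_boundary p \<Omega> T \<phi> D\<phi> \<longrightarrow>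
          set_integrable lborel (\<Omega> \<times> {0<..<T}) (weak_integrand p \<alpha> w Dw \<phi> D\<phi> \<phi>t) \<and>
          R (LINT z:\<Omega> \<times> {0<..<T}|lborel. weak_integrand p \<alpha> w Dw \<phi> D\<phi> \<phi>t z) 0))"

definition weak_subsolution ::
  "real \<Rightarrow> ('a::euclidean_space \<Rightarrow> real \<Rightarrow> real) \<Rightarrow> 'a set \<Rightarrow> ereal \<Rightarrow> ('a \<times> real \<Rightarrow> real) \<Rightarrow> bool" where
  "weak_subsolution p \<alpha> \<Omega> T w \<longleftrightarrow>
     (if T = \<infinity> then \<forall>S>0. weak_ineq (\<le>) p \<alpha> \<Omega> S w else weak_ineq (\<le>) p \<alpha> \<Omega> (real_of_ereal T) w)"

definition weak_supersolution ::
  "real \<Rightarrow> ('a::euclidean_space \<Rightarrow> real \<Rightarrow> real) \<Rightarrow> 'a set \<Rightarrow> ereal \<Rightarrow> ('a \<times> real \<Rightarrow> real) \<Rightarrow> bool" where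
  "weak_supersolution p \<alpha> \<Omega> T w \<longleftrightarrow>
     (if T = \<infinity> then \<forall>S>0. weak_ineq (\<ge>) p \<alpha> \<Omega> S w else weak_ineq (\<ge>) p \<alpha> \<Omega> (real_of_ereal T) w)"

text \<open>On the lateral boundary, \<open>w\<^sub>1 \<le> w\<^sub>2\<close> is understood in the usual Sobolev sense: the positive part
  of \<open>w\<^sub>1 - w\<^sub>2\<close> vanishes there, that is, it belongs to $W^{1,p}_0(\Omega)$ (cf. Gilbarg and Trudinger,
  Section 8.1).\<close>

definition le_on_parabolic_boundary ::
  "real \<Rightarrow> 'a::euclidean_space set \<Rightarrow> ereal \<Rightarrow> ('a \<times> real \<Rightarrow> real) \<Rightarrow> ('a \<times> real \<Rightarrow> real) \<Rightarrow> bool" where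
  "le_on_parabolic_boundary p \<Omega> T w\<^sub>1 w\<^sub>2 \<longleftrightarrow>
     (AE x in lborel. x \<in> closure \<Omega> \<longrightarrow> w\<^sub>1 (x, 0) \<le> w\<^sub>2 (x, 0)) \<and>
     (AE t in lborel. 0 < t \<and> ereal t < T \<longrightarrow>
        (\<exists>D. W1p_0 p \<Omega> (\<lambda>x. max (w\<^sub>1 (x, t) - w\<^sub>2 (x, t)) 0) D))"

end

theory Submission
  imports Defs
begin

text \<open>Let \<open>u\<close> be the difference of the sub-solution and the super-solution. It satisfies
\<open>u_t - div (A\<^sub>1 - A\<^sub>2) + (\<beta>\<^sub>1 - \<beta>\<^sub>2) \<le> 0\<close> weakly, where \<open>A\<^sub>j\<close> is the flux and \<open>\<beta>\<^sub>j\<close> the zeroth-order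
term. The flux is monotone (\<open>flux_monotone\<close>) and \<open>\<bar>\<beta>\<^sub>1 - \<beta>\<^sub>2\<bar> \<le> K \<bar>u\<bar>\<close>. Take a bounded nondecreasing function
\<open>trunc\<close> that vanishes on the negative half line, and let \<open>prim\<close> be its primitive. Formally, testing
with \<open>trunc u\<close>, which vanishes on the lateral boundary, shows that the energy \<open>\<integral> prim u dx\<close> has a time
derivative of at most \<open>3 K\<close> times itself. It vanishes initially, hence always, and so \<open>u \<le> 0\<close>.

To make this rigorous without a time derivative of \<open>u\<close>, the test function is frozen: on a short
interval \<open>(t - h, t)\<close> the weak inequality is tested with the stationary function \<open>trunc (u (\<cdot>, t))\<close>.
Convexity of \<open>prim\<close> still bounds the increase of the energy (\<open>frozen_test_inequality\<close>). The price is
the change of \<open>A\<^sub>1 - A\<^sub>2\<close> and \<open>\<beta>\<^sub>1 - \<beta>\<^sub>2\<close> over times shorter than \<open>h\<close>, paired with the test function and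
its gradient. After integration over \<open>t\<close> this is \<open>o(h)\<close> by the continuity of translations
(\<open>difference_time_modulus\<close>), and a Gronwall argument with an exponential weight concludes for almost
every time (\<open>weighted_gronwall\<close>, \<open>comparison_almost_every_time\<close>). From there, the weak inequality on
intervals that shrink to their right end point reaches every single time (\<open>comparison_every_time\<close>).

Two points need more than this. First, the pairing of the flux with a gradient at another time
makes sense only if the flux is square integrable in time with values in the dual Lebesgue space,
that is, if the power \<open>2 (p - 1)\<close> of the $L^p$ norm of the gradient is integrable in time. For
\<open>p > 2\<close> membership in $L^2(0,T;W^{1,p}(\Omega))$ does not give that. But the integrals in the weak inequality
have to exist for all test functions, and this is a strong condition (\<open>gradient_time_integrability\<close>):
if the integrability failed, disjoint time intervals would each carry a large part of the divergent
integral, and on each of them there would be a uniformly small, rapidly oscillating test function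
whose gradient picks up a fixed amount of it. The sum of these humps is a test function for which
the integral does not exist. Second, the boundary condition provides some weak gradient of the
positive part of \<open>u\<close>. It equals the gradient of \<open>u\<close> where \<open>u > 0\<close>, because weak derivatives are limits of
difference quotients (\<open>weak_deriv_difference_quotient\<close>, \<open>weak_deriv_positive_part\<close>).\<close>

section \<open>Smooth functions\<close>

abbreviation smooth :: "('a::euclidean_space \<Rightarrow> real) \<Rightarrow> bool" where
  "smooth \<equiv> smooth_on UNIV"

lemma Ck_on_SucI:
  assumes "\<And>x. (f has_derivative f' x) (at x)" "\<And>v. Ck_on k UNIV (\<lambda>x. f' x v)"
  shows "Ck_on (Suc k) UNIV f"
proof -
  have "frechet_derivative f (at x) = f' x" for x
    using assms(1) frechet_derivative_at by metis
  then show ?thesis using assms by (auto simp: differentiable_def)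
qed

lemma Ck_on_Suc_has_derivative:
  assumes "Ck_on (Suc k) UNIV f"
  shows "(f has_derivative frechet_derivative f (at x)) (at x)"
  using assms by (simp add: frechet_derivative_works)

lemma Ck_on_SucD: "Ck_on (Suc k) UNIV f \<Longrightarrow> Ck_on k UNIV f"
proof (induction k arbitrary: f)
  case 0
  then show ?case by (auto intro!: continuous_at_imp_continuous_on differentiable_imp_continuous_within)
next
  case (Suc k)
  then show ?case by simp
qed

lemma Ck_on_const: "Ck_on k UNIV (\<lambda>x::'a::euclidean_space. c)"
proof (induction k arbitrary: c)
  case (Suc k)
  show ?case by (rule Ck_on_SucI[where f'="\<lambda>_ _. 0"]) (auto intro: Suc)
qed simp

lemma Ck_on_bounded_linear:
  assumes "bounded_linear f" shows "Ck_on k UNIV f"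
proof (cases k)
  case 0
  then show ?thesis using assms by (simp add: linear_continuous_on)
next
  case (Suc m)
  then show ?thesis
    using Ck_on_SucI[of f "\<lambda>_. f"] assms bounded_linear_imp_has_derivative Ck_on_const by metis
qed

lemma Ck_on_add:
  assumes "Ck_on k UNIV f" "Ck_on k UNIV g" shows "Ck_on k UNIV (\<lambda>x. f x + g x)"
  using assms
proof (induction k arbitrary: f g)
  case 0
  then show ?case by (auto intro: continuous_intros)
next
  case (Suc k)
  show ?case
  proof (rule Ck_on_SucI)
    show "((\<lambda>x. f x + g x) has_derivative (\<lambda>v. frechet_derivative f (at x) v + frechet_derivative g (at x) v)) (at x)" for x
      by (rule has_derivative_add Suc.prems[THEN Ck_on_Suc_has_derivative])+
    show "Ck_on k UNIV (\<lambda>x. frechet_derivative f (at x) v + frechet_derivative g (at x) v)" for v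
      using Suc.prems by (auto intro: Suc.IH)
  qed
qed

lemma Ck_on_mult:
  assumes "Ck_on k UNIV f" "Ck_on k UNIV g" shows "Ck_on k UNIV (\<lambda>x. f x * g x)"
  using assms
proof (induction k arbitrary: f g)
  case 0
  then show ?case by (auto intro: continuous_intros)
next
  case (Suc k)
  show ?case
  proof (rule Ck_on_SucI)
    show "((\<lambda>x. f x * g x) has_derivative (\<lambda>v. f x * frechet_derivative g (at x) v + frechet_derivative f (at x) v * g x)) (at x)" for x
      by (rule has_derivative_mult Suc.prems[THEN Ck_on_Suc_has_derivative])+
    show "Ck_on k UNIV (\<lambda>x. f x * frechet_derivative g (at x) v + frechet_derivative f (at x) v * g x)" for v
      using Suc.prems Suc.prems[THEN Ck_on_SucD] by (intro Ck_on_add Suc.IH) auto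
  qed
qed

text \<open>A sequence of functions of one variable, each of which has a derivative in the linear span of
  the sequence, consists of smooth functions; this covers both the trigonometric functions and
  the functions that build the bumps below.\<close>

lemma Ck_on_compose_family:
  fixes e :: "nat \<Rightarrow> real \<Rightarrow> real"
  assumes e: "\<And>m s. (e m has_real_derivative (a m * e (i m) s + b m * e (j m) s)) (at s)"
    and f: "\<And>k. Ck_on k UNIV f"
  shows "Ck_on k UNIV (\<lambda>x. e m (f x))"
proof (induction k arbitrary: m)
  case 0
  have "continuous_on UNIV (e m)"
    using e by (meson DERIV_isCont continuous_at_imp_continuous_on)
  then show ?case using f[of 0] by (auto intro: continuous_on_compose2)
next
  case (Suc k)
  show ?case
  proof (rule Ck_on_SucI)
    show "((\<lambda>x. e m (f x)) has_derivative
        (\<lambda>v. (a m * e (i m) (f x) + b m * e (j m) (f x)) * frechet_derivative f (at x) v)) (at x)" for x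
      by (rule has_derivative_eq_rhs[OF DERIV_compose_FDERIV[OF e Ck_on_Suc_has_derivative[OF f]]])
         (auto simp: mult.commute)
    show "Ck_on k UNIV (\<lambda>x. (a m * e (i m) (f x) + b m * e (j m) (f x)) * frechet_derivative f (at x) v)" for v
      by (intro Ck_on_add Ck_on_mult Ck_on_const Suc) (use f[of "Suc k"] in auto)
  qed
qed

lemma smooth_const [intro!]: "smooth (\<lambda>x. c)"
  and smooth_bounded_linear: "bounded_linear f \<Longrightarrow> smooth f"
  and smooth_add [intro!]: "smooth f \<Longrightarrow> smooth g \<Longrightarrow> smooth (\<lambda>x. f x + g x)"
  and smooth_mult [intro!]: "smooth f \<Longrightarrow> smooth g \<Longrightarrow> smooth (\<lambda>x. f x * g x)"
  by (auto simp: smooth_on_def intro: Ck_on_const Ck_on_bounded_linear Ck_on_add Ck_on_mult)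

lemma smooth_inner [intro!]: "smooth (\<lambda>x. x \<bullet> i)"
  by (intro smooth_bounded_linear bounded_linear_inner_left)

lemma smooth_diff [intro!]: "smooth f \<Longrightarrow> smooth g \<Longrightarrow> smooth (\<lambda>x. f x - g x)"
  using smooth_add[OF _ smooth_mult[OF smooth_const[of "-1"]], of f g] by simp

lemma smooth_prod [intro!]: "(\<And>i. i \<in> A \<Longrightarrow> smooth (f i)) \<Longrightarrow> smooth (\<lambda>x. \<Prod>i\<in>A. f i x)"
  by (induction A rule: infinite_finite_induct) auto

lemma smooth_has_derivative: "smooth f \<Longrightarrow> (f has_derivative frechet_derivative f (at x)) (at x)"
  using Ck_on_Suc_has_derivative unfolding smooth_on_def by blast

lemma smooth_deriv: "smooth f \<Longrightarrow> smooth (\<lambda>x. frechet_derivative f (at x) v)"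
  unfolding smooth_on_def by (metis Ck_on.simps(2))

lemma smooth_continuous: "smooth f \<Longrightarrow> continuous_on A f"
  unfolding smooth_on_def by (metis Ck_on.simps(1) continuous_on_subset subset_UNIV)

lemma Ck_on_affine:
  fixes L :: "'a::euclidean_space \<Rightarrow> 'b::euclidean_space"
  assumes "bounded_linear L" "Ck_on k UNIV f"
  shows "Ck_on k UNIV (\<lambda>x. f (L x + c))"
  using assms(2)
proof (induction k arbitrary: f)
  case 0
  then show ?case
    using linear_continuous_on[OF assms(1), of UNIV]
    by (auto intro!: continuous_on_compose2[of UNIV f] continuous_on_add continuous_on_const)
next
  case (Suc k)
  show ?case
  proof (rule Ck_on_SucI)
    have "((\<lambda>x. L x + c) has_derivative L) (at x)" for x
      using bounded_linear_imp_has_derivative[OF assms(1)] by (auto intro!: derivative_eq_intros)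
    then show "((\<lambda>x. f (L x + c)) has_derivative (\<lambda>v. frechet_derivative f (at (L x + c)) (L v))) (at x)" for x
      using has_derivative_compose[of "\<lambda>x. L x + c" L x UNIV f] Ck_on_Suc_has_derivative[OF Suc.prems] by blast
    show "Ck_on k UNIV (\<lambda>x. frechet_derivative f (at (L x + c)) (L v))" for v
      using Suc.prems by (intro Suc.IH[of "\<lambda>y. frechet_derivative f (at y) (L v)"]) simp
  qed
qed

lemma smooth_affine: "bounded_linear L \<Longrightarrow> smooth f \<Longrightarrow> smooth (\<lambda>x. f (L x + c))"
  by (auto simp: smooth_on_def intro: Ck_on_affine)

lemma smooth_sin: "smooth f \<Longrightarrow> smooth (\<lambda>x. sin (f x))"
  and smooth_cos: "smooth f \<Longrightarrow> smooth (\<lambda>x. cos (f x))"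
proof -
  let ?e = "\<lambda>m::nat. if m = 0 then sin else (cos :: real \<Rightarrow> real)"
  have "(?e m has_real_derivative ((if m = 0 then 1 else -1) * ?e (1 - m) s + 0 * ?e 0 s)) (at s)" for m s
    by (auto intro!: derivative_eq_intros)
  from Ck_on_compose_family[of ?e "\<lambda>m. if m = 0 then 1 else -1" "\<lambda>m. 1 - m" "\<lambda>_. 0" "\<lambda>_. 0", OF this]
  have *: "smooth f \<Longrightarrow> smooth (\<lambda>x. ?e m (f x))" for m unfolding smooth_on_def by blast
  show "smooth f \<Longrightarrow> smooth (\<lambda>x. sin (f x))" "smooth f \<Longrightarrow> smooth (\<lambda>x. cos (f x))"
    using *[of 0] *[of 1] by auto
qed

text \<open>The functions \<open>exp (- 1 / s) / s ^ m\<close>, extended by zero, are closed under differentiation up to linear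
  combinations; the smoothness of the classical function \<open>flat 0\<close> is therefore an instance of the lemma
  on such families.\<close>

definition flat :: "nat \<Rightarrow> real \<Rightarrow> real" where
  "flat m s = (if s \<le> 0 then 0 else inverse s ^ m * exp (- inverse s))"

lemma flat_tendsto_0: "((\<lambda>s. inverse s ^ m * exp (- inverse s)) \<longlongrightarrow> (0::real)) (at_right 0)"
proof -
  have "((\<lambda>x::real. x ^ m * exp (- x)) \<longlongrightarrow> 0) at_top"
    using tendsto_power_div_exp_0[of m] by (simp add: exp_minus divide_inverse)
  then show ?thesis
    using filterlim_compose[OF _ filterlim_inverse_at_top_right] by fastforce
qed

lemma flat_deriv: "(flat m has_real_derivative (- real m * flat (Suc m) s + 1 * flat (Suc (Suc m)) s)) (at s)"
proof -
  consider "s < 0" | "s > 0" | "s = 0" by linarith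
  then show ?thesis
  proof cases
    case 1
    have "(flat m has_real_derivative 0) (at s)"
      by (rule DERIV_cong_ev[THEN iffD1, OF refl _ refl DERIV_const[of 0]])
         (use 1 in \<open>auto simp: flat_def eventually_nhds intro!: exI[of _ "{..<0}"]\<close>)
    then show ?thesis using 1 by (simp add: flat_def)
  next
    case 2
    have "((\<lambda>s. inverse s ^ m * exp (- inverse s)) has_real_derivative
       (- real m * flat (Suc m) s + 1 * flat (Suc (Suc m)) s)) (at s)"
      using 2 by (auto intro!: derivative_eq_intros DERIV_inverse
          simp: flat_def algebra_simps power_Suc[symmetric] simp del: power_Suc)
         (cases m; simp add: algebra_simps)
    then show ?thesis
      by (rule DERIV_cong_ev[THEN iffD1, OF refl _ refl, rotated])
         (use 2 in \<open>auto simp: flat_def eventually_nhds intro!: exI[of _ "{0<..}"]\<close>)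
  next
    case 3
    have "((\<lambda>h. flat m h / h) \<longlongrightarrow> 0) (at_right 0)"
      by (rule Lim_transform_eventually[OF flat_tendsto_0[of "Suc m"]])
         (auto simp: flat_def field_simps eventually_at_right_less intro!: eventually_at_rightI[of 0 1])
    moreover have "((\<lambda>h. flat m h / h) \<longlongrightarrow> 0) (at_left 0)"
      by (rule Lim_transform_eventually[OF tendsto_const[of 0]])
         (auto simp: flat_def intro!: eventually_at_leftI[of "-1" 0])
    ultimately have "((\<lambda>h. flat m h / h) \<longlongrightarrow> 0) (at 0)"
      using filterlim_split_at_real by blast
    then show ?thesis using 3 by (simp add: DERIV_def flat_def)
  qed
qed

lemma smooth_flat [intro!]: "smooth f \<Longrightarrow> smooth (\<lambda>x. flat m (f x))"
  unfolding smooth_on_def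
  using Ck_on_compose_family[of flat "\<lambda>m. - real m" Suc "\<lambda>_. 1" "\<lambda>m. Suc (Suc m)", OF flat_deriv] by blast

lemma flat0_bounds: "0 \<le> flat 0 s" "flat 0 s \<le> 1" "0 < s \<Longrightarrow> 0 < flat 0 s" "s \<le> 0 \<Longrightarrow> flat 0 s = 0"
  by (auto simp: flat_def)

section \<open>Density of smooth functions with compact support\<close>

lemma test_smoothI:
  assumes "smooth f" "compact K" "K \<subseteq> U" "\<And>x. x \<notin> K \<Longrightarrow> f x = 0"
  shows "test_smooth U f"
proof -
  have K: "closure {x. f x \<noteq> 0} \<subseteq> K"
    using assms by (intro closure_minimal) (auto intro: compact_imp_closed)
  have "compact (K \<inter> closure {x. f x \<noteq> 0})" using assms(2) by (rule compact_Int_closed) simp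
  then have "compact (closure {x. f x \<noteq> 0})" using K by (simp add: inf.absorb2)
  then show ?thesis using assms(1,3) K unfolding test_smooth_def by auto
qed

lemma test_smooth_smooth: "test_smooth U f \<Longrightarrow> smooth f"
  by (simp add: test_smooth_def)

lemma test_smooth_support:
  assumes "test_smooth U f"
  obtains K where "compact K" "K \<subseteq> U" "\<And>x. x \<notin> K \<Longrightarrow> f x = 0"
proof (rule that[of "closure {x. f x \<noteq> 0}"])
  show "x \<notin> closure {x. f x \<noteq> 0} \<Longrightarrow> f x = 0" for x
    using closure_subset[of "{x. f x \<noteq> 0}"] by blast
qed (use assms in \<open>auto simp: test_smooth_def\<close>)

lemma test_smooth_outside: "test_smooth U f \<Longrightarrow> x \<notin> U \<Longrightarrow> f x = 0"
  using test_smooth_support by (metis subsetD)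

lemma test_smooth_mono: "test_smooth U f \<Longrightarrow> U \<subseteq> V \<Longrightarrow> test_smooth V f"
  unfolding test_smooth_def by auto

lemma test_smooth_zero: "test_smooth U (\<lambda>x. 0)"
  by (rule test_smoothI[of _ "{}"]) auto

lemma test_smooth_mult_left:
  assumes "smooth f" "test_smooth U g" shows "test_smooth U (\<lambda>x. f x * g x)"
proof -
  obtain K where K: "compact K" "K \<subseteq> U" "\<And>x. x \<notin> K \<Longrightarrow> g x = 0"
    using test_smooth_support[OF assms(2)] by blast
  show ?thesis
    by (rule test_smoothI[of _ K]) (use K assms test_smooth_smooth[OF assms(2)] in auto)
qed

lemma test_smooth_add:
  assumes "test_smooth U f" "test_smooth U g" shows "test_smooth U (\<lambda>x. f x + g x)"
proof -
  obtain K where K: "compact K" "K \<subseteq> U" "\<And>x. x \<notin> K \<Longrightarrow> f x = 0"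
    using test_smooth_support[OF assms(1)] by blast
  obtain L where L: "compact L" "L \<subseteq> U" "\<And>x. x \<notin> L \<Longrightarrow> g x = 0"
    using test_smooth_support[OF assms(2)] by blast
  show ?thesis
    by (rule test_smoothI[of _ "K \<union> L"])
       (use K L test_smooth_smooth[OF assms(1)] test_smooth_smooth[OF assms(2)] in auto)
qed

lemma test_smooth_sum: "(\<And>i. i \<in> A \<Longrightarrow> test_smooth U (f i)) \<Longrightarrow> test_smooth U (\<lambda>x. \<Sum>i\<in>A. f i x)"
  by (induction A rule: infinite_finite_induct) (auto intro: test_smooth_zero test_smooth_add)

text \<open>A product of one-dimensional bumps. The factor \<open>Suc n\<close> makes it converge to the indicator function
  of the open box as \<open>n\<close> grows, since \<open>exp (- 1 / (n s))\<close> tends to \<open>1\<close> for \<open>s > 0\<close>.\<close>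

definition bump :: "nat \<Rightarrow> 'a::euclidean_space \<Rightarrow> 'a \<Rightarrow> 'a \<Rightarrow> real" where
  "bump n a b x = (\<Prod>i\<in>Basis. flat 0 (real (Suc n) * (x \<bullet> i - a \<bullet> i)) * flat 0 (real (Suc n) * (b \<bullet> i - x \<bullet> i)))"

lemma smooth_bump: "smooth (bump n a b)"
  unfolding bump_def by auto

lemma bump_bounds: "0 \<le> bump n a b x" "bump n a b x \<le> 1"
  unfolding bump_def by (auto intro!: prod_nonneg prod_le_1 mult_le_one simp: flat0_bounds)

lemma bump_pos: "x \<in> box a b \<Longrightarrow> 0 < bump n a b x"
  unfolding bump_def by (auto intro!: prod_pos mult_pos_pos flat0_bounds(3) simp: mem_box)

lemma bump_eq_0: "x \<notin> box a b \<Longrightarrow> bump n a b x = 0"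
  unfolding bump_def
  by (auto simp: mem_box not_less intro!: prod_zero bexI flat0_bounds(4) mult_nonneg_nonpos simp del: of_nat_Suc)

lemma test_smooth_bump: "cbox a b \<subseteq> U \<Longrightarrow> test_smooth U (bump n a b)"
  by (rule test_smoothI[of _ "cbox a b"]) (use box_subset_cbox smooth_bump in \<open>auto intro!: bump_eq_0\<close>)

lemma bump_tendsto:
  assumes "x \<in> box a b" shows "(\<lambda>n. bump n a b x) \<longlonglongrightarrow> 1"
proof -
  have *: "(\<lambda>n. flat 0 (real (Suc n) * c)) \<longlonglongrightarrow> 1" if "0 < c" for c
  proof -
    have "(\<lambda>n. exp (- (inverse (real (Suc n)) * inverse c))) \<longlonglongrightarrow> exp (- (0 * inverse c))"
      by (intro tendsto_intros LIMSEQ_inverse_real_of_nat)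
    then show ?thesis using that by (simp add: flat_def not_le zero_less_mult_iff mult_le_0_iff del: of_nat_Suc)
  qed
  have "(\<lambda>n. bump n a b x) \<longlonglongrightarrow> (\<Prod>i\<in>(Basis::'a set). 1 * 1)"
    unfolding bump_def using assms by (intro tendsto_prod tendsto_mult *) (auto simp: mem_box)
  then show ?thesis by simp
qed

text \<open>Finitely many positive bumps cover the compact set, so that a large multiple of their sum is at
  least \<open>1\<close> there.\<close>

lemma compact_cutoff:
  fixes K U :: "'a::euclidean_space set"
  assumes "compact K" "K \<subseteq> U" "open U"
  obtains \<zeta> where "test_smooth U \<zeta>" "\<And>x. 0 \<le> \<zeta> x" "\<And>x. x \<in> K \<Longrightarrow> 1 \<le> \<zeta> x"
proof (cases "K = {}")
  case True
  then show ?thesis using that[of "\<lambda>x. 0"] test_smooth_zero by auto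
next
  case False
  have "\<exists>a b. x \<in> box a b \<and> cbox a b \<subseteq> U" if "x \<in> K" for x
  proof -
    have "x \<in> U" using that assms(2) by blast
    then obtain a b where "x \<in> box a b" "cbox a b \<subseteq> U"
      by (rule open_contains_cbox[OF assms(3)])
    then show ?thesis by blast
  qed
  then obtain a b where ab: "\<And>x. x \<in> K \<Longrightarrow> x \<in> box (a x) (b x) \<and> cbox (a x) (b x) \<subseteq> U" by metis
  obtain C where C: "C \<subseteq> K" "finite C" "K \<subseteq> (\<Union>x\<in>C. box (a x) (b x))"
    by (rule compactE_image[OF assms(1), of K "\<lambda>x. box (a x) (b x)"]) (use ab in auto)
  define f where "f x = (\<Sum>c\<in>C. bump 0 (a c) (b c) x)" for x
  have f: "test_smooth U f"
    unfolding f_def using C ab by (intro test_smooth_sum test_smooth_bump) auto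
  then have "continuous_on K f" by (intro smooth_continuous test_smooth_smooth)
  then obtain y where y: "y \<in> K" "\<And>x. x \<in> K \<Longrightarrow> f y \<le> f x"
    using continuous_attains_inf[OF assms(1) False] by blast
  have f0: "0 \<le> f x" for x unfolding f_def by (simp add: sum_nonneg bump_bounds)
  obtain c where "c \<in> C" "y \<in> box (a c) (b c)" using C y by auto
  then have "0 < f y"
    unfolding f_def using C by (intro sum_pos2[of C c]) (auto intro: bump_pos simp: bump_bounds)
  show ?thesis
  proof (rule that[of "\<lambda>x. inverse (f y) * f x"])
    show "test_smooth U (\<lambda>x. inverse (f y) * f x)"
      by (intro test_smooth_mult_left smooth_const f)
  qed (use f0 \<open>0 < f y\<close> y in \<open>auto simp: field_simps\<close>)
qed

text \<open>An open set is a countable union of closed boxes. One minus the product of \<open>1 - bump\<close> over the first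
  of them stays between \<open>0\<close> and \<open>1\<close>. Their frontiers are null sets.\<close>

lemma open_indicator_approx:
  fixes U :: "'a::euclidean_space set"
  assumes "open U"
  obtains \<zeta> :: "nat \<Rightarrow> 'a \<Rightarrow> real" where "\<And>n. test_smooth U (\<zeta> n)" "\<And>n x. 0 \<le> \<zeta> n x" "\<And>n x. \<zeta> n x \<le> 1"
    "AE x in lborel. (\<lambda>n. \<zeta> n x) \<longlonglongrightarrow> indicator U x"
proof -
  obtain \<D> where D: "countable \<D>" "\<D> \<subseteq> Pow U" "\<And>X. X \<in> \<D> \<Longrightarrow> \<exists>a b. X = cbox a b" "\<Union>\<D> = U"
    using open_countable_Union_open_cbox[OF assms] by metis
  show ?thesis
  proof (cases "U = {}")
    case True
    then show ?thesis using that[of "\<lambda>_ _. 0"] test_smooth_zero by auto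
  next
    case False
    then have "\<D> \<noteq> {}" using D by auto
    then have r: "range (from_nat_into \<D>) = \<D>" using D(1) by (rule range_from_nat_into)
    have "\<exists>a b. from_nat_into \<D> n = cbox a b" for n using D(3) r by blast
    then obtain a b where ab: "\<And>n. from_nat_into \<D> n = cbox (a n) (b n)" by metis
    have sub: "cbox (a n) (b n) \<subseteq> U" for n using ab r D(2) by (metis PowD rangeI subsetD)
    have un: "U = (\<Union>n. cbox (a n) (b n))"
      using D(4) r unfolding ab[symmetric] by simp
    define \<zeta> where "\<zeta> n x = 1 - (\<Prod>j\<le>n. 1 - bump n (a j) (b j) x)" for n x
    have p01: "0 \<le> (\<Prod>j\<in>A. 1 - bump n (a j) (b j) x)" "(\<Prod>j\<in>A. 1 - bump n (a j) (b j) x) \<le> 1" for A n x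
      by (auto intro!: prod_nonneg prod_le_1 simp: bump_bounds)
    have ts: "test_smooth U (\<zeta> n)" for n
    proof (rule test_smoothI[of _ "\<Union>j\<le>n. cbox (a j) (b j)"])
      show "smooth (\<zeta> n)" unfolding \<zeta>_def by (intro smooth_diff smooth_const smooth_prod smooth_bump)
      fix x assume "x \<notin> (\<Union>j\<le>n. cbox (a j) (b j))"
      then have "bump n (a j) (b j) x = 0" if "j \<le> n" for j
        using that box_subset_cbox by (intro bump_eq_0) blast
      then show "\<zeta> n x = 0" by (simp add: \<zeta>_def)
    qed (use sub in auto)
    have "cbox (a n) (b n) - box (a n) (b n) \<in> null_sets lborel" for n
    proof -
      have "negligible (cbox (a n) (b n) - box (a n) (b n))" by (rule negligible_frontier_interval)
      then show ?thesis by (simp add: negligible_iff_null_sets null_sets_completion_iff)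
    qed
    then have "AE x in lborel. \<forall>n. x \<notin> cbox (a n) (b n) - box (a n) (b n)"
      by (subst AE_all_countable) (intro allI AE_not_in)
    moreover have "(\<lambda>n. \<zeta> n x) \<longlonglongrightarrow> indicator U x" if x: "\<forall>n. x \<notin> cbox (a n) (b n) - box (a n) (b n)" for x
    proof (cases "x \<in> U")
      case True
      then obtain m where m: "x \<in> box (a m) (b m)" using un x by auto
      have "bump n (a m) (b m) x \<le> \<zeta> n x" if "m \<le> n" for n
      proof -
        have "(\<Prod>j\<le>n. 1 - bump n (a j) (b j) x)
            = (1 - bump n (a m) (b m) x) * (\<Prod>j\<in>{..n}-{m}. 1 - bump n (a j) (b j) x)"
          using that by (intro prod.remove) auto
        also have "\<dots> \<le> (1 - bump n (a m) (b m) x) * 1"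
          by (intro mult_left_mono p01) (simp add: bump_bounds)
        finally show ?thesis unfolding \<zeta>_def by simp
      qed
      then have "(\<lambda>n. \<zeta> n x) \<longlonglongrightarrow> 1"
        by (intro tendsto_sandwich[OF _ _ bump_tendsto[OF m] tendsto_const])
           (auto simp: eventually_sequentially \<zeta>_def p01)
      then show ?thesis using True by simp
    next
      case False
      then have "\<zeta> n x = 0" for n using test_smooth_outside[OF ts] by simp
      then show ?thesis using False by simp
    qed
    ultimately show ?thesis using p01 by (intro that[of \<zeta>] ts) (auto simp: \<zeta>_def)
  qed
qed

text \<open>By outer regularity, a Borel set differs little from an open set.\<close>

lemma smooth_approx_set:
  fixes U B :: "'a::euclidean_space set"
  assumes "open U" "emeasure lborel U < \<infinity>" and B[measurable]: "B \<in> sets borel" and "B \<subseteq> U" "0 < e"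
  obtains \<zeta> where "test_smooth U \<zeta>" "\<And>x. 0 \<le> \<zeta> x" "\<And>x. \<zeta> x \<le> 1"
    "integrable lborel (\<lambda>x. \<zeta> x - indicator B x)" "(LINT x|lborel. \<bar>\<zeta> x - indicator B x\<bar>) < e"
proof -
  obtain V where V: "open V" "B \<subseteq> V" "emeasure lborel (V - B) < ennreal (e/2)"
    using outer_regular_lborel[of B "e/2"] assms by auto
  define W where "W = V \<inter> U"
  have W: "open W" "B \<subseteq> W" "W \<subseteq> U" using V assms by (auto simp: W_def)
  have mW[measurable]: "W \<in> sets borel" using W by auto
  have "emeasure lborel W \<le> emeasure lborel U" using assms(1) W by (intro emeasure_mono) auto
  then have fW: "emeasure lborel W < \<infinity>" using assms(2) by simp
  have WB: "measure lborel (W - B) < e / 2"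
  proof -
    have "emeasure lborel (W - B) \<le> emeasure lborel (V - B)"
      using V by (intro emeasure_mono) (auto simp: W_def)
    also have "\<dots> < ennreal (e / 2)" by (rule V)
    finally have *: "emeasure lborel (W - B) < ennreal (e / 2)" .
    then have "emeasure lborel (W - B) = ennreal (measure lborel (W - B))"
      by (intro emeasure_eq_ennreal_measure) auto
    with * show ?thesis by (simp add: ennreal_less_iff)
  qed
  obtain \<zeta> :: "nat \<Rightarrow> 'a \<Rightarrow> real" where z: "\<And>n. test_smooth W (\<zeta> n)" "\<And>n x. 0 \<le> \<zeta> n x" "\<And>n x. \<zeta> n x \<le> 1"
    "AE x in lborel. (\<lambda>n. \<zeta> n x) \<longlonglongrightarrow> indicator W x"
    using open_indicator_approx[OF W(1)] by blast
  have zm[measurable]: "\<zeta> n \<in> borel_measurable borel" for n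
    by (intro borel_measurable_continuous_onI smooth_continuous test_smooth_smooth[OF z(1)])
  have z0: "\<zeta> n x = 0" if "x \<notin> W" for n x
    using test_smooth_outside[OF z(1) that] .
  have "emeasure lborel B \<le> emeasure lborel W" using W by (intro emeasure_mono) auto
  then have iW: "integrable lborel (indicator W :: 'a \<Rightarrow> real)" "integrable lborel (indicator B :: 'a \<Rightarrow> real)"
    using fW by (auto intro!: integrable_real_indicator)
  have iz: "integrable lborel (\<zeta> n)" for n
    by (rule Bochner_Integration.integrable_bound[OF iW(1)]) (auto simp: indicator_def z z0)
  have "(\<lambda>n. LINT x|lborel. \<bar>\<zeta> n x - indicator W x\<bar>) \<longlonglongrightarrow> (LINT (x::'a)|lborel. (0::real))"
  proof (rule integral_dominated_convergence[where w = "indicator W"])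
    show "AE x in lborel. (\<lambda>n. \<bar>\<zeta> n x - indicator W x\<bar>) \<longlonglongrightarrow> 0"
      using z(4) by eventually_elim (metis LIM_zero tendsto_rabs_zero)
    show "AE x in lborel. norm \<bar>\<zeta> n x - indicator W x\<bar> \<le> indicator W x" for n
      using z(2)[of n] z(3)[of n] by (auto simp: indicator_def z0 abs_le_iff)
  qed (use iW in auto)
  then have "\<forall>\<^sub>F n in sequentially. (LINT x|lborel. \<bar>\<zeta> n x - indicator W x\<bar>) < e/2"
    using \<open>0 < e\<close> by (intro order_tendstoD) auto
  then obtain n where n: "(LINT x|lborel. \<bar>\<zeta> n x - indicator W x\<bar>) < e/2"
    by (auto simp: eventually_sequentially)
  have iWB: "integrable lborel (indicator (W - B) :: 'a \<Rightarrow> real)"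
    by (rule Bochner_Integration.integrable_bound[OF iW(1)]) (auto simp: indicator_def)
  have "\<bar>\<zeta> n x - indicator B x\<bar> \<le> \<bar>\<zeta> n x - indicator W x\<bar> + indicator (W - B) x" for x
    using W(2) by (auto simp: indicator_def)
  then have "(LINT x|lborel. \<bar>\<zeta> n x - indicator B x\<bar>) \<le> (LINT x|lborel. \<bar>\<zeta> n x - indicator W x\<bar> + indicator (W - B) x)"
    using iW iz iWB by (intro integral_mono) auto
  also have "\<dots> = (LINT x|lborel. \<bar>\<zeta> n x - indicator W x\<bar>) + measure lborel (W - B)"
    using iW iz iWB by (subst Bochner_Integration.integral_add) auto
  also have "\<dots> < e" using n WB by simp
  finally show ?thesis
    using that[of "\<zeta> n"] test_smooth_mono[OF z(1) W(3)] z iz iW by auto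
qed

text \<open>The bounds on the approximating functions are the same as those on \<open>G\<close>, which matters when they are
  used as test functions against a merely integrable function. They survive because \<open>G\<close> is approximated
  by averages of indicator functions of its superlevel sets.\<close>

lemma smooth_approx_bounded:
  fixes U :: "'a::euclidean_space set" and G :: "'a \<Rightarrow> real"
  assumes "open U" "emeasure lborel U < \<infinity>" and G[measurable]: "G \<in> borel_measurable borel"
    and G0: "\<And>x. 0 \<le> G x" and GM: "\<And>x. G x \<le> M" and GU: "\<And>x. x \<notin> U \<Longrightarrow> G x = 0"
  obtains g :: "nat \<Rightarrow> 'a \<Rightarrow> real" where "\<And>k. test_smooth U (g k)" "\<And>k x. 0 \<le> g k x" "\<And>k x. g k x \<le> M"
    "AE x in lborel. (\<lambda>k. g k x) \<longlonglongrightarrow> G x"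
proof (cases "M > 0")
  case False
  then have "G x = 0" for x using G0[of x] GM[of x] by auto
  moreover have "0 \<le> M" using G0 GM order_trans by blast
  ultimately show ?thesis using that[of "\<lambda>_ _. 0"] test_smooth_zero by auto
next
  case M: True
  have mU: "U \<in> sets borel" using assms by auto
  have iU: "integrable lborel (indicator U :: 'a \<Rightarrow> real)" using assms mU by (auto intro!: integrable_real_indicator)
  have "\<exists>g. test_smooth U g \<and> (\<forall>x. 0 \<le> g x \<and> g x \<le> M) \<and> integrable lborel (\<lambda>x. g x - G x) \<and>
      (LINT x|lborel. \<bar>g x - G x\<bar>) < e" if e: "0 < e" for e :: real
  proof -
    obtain N :: nat where N: "2 * M * measure lborel U / e < real N" using reals_Archimedean2 by blast
    moreover have "0 \<le> 2 * M * measure lborel U / e" using e M by simp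
    ultimately have "N > 0" by linarith
    \<comment> \<open>The levels \<open>c, 2 c, \<dots>, M\<close> give a staircase \<open>S\<close> that stays within \<open>c\<close> of \<open>G\<close>.\<close>
    define c where "c = M / N"
    have c: "0 < c" "real N * c = M" using M \<open>N > 0\<close> by (auto simp: c_def)
    have cU: "c * measure lborel U < e / 2" using N e \<open>N > 0\<close> by (simp add: c_def field_simps)
    define B where "B i = {x. real i * c < G x}" for i :: nat
    have B[measurable]: "B i \<in> sets borel" for i unfolding B_def by measurable
    have BU: "B i \<subseteq> U" for i
    proof
      fix x assume "x \<in> B i"
      moreover have "0 \<le> real i * c" using c by simp
      ultimately have "G x \<noteq> 0" by (auto simp: B_def)
      then show "x \<in> U" using GU by blast
    qed
    have "\<exists>\<zeta>. test_smooth U \<zeta> \<and> (\<forall>x. 0 \<le> \<zeta> x \<and> \<zeta> x \<le> 1) \<and>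
       integrable lborel (\<lambda>x. \<zeta> x - indicator (B i) x) \<and> (LINT x|lborel. \<bar>\<zeta> x - indicator (B i) x\<bar>) < e / (2 * M)" for i
    proof -
      have pos: "0 < e / (2 * M)" using e M by simp
      show ?thesis by (rule smooth_approx_set[OF assms(1,2) B BU pos]) blast
    qed
    then obtain \<zeta> where z: "\<And>i. test_smooth U (\<zeta> i)" "\<And>i x. 0 \<le> \<zeta> i x \<and> \<zeta> i x \<le> 1"
       "\<And>i. integrable lborel (\<lambda>x. \<zeta> i x - indicator (B i) x)" "\<And>i. (LINT x|lborel. \<bar>\<zeta> i x - indicator (B i) x\<bar>) < e / (2 * M)"
      by metis
    define g where "g x = (\<Sum>i=1..N. c * \<zeta> i x)" for x
    define S where "S x = (\<Sum>i=1..N. c * indicator (B i) x)" for x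
    have S: "\<bar>S x - G x\<bar> \<le> c * indicator U x" for x
    proof -
      define m where "m = nat (\<lceil>G x / c\<rceil> - 1)"
      have *: "real i * c < G x \<longleftrightarrow> i \<le> m" if "i \<ge> 1" for i
      proof -
        have "real i * c < G x \<longleftrightarrow> real i < G x / c" using c by (simp add: field_simps)
        also have "\<dots> \<longleftrightarrow> int i < \<lceil>G x / c\<rceil>" by (simp add: less_ceiling_iff)
        also have "\<dots> \<longleftrightarrow> i \<le> m" unfolding m_def using that by linarith
        finally show ?thesis .
      qed
      have "m \<le> N"
      proof (rule ccontr)
        assume "\<not> m \<le> N"
        then have "m \<ge> 1" "real N < real m" by auto
        then have "real m * c < G x" using *[of m] by auto
        moreover have "real N * c < real m * c" using c(1) \<open>real N < real m\<close> by (rule mult_strict_right_mono[rotated])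
        ultimately show False using GM[of x] c by linarith
      qed
      have "S x = (\<Sum>i\<in>{1..N}. if i \<le> m then c else 0)"
        unfolding S_def by (intro sum.cong refl) (auto simp: B_def indicator_def *)
      also have "\<dots> = (\<Sum>i\<in>{1..m}. c)"
        using \<open>m \<le> N\<close> by (intro sum.mono_neutral_cong_right) auto
      finally have S: "S x = real m * c" by simp
      show ?thesis
      proof (cases "x \<in> U")
        case True
        have "S x \<le> G x" using S *[of m] G0[of x] by (cases "m = 0") (auto simp: Suc_le_eq less_imp_le)
        moreover have "G x \<le> S x + c" using S *[of "Suc m"] by (auto simp: algebra_simps)
        ultimately show ?thesis using True by simp
      next
        case False
        then have "G x = 0" by (rule GU)
        then have "m = 0" by (simp add: m_def)
        then show ?thesis using S \<open>G x = 0\<close> False by simp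
      qed
    qed
    have iS: "integrable lborel (\<lambda>x. g x - S x)"
      unfolding g_def S_def sum_subtractf[symmetric] right_diff_distrib[symmetric] using z(3) by auto
    have "(LINT x|lborel. \<bar>g x - S x\<bar>) \<le> (LINT x|lborel. (\<Sum>i=1..N. c * \<bar>\<zeta> i x - indicator (B i) x\<bar>))"
      using iS z(3) c unfolding g_def S_def sum_subtractf[symmetric] right_diff_distrib[symmetric]
      by (intro integral_mono integrable_abs) (auto intro!: order.trans[OF sum_abs] sum_mono simp: abs_mult)
    also have "\<dots> = (\<Sum>i=1..N. c * (LINT x|lborel. \<bar>\<zeta> i x - indicator (B i) x\<bar>))"
      using z(3) by (subst Bochner_Integration.integral_sum) auto
    also have "\<dots> \<le> (\<Sum>i=1..N. c * (e / (2 * M)))"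
      using z(4) c by (intro sum_mono mult_left_mono) (auto intro: less_imp_le)
    also have "\<dots> = e / 2" using c M by (simp add: field_simps)
    finally have gS: "(LINT x|lborel. \<bar>g x - S x\<bar>) \<le> e / 2" .
    have [measurable]: "S \<in> borel_measurable borel" unfolding S_def by measurable
    have iSG: "integrable lborel (\<lambda>x. S x - G x)"
      by (rule Bochner_Integration.integrable_bound[OF integrable_mult_right[OF iU, of c]]) (use S c in auto)
    have "(LINT x|lborel. \<bar>S x - G x\<bar>) \<le> (LINT x|lborel. c * indicator U x)"
      using S iSG iU by (intro integral_mono) auto
    then have SG: "(LINT x|lborel. \<bar>S x - G x\<bar>) < e / 2" using cU by simp
    have ig: "integrable lborel (\<lambda>x. g x - G x)"
      using Bochner_Integration.integrable_add[OF iS iSG] by simp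
    have "(LINT x|lborel. \<bar>g x - G x\<bar>) \<le> (LINT x|lborel. \<bar>g x - S x\<bar> + \<bar>S x - G x\<bar>)"
      using ig iS iSG by (intro integral_mono) auto
    also have "\<dots> < e" using gS SG iS iSG by (subst Bochner_Integration.integral_add) auto
    finally have "(LINT x|lborel. \<bar>g x - G x\<bar>) < e" .
    moreover have "test_smooth U g"
      unfolding g_def by (intro test_smooth_sum test_smooth_mult_left smooth_const z)
    moreover have "0 \<le> g x" "g x \<le> M" for x
    proof -
      show "0 \<le> g x" unfolding g_def using z c by (auto intro!: sum_nonneg)
      have "g x \<le> (\<Sum>i=1..N. c)" unfolding g_def using z c by (intro sum_mono) (auto intro: mult_left_le)
      then show "g x \<le> M" using c by simp
    qed
    ultimately show ?thesis using ig by blast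
  qed
  then have "\<exists>g. test_smooth U g \<and> (\<forall>x. 0 \<le> g x \<and> g x \<le> M) \<and> integrable lborel (\<lambda>x. g x - G x) \<and>
      (LINT x|lborel. \<bar>g x - G x\<bar>) < inverse (real (Suc k))" for k by simp
  then obtain g where g: "\<And>k. test_smooth U (g k)" "\<And>k x. 0 \<le> g k x \<and> g k x \<le> M"
      "\<And>k. integrable lborel (\<lambda>x. g k x - G x)" "\<And>k. (LINT x|lborel. \<bar>g k x - G x\<bar>) < inverse (real (Suc k))"
    by metis
  have "(\<lambda>k. LINT x|lborel. norm (g k x - G x)) \<longlonglongrightarrow> 0"
    by (rule tendsto_sandwich[OF _ _ tendsto_const LIMSEQ_inverse_real_of_nat])
       (use g(4) in \<open>auto intro!: always_eventually less_imp_le simp del: of_nat_Suc\<close>)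
  from tendsto_L1_AE_subseq[OF g(3) this] obtain r where r: "strict_mono r" "AE x in lborel. (\<lambda>n. g (r n) x - G x) \<longlonglongrightarrow> 0"
    by auto
  from r(2) have "AE x in lborel. (\<lambda>n. g (r n) x) \<longlonglongrightarrow> G x"
    by eventually_elim (simp add: LIM_zero_iff)
  then show ?thesis using that[of "\<lambda>n. g (r n)"] g by auto
qed

text \<open>The smooth functions \<open>\<zeta>\<close> are chosen to approximate the indicator function of the set where \<open>f\<close> is
  positive.\<close>

lemma integral_positive_part_le:
  fixes f :: "'a::euclidean_space \<Rightarrow> real"
  assumes U: "open U" "emeasure lborel U < \<infinity>" and f: "set_integrable lborel U f"
    and C: "\<And>\<zeta>. test_smooth U \<zeta> \<Longrightarrow> (\<And>x. 0 \<le> \<zeta> x) \<Longrightarrow> (\<And>x. \<zeta> x \<le> 1) \<Longrightarrow> (LINT x:U|lborel. f x * \<zeta> x) \<le> C"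
  shows "(LINT x:U|lborel. max (f x) 0) \<le> C"
proof -
  define F where "F x = indicator U x * f x" for x
  have iF: "integrable lborel F" using f by (simp add: F_def[abs_def] set_integrable_def)
  then have [measurable]: "F \<in> borel_measurable borel" by (auto dest: borel_measurable_integrable)
  have "(\<lambda>x. indicator {x. 0 < F x} x :: real) \<in> borel_measurable borel" by measurable
  moreover have "x \<notin> U \<Longrightarrow> indicator {x. 0 < F x} x = (0::real)" for x by (simp add: F_def)
  ultimately obtain g :: "nat \<Rightarrow> 'a \<Rightarrow> real" where g: "\<And>k. test_smooth U (g k)" "\<And>k x. 0 \<le> g k x" "\<And>k x. g k x \<le> 1"
    "AE x in lborel. (\<lambda>k. g k x) \<longlonglongrightarrow> indicator {x. 0 < F x} x"
    using smooth_approx_bounded[OF U, of "indicator {x. 0 < F x}" 1] by (auto simp: indicator_le_1)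
  have [measurable]: "g k \<in> borel_measurable borel" for k
    by (intro borel_measurable_continuous_onI smooth_continuous test_smooth_smooth[OF g(1)])
  have "(\<lambda>k. LINT x|lborel. F x * g k x) \<longlonglongrightarrow> (LINT x|lborel. F x * indicator {x. 0 < F x} x)"
  proof (rule integral_dominated_convergence[where w="\<lambda>x. \<bar>F x\<bar>"])
    show "AE x in lborel. (\<lambda>k. F x * g k x) \<longlonglongrightarrow> F x * indicator {x. 0 < F x} x"
      using g(4) by eventually_elim (intro tendsto_intros)
    show "AE x in lborel. norm (F x * g k x) \<le> \<bar>F x\<bar>" for k
      using g(2,3) by (auto simp: abs_mult mult_left_le)
  qed (use iF in auto)
  moreover have "(LINT x|lborel. F x * g k x) \<le> C" for k
    using C[OF g(1)[of k] g(2,3)] by (simp add: F_def set_lebesgue_integral_def mult.assoc)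
  ultimately have "(LINT x|lborel. F x * indicator {x. 0 < F x} x) \<le> C"
    by (intro LIMSEQ_le_const2) auto
  moreover have "(LINT x|lborel. F x * indicator {x. 0 < F x} x) = (LINT x:U|lborel. max (f x) 0)"
    unfolding set_lebesgue_integral_def
    by (intro Bochner_Integration.integral_cong) (auto simp: F_def indicator_def max_def)
  ultimately show ?thesis by simp
qed

lemma AE_on_open_by_boxes:
  fixes U :: "'a::euclidean_space set"
  assumes "open U" and "\<And>a b. cbox a b \<subseteq> U \<Longrightarrow> AE x in lborel. x \<in> box a b \<longrightarrow> P x"
  shows "AE x in lborel. x \<in> U \<longrightarrow> P x"
proof -
  define \<F> where "\<F> = {box a b | a b. cbox a b \<subseteq> U}"
  have "\<Union>\<F> = U"
  proof
    show "\<Union>\<F> \<subseteq> U" using box_subset_cbox by (force simp: \<F>_def)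
    show "U \<subseteq> \<Union>\<F>"
    proof
      fix x assume "x \<in> U"
      then obtain a b where "x \<in> box a b" "cbox a b \<subseteq> U"
        by (rule open_contains_cbox[OF assms(1)])
      then show "x \<in> \<Union>\<F>" by (auto simp: \<F>_def)
    qed
  qed
  moreover obtain \<F>' where "\<F>' \<subseteq> \<F>" "countable \<F>'" "\<Union>\<F>' = \<Union>\<F>"
    by (rule Lindelof[of \<F>]) (auto simp: \<F>_def)
  ultimately have F: "\<F>' \<subseteq> \<F>" "countable \<F>'" "\<Union>\<F>' = U" by auto
  have "AE x in lborel. x \<in> B \<longrightarrow> P x" if "B \<in> \<F>'" for B
    using that F(1) assms(2) by (auto simp: \<F>_def)
  then have "AE x in lborel. \<forall>B\<in>\<F>'. x \<in> B \<longrightarrow> P x"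
    using F(2) by (subst AE_ball_countable) auto
  then show ?thesis by eventually_elim (use F(3) in auto)
qed

lemma set_integrable_box_of_cbox:
  fixes f :: "'a::euclidean_space \<Rightarrow> 'b::euclidean_space"
  shows "set_integrable lborel (cbox a b) f \<Longrightarrow> set_integrable lborel (box a b) f"
  by (rule set_integrable_subset) (use box_subset_cbox in auto)

lemma emeasure_box_finite: "emeasure lborel (box a b) < \<infinity>"
  by (simp add: emeasure_lborel_box_eq)

text \<open>The fundamental lemma of the calculus of variations, for an inequality.\<close>

lemma AE_nonpos_of_test:
  fixes f :: "'a::euclidean_space \<Rightarrow> real"
  assumes U: "open U" and f: "\<And>a b. cbox a b \<subseteq> U \<Longrightarrow> set_integrable lborel (cbox a b) f"
    and C: "\<And>\<zeta>. test_smooth U \<zeta> \<Longrightarrow> (\<And>x. 0 \<le> \<zeta> x) \<Longrightarrow> (LINT x:U|lborel. f x * \<zeta> x) \<le> 0"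
  shows "AE x in lborel. x \<in> U \<longrightarrow> f x \<le> 0"
proof (rule AE_on_open_by_boxes[OF U])
  fix a b :: 'a assume ab: "cbox a b \<subseteq> U"
  then have bU: "box a b \<subseteq> U" using box_subset_cbox by blast
  have i: "set_integrable lborel (box a b) f" by (rule set_integrable_box_of_cbox[OF f[OF ab]])
  have "(LINT x:box a b|lborel. max (f x) 0) \<le> 0"
  proof (rule integral_positive_part_le[OF open_box emeasure_box_finite i])
    fix \<zeta> assume z: "test_smooth (box a b) \<zeta>" "\<And>x. 0 \<le> \<zeta> x"
    have "(LINT x:box a b|lborel. f x * \<zeta> x) = (LINT x:U|lborel. f x * \<zeta> x)"
      unfolding set_lebesgue_integral_def
      by (intro Bochner_Integration.integral_cong refl)
         (use bU test_smooth_outside[OF z(1)] in \<open>auto simp: indicator_def\<close>)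
    also have "\<dots> \<le> 0" using z test_smooth_mono[OF z(1) bU] by (intro C) auto
    finally show "(LINT x:box a b|lborel. f x * \<zeta> x) \<le> 0" .
  qed
  moreover have i': "integrable lborel (\<lambda>x. indicator (box a b) x * max (f x) 0)"
  proof -
    have "integrable lborel (\<lambda>x. max (indicator (box a b) x * f x) 0)"
      using i by (auto simp: set_integrable_def)
    also have "(\<lambda>x. max (indicator (box a b) x * f x) 0) = (\<lambda>x. indicator (box a b) x * max (f x) 0)"
      by (auto simp: indicator_def)
    finally show ?thesis .
  qed
  ultimately have "(LINT x|lborel. indicator (box a b) x * max (f x) 0) = 0"
    by (intro antisym Bochner_Integration.integral_nonneg) (auto simp: set_lebesgue_integral_def)
  then have "AE x in lborel. indicator (box a b) x * max (f x) 0 = 0"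
    by (subst (asm) integral_nonneg_eq_0_iff_AE[OF i']) auto
  then show "AE x in lborel. x \<in> box a b \<longrightarrow> f x \<le> 0"
    by eventually_elim (auto simp: indicator_def max_def split: if_splits)
qed

section \<open>Translations\<close>

lemma nn_integral_translate:
  fixes f :: "'a::euclidean_space \<Rightarrow> ennreal"
  assumes "f \<in> borel_measurable borel"
  shows "(\<integral>\<^sup>+x. f (x + h) \<partial>lborel) = (\<integral>\<^sup>+x. f x \<partial>lborel)"
proof -
  have "(\<integral>\<^sup>+x. f x \<partial>lborel) = (\<integral>\<^sup>+x. f x \<partial>distr lborel borel ((+) h))" by (simp add: lborel_distr_plus)
  also have "\<dots> = (\<integral>\<^sup>+x. f (h + x) \<partial>lborel)" using assms by (subst nn_integral_distr) auto
  finally show ?thesis by (simp add: add.commute)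
qed

lemma
  fixes f :: "'a::euclidean_space \<Rightarrow> 'b::euclidean_space"
  shows integrable_translate: "integrable lborel f \<Longrightarrow> integrable lborel (\<lambda>x. f (x + h))"
    and integral_translate: "f \<in> borel_measurable borel \<Longrightarrow> (LINT x|lborel. f (x + h)) = (LINT x|lborel. f x)"
proof -
  have *: "distr lborel borel (\<lambda>x. x + h) = lborel"
    using lborel_distr_plus[of h] by (simp add: fun_eq_iff add.commute[of h] cong: distr_cong)
  show "integrable lborel (\<lambda>x. f (x + h))" if "integrable lborel f"
    by (rule integrable_distr[of "\<lambda>x. x + h" lborel borel f]) (use that * in auto)
  show "(LINT x|lborel. f (x + h)) = (LINT x|lborel. f x)" if "f \<in> borel_measurable borel"
    using integral_distr[of "\<lambda>x. x + h" lborel borel f] that * by simp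
qed

lemma L1_translation_indicator:
  fixes A :: "'a::euclidean_space set"
  assumes A: "A \<in> sets borel" "emeasure lborel A < \<infinity>" and "0 < e"
  shows "\<exists>d>0. \<forall>h. norm h < d \<longrightarrow> (LINT x|lborel. \<bar>indicator A (x + h) - indicator A x\<bar>) < (e::real)"
proof -
  note [measurable] = A(1)
  obtain V where V: "open V" "A \<subseteq> V" "emeasure lborel (V - A) < ennreal (e / 4)"
    using outer_regular_lborel[OF A(1), of "e / 4"] \<open>0 < e\<close> by auto
  have mV[measurable]: "V \<in> sets borel" using V by auto
  have "emeasure lborel V \<le> emeasure lborel A + emeasure lborel (V - A)"
    using V by (subst plus_emeasure) (auto simp: Un_absorb1)
  also have "\<dots> < \<infinity>" using A V(3) by (auto intro: order.strict_trans)
  finally have fV: "emeasure lborel V < \<infinity>" .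
  have iA: "integrable lborel (indicator A :: 'a \<Rightarrow> real)" "integrable lborel (indicator V :: 'a \<Rightarrow> real)"
    using A fV by (auto intro!: integrable_real_indicator)
  have iVA: "integrable lborel (indicator (V - A) :: 'a \<Rightarrow> real)"
    by (rule Bochner_Integration.integrable_bound[OF iA(2)]) (auto simp: indicator_def)
  have VA: "(LINT x|lborel. indicator (V - A) x) < e / 4"
  proof -
    have "emeasure lborel (V - A) = ennreal (measure lborel (V - A))"
      using V(3) by (intro emeasure_eq_ennreal_measure) auto
    with V(3) show ?thesis by (simp add: ennreal_less_iff)
  qed
  define D where "D h = (LINT x|lborel. max (indicator V x - indicator V (x + h)) (0::real))" for h
  have iV: "integrable lborel (\<lambda>x. indicator V (x + h) :: real)" for h
    by (rule integrable_translate[OF iA(2)])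
  have "(D \<longlongrightarrow> 0) (at 0)"
    unfolding tendsto_at_iff_sequentially comp_def
  proof (intro allI impI)
    fix X :: "nat \<Rightarrow> 'a" assume X: "\<forall>i. X i \<in> UNIV - {0}" "X \<longlonglongrightarrow> 0"
    have "(\<lambda>i. D (X i)) \<longlonglongrightarrow> (LINT (x::'a)|lborel. (0::real))"
      unfolding D_def
    proof (rule integral_dominated_convergence[where w="indicator V"])
      show "AE x in lborel. (\<lambda>i. max (indicator V x - indicator V (x + X i)) (0::real)) \<longlonglongrightarrow> 0"
      proof (intro AE_I2)
        fix x :: 'a
        show "(\<lambda>i. max (indicator V x - indicator V (x + X i)) (0::real)) \<longlonglongrightarrow> 0"
        proof (cases "x \<in> V")
          case True
          have "(\<lambda>i. x + X i) \<longlonglongrightarrow> x + 0" by (intro tendsto_intros X)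
          then have "\<forall>\<^sub>F i in sequentially. x + X i \<in> V"
            using V(1) True by (auto dest: topological_tendstoD)
          then show ?thesis
            by (intro tendsto_eventually) (auto elim!: eventually_mono simp: indicator_def)
        qed (simp add: indicator_def)
      qed
    qed (use iA iV in \<open>auto simp: indicator_def\<close>)
    then show "(\<lambda>i. D (X i)) \<longlonglongrightarrow> 0" by simp
  qed
  then have "\<forall>\<^sub>F h in at 0. D h < e / 4"
    using \<open>0 < e\<close> by (intro order_tendstoD) auto
  then obtain d where d: "d > 0" "\<And>h. h \<noteq> 0 \<Longrightarrow> norm h < d \<Longrightarrow> D h < e / 4"
    unfolding eventually_at by auto
  have "(LINT x|lborel. \<bar>indicator A (x + h) - indicator A x\<bar>) < e" if h: "norm h < d" for h
  proof -
    have D: "D h < e / 4"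
      using d(2)[OF _ h] \<open>0 < e\<close> by (cases "h = 0") (auto simp: D_def)
    have iM: "integrable lborel (\<lambda>x. max (indicator V x - indicator V (x + h)) (0::real))"
      using iA iV by auto
    have iS: "integrable lborel (\<lambda>x. indicator (V - A) (x + h) :: real)"
      by (rule integrable_translate[OF iVA])
    have "\<bar>indicator A (x + h) - indicator A x\<bar> \<le>
        2 * max (indicator V x - indicator V (x + h)) (0::real) + (indicator V (x + h) - indicator V x)
        + (indicator (V - A) x + indicator (V - A) (x + h))" for x
      using V(2) by (auto simp: indicator_def)
    then have "(LINT x|lborel. \<bar>indicator A (x + h) - indicator A x\<bar>) \<le> (LINT x|lborel.
        2 * max (indicator V x - indicator V (x + h)) (0::real) + (indicator V (x + h) - indicator V x)
        + (indicator (V - A) x + indicator (V - A) (x + h)))"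
      using iA iV iM iS iVA integrable_translate[OF iA(1), of h] by (intro integral_mono) auto
    also have "\<dots> = 2 * D h + ((LINT x|lborel. indicator V (x + h)) - (LINT x|lborel. indicator V x))
       + ((LINT x|lborel. indicator (V - A) x) + (LINT x|lborel. indicator (V - A) (x + h)))"
      unfolding D_def using iA iV iM iS iVA by simp
    also have "(LINT x|lborel. indicator V (x + h) :: real) = (LINT x|lborel. indicator V x)"
      by (rule integral_translate) measurable
    also have "(LINT x|lborel. indicator (V - A) (x + h) :: real) = (LINT x|lborel. indicator (V - A) x)"
      by (rule integral_translate) measurable
    finally show ?thesis using D VA by linarith
  qed
  then show ?thesis using d(1) by blast
qed

text \<open>Continuity of translations in $L^1$, by approximation with simple functions.\<close>

lemma L1_translation:
  fixes f :: "'a::euclidean_space \<Rightarrow> 'b::euclidean_space"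
  assumes "integrable lborel f" "0 < e"
  shows "\<exists>d>0. \<forall>h. norm h < d \<longrightarrow> (LINT x|lborel. norm (f (x + h) - f x)) < e"
  using assms
proof (induction arbitrary: e rule: integrable_induct)
  case (base A c)
  obtain d where d: "d > 0" "\<And>h. norm h < d \<Longrightarrow> (LINT x|lborel. \<bar>indicator A (x + h) - indicator A x\<bar>) < e / (norm c + 1)"
    using L1_translation_indicator[of A "e / (norm c + 1)"] base
    by (auto simp: add_nonneg_pos)
  have "(LINT x|lborel. norm (indicator A (x + h) *\<^sub>R c - indicator A x *\<^sub>R c)) < e" if "norm h < d" for h
  proof -
    have "(LINT x|lborel. norm (indicator A (x + h) *\<^sub>R c - indicator A x *\<^sub>R c))
      = (LINT x|lborel. \<bar>indicator A (x + h) - indicator A x\<bar> * norm c)"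
      by (simp add: scaleR_diff_left[symmetric])
    also have "\<dots> = (LINT x|lborel. \<bar>indicator A (x + h) - indicator A x\<bar>) * norm c" by simp
    also have "\<dots> \<le> e / (norm c + 1) * norm c"
      using d(2)[OF that] by (intro mult_right_mono) auto
    also have "\<dots> < e" using \<open>0 < e\<close> add_nonneg_pos[OF norm_ge_zero[of c] zero_less_one] by (simp add: field_simps)
    finally show ?thesis .
  qed
  then show ?case using d(1) by blast
next
  case (add f g)
  obtain d1 where d1: "d1 > 0" "\<And>h. norm h < d1 \<Longrightarrow> (LINT x|lborel. norm (f (x + h) - f x)) < e / 2"
    using add.IH(1)[of "e/2"] add.prems by auto
  obtain d2 where d2: "d2 > 0" "\<And>h. norm h < d2 \<Longrightarrow> (LINT x|lborel. norm (g (x + h) - g x)) < e / 2"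
    using add.IH(2)[of "e/2"] add.prems by auto
  have "(LINT x|lborel. norm (f (x + h) + g (x + h) - (f x + g x))) < e" if "norm h < min d1 d2" for h
  proof -
    have i: "integrable lborel (\<lambda>x. f (x + h))" "integrable lborel (\<lambda>x. g (x + h))"
      using add.hyps by (auto intro: integrable_translate)
    have "(LINT x|lborel. norm (f (x + h) + g (x + h) - (f x + g x)))
      \<le> (LINT x|lborel. norm (f (x + h) - f x) + norm (g (x + h) - g x))"
      using i add.hyps by (intro integral_mono) (auto simp: add_diff_add norm_triangle_ineq)
    also have "\<dots> = (LINT x|lborel. norm (f (x + h) - f x)) + (LINT x|lborel. norm (g (x + h) - g x))"
      using i add.hyps by (subst Bochner_Integration.integral_add) auto
    finally show ?thesis using d1(2)[of h] d2(2)[of h] that by auto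
  qed
  then show ?case using d1(1) d2(1) by (intro exI[of _ "min d1 d2"]) auto
next
  case (lim f s)
  have "(\<lambda>i. LINT x|lborel. norm (s i x - f x)) \<longlonglongrightarrow> (LINT (x::'a)|lborel. (0::real))"
  proof (rule integral_dominated_convergence[where w="\<lambda>x. 3 * norm (f x)"])
    show "AE x in lborel. (\<lambda>i. norm (s i x - f x)) \<longlonglongrightarrow> 0"
      using lim.hyps(2) by (auto simp: tendsto_norm_zero_iff LIM_zero_iff)
    show "AE x in lborel. norm (norm (s i x - f x)) \<le> 3 * norm (f x)" for i
    proof (intro AE_I2)
      fix x :: 'a
      have "norm (s i x - f x) \<le> norm (s i x) + norm (f x)" by (rule norm_triangle_ineq4)
      then show "norm (norm (s i x - f x)) \<le> 3 * norm (f x)" using lim.hyps(3)[of x i] by simp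
    qed
  qed (use lim.hyps in auto)
  then have "\<forall>\<^sub>F i in sequentially. (LINT x|lborel. norm (s i x - f x)) < e / 4"
    using lim.prems by (intro order_tendstoD) auto
  then obtain i where i: "(LINT x|lborel. norm (s i x - f x)) < e / 4"
    by (auto simp: eventually_sequentially)
  obtain d where d: "d > 0" "\<And>h. norm h < d \<Longrightarrow> (LINT x|lborel. norm (s i (x + h) - s i x)) < e / 4"
    using lim.IH[of "e/4" i] lim.prems by auto
  have "(LINT x|lborel. norm (f (x + h) - f x)) < e" if "norm h < d" for h
  proof -
    have I: "integrable lborel (\<lambda>x. f (x + h))" "integrable lborel (\<lambda>x. s i (x + h))"
      using lim.hyps by (auto intro: integrable_translate)
    have [measurable]: "f \<in> borel_measurable borel" "s i \<in> borel_measurable borel"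
      using lim.hyps(1)[of i] lim.hyps(4) by (auto dest: borel_measurable_integrable)
    have "norm (f (x + h) - f x) \<le> norm (s i (x + h) - s i x) + (norm (s i (x + h) - f (x + h)) + norm (s i x - f x))" for x
    proof -
      have "f (x + h) - f x = (s i (x + h) - s i x) + (f (x + h) - s i (x + h)) + (s i x - f x)" by simp
      also have "norm \<dots> \<le> norm (s i (x + h) - s i x) + norm (f (x + h) - s i (x + h)) + norm (s i x - f x)"
        by (intro order_trans[OF norm_triangle_ineq] add_mono norm_triangle_ineq order_refl)
      finally show ?thesis by (simp add: norm_minus_commute)
    qed
    then have "(LINT x|lborel. norm (f (x + h) - f x))
      \<le> (LINT x|lborel. norm (s i (x + h) - s i x) + (norm (s i (x + h) - f (x + h)) + norm (s i x - f x)))"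
      using I lim.hyps by (intro integral_mono) auto
    also have "\<dots> = (LINT x|lborel. norm (s i (x + h) - s i x)) +
        ((LINT x|lborel. norm (s i (x + h) - f (x + h))) + (LINT x|lborel. norm (s i x - f x)))"
      using I lim.hyps by simp
    also have "(LINT x|lborel. norm (s i (x + h) - f (x + h))) = (LINT x|lborel. norm (s i x - f x))"
      by (rule integral_translate[of "\<lambda>x. norm (s i x - f x)"]) measurable
    finally show ?thesis using i d(2)[OF that] lim.prems by linarith
  qed
  then show ?case using d(1) by blast
qed

section \<open>Weak derivatives\<close>

text \<open>The integral of a directional derivative of a function with compact support is the limit of the
  integrals of its difference quotients, which vanish by translation invariance.\<close>

lemma integral_directional_derivative_eq_0:
  fixes F G :: "'a::euclidean_space \<Rightarrow> real"
  assumes F: "continuous_on UNIV F" and G: "continuous_on UNIV G"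
    and D: "\<And>x. ((\<lambda>s. F (x + s *\<^sub>R v)) has_real_derivative G x) (at 0)"
    and K: "compact K" "\<And>x. x \<notin> K \<Longrightarrow> F x = 0"
  shows "(LINT x|lborel. G x) = 0"
proof -
  have Ds: "((\<lambda>s. F (x + s *\<^sub>R v)) has_real_derivative G (x + s *\<^sub>R v)) (at s)" for x s
    using D[of "x + s *\<^sub>R v"] DERIV_shift[of "\<lambda>s. F (x + s *\<^sub>R v)" "G (x + s *\<^sub>R v)" 0 s]
    by (simp add: algebra_simps)
  have G0: "G x = 0" if "x \<notin> K" for x
  proof -
    have "open (- K)" using K(1) compact_imp_closed by auto
    moreover have "((\<lambda>s. x + s *\<^sub>R v) \<longlongrightarrow> x + 0 *\<^sub>R v) (nhds 0)" by (intro tendsto_intros filterlim_ident)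
    ultimately have "\<forall>\<^sub>F s in nhds 0. x + s *\<^sub>R v \<in> - K"
      using that by (auto dest!: topological_tendstoD[where S="- K"])
    then have "\<forall>\<^sub>F s in nhds 0. F (x + s *\<^sub>R v) = 0" by (elim eventually_mono) (use K(2) in auto)
    then have "((\<lambda>s. F (x + s *\<^sub>R v)) has_real_derivative 0) (at 0)"
      using DERIV_cong_ev[of 0 0 "\<lambda>s. F (x + s *\<^sub>R v)" "\<lambda>_. 0" 0 0] by simp
    then show "G x = 0" using D DERIV_unique by blast
  qed
  obtain B where B: "\<And>x. x \<in> K \<Longrightarrow> \<bar>G x\<bar> \<le> B" "0 \<le> B"
  proof -
    have "bounded (G ` K)" using compact_continuous_image[OF continuous_on_subset[OF G] K(1)] compact_imp_bounded by auto
    then show ?thesis using that by (metis bounded_pos image_eqI real_norm_def less_imp_le)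
  qed
  have GB: "\<bar>G x\<bar> \<le> B" for x using G0 B by (cases "x \<in> K") auto
  define h where "h n = inverse (real (Suc n))" for n
  have h: "0 < h n" "h n \<le> 1" "h \<longlonglongrightarrow> 0" for n
    using LIMSEQ_inverse_real_of_nat by (auto simp: h_def[abs_def] inverse_eq_divide)
  define K' where "K' = (\<lambda>(x, s). x - s *\<^sub>R v) ` (K \<times> {0..1})"
  have K': "compact K'" unfolding K'_def
    by (intro compact_continuous_image compact_Times K(1) compact_Icc) (auto simp: case_prod_beta intro!: continuous_intros)
  define q where "q n x = (F (x + h n *\<^sub>R v) - F x) / h n" for n x
  have qB: "\<bar>q n x\<bar> \<le> B * indicator K' x" for n x
  proof (cases "x \<in> K'")
    case True
    obtain z where "F (x + h n *\<^sub>R v) - F (x + 0 *\<^sub>R v) = (h n - 0) * G (x + z *\<^sub>R v)"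
      using MVT2[OF h(1), of n "\<lambda>s. F (x + s *\<^sub>R v)" "\<lambda>s. G (x + s *\<^sub>R v)"] Ds by blast
    then have "q n x = G (x + z *\<^sub>R v)" using h(1)[of n] by (simp add: q_def field_simps)
    then show ?thesis using True GB by simp
  next
    case False
    have "x \<notin> K" using False unfolding K'_def by (force intro: rev_image_eqI[of "(x, 0)"])
    moreover have "x + h n *\<^sub>R v \<notin> K"
    proof
      assume "x + h n *\<^sub>R v \<in> K"
      then have "x \<in> K'"
        unfolding K'_def using h(1,2)[of n] by (intro rev_image_eqI[of "(x + h n *\<^sub>R v, h n)"]) auto
      with False show False by simp
    qed
    ultimately show ?thesis using False K(2) by (simp add: q_def)
  qed
  have [measurable]: "F \<in> borel_measurable borel" "G \<in> borel_measurable borel"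
    using F G by (auto intro: borel_measurable_continuous_onI)
  have iF: "integrable lborel F"
  proof -
    have "integrable lborel (\<lambda>x. indicator K x *\<^sub>R F x)"
      using F K(1) continuous_on_subset by (intro borel_integrable_compact) auto
    also have "(\<lambda>x. indicator K x *\<^sub>R F x) = F" using K(2) by (auto simp: indicator_def fun_eq_iff)
    finally show ?thesis .
  qed
  have q0: "(LINT x|lborel. q n x) = 0" for n
  proof -
    have "(LINT x|lborel. q n x) = ((LINT x|lborel. F (x + h n *\<^sub>R v)) - (LINT x|lborel. F x)) / h n"
      unfolding q_def using iF integrable_translate[OF iF] by simp
    then show ?thesis by (simp add: integral_translate)
  qed
  have "(\<lambda>n. LINT x|lborel. q n x) \<longlonglongrightarrow> (LINT x|lborel. G x)"
  proof (rule integral_dominated_convergence[where w="\<lambda>x. B * indicator K' x"])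
    show "AE x in lborel. (\<lambda>n. q n x) \<longlonglongrightarrow> G x"
    proof (intro AE_I2)
      fix x
      have "(\<lambda>s. (F (x + s *\<^sub>R v) - F x) / s) \<midarrow>0\<rightarrow> G x"
        using D[of x] by (simp add: DERIV_def)
      moreover have "h n \<noteq> 0" for n using h(1)[of n] by simp
      then have "filterlim h (at 0) sequentially" by (simp add: filterlim_at h(3))
      ultimately show "(\<lambda>n. q n x) \<longlonglongrightarrow> G x" unfolding q_def by (rule filterlim_compose)
    qed
    show "q n \<in> borel_measurable lborel" for n unfolding q_def by measurable
    show "integrable lborel (\<lambda>x. B * indicator K' x)"
      using K' emeasure_compact_finite[OF K']
      by (intro integrable_mult_right integrable_real_indicator) (auto simp: borel_compact)
  qed (use qB in auto)
  then show ?thesis by (simp add: q0 LIMSEQ_const_iff)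
qed

lemma set_integrable_compact:
  fixes f :: "'a::euclidean_space \<Rightarrow> 'b::euclidean_space"
  shows "continuous_on UNIV f \<Longrightarrow> compact C \<Longrightarrow> set_integrable lborel C f"
  unfolding set_integrable_def by (intro borel_integrable_compact) (auto intro: continuous_on_subset)

lemma has_real_derivative_along:
  assumes "(f has_derivative f') (at x)"
  shows "((\<lambda>s. f (x + s *\<^sub>R v)) has_real_derivative f' v) (at 0)"
proof -
  have "((\<lambda>s. x + s *\<^sub>R v) has_derivative (\<lambda>s. s *\<^sub>R v)) (at 0)"
    by (auto intro!: derivative_eq_intros)
  from has_derivative_compose[OF this, of f f'] assms
  have "((\<lambda>s. f (x + s *\<^sub>R v)) has_derivative (\<lambda>s. f' (s *\<^sub>R v))) (at 0)" by simp
  moreover have "f' (s *\<^sub>R v) = f' v * s" for s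
    using linear_scale[OF has_derivative_linear[OF assms]] by (simp add: mult.commute)
  ultimately show ?thesis by (simp add: has_field_derivative_def)
qed

lemma frechet_derivative_zero_outside:
  fixes f :: "'a::euclidean_space \<Rightarrow> real"
  assumes "closed K" "\<And>x. x \<notin> K \<Longrightarrow> f x = 0" "x \<notin> K"
  shows "frechet_derivative f (at x) v = 0"
proof -
  have "(f has_derivative (\<lambda>_. 0)) (at x)"
    by (rule has_derivative_transform_within_open[OF has_derivative_const, where s="- K"])
       (use assms in auto)
  then show ?thesis using frechet_derivative_at by metis
qed

lemma weak_deriv_classical:
  fixes f g :: "'a::euclidean_space \<Rightarrow> real"
  assumes f: "continuous_on UNIV f" and g: "continuous_on UNIV g"
    and D: "\<And>x. ((\<lambda>s. f (x + s *\<^sub>R v)) has_real_derivative g x) (at 0)"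
  shows "weak_deriv U v f g"
  unfolding weak_deriv_def
proof (intro conjI allI impI)
  fix C assume "compact C \<and> C \<subseteq> U"
  then show "set_integrable lborel C f" "set_integrable lborel C g"
    using f g by (auto intro: set_integrable_compact)
next
  fix \<zeta> assume z: "test_smooth U \<zeta>"
  obtain K where K: "compact K" "K \<subseteq> U" "\<And>x. x \<notin> K \<Longrightarrow> \<zeta> x = 0"
    using test_smooth_support[OF z] by blast
  let ?D = "\<lambda>x. frechet_derivative \<zeta> (at x) v"
  have cz: "continuous_on UNIV \<zeta>" "continuous_on UNIV ?D"
    using test_smooth_smooth[OF z] by (auto intro: smooth_continuous smooth_deriv)
  have Dz: "((\<lambda>s. \<zeta> (x + s *\<^sub>R v)) has_real_derivative ?D x) (at 0)" for x
    by (intro has_real_derivative_along smooth_has_derivative test_smooth_smooth[OF z])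
  have D0: "?D x = 0" if "x \<notin> K" for x
    by (rule frechet_derivative_zero_outside[OF compact_imp_closed[OF K(1)] K(3) that])
  have "(LINT x|lborel. f x * ?D x + g x * \<zeta> x) = 0"
  proof (rule integral_directional_derivative_eq_0[of "\<lambda>x. f x * \<zeta> x" _ v K])
    show "((\<lambda>s. f (x + s *\<^sub>R v) * \<zeta> (x + s *\<^sub>R v)) has_real_derivative f x * ?D x + g x * \<zeta> x) (at 0)" for x
      using DERIV_mult[OF D[of x] Dz[of x]] by (simp add: algebra_simps)
  qed (use K f g cz in \<open>auto intro!: continuous_intros\<close>)
  moreover have i: "integrable lborel (\<lambda>x. f x * ?D x)" "integrable lborel (\<lambda>x. g x * \<zeta> x)"
  proof -
    have "set_integrable lborel K (\<lambda>x. f x * ?D x)" "set_integrable lborel K (\<lambda>x. g x * \<zeta> x)"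
      using K(1) f g cz by (auto intro!: set_integrable_compact continuous_intros)
    moreover have "(\<lambda>x. indicator K x *\<^sub>R (f x * ?D x)) = (\<lambda>x. f x * ?D x)"
      "(\<lambda>x. indicator K x *\<^sub>R (g x * \<zeta> x)) = (\<lambda>x. g x * \<zeta> x)"
      using K(3) D0 by (auto simp: indicator_def fun_eq_iff)
    ultimately show "integrable lborel (\<lambda>x. f x * ?D x)" "integrable lborel (\<lambda>x. g x * \<zeta> x)"
      unfolding set_integrable_def by metis+
  qed
  moreover have "(LINT x:U|lborel. f x * ?D x) = (LINT x|lborel. f x * ?D x)"
    "(LINT x:U|lborel. g x * \<zeta> x) = (LINT x|lborel. g x * \<zeta> x)"
    unfolding set_lebesgue_integral_def
    by (intro Bochner_Integration.integral_cong refl; use K D0 in \<open>force simp: indicator_def\<close>)+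
  ultimately show "(LINT x:U|lborel. f x * ?D x) = - (LINT x:U|lborel. g x * \<zeta> x)"
    by (simp add: Bochner_Integration.integral_add[OF i])
qed

text \<open>Differentiation under the integral sign: the difference quotients of \<open>\<zeta>\<close> are bounded by the supremum
  of its derivative.\<close>

lemma integral_smooth_translate_deriv:
  fixes f \<zeta> :: "'a::euclidean_space \<Rightarrow> real"
  assumes f: "integrable lborel f" and z: "test_smooth U \<zeta>"
  shows "((\<lambda>s. LINT y|lborel. f y * \<zeta> (y - s *\<^sub>R v)) has_real_derivative
     - (LINT y|lborel. f y * frechet_derivative \<zeta> (at (y - s *\<^sub>R v)) v)) (at s)"
proof -
  let ?D = "\<lambda>x. frechet_derivative \<zeta> (at x) v"
  have sm: "smooth \<zeta>" by (rule test_smooth_smooth[OF z])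
  have cz: "continuous_on UNIV \<zeta>" "continuous_on UNIV ?D"
    using sm by (auto intro: smooth_continuous smooth_deriv)
  have [measurable]: "f \<in> borel_measurable borel" "\<zeta> \<in> borel_measurable borel" "?D \<in> borel_measurable borel"
    using f cz by (auto dest: borel_measurable_integrable intro: borel_measurable_continuous_onI)
  obtain K where K: "compact K" "K \<subseteq> U" "\<And>x. x \<notin> K \<Longrightarrow> \<zeta> x = 0"
    using test_smooth_support[OF z] by blast
  have Dz: "((\<lambda>s. \<zeta> (y - s *\<^sub>R v)) has_real_derivative - ?D (y - s *\<^sub>R v)) (at s)" for y s
  proof -
    have "((\<lambda>s. y - s *\<^sub>R v) has_derivative (\<lambda>s. - (s *\<^sub>R v))) (at s)"
      by (auto intro!: derivative_eq_intros)
    from has_derivative_compose[OF this smooth_has_derivative[OF sm]]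
    have A: "((\<lambda>s. \<zeta> (y - s *\<^sub>R v)) has_derivative (\<lambda>t. frechet_derivative \<zeta> (at (y - s *\<^sub>R v)) (- (t *\<^sub>R v)))) (at s)" .
    have "frechet_derivative \<zeta> (at x) (- (t *\<^sub>R v)) = - ?D x * t" for x t
      using has_derivative_linear[OF smooth_has_derivative[OF sm, of x]]
      by (simp add: linear_scale linear_neg mult.commute)
    then show ?thesis
      unfolding has_field_derivative_def by (intro has_derivative_eq_rhs[OF A]) (simp add: fun_eq_iff)
  qed
  obtain B where B: "\<And>x. \<bar>\<zeta> x\<bar> \<le> B" "\<And>x. \<bar>?D x\<bar> \<le> B"
  proof -
    have D0: "?D x = 0" if "x \<notin> K" for x
      by (rule frechet_derivative_zero_outside[OF compact_imp_closed[OF K(1)] K(3) that])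
    have "bounded (\<zeta> ` K)" "bounded (?D ` K)"
      using cz K(1) by (auto intro!: compact_imp_bounded compact_continuous_image intro: continuous_on_subset)
    then obtain B1 B2 where B: "\<And>x. x \<in> K \<Longrightarrow> \<bar>\<zeta> x\<bar> \<le> B1" "\<And>x. x \<in> K \<Longrightarrow> \<bar>?D x\<bar> \<le> B2"
      unfolding bounded_iff by (metis image_eqI real_norm_def)
    have "\<bar>\<zeta> x\<bar> \<le> \<bar>B1\<bar> + \<bar>B2\<bar>" "\<bar>?D x\<bar> \<le> \<bar>B1\<bar> + \<bar>B2\<bar>" for x
      using B[of x] K(3)[of x] D0[of x] by (cases "x \<in> K"; force)+
    then show ?thesis using that by blast
  qed
  show ?thesis
    unfolding DERIV_def tendsto_at_iff_sequentially comp_def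
  proof (intro allI impI)
    fix X :: "nat \<Rightarrow> real" assume X: "\<forall>i. X i \<in> UNIV - {0}" "X \<longlonglongrightarrow> 0"
    have i: "integrable lborel (\<lambda>y. f y * \<zeta> (y - t *\<^sub>R v))" for t
      by (rule Bochner_Integration.integrable_bound[OF integrable_mult_left[OF f, of B]])
         (use B in \<open>auto simp: abs_mult intro!: AE_I2 mult_left_mono intro: order_trans[OF _ abs_ge_self]\<close>)
    define q where "q n y = f y * ((\<zeta> (y - (s + X n) *\<^sub>R v) - \<zeta> (y - s *\<^sub>R v)) / X n)" for n y
    have eq: "((LINT y|lborel. f y * \<zeta> (y - (s + X n) *\<^sub>R v)) - (LINT y|lborel. f y * \<zeta> (y - s *\<^sub>R v))) / X n
       = (LINT y|lborel. q n y)" for n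
    proof -
      have "q n = (\<lambda>y. (f y * \<zeta> (y - (s + X n) *\<^sub>R v) - f y * \<zeta> (y - s *\<^sub>R v)) / X n)"
        by (simp add: q_def fun_eq_iff right_diff_distrib)
      then show ?thesis using i[of "s + X n"] i[of s] by simp
    qed
    have "(\<lambda>n. LINT y|lborel. q n y) \<longlonglongrightarrow> (LINT y|lborel. - (f y * ?D (y - s *\<^sub>R v)))"
    proof (rule integral_dominated_convergence[where w="\<lambda>y. \<bar>f y\<bar> * B"])
      show "q n \<in> borel_measurable lborel" for n unfolding q_def by measurable
      show "(\<lambda>y. - (f y * ?D (y - s *\<^sub>R v))) \<in> borel_measurable lborel" by measurable
      show "integrable lborel (\<lambda>y. \<bar>f y\<bar> * B)" using f by auto
      show "AE y in lborel. (\<lambda>n. q n y) \<longlonglongrightarrow> - (f y * ?D (y - s *\<^sub>R v))"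
      proof (intro AE_I2)
        fix y
        have "(\<lambda>h. (\<zeta> (y - (s + h) *\<^sub>R v) - \<zeta> (y - s *\<^sub>R v)) / h) \<midarrow>0\<rightarrow> - ?D (y - s *\<^sub>R v)"
          using Dz[of y s] by (simp add: DERIV_def)
        moreover have "filterlim X (at 0) sequentially"
          using X by (simp add: filterlim_at)
        ultimately have "(\<lambda>n. (\<zeta> (y - (s + X n) *\<^sub>R v) - \<zeta> (y - s *\<^sub>R v)) / X n) \<longlonglongrightarrow> - ?D (y - s *\<^sub>R v)"
          by (rule filterlim_compose)
        from tendsto_mult[OF tendsto_const[of "f y"] this]
        show "(\<lambda>n. q n y) \<longlonglongrightarrow> - (f y * ?D (y - s *\<^sub>R v))" by (simp add: q_def)
      qed
      show "AE y in lborel. norm (q n y) \<le> \<bar>f y\<bar> * B" for n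
      proof (intro AE_I2)
        fix y
        have "norm (\<zeta> (y - (s + X n) *\<^sub>R v) - \<zeta> (y - s *\<^sub>R v)) \<le> B * norm (s + X n - s)"
          by (rule field_differentiable_bound[of UNIV "\<lambda>s. \<zeta> (y - s *\<^sub>R v)" "\<lambda>s. - ?D (y - s *\<^sub>R v)" B])
             (use Dz B(2) in auto)
        then have "\<bar>(\<zeta> (y - (s + X n) *\<^sub>R v) - \<zeta> (y - s *\<^sub>R v)) / X n\<bar> \<le> B"
          using X(1) by (auto simp: abs_divide divide_le_eq)
        then show "norm (q n y) \<le> \<bar>f y\<bar> * B"
          unfolding q_def real_norm_def abs_mult by (rule mult_left_mono) simp
      qed
    qed
    then show "(\<lambda>n. ((LINT y|lborel. f y * \<zeta> (y - (s + X n) *\<^sub>R v)) - (LINT y|lborel. f y * \<zeta> (y - s *\<^sub>R v))) / X n)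
      \<longlonglongrightarrow> - (LINT y|lborel. f y * ?D (y - s *\<^sub>R v))"
      by (simp add: eq)
  qed
qed

text \<open>The difference quotient of \<open>f\<close>, integrated against \<open>\<zeta>\<close>, is a difference quotient of the function
  \<open>P t = \<integral> f(y) \<zeta>(y - t v) dy\<close>, whose derivative is \<open>Q t = \<integral> g(y) \<zeta>(y - t v) dy\<close>. By the mean value theorem
  it equals \<open>Q t\<close> at an intermediate \<open>t\<close>, and \<open>Q t - Q 0\<close> is controlled by the $L^1$ modulus of continuity
  of \<open>g\<close>, uniformly in \<open>\<zeta> \<le> 1\<close>. So the difference quotients converge to \<open>g\<close> in $L^1$ of the box.\<close>

lemma weak_deriv_difference_quotient:
  fixes f g :: "'a::euclidean_space \<Rightarrow> real"
  assumes w: "weak_deriv U v f g" and U: "open U" "cbox a b \<subseteq> U"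
    and h: "\<And>n. 0 < h n" "h \<longlonglongrightarrow> 0"
  obtains r :: "nat \<Rightarrow> nat" where "strict_mono r"
    "AE x in lborel. x \<in> box a b \<longrightarrow> (\<lambda>n. (f (x + h (r n) *\<^sub>R v) - f x) / h (r n)) \<longlonglongrightarrow> g x"
proof -
  obtain \<delta> where d: "0 < \<delta>" "{x + y | x y. x \<in> cbox a b \<and> y \<in> cball 0 \<delta>} \<subseteq> U"
  proof -
    obtain e where e: "e > 0" "(\<Union>x\<in>cbox a b. ball x e) \<subseteq> U"
      using compact_subset_open_imp_ball_epsilon_subset[OF compact_cbox U] by blast
    have "x + y \<in> ball x e" if "y \<in> cball 0 (e/2)" for x y :: 'a
      using that e(1) by (auto simp: dist_norm)
    then have "{x + y | x y. x \<in> cbox a b \<and> y \<in> cball 0 (e/2)} \<subseteq> U" using e(2) by blast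
    then show ?thesis using that e(1) by (meson half_gt_zero)
  qed
  \<comment> \<open>A compact neighbourhood of the box inside \<open>U\<close>. Cut off outside of it, \<open>f\<close> and \<open>g\<close> are integrable on
    the whole space, and short translates of functions supported in the box do not notice.\<close>
  define C where "C = {x + y | x y. x \<in> cbox a b \<and> y \<in> cball 0 \<delta>}"
  have C: "compact C" "C \<subseteq> U"
    using d(2) compact_sums[OF compact_cbox[of a b] compact_cball[of 0 \<delta>]] by (auto simp: C_def)
  have inC: "x + y \<in> C" if "x \<in> box a b" "norm y \<le> \<delta>" for x y
  proof -
    have "x \<in> cbox a b" using that(1) box_subset_cbox by blast
    moreover have "y \<in> cball 0 \<delta>" using that(2) by simp
    ultimately show ?thesis unfolding C_def by blast
  qed
  define f' where "f' x = indicator C x * f x" for x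
  define g' where "g' x = indicator C x * g x" for x
  have i: "integrable lborel f'" "integrable lborel g'"
    using w C unfolding weak_deriv_def f'_def[abs_def] g'_def[abs_def] set_integrable_def by auto
  then have [measurable]: "f' \<in> borel_measurable borel" "g' \<in> borel_measurable borel"
    by (auto dest: borel_measurable_integrable)
  define X where "X s x = (f' (x + s *\<^sub>R v) - f' x) / s - g' x" for s x
  have iX: "integrable lborel (X s)" for s
    unfolding X_def[abs_def] using i integrable_translate[OF i(1), of "s *\<^sub>R v"] by auto
  have key: "(LINT x:box a b|lborel. \<bar>X s x\<bar>) \<le> 2 * e"
    if s: "0 < s" "s * norm v \<le> \<delta>" and e: "\<And>t. 0 \<le> t \<Longrightarrow> t \<le> s \<Longrightarrow> (LINT x|lborel. \<bar>g' (x + t *\<^sub>R v) - g' x\<bar>) \<le> e" for s e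
  proof -
    have *: "\<bar>LINT x:box a b|lborel. X s x * \<zeta> x\<bar> \<le> e"
      if z: "test_smooth (box a b) \<zeta>" and z01: "\<And>x. 0 \<le> \<zeta> x" "\<And>x. \<zeta> x \<le> 1" for \<zeta>
    proof -
      let ?D = "\<lambda>x. frechet_derivative \<zeta> (at x) v"
      have z0: "\<And>x. x \<notin> box a b \<Longrightarrow> \<zeta> x = 0" using test_smooth_outside[OF z] .
      have [measurable]: "\<zeta> \<in> borel_measurable borel"
        by (intro borel_measurable_continuous_onI smooth_continuous test_smooth_smooth[OF z])
      define P where "P t = (LINT y|lborel. f' y * \<zeta> (y - t *\<^sub>R v))" for t
      define Q where "Q t = (LINT y|lborel. g' y * \<zeta> (y - t *\<^sub>R v))" for t
      have ib: "integrable lborel (\<lambda>y. q y * \<zeta> (y - t *\<^sub>R v))" if "integrable lborel q" for q t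
        by (rule Bochner_Integration.integrable_bound[OF that])
           (use that z01 in \<open>auto simp: abs_mult mult_left_le dest: borel_measurable_integrable\<close>)
      have P: "(P has_real_derivative Q t) (at t)" if t: "0 \<le> t" "t \<le> s" for t
      proof -
        have zt: "test_smooth U (\<lambda>y. \<zeta> (y - t *\<^sub>R v))" and supp: "y \<in> C" if "y - t *\<^sub>R v \<in> box a b" for y
        proof -
          obtain K where K: "compact K" "K \<subseteq> box a b" "\<And>x. x \<notin> K \<Longrightarrow> \<zeta> x = 0"
            using test_smooth_support[OF z] by blast
          have tv: "norm (t *\<^sub>R v) \<le> \<delta>" using s t mult_right_mono[OF t(2), of "norm v"] by simp
          have "(\<lambda>x. x + t *\<^sub>R v) ` K \<subseteq> C" using inC[OF _ tv] K(2) by blast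
          moreover have "compact ((\<lambda>x. x + t *\<^sub>R v) ` K)" using K(1) by (intro compact_continuous_image continuous_intros)
          moreover have "smooth (\<lambda>y. \<zeta> (y - t *\<^sub>R v))"
            using smooth_affine[OF bounded_linear_ident test_smooth_smooth[OF z], of "- (t *\<^sub>R v)"] by simp
          moreover have "\<zeta> (y - t *\<^sub>R v) = 0" if "y \<notin> (\<lambda>x. x + t *\<^sub>R v) ` K" for y
            using that by (intro K(3)) (metis diff_add_cancel image_eqI)
          ultimately show "test_smooth U (\<lambda>y. \<zeta> (y - t *\<^sub>R v))"
            using C(2) by (intro test_smoothI[of _ "(\<lambda>x. x + t *\<^sub>R v) ` K"]) auto
          show "y \<in> C" using inC[OF that tv] by simp
        qed
        have sd: "frechet_derivative (\<lambda>y. \<zeta> (y - t *\<^sub>R v)) (at y) = frechet_derivative \<zeta> (at (y - t *\<^sub>R v))" for y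
        proof -
          have "((\<lambda>y. y - t *\<^sub>R v) has_derivative (\<lambda>y. y)) (at y)" by (auto intro!: derivative_eq_intros)
          from has_derivative_compose[OF this smooth_has_derivative[OF test_smooth_smooth[OF z]]]
          show ?thesis using frechet_derivative_at by fastforce
        qed
        have D0: "?D x = 0" if "x \<notin> box a b" for x
        proof -
          obtain K where K: "compact K" "K \<subseteq> box a b" "\<And>x. x \<notin> K \<Longrightarrow> \<zeta> x = 0"
            using test_smooth_support[OF z] by blast
          have "x \<notin> K" using that K(2) by blast
          then show ?thesis
            by (intro frechet_derivative_zero_outside[OF compact_imp_closed[OF K(1)] K(3)])
        qed
        have CU: "x \<in> C \<Longrightarrow> x \<in> U" for x using C(2) by auto
        have "Q t = - (LINT y|lborel. f' y * ?D (y - t *\<^sub>R v))"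
        proof (cases "box a b = {}")
          case True
          then show ?thesis using z0 D0 by (simp add: Q_def)
        next
          case False
          then obtain x where "x \<in> box a b" by blast
          then have zt': "test_smooth U (\<lambda>y. \<zeta> (y - t *\<^sub>R v))" using zt[of "x + t *\<^sub>R v"] by simp
          have "(LINT x:U|lborel. f x * frechet_derivative (\<lambda>y. \<zeta> (y - t *\<^sub>R v)) (at x) v)
              = - (LINT x:U|lborel. g x * \<zeta> (x - t *\<^sub>R v))"
            using w zt' unfolding weak_deriv_def by blast
          moreover have "(LINT x:U|lborel. f x * frechet_derivative (\<lambda>y. \<zeta> (y - t *\<^sub>R v)) (at x) v)
            = (LINT y|lborel. f' y * ?D (y - t *\<^sub>R v))"
            unfolding set_lebesgue_integral_def sd
          proof (intro Bochner_Integration.integral_cong refl)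
            fix y show "indicat_real U y *\<^sub>R (f y * ?D (y - t *\<^sub>R v)) = f' y * ?D (y - t *\<^sub>R v)"
              using supp[of y] D0[of "y - t *\<^sub>R v"] CU[of y] by (cases "y - t *\<^sub>R v \<in> box a b") (auto simp: f'_def)
          qed
          moreover have "(LINT x:U|lborel. g x * \<zeta> (x - t *\<^sub>R v)) = Q t"
            unfolding set_lebesgue_integral_def Q_def
          proof (intro Bochner_Integration.integral_cong refl)
            fix y show "indicat_real U y *\<^sub>R (g y * \<zeta> (y - t *\<^sub>R v)) = g' y * \<zeta> (y - t *\<^sub>R v)"
              using supp[of y] z0[of "y - t *\<^sub>R v"] CU[of y] by (cases "y - t *\<^sub>R v \<in> box a b") (auto simp: g'_def)
          qed
          ultimately show ?thesis by simp
        qed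
        then show ?thesis using integral_smooth_translate_deriv[OF i(1) z, of v t] unfolding P_def[abs_def] by simp
      qed
      obtain t where t: "0 < t" "t < s" "P s - P 0 = (s - 0) * Q t"
        using MVT2[OF s(1), of P Q] P by auto
      have tr: "(LINT y|lborel. q y * \<zeta> (y - t *\<^sub>R v)) = (LINT x|lborel. q (x + t *\<^sub>R v) * \<zeta> x)"
        if [measurable]: "q \<in> borel_measurable borel" for q t
        using integral_translate[of "\<lambda>y. q y * \<zeta> (y - t *\<^sub>R v)" "t *\<^sub>R v"] by simp
      have itr: "integrable lborel (\<lambda>x. q (x + t *\<^sub>R v) * \<zeta> x)" if "integrable lborel q" for q t
        using integrable_translate[OF ib[OF that, of t], of "t *\<^sub>R v"] by simp
      have "(LINT x:box a b|lborel. X s x * \<zeta> x) = (LINT x|lborel. X s x * \<zeta> x)"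
        unfolding set_lebesgue_integral_def
        by (intro Bochner_Integration.integral_cong refl) (use z0 in \<open>auto simp: indicator_def\<close>)
      also have "\<dots> = (LINT x|lborel. (f' (x + s *\<^sub>R v) * \<zeta> x - f' (x + 0 *\<^sub>R v) * \<zeta> x) / s - g' (x + 0 *\<^sub>R v) * \<zeta> x)"
        by (intro Bochner_Integration.integral_cong refl) (simp add: X_def algebra_simps diff_divide_distrib)
      also have "\<dots> = ((LINT x|lborel. f' (x + s *\<^sub>R v) * \<zeta> x) - (LINT x|lborel. f' (x + 0 *\<^sub>R v) * \<zeta> x)) / s
           - (LINT x|lborel. g' (x + 0 *\<^sub>R v) * \<zeta> x)"
        using itr[OF i(1), of s] itr[OF i(1), of 0] itr[OF i(2), of 0] by simp
      also have "\<dots> = (P s - P 0) / s - Q 0"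
        unfolding P_def Q_def tr[OF \<open>f' \<in> borel_measurable borel\<close>] tr[OF \<open>g' \<in> borel_measurable borel\<close>] ..
      also have "\<dots> = Q t - Q 0" using t(3) s(1) by simp
      also have "\<dots> = (LINT x|lborel. (g' (x + t *\<^sub>R v) - g' x) * \<zeta> x)"
        unfolding Q_def tr[OF \<open>g' \<in> borel_measurable borel\<close>] using itr[OF i(2), of t] itr[OF i(2), of 0]
        by (simp add: left_diff_distrib)
      also have "\<bar>\<dots>\<bar> \<le> (LINT x|lborel. \<bar>(g' (x + t *\<^sub>R v) - g' x) * \<zeta> x\<bar>)" by (rule integral_abs_bound)
      also have "\<dots> \<le> (LINT x|lborel. \<bar>g' (x + t *\<^sub>R v) - g' x\<bar>)"
      proof (intro integral_mono)
        show "\<bar>(g' (x + t *\<^sub>R v) - g' x) * \<zeta> x\<bar> \<le> \<bar>g' (x + t *\<^sub>R v) - g' x\<bar>" for x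
          using z01[of x] by (simp add: abs_mult mult_left_le)
      qed (use itr[OF i(2), of t] itr[OF i(2), of 0] integrable_translate[OF i(2), of "t *\<^sub>R v"] i(2)
          in \<open>auto simp: left_diff_distrib\<close>)
      also have "\<dots> \<le> e" using t by (intro e) auto
      finally show ?thesis .
    qed
    have iXs: "set_integrable lborel (box a b) (X s)" "set_integrable lborel (box a b) (\<lambda>x. - X s x)"
      using integrable_mult_indicator[OF _ iX[of s], of "box a b"] by (auto simp: set_integrable_def)
    \<comment> \<open>The bound is uniform in \<open>\<zeta>\<close>, so that it passes to the positive and the negative part.\<close>
    have m: "(LINT x:box a b|lborel. max (X s x) 0) \<le> e" "(LINT x:box a b|lborel. max (- X s x) 0) \<le> e"
    proof -
      show "(LINT x:box a b|lborel. max (X s x) 0) \<le> e"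
        by (rule integral_positive_part_le[OF open_box emeasure_box_finite iXs(1)]) (use * in \<open>force simp: abs_le_iff\<close>)
      have "(LINT x:box a b|lborel. - X s x * \<zeta> x) = - (LINT x:box a b|lborel. X s x * \<zeta> x)" for \<zeta>
        by (simp add: set_lebesgue_integral_def)
      then show "(LINT x:box a b|lborel. max (- X s x) 0) \<le> e"
        by (intro integral_positive_part_le[OF open_box emeasure_box_finite iXs(2)]) (use * in \<open>force simp: abs_le_iff\<close>)
    qed
    have "(LINT x:box a b|lborel. \<bar>X s x\<bar>) = (LINT x:box a b|lborel. max (X s x) 0 + max (- X s x) 0)"
      by (intro arg_cong[where f="\<lambda>f. LINT x:box a b|lborel. f x"] ext) (auto simp: max_def)
    also have "\<dots> = (LINT x:box a b|lborel. max (X s x) 0) + (LINT x:box a b|lborel. max (- X s x) 0)"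
    proof (intro set_integral_add)
      have "set_integrable lborel (box a b) (\<lambda>x. max (Y x) 0)" if "integrable lborel Y" for Y :: "'a \<Rightarrow> real"
        using integrable_mult_indicator[OF _ Bochner_Integration.integrable_max[OF that integrable_zero], of "box a b"]
        by (simp add: set_integrable_def)
      then show "set_integrable lborel (box a b) (\<lambda>x. max (X s x) 0)" "set_integrable lborel (box a b) (\<lambda>x. max (- X s x) 0)"
        using iX[of s] by auto
    qed
    finally show ?thesis using m by simp
  qed
  have lim: "(\<lambda>n. LINT x:box a b|lborel. \<bar>X (h n) x\<bar>) \<longlonglongrightarrow> 0"
  proof (rule LIMSEQ_I)
    fix e :: real assume e: "0 < e"
    obtain d where d': "d > 0" "\<And>k. norm k < d \<Longrightarrow> (LINT x|lborel. norm (g' (x + k) - g' x)) < e / 4"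
      using L1_translation[OF i(2), of "e/4"] e by auto
    have "(\<lambda>n. h n * norm v) \<longlonglongrightarrow> 0 * norm v" by (intro tendsto_intros h(2))
    then have "\<forall>\<^sub>F n in sequentially. h n * norm v < min d \<delta>"
      using d(1) d'(1) by (intro order_tendstoD) auto
    then obtain N where N: "\<And>n. n \<ge> N \<Longrightarrow> h n * norm v < min d \<delta>" by (auto simp: eventually_sequentially)
    have "\<bar>LINT x:box a b|lborel. \<bar>X (h n) x\<bar>\<bar> < e" if n: "n \<ge> N" for n
    proof -
      have "(LINT x:box a b|lborel. \<bar>X (h n) x\<bar>) \<le> 2 * (e / 4)"
      proof (rule key)
        fix t assume t: "0 \<le> t" "t \<le> h n"
        then have "norm (t *\<^sub>R v) < d" using N[OF n] mult_right_mono[OF t(2), of "norm v"] by simp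
        from d'(2)[OF this] show "(LINT x|lborel. \<bar>g' (x + t *\<^sub>R v) - g' x\<bar>) \<le> e / 4" by simp
      qed (use N[OF n] h(1) in auto)
      moreover have "0 \<le> (LINT x:box a b|lborel. \<bar>X (h n) x\<bar>)"
        unfolding set_lebesgue_integral_def by (intro Bochner_Integration.integral_nonneg) auto
      ultimately show ?thesis using e by linarith
    qed
    then show "\<exists>N. \<forall>n\<ge>N. norm ((LINT x:box a b|lborel. \<bar>X (h n) x\<bar>) - 0) < e" by auto
  qed
  have "(\<lambda>n. LINT x|lborel. norm (indicator (box a b) x * X (h n) x)) \<longlonglongrightarrow> 0"
    using lim by (simp add: set_lebesgue_integral_def abs_mult)
  moreover have "integrable lborel (\<lambda>x. indicator (box a b) x * X (h n) x)" for n
    using integrable_mult_indicator[OF _ iX[of "h n"], of "box a b"] by simp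
  ultimately obtain r where r: "strict_mono r"
    "AE x in lborel. (\<lambda>n. indicator (box a b) x * X (h (r n)) x) \<longlonglongrightarrow> 0"
    using tendsto_L1_AE_subseq[of lborel "\<lambda>n x. indicator (box a b) x * X (h n) x"] by blast
  show ?thesis
  proof (rule that[OF r(1)])
    show "AE x in lborel. x \<in> box a b \<longrightarrow> (\<lambda>n. (f (x + h (r n) *\<^sub>R v) - f x) / h (r n)) \<longlonglongrightarrow> g x"
      using r(2)
    proof eventually_elim
      case (elim x)
      show ?case
      proof
        assume x: "x \<in> box a b"
        have xC: "x \<in> C" using inC[OF x, of 0] d(1) by simp
        have "(\<lambda>n. h (r n)) \<longlonglongrightarrow> 0" using LIMSEQ_subseq_LIMSEQ[OF h(2) r(1)] by (simp add: comp_def)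
        then have "(\<lambda>n. h (r n) * norm v) \<longlonglongrightarrow> 0 * norm v" by (intro tendsto_intros)
        then have "\<forall>\<^sub>F n in sequentially. h (r n) * norm v < \<delta>"
          using d(1) by (intro order_tendstoD) auto
        then have "\<forall>\<^sub>F n in sequentially. X (h (r n)) x = (f (x + h (r n) *\<^sub>R v) - f x) / h (r n) - g x"
        proof eventually_elim
          case (elim n)
          have "x + h (r n) *\<^sub>R v \<in> C" using h(1)[of "r n"] elim by (intro inC x) auto
          then show ?case using xC by (simp add: X_def f'_def g'_def)
        qed
        moreover have "(\<lambda>n. X (h (r n)) x) \<longlonglongrightarrow> 0" using elim x by simp
        ultimately have "(\<lambda>n. (f (x + h (r n) *\<^sub>R v) - f x) / h (r n) - g x) \<longlonglongrightarrow> 0"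
          by (rule Lim_transform_eventually[rotated])
        then show "(\<lambda>n. (f (x + h (r n) *\<^sub>R v) - f x) / h (r n)) \<longlonglongrightarrow> g x" by (simp add: LIM_zero_iff)
      qed
    qed
  qed
qed

text \<open>Where \<open>u > 0\<close>, the difference quotients of \<open>u\<close> and of its positive part eventually agree.\<close>

lemma weak_deriv_positive_part:
  fixes u du d :: "'a::euclidean_space \<Rightarrow> real"
  assumes U: "open U" and u: "weak_deriv U v u du" and up: "weak_deriv U v (\<lambda>x. max (u x) 0) d"
  shows "AE x in lborel. x \<in> U \<longrightarrow> 0 < u x \<longrightarrow> d x = du x"
proof (rule AE_on_open_by_boxes[OF U])
  fix a b :: 'a assume ab: "cbox a b \<subseteq> U"
  define h where "h n = inverse (real (Suc n))" for n
  have h: "\<And>n. 0 < h n" "h \<longlonglongrightarrow> 0"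
    using LIMSEQ_inverse_real_of_nat by (auto simp: h_def[abs_def])
  obtain r where r: "strict_mono r"
    "AE x in lborel. x \<in> box a b \<longrightarrow> (\<lambda>n. (u (x + h (r n) *\<^sub>R v) - u x) / h (r n)) \<longlonglongrightarrow> du x"
    using weak_deriv_difference_quotient[OF u U ab h] by blast
  have "(\<lambda>n. h (r n)) \<longlonglongrightarrow> 0" using LIMSEQ_subseq_LIMSEQ[OF h(2) r(1)] by (simp add: comp_def)
  then obtain s where s: "strict_mono s"
    "AE x in lborel. x \<in> box a b \<longrightarrow> (\<lambda>n. (max (u (x + h (r (s n)) *\<^sub>R v)) 0 - max (u x) 0) / h (r (s n))) \<longlonglongrightarrow> d x"
    using weak_deriv_difference_quotient[OF up U ab, of "\<lambda>n. h (r n)"] h(1) by blast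
  show "AE x in lborel. x \<in> box a b \<longrightarrow> 0 < u x \<longrightarrow> d x = du x"
    using r(2) s(2)
  proof eventually_elim
    case (elim x)
    show ?case
    proof (intro impI)
      assume x: "x \<in> box a b" "0 < u x"
      define k where "k n = h (r (s n))" for n
      have k0: "k \<longlonglongrightarrow> 0" "\<And>n. 0 < k n"
        using LIMSEQ_subseq_LIMSEQ[OF h(2) strict_mono_o[OF r(1) s(1)]] h(1) by (auto simp: k_def[abs_def] comp_def)
      have 1: "(\<lambda>n. (u (x + k n *\<^sub>R v) - u x) / k n) \<longlonglongrightarrow> du x"
        using LIMSEQ_subseq_LIMSEQ[OF mp[OF elim(1) x(1)] s(1)] by (simp add: comp_def k_def)
      have 2: "(\<lambda>n. (max (u (x + k n *\<^sub>R v)) 0 - max (u x) 0) / k n) \<longlonglongrightarrow> d x"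
        using elim(2) x(1) by (simp add: k_def)
      have "(\<lambda>n. u x + k n * ((u (x + k n *\<^sub>R v) - u x) / k n)) \<longlonglongrightarrow> u x + 0 * du x"
        by (intro tendsto_intros 1 k0)
      then have "\<forall>\<^sub>F n in sequentially. 0 < u x + k n * ((u (x + k n *\<^sub>R v) - u x) / k n)"
        using x(2) by (intro order_tendstoD) auto
      then have "\<forall>\<^sub>F n in sequentially. (u (x + k n *\<^sub>R v) - u x) / k n = (max (u (x + k n *\<^sub>R v)) 0 - max (u x) 0) / k n"
        by eventually_elim (use k0(2) x(2) in \<open>auto simp: max_def less_imp_neq[symmetric]\<close>)
      from Lim_transform_eventually[OF 1 this] 2 show "d x = du x" using LIMSEQ_unique by blast
    qed
  qed
qed

section \<open>Test functions built from smooth functions\<close>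

abbreviation W1p_norm_at :: "real \<Rightarrow> 'a::euclidean_space set \<Rightarrow> ('a \<times> real \<Rightarrow> real) \<Rightarrow> ('a \<times> real \<Rightarrow> 'a) \<Rightarrow> real \<Rightarrow> real" where
  "W1p_norm_at p \<Omega> u Du t \<equiv> W1p_norm p \<Omega> (\<lambda>x. u (x, t)) (\<lambda>x. Du (x, t))"

definition grad_x :: "('a::euclidean_space \<times> real \<Rightarrow> real) \<Rightarrow> 'a \<times> real \<Rightarrow> 'a" where
  "grad_x f z = (\<Sum>i\<in>Basis. frechet_derivative f (at z) (i, 0) *\<^sub>R i)"

definition deriv_t :: "('a::euclidean_space \<times> real \<Rightarrow> real) \<Rightarrow> 'a \<times> real \<Rightarrow> real" where
  "deriv_t f z = frechet_derivative f (at z) (0, 1)"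

lemma smooth_measurable [measurable_dest]: "smooth f \<Longrightarrow> f \<in> borel_measurable borel"
  by (intro borel_measurable_continuous_onI smooth_continuous)

lemma smooth_slice: "smooth f \<Longrightarrow> smooth (\<lambda>x. f (x, t))"
  using smooth_affine[of "\<lambda>x. (x, 0)" f "(0, t)"]
  by (simp add: bounded_linear_Pair bounded_linear_ident bounded_linear_zero)

lemma frechet_derivative_slice:
  assumes "smooth f"
  shows "frechet_derivative (\<lambda>x. f (x, t)) (at x) v = frechet_derivative f (at (x, t)) (v, 0)"
proof -
  have "((\<lambda>x. (x, t)) has_derivative (\<lambda>v. (v, 0))) (at x)" by (auto intro!: derivative_eq_intros)
  from has_derivative_compose[OF this smooth_has_derivative[OF assms]]
  have "((\<lambda>x. f (x, t)) has_derivative (\<lambda>v. frechet_derivative f (at (x, t)) (v, 0))) (at x)" .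
  then show ?thesis using frechet_derivative_at by metis
qed

lemma gradient_slice: "smooth f \<Longrightarrow> gradient (\<lambda>x. f (x, t)) x = grad_x f (x, t)"
  by (simp add: gradient_def grad_x_def frechet_derivative_slice)

lemma continuous_gradient: "smooth f \<Longrightarrow> continuous_on A (gradient f)"
  unfolding gradient_def[abs_def]
  by (intro continuous_intros smooth_continuous smooth_deriv)

lemma continuous_grad_x: "smooth f \<Longrightarrow> continuous_on A (grad_x f)"
  unfolding grad_x_def[abs_def]
  by (intro continuous_intros smooth_continuous smooth_deriv)

lemma smooth_deriv_t: "smooth f \<Longrightarrow> smooth (deriv_t f)"
  unfolding deriv_t_def[abs_def] by (rule smooth_deriv)

lemma gradient_inner:
  assumes "smooth f" shows "gradient f x \<bullet> v = frechet_derivative f (at x) v"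
proof -
  have l: "linear (frechet_derivative f (at x))"
    using smooth_has_derivative[OF assms] by (rule has_derivative_linear)
  have "gradient f x \<bullet> v = (\<Sum>i\<in>Basis. frechet_derivative f (at x) i * (i \<bullet> v))"
    by (simp add: gradient_def inner_sum_left)
  also have "\<dots> = (\<Sum>i\<in>Basis. frechet_derivative f (at x) ((v \<bullet> i) *\<^sub>R i))"
    by (simp add: linear_scale[OF l] inner_commute mult.commute)
  also have "\<dots> = frechet_derivative f (at x) (\<Sum>i\<in>Basis. (v \<bullet> i) *\<^sub>R i)"
    by (simp add: linear_sum[OF l])
  finally show ?thesis by (simp add: euclidean_representation)
qed

lemma test_smooth_slice:
  assumes "test_smooth (\<Omega> \<times> I) f" shows "test_smooth \<Omega> (\<lambda>x. f (x, t))"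
proof -
  obtain K where K: "compact K" "K \<subseteq> \<Omega> \<times> I" "\<And>z. z \<notin> K \<Longrightarrow> f z = 0"
    using test_smooth_support[OF assms] by blast
  show ?thesis
  proof (rule test_smoothI[of _ "fst ` K"])
    show "compact (fst ` K)" using K(1) by (intro compact_continuous_image continuous_intros)
    show "f (x, t) = 0" if "x \<notin> fst ` K" for x
      using that by (intro K(3)) (metis fst_conv image_eqI)
  qed (use K smooth_slice[OF test_smooth_smooth[OF assms]] in auto)
qed

lemma test_smooth_bounded:
  assumes "test_smooth U f"
  obtains B where "0 \<le> B" "\<And>x. \<bar>f x\<bar> \<le> B" "\<And>x v. norm v \<le> 1 \<Longrightarrow> \<bar>frechet_derivative f (at x) v\<bar> \<le> B"
proof -
  have sm: "smooth f" by (rule test_smooth_smooth[OF assms])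
  obtain K where K: "compact K" "K \<subseteq> U" "\<And>x. x \<notin> K \<Longrightarrow> f x = 0"
    using test_smooth_support[OF assms] by blast
  have "bounded (f ` K)" "bounded (gradient f ` K)"
    using smooth_continuous[OF sm] continuous_gradient[OF sm] K(1)
    by (auto intro!: compact_imp_bounded compact_continuous_image)
  then obtain B1 B2 where B: "\<And>x. x \<in> K \<Longrightarrow> \<bar>f x\<bar> \<le> B1" "\<And>x. x \<in> K \<Longrightarrow> norm (gradient f x) \<le> B2"
    unfolding bounded_iff by (metis image_eqI real_norm_def)
  show ?thesis
  proof (rule that[of "\<bar>B1\<bar> + \<bar>B2\<bar>"])
    fix x show "\<bar>f x\<bar> \<le> \<bar>B1\<bar> + \<bar>B2\<bar>" using B(1)[of x] K(3)[of x] by (cases "x \<in> K") auto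
    fix v :: 'a assume v: "norm v \<le> 1"
    show "\<bar>frechet_derivative f (at x) v\<bar> \<le> \<bar>B1\<bar> + \<bar>B2\<bar>"
    proof (cases "x \<in> K")
      case True
      have "\<bar>gradient f x \<bullet> v\<bar> \<le> norm (gradient f x) * norm v" by (rule Cauchy_Schwarz_ineq2)
      also have "\<dots> \<le> norm (gradient f x) * 1" using v by (intro mult_left_mono) auto
      finally show ?thesis using B(2)[OF True] by (simp add: gradient_inner[OF sm])
    next
      case False
      then show ?thesis
        using frechet_derivative_zero_outside[OF compact_imp_closed[OF K(1)] K(3)] by simp
    qed
  qed simp
qed

lemma test_smooth_frechet_outside:
  assumes "test_smooth U f" "x \<notin> U" shows "frechet_derivative f (at x) v = 0"
proof -
  obtain K where K: "compact K" "K \<subseteq> U" "\<And>x. x \<notin> K \<Longrightarrow> f x = 0"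
    using test_smooth_support[OF assms(1)] by blast
  have "x \<notin> K" using K(2) assms(2) by blast
  then show ?thesis
    using frechet_derivative_zero_outside[OF compact_imp_closed[OF K(1)] K(3)] by simp
qed

lemma set_integrable_bounded:
  fixes f :: "'a::euclidean_space \<Rightarrow> 'b::euclidean_space"
  assumes "bounded U" "U \<in> sets borel" "f \<in> borel_measurable borel" "\<And>x. norm (f x) \<le> B"
  shows "set_integrable lborel U f"
  unfolding set_integrable_def
proof (rule Bochner_Integration.integrable_bound[where f="\<lambda>x. indicator U x * B"])
  have "emeasure lborel U < \<infinity>" using assms(1) by (rule emeasure_bounded_finite)
  then show "integrable lborel (\<lambda>x. indicator U x * B)"
    using assms by (intro integrable_mult_left integrable_real_indicator) auto
  have "0 \<le> B" using assms(4) norm_ge_zero order_trans by blast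
  then show "AE x in lborel. norm (indicator U x *\<^sub>R f x) \<le> norm (indicator U x * B)"
    using assms(4) by (auto simp: indicator_def)
qed (use assms in auto)

lemma set_borel_measurable_borel:
  assumes [measurable]: "U \<in> sets borel" "f \<in> borel_measurable borel"
  shows "set_borel_measurable lborel U (f :: 'a::euclidean_space \<Rightarrow> 'b::euclidean_space)"
  unfolding set_borel_measurable_def by measurable

text \<open>Classical derivatives are weak derivatives, and continuous functions with compact support are
  integrable to every positive power.\<close>

lemma W1p_C1:
  fixes \<Omega> :: "'a::euclidean_space set" and f :: "'a \<Rightarrow> real"
  assumes "bounded \<Omega>" "open \<Omega>" "0 \<le> p" and f: "\<And>x. (f has_derivative (\<lambda>v. g x \<bullet> v)) (at x)" and g: "continuous_on UNIV g"
    and K: "compact K" "\<And>x. x \<notin> K \<Longrightarrow> f x = 0"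
  shows "W1p p \<Omega> f g"
proof -
  have cf: "continuous_on UNIV f"
    using f by (meson continuous_at_imp_continuous_on has_derivative_continuous)
  have g0: "g x = 0" if "x \<notin> K" for x
  proof -
    have "frechet_derivative f (at x) = (\<lambda>v. g x \<bullet> v)" using frechet_derivative_at[OF f] by simp
    moreover have "frechet_derivative f (at x) (g x) = 0"
      by (rule frechet_derivative_zero_outside[OF compact_imp_closed[OF K(1)] K(2) that])
    ultimately show ?thesis by simp
  qed
  have [measurable]: "f \<in> borel_measurable borel" "g \<in> borel_measurable borel" "\<Omega> \<in> sets borel"
    using cf g assms(2) by (auto intro: borel_measurable_continuous_onI)
  have bd: "\<exists>B. \<forall>x. norm (h x) \<le> B" if "continuous_on UNIV h" "\<And>x. x \<notin> K \<Longrightarrow> h x = 0" for h :: "'a \<Rightarrow> 'b::euclidean_space"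
  proof -
    have "bounded (h ` K)"
      using continuous_on_subset[OF that(1)] K(1) by (auto intro!: compact_imp_bounded compact_continuous_image)
    then obtain B where B: "\<And>x. x \<in> K \<Longrightarrow> norm (h x) \<le> B" unfolding bounded_iff by blast
    have "norm (h x) \<le> \<bar>B\<bar>" for x using B[of x] that(2)[of x] by (cases "x \<in> K") auto
    then show ?thesis by blast
  qed
  have Lp: "Lp_on p \<Omega> h" if h: "\<exists>B. \<forall>x. norm (h x) \<le> B" and [measurable]: "h \<in> borel_measurable borel"
    for h :: "'a \<Rightarrow> 'b::euclidean_space"
  proof -
    obtain B where B: "\<And>x. norm (h x) \<le> B" using h by blast
    have "set_integrable lborel \<Omega> (\<lambda>x. norm (h x) powr p)"
      using B assms(1,3) by (intro set_integrable_bounded[where B="B powr p"]) (auto intro: powr_mono2)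
    then show ?thesis unfolding Lp_on_def using set_borel_measurable_borel[of \<Omega> h] by simp
  qed
  show ?thesis
    unfolding W1p_def
  proof (intro conjI ballI)
    show "Lp_on p \<Omega> f" by (rule Lp[OF bd[OF cf K(2)]]) measurable
    show "Lp_on p \<Omega> g" by (rule Lp[OF bd[OF g g0]]) measurable
    fix i :: 'a assume "i \<in> Basis"
    show "weak_deriv \<Omega> i f (\<lambda>x. g x \<bullet> i)"
      by (intro weak_deriv_classical cf has_real_derivative_along[OF f] continuous_intros g)
  qed
qed
lemma W1p_norm_power2: "(W1p_norm p \<Omega> u Du)\<^sup>2 =
    ((LINT x:\<Omega>|lborel. \<bar>u x\<bar> powr p) + (LINT x:\<Omega>|lborel. norm (Du x) powr p)) powr (2 / p)"
proof -
  have "0 \<le> (LINT x:\<Omega>|lborel. \<bar>u x\<bar> powr p) + (LINT x:\<Omega>|lborel. norm (Du x) powr p)"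
    unfolding set_lebesgue_integral_def by (intro add_nonneg_nonneg Bochner_Integration.integral_nonneg) auto
  then show ?thesis unfolding W1p_norm_def by (simp add: powr_powr flip: powr_numeral)
qed

lemma smooth_gradient_derivative: "smooth f \<Longrightarrow> (f has_derivative (\<lambda>v. gradient f x \<bullet> v)) (at x)"
  using smooth_has_derivative[of f x] by (simp add: gradient_inner)

lemma W1p_0_test_smooth:
  fixes \<Omega> :: "'a::euclidean_space set"
  assumes "bounded \<Omega>" "open \<Omega>" "0 < p" "test_smooth \<Omega> f"
  shows "W1p_0 p \<Omega> f (gradient f)" "W1p p \<Omega> f (gradient f)"
proof -
  have sm: "smooth f" by (rule test_smooth_smooth[OF assms(4)])
  obtain K where K: "compact K" "K \<subseteq> \<Omega>" "\<And>x. x \<notin> K \<Longrightarrow> f x = 0"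
    using test_smooth_support[OF assms(4)] by blast
  show 1: "W1p p \<Omega> f (gradient f)"
    using W1p_C1[OF assms(1,2) _ smooth_gradient_derivative[OF sm] continuous_gradient[OF sm] K(1,3)] assms(3) by simp
  have "(\<lambda>k::nat. W1p_norm p \<Omega> (\<lambda>x. f x - f x) (\<lambda>x. gradient f x - gradient f x)) \<longlonglongrightarrow> 0"
    using assms(3) by (simp add: W1p_norm_def set_lebesgue_integral_def)
  then show "W1p_0 p \<Omega> f (gradient f)"
    unfolding W1p_0_def using 1 assms(4) by (intro conjI exI[of _ "\<lambda>_. f"]) auto
qed

lemma borel_measurable_slice_integral:
  fixes f :: "'a::euclidean_space \<times> real \<Rightarrow> real"
  assumes [measurable]: "f \<in> borel_measurable borel" "\<Omega> \<in> sets borel"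
  shows "(\<lambda>t. LINT x:\<Omega>|lborel. f (x, t)) \<in> borel_measurable borel"
  unfolding set_lebesgue_integral_def by measurable

lemma measurable_W1p_norm:
  fixes u :: "'a::euclidean_space \<times> real \<Rightarrow> real" and Du :: "'a \<times> real \<Rightarrow> 'a"
  assumes [measurable]: "u \<in> borel_measurable borel" "Du \<in> borel_measurable borel" "\<Omega> \<in> sets borel"
  shows "(\<lambda>t. W1p_norm_at p \<Omega> u Du t) \<in> borel_measurable borel"
proof -
  have [measurable]: "(\<lambda>t. LINT x:\<Omega>|lborel. \<bar>u (x, t)\<bar> powr p) \<in> borel_measurable borel"
    "(\<lambda>t. LINT x:\<Omega>|lborel. norm (Du (x, t)) powr p) \<in> borel_measurable borel"
    using borel_measurable_slice_integral[of "\<lambda>z. \<bar>u z\<bar> powr p" \<Omega>]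
      borel_measurable_slice_integral[of "\<lambda>z. norm (Du z) powr p" \<Omega>] by simp_all
  show ?thesis unfolding W1p_norm_def by measurable
qed

text \<open>A series of smooth functions whose supports lie over disjoint sets of times is a test function
  as soon as the terms and their time derivatives are dominated by a geometric series and the
  Sobolev norms are summable. Only the time derivative of the sum has to exist classically: at each
  time the sum reduces to a single smooth term, whose spatial derivatives enter only through the norm.\<close>

lemma test_function_series:
  fixes \<Omega> :: "'a::euclidean_space set" and \<phi> :: "nat \<Rightarrow> 'a \<times> real \<Rightarrow> real"
  assumes p: "1 < p" and \<Omega>: "bounded \<Omega>" "open \<Omega>" and I: "disjoint_family I" "\<And>j. I j \<subseteq> {0<..<T}"
    and \<phi>: "\<And>j. test_smooth (\<Omega> \<times> I j) (\<phi> j)" "\<And>j z. 0 \<le> \<phi> j z"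
    and B: "\<And>j z. \<phi> j z \<le> B * (1/2) ^ j" "\<And>j z. \<bar>deriv_t (\<phi> j) z\<bar> \<le> B * (1/2) ^ j"
    and N: "summable (\<lambda>j. LINT t|lborel. (W1p_norm_at p \<Omega> (\<phi> j) (grad_x (\<phi> j)) t)\<^sup>2)"
    and Ni: "\<And>j. integrable lborel (\<lambda>t. (W1p_norm_at p \<Omega> (\<phi> j) (grad_x (\<phi> j)) t)\<^sup>2)"
  obtains \<Phi> D\<Phi> \<Phi>t where "test_function p \<Omega> T \<Phi> D\<Phi> \<Phi>t" "zero_on_boundary p \<Omega> T \<Phi> D\<Phi>"
    "\<And>j x t. t \<in> I j \<Longrightarrow> \<Phi> (x, t) = \<phi> j (x, t)"
    "\<And>j x t. t \<in> I j \<Longrightarrow> D\<Phi> (x, t) = grad_x (\<phi> j) (x, t)"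
    "\<And>j x t. t \<in> I j \<Longrightarrow> \<Phi>t (x, t) = deriv_t (\<phi> j) (x, t)"
proof -
  have B0: "0 \<le> B" using order_trans[OF \<phi>(2)[of 0 undefined] B(1)] by simp
  have sm: "smooth (\<phi> j)" for j by (rule test_smooth_smooth[OF \<phi>(1)])
  have m\<phi>[measurable]: "\<phi> j \<in> borel_measurable borel" "grad_x (\<phi> j) \<in> borel_measurable borel"
    "deriv_t (\<phi> j) \<in> borel_measurable borel" for j
    using sm by (auto intro!: borel_measurable_continuous_onI smooth_continuous continuous_grad_x smooth_deriv_t)
  have [measurable]: "\<Omega> \<in> sets borel" using \<Omega> by auto
  have out: "\<phi> j (x, t) = 0" "grad_x (\<phi> j) (x, t) = 0" "deriv_t (\<phi> j) (x, t) = 0" if "t \<notin> I j" for j x t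
    using test_smooth_outside[OF \<phi>(1)] test_smooth_frechet_outside[OF \<phi>(1)] that
    by (auto simp: grad_x_def deriv_t_def)
  define \<Phi> where "\<Phi> z = (\<Sum>j. \<phi> j z)" for z
  define D\<Phi> where "D\<Phi> z = (\<Sum>j. grad_x (\<phi> j) z)" for z
  define \<Phi>t where "\<Phi>t z = (\<Sum>j. deriv_t (\<phi> j) z)" for z
  have single: "\<exists>j. \<forall>k\<noteq>j. t \<notin> I k" for t
    using I(1) unfolding disjoint_family_on_def by blast
  have inI: "\<Phi> (x, t) = \<phi> j (x, t)" "D\<Phi> (x, t) = grad_x (\<phi> j) (x, t)" "\<Phi>t (x, t) = deriv_t (\<phi> j) (x, t)"
    if "\<forall>k\<noteq>j. t \<notin> I k" for j x t
    using that out unfolding \<Phi>_def D\<Phi>_def \<Phi>t_def by (subst suminf_finite[of "{j}"]; auto)+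
  have Ij: "\<forall>k\<noteq>j. t \<notin> I k" if "t \<in> I j" for t j
    using I(1) that unfolding disjoint_family_on_def by blast
  have geo: "summable (\<lambda>j. B * (1/2::real) ^ j)" by (intro summable_mult summable_geometric) simp
  have uc: "uniformly_convergent_on UNIV (\<lambda>n z. \<Sum>i<n. f i z)" "continuous_on UNIV (\<lambda>z. \<Sum>j. f j z)"
    if f: "\<And>j z. \<bar>f j z\<bar> \<le> B * (1/2) ^ j" "\<And>j. continuous_on UNIV (f j)" for f :: "nat \<Rightarrow> 'b::euclidean_space \<Rightarrow> real"
  proof -
    show 1: "uniformly_convergent_on UNIV (\<lambda>n z. \<Sum>i<n. f i z)"
      by (rule Weierstrass_m_test'_ev[OF _ geo]) (use f in auto)
    have "uniform_limit UNIV (\<lambda>n z. \<Sum>i<n. f i z) (\<lambda>z. \<Sum>j. f j z) sequentially"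
      using 1 by (simp add: uniformly_convergent_uniform_limit_iff suminf_eq_lim)
    then show "continuous_on UNIV (\<lambda>z. \<Sum>j. f j z)"
      by (rule uniform_limit_theorem[rotated]) (auto intro!: always_eventually continuous_intros f)
  qed
  have cont: "continuous_on UNIV \<Phi>" "continuous_on UNIV \<Phi>t"
    unfolding \<Phi>_def[abs_def] \<Phi>t_def[abs_def]
    by (intro uc; use B \<phi>(2) sm in \<open>auto intro!: smooth_continuous smooth_deriv_t\<close>)+
  have meas[measurable]: "\<Phi> \<in> borel_measurable borel" "\<Phi>t \<in> borel_measurable borel" "D\<Phi> \<in> borel_measurable borel"
    using cont by (auto intro: borel_measurable_continuous_onI) (auto simp: D\<Phi>_def[abs_def])
  have \<Phi>0: "0 \<le> \<Phi> z" "\<Phi> z \<le> B" "\<bar>\<Phi>t z\<bar> \<le> B" for z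
  proof -
    obtain j where "\<forall>k\<noteq>j. snd z \<notin> I k" using single by blast
    from inI[OF this, of "fst z"] have "\<Phi> z = \<phi> j z" "\<Phi>t z = deriv_t (\<phi> j) z" by auto
    moreover have "B * (1/2) ^ j \<le> B" using B0 by (simp add: mult_left_le power_le_one)
    ultimately show "0 \<le> \<Phi> z" "\<Phi> z \<le> B" "\<bar>\<Phi>t z\<bar> \<le> B" using \<phi>(2)[of j z] B[of j z] by auto
  qed
  have Dt: "((\<lambda>s. \<Phi> (x, t + s)) has_real_derivative \<Phi>t (x, t)) (at 0)" for x t
  proof -
    have d: "((\<lambda>s. \<phi> j (x, t + s)) has_real_derivative deriv_t (\<phi> j) (x, t + s)) (at s)" for j s
    proof -
      have "((\<lambda>r. \<phi> j ((x, t + s) + r *\<^sub>R (0, 1))) has_real_derivative deriv_t (\<phi> j) (x, t + s)) (at 0)"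
        unfolding deriv_t_def by (intro has_real_derivative_along smooth_has_derivative sm)
      then show ?thesis using DERIV_shift[of "\<lambda>s. \<phi> j (x, t + s)" "deriv_t (\<phi> j) (x, t + s)" 0 s]
        by (simp add: algebra_simps)
    qed
    have c: "continuous_on UNIV (\<lambda>s. deriv_t (\<phi> j) (x, t + s))" for j
      using smooth_continuous[OF smooth_deriv_t[OF sm], of UNIV j]
      by (rule continuous_on_compose2) (auto intro!: continuous_intros)
    have "((\<lambda>s. \<Sum>j. \<phi> j (x, t + s)) has_real_derivative (\<Sum>j. deriv_t (\<phi> j) (x, t + 0))) (at 0)"
    proof (rule has_field_derivative_series'(2)[where S=UNIV and x0=0])
      show "uniformly_convergent_on UNIV (\<lambda>n s. \<Sum>i<n. deriv_t (\<phi> i) (x, t + s))"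
        by (rule uc) (use B c in auto)
      show "summable (\<lambda>n. \<phi> n (x, t + 0))"
        by (rule summable_comparison_test'[OF geo]) (use B \<phi>(2) in auto)
    qed (use d in auto)
    then show ?thesis by (simp add: \<Phi>_def[symmetric] \<Phi>t_def[symmetric])
  qed
  have slice: "\<exists>j. (\<forall>x. \<Phi> (x, t) = \<phi> j (x, t)) \<and> (\<forall>x. D\<Phi> (x, t) = gradient (\<lambda>x. \<phi> j (x, t)) x) \<and> test_smooth \<Omega> (\<lambda>x. \<phi> j (x, t))" for t
    using single[of t] inI test_smooth_slice[OF \<phi>(1)] gradient_slice[OF sm] by metis
  have W: "W1p_0 p \<Omega> (\<lambda>x. \<Phi> (x, t)) (\<lambda>x. D\<Phi> (x, t))" for t
  proof -
    obtain j where j: "(\<lambda>x. \<Phi> (x, t)) = (\<lambda>x. \<phi> j (x, t))" "(\<lambda>x. D\<Phi> (x, t)) = gradient (\<lambda>x. \<phi> j (x, t))"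
       "test_smooth \<Omega> (\<lambda>x. \<phi> j (x, t))" using slice[of t] by (auto simp: fun_eq_iff)
    show ?thesis unfolding j by (rule W1p_0_test_smooth[OF \<Omega> _ j(3)]) (use p in simp)
  qed
  have O[measurable]: "\<Omega> \<times> {0..T} \<in> sets borel" "\<Omega> \<times> {0<..<T} \<in> sets borel"
    by (auto intro!: borel_Times)
  let ?N = "\<lambda>j t. (W1p_norm_at p \<Omega> (\<phi> j) (grad_x (\<phi> j)) t)\<^sup>2"
  have L2: "L2_W1p p \<Omega> T \<Phi> D\<Phi>"
    unfolding L2_W1p_def
  proof (intro conjI)
    show "set_borel_measurable lborel (\<Omega> \<times> {0..T}) \<Phi>" "set_borel_measurable lborel (\<Omega> \<times> {0<..<T}) D\<Phi>"
      by (intro set_borel_measurable_borel O meas)+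
    show "AE t in lborel. t \<in> {0<..<T} \<longrightarrow> W1p p \<Omega> (\<lambda>x. \<Phi> (x, t)) (\<lambda>x. D\<Phi> (x, t))"
      using W unfolding W1p_0_def by auto
    have mN[measurable]: "(\<lambda>t. W1p_norm_at p \<Omega> \<Phi> D\<Phi> t) \<in> borel_measurable borel"
       "(\<lambda>t. W1p_norm_at p \<Omega> (\<phi> j) (grad_x (\<phi> j)) t) \<in> borel_measurable borel" for j
      by (rule measurable_W1p_norm; measurable)+
    have "integrable lborel (\<lambda>t. (W1p_norm_at p \<Omega> \<Phi> D\<Phi> t)\<^sup>2)"
    proof (rule integrableI_bounded)
      have "(\<integral>\<^sup>+t. ennreal (norm ((W1p_norm_at p \<Omega> \<Phi> D\<Phi> t)\<^sup>2)) \<partial>lborel)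
        \<le> (\<integral>\<^sup>+t. (\<Sum>j. ennreal (?N j t)) \<partial>lborel)"
      proof (rule nn_integral_mono)
        fix t
        obtain j where "\<forall>k\<noteq>j. t \<notin> I k" using single by blast
        from inI[OF this] have "(W1p_norm_at p \<Omega> \<Phi> D\<Phi> t)\<^sup>2 = ?N j t" by simp
        then have "ennreal (norm ((W1p_norm_at p \<Omega> \<Phi> D\<Phi> t)\<^sup>2)) = (\<Sum>j\<in>{j}. ennreal (?N j t))" by simp
        also have "\<dots> \<le> (\<Sum>j. ennreal (?N j t))" by (intro sum_le_suminf) auto
        finally show "ennreal (norm ((W1p_norm_at p \<Omega> \<Phi> D\<Phi> t)\<^sup>2)) \<le> (\<Sum>j. ennreal (?N j t))" .
      qed
      also have "\<dots> = (\<Sum>j. \<integral>\<^sup>+t. ennreal (?N j t) \<partial>lborel)"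
        by (rule nn_integral_suminf) measurable
      also have "\<dots> = (\<Sum>j. ennreal (LINT t|lborel. ?N j t))"
        by (intro suminf_cong nn_integral_eq_integral Ni) auto
      also have "\<dots> = ennreal (\<Sum>j. LINT t|lborel. ?N j t)"
        by (intro suminf_ennreal_eq summable_sums N) (auto intro!: Bochner_Integration.integral_nonneg)
      also have "\<dots> < \<infinity>" by simp
      finally show "(\<integral>\<^sup>+t. ennreal (norm ((W1p_norm_at p \<Omega> \<Phi> D\<Phi> t)\<^sup>2)) \<partial>lborel) < \<infinity>" .
    qed measurable
    then show "set_integrable lborel {0<..<T} (\<lambda>t. (W1p_norm_at p \<Omega> \<Phi> D\<Phi> t)\<^sup>2)"
      unfolding set_integrable_def by (intro integrable_mult_indicator) auto
  qed
  have bd: "bounded (\<Omega> \<times> {0<..<T})" using \<Omega>(1) by (intro bounded_Times) auto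
  have tf: "test_function p \<Omega> T \<Phi> D\<Phi> \<Phi>t"
    unfolding test_function_def
  proof (intro conjI ballI L2)
    show "weak_deriv (\<Omega> \<times> {0<..<T}) (0, 1) \<Phi> \<Phi>t"
    proof (rule weak_deriv_classical[OF cont])
      show "((\<lambda>s. \<Phi> (z + s *\<^sub>R (0, 1))) has_real_derivative \<Phi>t z) (at 0)" for z
        using Dt[of "fst z" "snd z"] by (cases z) simp
    qed
    have "set_integrable lborel (\<Omega> \<times> {0<..<T}) (\<lambda>x. norm (\<Phi>t x) powr 2)"
      by (rule set_integrable_bounded[OF bd O(2), where B="B\<^sup>2"]) (use \<Phi>0(3) B0 in \<open>auto simp flip: abs_le_square_iff\<close>)
    then show "Lp_on 2 (\<Omega> \<times> {0<..<T}) \<Phi>t"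
      unfolding Lp_on_def by (auto intro: set_borel_measurable_borel)
    show "0 \<le> \<Phi> (x, t)" for x t by (rule \<Phi>0)
    have i\<Phi>: "set_integrable lborel \<Omega> (\<lambda>x. \<Phi> (x, t))" for t
      by (rule set_integrable_bounded[OF \<Omega>(1), where B=B]) (use \<Phi>0 in auto)
    then show "set_integrable lborel \<Omega> (\<lambda>x. \<Phi> (x, t))" for t .
    fix s
    have bnd: "\<bar>\<Phi> (x, t) - \<Phi> (x, s)\<bar> \<le> B * \<bar>t - s\<bar>" for x t
    proof -
      have "((\<lambda>s. \<Phi> (x, s)) has_real_derivative \<Phi>t (x, t)) (at t)" for t
        using Dt[of x t] DERIV_shift[of "\<lambda>s. \<Phi> (x, s)" "\<Phi>t (x, t)" 0 t] by (simp add: add.commute)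
      then have "norm (\<Phi> (x, t) - \<Phi> (x, s)) \<le> B * norm (t - s)"
        using \<Phi>0(3) by (intro field_differentiable_bound[of UNIV _ "\<lambda>t. \<Phi>t (x, t)"]) auto
      then show ?thesis by simp
    qed
    have le: "(LINT x:\<Omega>|lborel. \<bar>\<Phi> (x, t) - \<Phi> (x, s)\<bar>) \<le> B * \<bar>t - s\<bar> * measure lborel \<Omega>" for t
    proof -
      have "(LINT x:\<Omega>|lborel. \<bar>\<Phi> (x, t) - \<Phi> (x, s)\<bar>) \<le> (LINT x:\<Omega>|lborel. B * \<bar>t - s\<bar>)"
        by (intro set_integral_mono set_integrable_abs set_integral_diff i\<Phi> bnd set_integrable_bounded[OF \<Omega>(1), where B="B * \<bar>t - s\<bar>"])
           (use B0 in auto)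
      also have "\<dots> = B * \<bar>t - s\<bar> * measure lborel \<Omega>"
        using emeasure_bounded_finite[OF \<Omega>(1)] by (subst set_integral_const) auto
      finally show ?thesis .
    qed
    have ge: "0 \<le> (LINT x:\<Omega>|lborel. \<bar>\<Phi> (x, t) - \<Phi> (x, s)\<bar>)" for t
      unfolding set_lebesgue_integral_def by (rule Bochner_Integration.integral_nonneg) simp
    have "((\<lambda>t. B * \<bar>t - s\<bar> * measure lborel \<Omega>) \<longlongrightarrow> B * \<bar>s - s\<bar> * measure lborel \<Omega>) (at s within {0..T})"
      by (intro tendsto_intros)
    then have lim: "((\<lambda>t. B * \<bar>t - s\<bar> * measure lborel \<Omega>) \<longlongrightarrow> 0) (at s within {0..T})" by simp
    show "((\<lambda>t. LINT x:\<Omega>|lborel. \<bar>\<Phi> (x, t) - \<Phi> (x, s)\<bar>) \<longlongrightarrow> 0) (at s within {0..T})"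
      by (rule tendsto_sandwich[OF always_eventually[OF allI[OF ge]] always_eventually[OF allI[OF le]] tendsto_const lim])
  qed
  have "\<Phi> (x, 0) = 0" "\<Phi> (x, T) = 0" for x
  proof -
    have "0 \<notin> I j" "T \<notin> I j" for j using I(2)[of j] by auto
    then show "\<Phi> (x, 0) = 0" "\<Phi> (x, T) = 0" by (simp_all add: \<Phi>_def out)
  qed
  then have "zero_on_boundary p \<Omega> T \<Phi> D\<Phi>" unfolding zero_on_boundary_def using W by auto
  then show ?thesis using that[OF tf] inI Ij by blast
qed

section \<open>Integrals over time slices\<close>

lemma AE_slice:
  fixes P :: "'a::euclidean_space \<times> real \<Rightarrow> bool"
  assumes "AE z in lborel. P z"
  shows "AE t in lborel. AE x in lborel. P (x, t)"
proof -
  obtain N where N: "N \<in> null_sets lborel" "{z. \<not> P z} \<subseteq> N"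
    using assms by (auto elim!: AE_E simp: null_sets_def)
  have [measurable]: "N \<in> sets (borel \<Otimes>\<^sub>M borel)" using null_setsD2[OF N(1)] unfolding borel_prod by simp
  have "AE z in lborel. z \<notin> N" using N(1) by (rule AE_not_in)
  then have "AE z in lborel \<Otimes>\<^sub>M lborel. z \<notin> N" unfolding lborel_prod .
  then have "AE x in lborel. AE t in lborel. (x, t) \<notin> N" by (rule lborel_pair.AE_pair)
  moreover have "{z \<in> space (lborel \<Otimes>\<^sub>M lborel). (fst z, snd z) \<notin> N} \<in> sets (lborel \<Otimes>\<^sub>M lborel)"
    by measurable
  ultimately have "AE t in lborel. AE x in lborel. (x, t) \<notin> N"
    using lborel_pair.AE_commute[of "\<lambda>x t. (x, t) \<notin> N"] by simp
  then show ?thesis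
  proof eventually_elim
    case (elim t)
    then show ?case by eventually_elim (use N(2) in auto)
  qed
qed

lemma nn_integral_slices:
  fixes f :: "'a::euclidean_space \<times> real \<Rightarrow> ennreal"
  assumes "f \<in> borel_measurable borel"
  shows "(\<integral>\<^sup>+z. f z \<partial>lborel) = (\<integral>\<^sup>+t. \<integral>\<^sup>+x. f (x, t) \<partial>lborel \<partial>lborel)"
proof -
  have "f \<in> borel_measurable (lborel \<Otimes>\<^sub>M lborel)" using assms by (simp add: lborel_prod)
  from lborel_pair.nn_integral_snd[OF this] show ?thesis by (simp add: lborel_prod)
qed

text \<open>Dominated convergence twice, once in space and once in time.\<close>

lemma mixed_dominated_convergence:
  fixes h :: "nat \<Rightarrow> 'a::euclidean_space \<times> real \<Rightarrow> real"
  assumes \<Omega>: "bounded \<Omega>" "\<Omega> \<in> sets borel" and I: "bounded I" "I \<in> sets borel" and r: "0 < r"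
    and h[measurable]: "\<And>k. h k \<in> borel_measurable borel" "h' \<in> borel_measurable borel"
    and b: "\<And>k z. 0 \<le> h k z" "\<And>k z. h k z \<le> M" "\<And>k x t. x \<notin> \<Omega> \<or> t \<notin> I \<Longrightarrow> h k (x, t) = 0"
    and lim: "AE z in lborel. (\<lambda>k. h k z) \<longlonglongrightarrow> h' z"
  shows "(\<lambda>k. LINT t|lborel. (LINT x|lborel. h k (x, t)) powr r) \<longlonglongrightarrow> (LINT t|lborel. (LINT x|lborel. h' (x, t)) powr r)"
    "\<And>k. integrable lborel (\<lambda>t. (LINT x|lborel. h k (x, t)) powr r)"
proof -
  note [measurable] = \<Omega>(2) I(2)
  have i\<Omega>: "integrable lborel (\<lambda>x. M * indicator \<Omega> x)"
    using emeasure_bounded_finite[OF \<Omega>(1)] by (intro integrable_mult_right integrable_real_indicator) auto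
  have M0: "0 \<le> M" using order_trans[OF b(1) b(2)] .
  have hb: "h k (x, t) \<le> M * indicator \<Omega> x" for k x t
    using b(2)[of k "(x, t)"] b(3)[of x t k] by (auto simp: indicator_def)
  have bd: "norm ((LINT x|lborel. h k (x, t)) powr r) \<le> (M * measure lborel \<Omega>) powr r * indicator I t" for k t
  proof (cases "t \<in> I")
    case True
    have "(LINT x|lborel. h k (x, t)) \<le> (LINT x|lborel. M * indicator \<Omega> x)"
      using M0 hb by (intro integral_mono' i\<Omega>) auto
    then have "(LINT x|lborel. h k (x, t)) powr r \<le> (M * measure lborel \<Omega>) powr r"
      using r b(1) by (intro powr_mono2) (auto intro!: Bochner_Integration.integral_nonneg)
    then show ?thesis using True by simp
  next
    case False then show ?thesis using b(3) by simp
  qed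
  have iI: "integrable lborel (\<lambda>t. (M * measure lborel \<Omega>) powr r * indicator I t)"
    using emeasure_bounded_finite[OF I(1)] by (intro integrable_mult_right integrable_real_indicator) auto
  show "(\<lambda>k. LINT t|lborel. (LINT x|lborel. h k (x, t)) powr r) \<longlonglongrightarrow> (LINT t|lborel. (LINT x|lborel. h' (x, t)) powr r)"
  proof (rule integral_dominated_convergence[OF _ _ iI])
    show "AE t in lborel. (\<lambda>k. (LINT x|lborel. h k (x, t)) powr r) \<longlonglongrightarrow> (LINT x|lborel. h' (x, t)) powr r"
      using AE_slice[OF lim]
    proof eventually_elim
      case (elim t)
      have "(\<lambda>k. LINT x|lborel. h k (x, t)) \<longlonglongrightarrow> (LINT x|lborel. h' (x, t))"
        by (rule integral_dominated_convergence[OF _ _ i\<Omega>]) (use elim b(1) hb in auto)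
      then show ?case
        by (intro tendsto_powr2 tendsto_const) (use r b(1) in \<open>auto intro!: always_eventually Bochner_Integration.integral_nonneg\<close>)
    qed
  qed (use bd in auto)
  show "integrable lborel (\<lambda>t. (LINT x|lborel. h k (x, t)) powr r)" for k
    by (rule Bochner_Integration.integrable_bound[OF iI]) (use bd in \<open>auto intro!: AE_I2 order_trans[OF bd abs_ge_self]\<close>)
qed

lemma
  fixes a b :: "'x \<Rightarrow> real"
  assumes p: "1 < p" and [measurable]: "a \<in> borel_measurable M" "b \<in> borel_measurable M"
    and nn: "\<And>x. 0 \<le> a x" "\<And>x. 0 \<le> b x"
    and i: "integrable M (\<lambda>x. a x powr p)" "integrable M (\<lambda>x. b x powr p)"
  shows Holder_integrable: "integrable M (\<lambda>x. a x powr (p - 1) * b x)"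
    and Holder_powr: "(LINT x|M. a x powr (p - 1) * b x) \<le>
       (LINT x|M. a x powr p) powr ((p - 1) / p) * (LINT x|M. b x powr p) powr (1 / p)"
proof -
  define q where "q = p / (p - 1)"
  have q: "1 < q" "1 / q + 1 / p = 1" "(p - 1) * q = p" using p by (auto simp: q_def field_simps)
  have Young: "s powr (p - 1) * r \<le> s powr p / q + r powr p / p" if "0 \<le> s" "0 \<le> r" for s r
    using Youngs_inequality[OF q(1) p q(2), of "s powr (p - 1)" r] that q(3) by (simp add: powr_powr)
  show I: "integrable M (\<lambda>x. a x powr (p - 1) * b x)"
  proof (rule Bochner_Integration.integrable_bound)
    show "integrable M (\<lambda>x. a x powr p / q + b x powr p / p)" using i by auto
    show "AE x in M. norm (a x powr (p - 1) * b x) \<le> norm (a x powr p / q + b x powr p / p)"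
      using Young[OF nn] nn by (auto intro!: AE_I2 order_trans[OF _ abs_ge_self] simp: abs_mult)
  qed measurable
  define \<alpha> where "\<alpha> = (LINT x|M. a x powr p)"
  define \<beta> where "\<beta> = (LINT x|M. b x powr p)"
  have nn': "0 \<le> \<alpha>" "0 \<le> \<beta>" by (auto simp: \<alpha>_def \<beta>_def)
  show "(LINT x|M. a x powr (p - 1) * b x) \<le>
       (LINT x|M. a x powr p) powr ((p - 1) / p) * (LINT x|M. b x powr p) powr (1 / p)"
  proof (cases "\<alpha> = 0 \<or> \<beta> = 0")
    case True
    then have "(AE x in M. a x powr p = 0) \<or> (AE x in M. b x powr p = 0)"
      unfolding \<alpha>_def \<beta>_def using integral_nonneg_eq_0_iff_AE[OF i(1)] integral_nonneg_eq_0_iff_AE[OF i(2)] by auto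
    then have "AE x in M. a x powr (p - 1) * b x = 0"
    proof
      assume "AE x in M. a x powr p = 0" then show ?thesis by eventually_elim auto
    next
      assume "AE x in M. b x powr p = 0" then show ?thesis by eventually_elim auto
    qed
    then have "(LINT x|M. a x powr (p - 1) * b x) = 0" by (rule integral_eq_zero_AE)
    then show ?thesis by simp
  next
    case False
    then have pos: "0 < \<alpha>" "0 < \<beta>" using nn' by auto
    define s where "s = \<alpha> powr (1 / p)"
    define r where "r = \<beta> powr (1 / p)"
    have sr: "0 < s" "0 < r" "s powr p = \<alpha>" "r powr p = \<beta>" using pos p by (auto simp: s_def r_def powr_powr)
    have "a x powr (p - 1) * b x \<le> s powr (p - 1) * r * (a x powr p / (\<alpha> * q) + b x powr p / (\<beta> * p))" for x
    proof -
      have "(a x / s) powr (p - 1) * (b x / r) \<le> (a x / s) powr p / q + (b x / r) powr p / p"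
        using Young[of "a x / s" "b x / r"] nn sr by simp
      then have "a x powr (p - 1) * b x / (s powr (p - 1) * r) \<le> a x powr p / (\<alpha> * q) + b x powr p / (\<beta> * p)"
        using nn sr by (simp add: powr_divide less_imp_le)
      then show ?thesis using sr by (simp add: divide_le_eq mult.commute)
    qed
    then have "(LINT x|M. a x powr (p - 1) * b x) \<le> (LINT x|M. s powr (p - 1) * r * (a x powr p / (\<alpha> * q) + b x powr p / (\<beta> * p)))"
      using I i by (intro integral_mono) auto
    also have "\<dots> = s powr (p - 1) * r * (\<alpha> / (\<alpha> * q) + \<beta> / (\<beta> * p))"
      using i by (simp add: \<alpha>_def \<beta>_def)
    also have "\<dots> = s powr (p - 1) * r" using pos q(2) by simp
    also have "\<dots> = \<alpha> powr ((p - 1) / p) * \<beta> powr (1 / p)" using pos by (simp add: s_def r_def powr_powr)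
    finally show ?thesis by (simp add: \<alpha>_def \<beta>_def)
  qed
qed

section \<open>Oscillating test functions\<close>

lemma grad_x_inner:
  assumes "smooth f" shows "grad_x f z \<bullet> v = frechet_derivative f (at z) (v, 0)"
proof -
  have "grad_x f z = gradient (\<lambda>x. f (x, snd z)) (fst z)"
    using gradient_slice[OF assms, of "snd z" "fst z"] by simp
  then show ?thesis
    using gradient_inner[OF smooth_slice[OF assms, of "snd z"], of "fst z" v]
    by (simp add: frechet_derivative_slice[OF assms])
qed

lemma norm_grad_x_le:
  assumes "smooth f" and B: "\<And>v. norm v \<le> 1 \<Longrightarrow> \<bar>frechet_derivative f (at z) v\<bar> \<le> B"
  shows "norm (grad_x f z) \<le> B"
proof (cases "grad_x f z = 0")
  case True
  then show ?thesis using B[of 0] by (simp add: order_trans[OF abs_ge_zero])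
next
  case False
  let ?v = "grad_x f z /\<^sub>R norm (grad_x f z)"
  have "norm (grad_x f z) = grad_x f z \<bullet> ?v"
    using False by (simp add: dot_square_norm power2_eq_square)
  also have "\<dots> = frechet_derivative f (at z) (?v, 0)" by (rule grad_x_inner[OF assms(1)])
  also have "\<dots> \<le> B"
    using B[of "(?v, 0)"] False by (simp add: norm_Pair abs_le_iff)
  finally show ?thesis .
qed

lemma W1p_norm_power2_le:
  fixes u :: "'a::euclidean_space \<Rightarrow> real" and Du :: "'a \<Rightarrow> 'a"
  assumes p: "1 < p" and [measurable]: "\<Omega> \<in> sets borel" "u \<in> borel_measurable borel" "Du \<in> borel_measurable borel"
    "h \<in> borel_measurable borel" "k \<in> borel_measurable borel"
    and le: "\<And>x. x \<in> \<Omega> \<Longrightarrow> \<bar>u x\<bar> \<le> h x" "\<And>x. x \<in> \<Omega> \<Longrightarrow> norm (Du x) \<le> k x" "\<And>x. 0 \<le> h x" "\<And>x. 0 \<le> k x"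
    and i: "integrable lborel (\<lambda>x. h x powr p)" "integrable lborel (\<lambda>x. k x powr p)"
  shows "(W1p_norm p \<Omega> u Du)\<^sup>2 \<le> (LINT x|lborel. h x powr p + k x powr p) powr (2 / p)"
proof -
  have "(LINT x:\<Omega>|lborel. \<bar>u x\<bar> powr p) \<le> (LINT x|lborel. h x powr p)"
    unfolding set_lebesgue_integral_def
    using p le by (intro integral_mono' i) (auto simp: indicator_def intro: powr_mono2)
  moreover have "(LINT x:\<Omega>|lborel. norm (Du x) powr p) \<le> (LINT x|lborel. k x powr p)"
    unfolding set_lebesgue_integral_def
    using p le by (intro integral_mono' i) (auto simp: indicator_def intro: powr_mono2)
  ultimately have "(LINT x:\<Omega>|lborel. \<bar>u x\<bar> powr p) + (LINT x:\<Omega>|lborel. norm (Du x) powr p)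
      \<le> (LINT x|lborel. h x powr p + k x powr p)" using i by simp
  moreover have "0 \<le> (LINT x:\<Omega>|lborel. \<bar>u x\<bar> powr p) + (LINT x:\<Omega>|lborel. norm (Du x) powr p)"
    unfolding set_lebesgue_integral_def by (intro add_nonneg_nonneg Bochner_Integration.integral_nonneg) auto
  ultimately show ?thesis unfolding W1p_norm_power2 using p by (intro powr_mono2) auto
qed

text \<open>A test function of size \<open>\<epsilon>\<close> whose derivative in the direction \<open>i\<close> is close to the modulated profile
  \<open>cos ((x \<bullet> i) / \<epsilon> + \<theta>) g\<close>. The summand \<open>1\<close> keeps it nonnegative.\<close>

definition osc :: "'a::euclidean_space \<Rightarrow> ('a \<times> real \<Rightarrow> real) \<Rightarrow> real \<Rightarrow> real \<Rightarrow> 'a \<times> real \<Rightarrow> real" where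
  "osc i g \<theta> \<epsilon> z = \<epsilon> * (1 + sin ((fst z \<bullet> i) / \<epsilon> + \<theta>)) * g z"

lemma smooth_osc_factor: "smooth (\<lambda>z::'a \<times> real. \<epsilon> * (1 + sin ((fst z \<bullet> i) / \<epsilon> + \<theta>)))" for i :: "'a::euclidean_space"
proof -
  have "bounded_linear (\<lambda>z::'a \<times> real. (fst z \<bullet> i) / \<epsilon>)"
    by (intro bounded_linear_compose[OF bounded_linear_divide] bounded_linear_compose[OF bounded_linear_inner_left bounded_linear_fst])
  then have "smooth (\<lambda>z::'a \<times> real. (fst z \<bullet> i) / \<epsilon>)" by (rule smooth_bounded_linear)
  then show ?thesis by (intro smooth_mult smooth_add smooth_const smooth_sin)
qed

lemma osc_derivative:
  fixes i :: "'a::euclidean_space"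
  assumes g: "smooth g" and \<epsilon>: "\<epsilon> \<noteq> 0"
  shows "frechet_derivative (osc i g \<theta> \<epsilon>) (at z) v =
    cos ((fst z \<bullet> i) / \<epsilon> + \<theta>) * (fst v \<bullet> i) * g z
    + \<epsilon> * (1 + sin ((fst z \<bullet> i) / \<epsilon> + \<theta>)) * frechet_derivative g (at z) v"
proof -
  have "(osc i g \<theta> \<epsilon> has_derivative (\<lambda>v. \<epsilon> * (1 + sin ((fst z \<bullet> i) / \<epsilon> + \<theta>)) * frechet_derivative g (at z) v
     + (\<epsilon> * (((fst v \<bullet> i) / \<epsilon>) * cos ((fst z \<bullet> i) / \<epsilon> + \<theta>))) * g z)) (at z)"
    unfolding osc_def[abs_def]
    by (rule has_derivative_mult[OF _ smooth_has_derivative[OF g]]) (use \<epsilon> in \<open>auto intro!: derivative_eq_intros simp: field_simps\<close>)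
  then have "frechet_derivative (osc i g \<theta> \<epsilon>) (at z) = (\<lambda>v. \<epsilon> * (1 + sin ((fst z \<bullet> i) / \<epsilon> + \<theta>)) * frechet_derivative g (at z) v
     + (\<epsilon> * (((fst v \<bullet> i) / \<epsilon>) * cos ((fst z \<bullet> i) / \<epsilon> + \<theta>))) * g z)"
    by (rule frechet_derivative_at[symmetric])
  then show ?thesis using \<epsilon> by simp
qed

lemma osc_grad_x:
  assumes "smooth g" "\<epsilon> \<noteq> 0" "i \<in> Basis"
  shows "grad_x (osc i g \<theta> \<epsilon>) z = (cos ((fst z \<bullet> i) / \<epsilon> + \<theta>) * g z) *\<^sub>R i
    + (\<epsilon> * (1 + sin ((fst z \<bullet> i) / \<epsilon> + \<theta>))) *\<^sub>R grad_x g z"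
proof -
  have "(\<Sum>j\<in>Basis. (c * (j \<bullet> i) * r) *\<^sub>R j) = (\<Sum>j\<in>Basis. if j = i then (c * r) *\<^sub>R i else 0)" for c r
    using assms(3) by (intro sum.cong) (auto simp: inner_Basis)
  then show ?thesis
    unfolding grad_x_def osc_derivative[OF assms(1,2)]
    using assms(3) by (simp add: scaleR_add_left sum.distrib scaleR_sum_right)
qed

lemma osc_deriv_t:
  assumes "smooth g" "\<epsilon> \<noteq> 0"
  shows "deriv_t (osc i g \<theta> \<epsilon>) z = \<epsilon> * (1 + sin ((fst z \<bullet> i) / \<epsilon> + \<theta>)) * deriv_t g z"
  unfolding deriv_t_def osc_derivative[OF assms] by simp

lemma one_plus_sin_bounds: "0 \<le> 1 + sin y" "1 + sin y \<le> (2::real)"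
  using sin_ge_minus_one[of y] sin_le_one[of y] by linarith+

text \<open>The integrand of the weak formulation for a smooth test function.\<close>

definition weak_form :: "('a::euclidean_space \<times> real \<Rightarrow> real) \<Rightarrow> ('a \<times> real \<Rightarrow> 'a) \<Rightarrow> ('a \<times> real \<Rightarrow> real) \<Rightarrow>
    ('a \<times> real \<Rightarrow> real) \<Rightarrow> 'a \<times> real \<Rightarrow> real" where
  "weak_form W A \<beta> \<phi> z = - W z * deriv_t \<phi> z + A z \<bullet> grad_x \<phi> z + \<beta> z * \<phi> z"

lemma abs_cos_sin_ge: "1 \<le> \<bar>cos y\<bar> + \<bar>sin (y::real)\<bar>"
proof -
  have "1 = (cos y)\<^sup>2 + (sin y)\<^sup>2" by simp
  also have "(cos y)\<^sup>2 \<le> \<bar>cos y\<bar>" by (metis abs_cos_le_one abs_ge_zero mult_left_le power2_abs power2_eq_square)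
  also have "(sin y)\<^sup>2 \<le> \<bar>sin y\<bar>" by (metis abs_sin_le_one abs_ge_zero mult_left_le power2_abs power2_eq_square)
  finally show ?thesis by simp
qed

text \<open>A small function with large gradient. As \<open>\<epsilon>\<close> tends to \<open>0\<close>, \<open>osc i g \<theta> \<epsilon>\<close> and its time derivative become
  uniformly small and its Sobolev norm is asymptotically at most the $L^p$ norm of \<open>g\<close>, while the
  pairing of \<open>A\<close> with its gradient approaches \<open>cos ((x \<bullet> i) / \<epsilon> + \<theta>) g (A \<bullet> i)\<close>. For one of two
  phases, the latter keeps at least half of the integral of \<open>\<bar>A \<bullet> i\<bar> g\<close>. Everything else in the integrand carries a factor \<open>\<epsilon>\<close>.\<close>

lemma oscillating_test:
  fixes \<Omega> :: "'a::euclidean_space set" and A :: "'a \<times> real \<Rightarrow> 'a" and W \<beta> :: "'a \<times> real \<Rightarrow> real"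
  assumes p: "1 < p" and \<Omega>: "bounded \<Omega>" "open \<Omega>" and I: "I = {c<..<d}"
    and mA[measurable]: "A \<in> borel_measurable borel" "\<beta> \<in> borel_measurable borel" and W: "integrable lborel W"
    and K: "0 \<le> K" "\<And>z. \<bar>\<beta> z\<bar> \<le> K * \<bar>W z\<bar>"
    and Aloc: "\<And>\<zeta>. test_smooth (\<Omega> \<times> I) \<zeta> \<Longrightarrow> (\<And>z. 0 \<le> \<zeta> z) \<Longrightarrow> integrable lborel (\<lambda>z. norm (A z) * \<zeta> z)"
    and i: "i \<in> Basis" and g: "test_smooth (\<Omega> \<times> I) g" "\<And>z. 0 \<le> g z"
    and B: "(LINT t|lborel. (LINT x|lborel. g (x, t) powr p) powr (2 / p)) < B"
    and L: "0 \<le> L" "ennreal L < (\<integral>\<^sup>+z. ennreal (\<bar>A z \<bullet> i\<bar> * g z) \<partial>lborel)" and \<delta>: "0 < \<delta>"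
  obtains \<phi> where "test_smooth (\<Omega> \<times> I) \<phi>" "\<And>z. 0 \<le> \<phi> z" "\<And>z. \<phi> z \<le> \<delta>" "\<And>z. \<bar>deriv_t \<phi> z\<bar> \<le> \<delta>"
    "integrable lborel (\<lambda>t. (W1p_norm_at p \<Omega> \<phi> (grad_x \<phi>) t)\<^sup>2)"
    "(LINT t|lborel. (W1p_norm_at p \<Omega> \<phi> (grad_x \<phi>) t)\<^sup>2) < B"
    "ennreal (L / 2) < (\<integral>\<^sup>+z. ennreal \<bar>weak_form W A \<beta> \<phi> z\<bar> \<partial>lborel)"
proof -
  have sm: "smooth g" by (rule test_smooth_smooth[OF g(1)])
  have [measurable]: "g \<in> borel_measurable borel" "\<Omega> \<in> sets borel" "I \<in> sets borel" "W \<in> borel_measurable borel"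
    using sm \<Omega> W by (auto intro: smooth_measurable simp: I dest: borel_measurable_integrable)
  have bI: "bounded I" by (simp add: I)
  have oU: "open (\<Omega> \<times> I)" using \<Omega>(2) by (auto simp: I intro: open_Times)
  obtain S where S: "compact S" "S \<subseteq> \<Omega> \<times> I" "\<And>z. z \<notin> S \<Longrightarrow> g z = 0"
    using test_smooth_support[OF g(1)] by blast
  \<comment> \<open>A cutoff that is at least \<open>1\<close> on the support of \<open>g\<close>: the local integrability of \<open>A\<close> is available only
    in the form of integrability against test functions.\<close>
  obtain \<zeta> where \<zeta>: "test_smooth (\<Omega> \<times> I) \<zeta>" "\<And>z. 0 \<le> \<zeta> z" "\<And>z. z \<in> S \<Longrightarrow> 1 \<le> \<zeta> z"
    using compact_cutoff[OF S(1,2) oU] by blast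
  obtain C where C: "0 \<le> C" "\<And>z. \<bar>g z\<bar> \<le> C" "\<And>z v. norm v \<le> 1 \<Longrightarrow> \<bar>frechet_derivative g (at z) v\<bar> \<le> C"
    using test_smooth_bounded[OF g(1)] by blast
  have grad: "norm (grad_x g z) \<le> C" for z by (rule norm_grad_x_le[OF sm C(3)])
  have dt: "\<bar>deriv_t g z\<bar> \<le> C" for z unfolding deriv_t_def by (rule C(3)) (simp add: norm_Pair)
  have D0: "frechet_derivative g (at z) v = 0" if "z \<notin> S" for z v
    by (rule frechet_derivative_zero_outside[OF compact_imp_closed[OF S(1)] S(3) that])
  have grad0: "grad_x g z = 0" if "z \<notin> S" for z using D0[OF that] by (simp add: grad_x_def)
  define R where "R z = 4 * (C * \<bar>W z\<bar> + C * (norm (A z) * \<zeta> z) + K * C * \<bar>W z\<bar>)" for z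
  have iR: "integrable lborel R"
    unfolding R_def using W Aloc[OF \<zeta>(1,2)] by auto
  have R0: "0 \<le> R z" for z unfolding R_def using C(1) K(1) \<zeta>(2) by auto
  define J where "J = (\<integral>\<^sup>+z. ennreal (\<bar>A z \<bullet> i\<bar> * g z) \<partial>lborel)"
  obtain r where r: "L < r" "ennreal r < J"
  proof -
    obtain e where e: "ennreal L < e" "e < J" using dense L(2) unfolding J_def by blast
    then obtain r where "e = ennreal r" "0 \<le> r" by (cases e) auto
    then show ?thesis using that[of r] e L(1) by (auto simp: ennreal_less_iff)
  qed
  \<comment> \<open>The two phases \<open>0\<close> and \<open>pi / 2\<close> together see the whole of \<open>A \<bullet> i\<close>.\<close>
  have osc_le: "\<bar>A z \<bullet> i\<bar> * g z \<le> \<bar>weak_form W A \<beta> (osc i g 0 \<epsilon>) z\<bar> + \<bar>weak_form W A \<beta> (osc i g (pi/2) \<epsilon>) z\<bar> + \<epsilon> * R z"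
    if \<epsilon>: "0 < \<epsilon>" for \<epsilon> z
  proof -
    define y where "y = (fst z \<bullet> i) / \<epsilon>"
    have *: "\<bar>cos (y + \<theta>)\<bar> * (\<bar>A z \<bullet> i\<bar> * g z) \<le> \<bar>weak_form W A \<beta> (osc i g \<theta> \<epsilon>) z\<bar> + \<epsilon> * R z / 2" for \<theta>
    proof -
      define s where "s = 1 + sin (y + \<theta>)"
      have s: "\<bar>s\<bar> \<le> 2" using one_plus_sin_bounds[of "y + \<theta>"] by (simp add: s_def)
      define Q where "Q = - W z * deriv_t g z + A z \<bullet> grad_x g z + \<beta> z * g z"
      have eq: "weak_form W A \<beta> (osc i g \<theta> \<epsilon>) z = cos (y + \<theta>) * g z * (A z \<bullet> i) + \<epsilon> * s * Q"
        unfolding weak_form_def osc_grad_x[OF sm less_imp_neq[OF \<epsilon>, symmetric] i] osc_deriv_t[OF sm less_imp_neq[OF \<epsilon>, symmetric]]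
        by (simp add: osc_def y_def s_def Q_def inner_add_right algebra_simps)
      have "\<bar>A z \<bullet> grad_x g z\<bar> \<le> C * (norm (A z) * \<zeta> z)"
      proof (cases "z \<in> S")
        case True
        have "\<bar>A z \<bullet> grad_x g z\<bar> \<le> norm (A z) * norm (grad_x g z)" by (rule Cauchy_Schwarz_ineq2)
        also have "\<dots> \<le> norm (A z) * C" by (intro mult_left_mono grad) auto
        also have "\<dots> = norm (A z) * C * 1" by simp
        also have "\<dots> \<le> norm (A z) * C * \<zeta> z" using \<zeta>(3)[OF True] C(1) by (intro mult_left_mono) auto
        finally show ?thesis by (simp add: mult_ac)
      next
        case False
        then show ?thesis using grad0 C(1) \<zeta>(2) by simp
      qed
      moreover have "\<bar>W z * deriv_t g z\<bar> \<le> C * \<bar>W z\<bar>"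
        using mult_left_mono[OF dt[of z], of "\<bar>W z\<bar>"] by (simp add: abs_mult mult.commute[of C])
      moreover have "\<bar>\<beta> z * g z\<bar> \<le> K * C * \<bar>W z\<bar>"
      proof -
        have "\<bar>\<beta> z * g z\<bar> \<le> (K * \<bar>W z\<bar>) * C" unfolding abs_mult using K C by (intro mult_mono) auto
        then show ?thesis by (simp add: mult_ac)
      qed
      moreover have "\<bar>- a + b + c\<bar> \<le> a' + b' + c'" if "\<bar>b\<bar> \<le> b'" "\<bar>a\<bar> \<le> a'" "\<bar>c\<bar> \<le> c'" for a b c a' b' c' :: real
        using that by linarith
      ultimately have "\<bar>- (W z * deriv_t g z) + A z \<bullet> grad_x g z + \<beta> z * g z\<bar>
          \<le> C * \<bar>W z\<bar> + C * (norm (A z) * \<zeta> z) + K * C * \<bar>W z\<bar>" by blast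
      then have "\<bar>Q\<bar> \<le> R z / 4" unfolding Q_def R_def by simp
      then have "\<bar>s\<bar> * \<bar>Q\<bar> \<le> 2 * (R z / 4)" using s by (intro mult_mono) auto
      then have "\<epsilon> * (\<bar>s\<bar> * \<bar>Q\<bar>) \<le> \<epsilon> * (2 * (R z / 4))" using \<epsilon> by (intro mult_left_mono) auto
      then have "\<bar>\<epsilon> * s * Q\<bar> \<le> \<epsilon> * R z / 2" using \<epsilon> by (simp add: abs_mult)
      moreover have "\<bar>cos (y + \<theta>) * g z * (A z \<bullet> i)\<bar> = \<bar>cos (y + \<theta>)\<bar> * (\<bar>A z \<bullet> i\<bar> * g z)"
        using g(2)[of z] by (simp add: abs_mult)
      ultimately show ?thesis unfolding eq by linarith
    qed
    have "1 * (\<bar>A z \<bullet> i\<bar> * g z) \<le> (\<bar>cos y\<bar> + \<bar>sin y\<bar>) * (\<bar>A z \<bullet> i\<bar> * g z)"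
      using g(2)[of z] by (intro mult_right_mono abs_cos_sin_ge) auto
    also have "\<dots> = \<bar>cos (y + 0)\<bar> * (\<bar>A z \<bullet> i\<bar> * g z) + \<bar>cos (y + pi/2)\<bar> * (\<bar>A z \<bullet> i\<bar> * g z)"
      by (simp add: cos_add distrib_right)
    finally show ?thesis using *[of 0] *[of "pi/2"] by simp
  qed
  have ts: "test_smooth (\<Omega> \<times> I) (osc i g \<theta> \<epsilon>)" for \<theta> \<epsilon>
    unfolding osc_def[abs_def] by (rule test_smooth_mult_left[OF smooth_osc_factor g(1)])
  have osc0: "0 \<le> osc i g \<theta> \<epsilon> z" "osc i g \<theta> \<epsilon> z \<le> \<epsilon> * (2 * C)" if "0 < \<epsilon>" for \<theta> \<epsilon> z
  proof -
    let ?s = "1 + sin ((fst z \<bullet> i) / \<epsilon> + \<theta>)"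
    have "0 \<le> ?s" "?s \<le> 2" by (rule one_plus_sin_bounds)+
    then have "0 \<le> ?s * g z" "?s * g z \<le> 2 * C" using g(2)[of z] C(2)[of z] by (auto intro!: mult_mono)
    then show "0 \<le> osc i g \<theta> \<epsilon> z" "osc i g \<theta> \<epsilon> z \<le> \<epsilon> * (2 * C)"
      using that by (auto simp: osc_def mult.assoc mult_left_mono)
  qed
  have oscdt: "\<bar>deriv_t (osc i g \<theta> \<epsilon>) z\<bar> \<le> \<epsilon> * (2 * C)" if "0 < \<epsilon>" for \<theta> \<epsilon> z
  proof -
    let ?s = "1 + sin ((fst z \<bullet> i) / \<epsilon> + \<theta>)"
    have "\<bar>?s\<bar> \<le> 2" using one_plus_sin_bounds[of "(fst z \<bullet> i) / \<epsilon> + \<theta>"] by simp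
    then have "\<bar>?s\<bar> * \<bar>deriv_t g z\<bar> \<le> 2 * C" using dt[of z] by (intro mult_mono) auto
    then show ?thesis using that
      by (simp add: osc_deriv_t[OF sm less_imp_neq[OF that, symmetric]] abs_mult mult.assoc mult_left_mono)
  qed
  have oscgrad: "norm (grad_x (osc i g \<theta> \<epsilon>) z) \<le> g z + \<epsilon> * (2 * C)" if "0 < \<epsilon>" for \<theta> \<epsilon> z
  proof -
    let ?s = "1 + sin ((fst z \<bullet> i) / \<epsilon> + \<theta>)"
    have "norm (grad_x (osc i g \<theta> \<epsilon>) z) \<le> \<bar>cos ((fst z \<bullet> i) / \<epsilon> + \<theta>) * g z\<bar> * norm i + \<bar>\<epsilon> * ?s\<bar> * norm (grad_x g z)"
      unfolding osc_grad_x[OF sm less_imp_neq[OF that, symmetric] i] by (rule order_trans[OF norm_triangle_ineq]) simp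
    also have "\<dots> \<le> 1 * g z * 1 + (\<epsilon> * 2) * C"
      using i g(2)[of z] that one_plus_sin_bounds[of "(fst z \<bullet> i) / \<epsilon> + \<theta>"] grad[of z] C(1)
      by (intro add_mono mult_mono) (auto simp: abs_mult mult_left_le_one_le abs_cos_le_one intro!: mult_mono)
    finally show ?thesis by simp
  qed
  define e where "e m = inverse (real (Suc m))" for m
  have e: "\<And>m. 0 < e m" "\<And>m. e m \<le> 1" "e \<longlonglongrightarrow> 0"
    using LIMSEQ_inverse_real_of_nat by (auto simp: e_def[abs_def] inverse_eq_divide)
  define u where "u m z = (indicator (\<Omega> \<times> I) z * (e m * (2 * C))) powr p + (indicator (\<Omega> \<times> I) z * (g z + e m * (2 * C))) powr p" for m z
  have mU[measurable]: "\<Omega> \<times> I \<in> sets borel" using oU by auto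
  have g0: "g z = 0" if "z \<notin> \<Omega> \<times> I" for z using test_smooth_outside[OF g(1) that] .
  have ui: "(\<lambda>m. LINT t|lborel. (LINT x|lborel. u m (x, t)) powr (2 / p)) \<longlonglongrightarrow> (LINT t|lborel. (LINT x|lborel. g (x, t) powr p) powr (2 / p))"
      "integrable lborel (\<lambda>t. (LINT x|lborel. u m (x, t)) powr (2 / p))" for m
  proof -
    have m: "u k \<in> borel_measurable borel" "(\<lambda>z. g z powr p) \<in> borel_measurable borel" for k unfolding u_def by measurable
    have 1: "0 \<le> u k z" for k z by (simp add: u_def)
    have 2: "u k z \<le> (2 * C) powr p + (3 * C) powr p" for k z
    proof -
      have "e k * (2 * C) \<le> 1 * (2 * C)" using e(2) C(1) by (intro mult_right_mono) auto
      then show ?thesis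
        unfolding u_def using p C(1) C(2)[of z] e(1)[of k] g(2)[of z]
        by (intro add_mono powr_mono2) (auto simp: indicator_def)
    qed
    have 3: "u k (x, t) = 0" if "x \<notin> \<Omega> \<or> t \<notin> I" for k x t using that by (auto simp: u_def)
    have 4: "(\<lambda>k. u k z) \<longlonglongrightarrow> g z powr p" for z
    proof -
      have "(\<lambda>k. u k z) \<longlonglongrightarrow> (indicator (\<Omega> \<times> I) z * (0 * (2 * C))) powr p + (indicator (\<Omega> \<times> I) z * (g z + 0 * (2 * C))) powr p"
        unfolding u_def using p C(1) g(2)[of z] e(1)
        by (intro tendsto_add tendsto_powr2 tendsto_intros e(3)) (auto intro!: always_eventually simp: less_imp_le)
      then show ?thesis using g0[of z] p by (cases "z \<in> \<Omega> \<times> I") auto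
    qed
    from mixed_dominated_convergence[where h=u and h'="\<lambda>z. g z powr p" and r="2/p", OF \<Omega>(1) _ bI _ _ m 1 2 3] 4 p
    show "(\<lambda>m. LINT t|lborel. (LINT x|lborel. u m (x, t)) powr (2 / p)) \<longlonglongrightarrow> (LINT t|lborel. (LINT x|lborel. g (x, t) powr p) powr (2 / p))"
      "integrable lborel (\<lambda>t. (LINT x|lborel. u m (x, t)) powr (2 / p))" by auto
  qed
  have Wle: "(W1p_norm_at p \<Omega> (osc i g \<theta> (e m)) (grad_x (osc i g \<theta> (e m))) t)\<^sup>2
      \<le> (LINT x|lborel. u m (x, t)) powr (2 / p)" for \<theta> m t
  proof -
    have so: "smooth (osc i g \<theta> (e m))" by (rule test_smooth_smooth[OF ts])
    have [measurable]: "osc i g \<theta> (e m) \<in> borel_measurable borel" "grad_x (osc i g \<theta> (e m)) \<in> borel_measurable borel"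
      using so by (auto intro!: smooth_measurable borel_measurable_continuous_onI continuous_grad_x)
    have Ce: "0 \<le> e m * (2 * C)" using e(1)[of m] C(1) by simp
    have nz: "osc i g \<theta> (e m) (x, t) = 0" "grad_x (osc i g \<theta> (e m)) (x, t) = 0" if "t \<notin> I" for x
      using that test_smooth_outside[OF ts] test_smooth_frechet_outside[OF ts] by (auto simp: grad_x_def)
    have bnd: "integrable lborel (\<lambda>x. q x powr p)" if [measurable]: "q \<in> borel_measurable borel" and "\<And>x. 0 \<le> q x"
      "\<And>x. q x \<le> indicator \<Omega> x * (3 * C)" for q :: "'a \<Rightarrow> real"
    proof (rule Bochner_Integration.integrable_bound[where f="\<lambda>x. (3 * C) powr p * indicator \<Omega> x"])
      show "integrable lborel (\<lambda>x. (3 * C) powr p * indicator \<Omega> x)"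
        using emeasure_bounded_finite[OF \<Omega>(1)] by (intro integrable_mult_right integrable_real_indicator) auto
      show "AE x in lborel. norm (q x powr p) \<le> norm ((3 * C) powr p * indicator \<Omega> x)"
      proof (intro AE_I2)
        fix x show "norm (q x powr p) \<le> norm ((3 * C) powr p * indicator \<Omega> x)"
          using that(2,3)[of x] p by (cases "x \<in> \<Omega>") (auto intro!: powr_mono2)
      qed
    qed measurable
    have e2: "e m * (2 * C) \<le> 2 * C" using e(2)[of m] C(1) by (simp add: mult_left_le_one_le e(1) less_imp_le)
    show ?thesis
      unfolding u_def
    proof (rule W1p_norm_power2_le[OF p])
      show "integrable lborel (\<lambda>x. (indicator (\<Omega> \<times> I) (x, t) * (e m * (2 * C))) powr p)"
        using Ce e2 C(1) by (intro bnd) (auto simp: indicator_def)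
      have "g (x, t) + e m * (2 * C) \<le> 3 * C" for x using C(2)[of "(x, t)"] e2 by linarith
      then show "integrable lborel (\<lambda>x. (indicator (\<Omega> \<times> I) (x, t) * (g (x, t) + e m * (2 * C))) powr p)"
        using Ce g(2) C(1) by (intro bnd) (auto simp: indicator_def)
      show "\<bar>osc i g \<theta> (e m) (x, t)\<bar> \<le> indicator (\<Omega> \<times> I) (x, t) * (e m * (2 * C))" if "x \<in> \<Omega>" for x
        using that osc0[OF e(1), of \<theta> m "(x, t)"] nz by (cases "t \<in> I") auto
      show "norm (grad_x (osc i g \<theta> (e m)) (x, t)) \<le> indicator (\<Omega> \<times> I) (x, t) * (g (x, t) + e m * (2 * C))" if "x \<in> \<Omega>" for x
        using that oscgrad[OF e(1), of \<theta> m "(x, t)"] nz by (cases "t \<in> I") auto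
    qed (use Ce g(2) in \<open>auto simp: indicator_def\<close>)
  qed
  have "\<forall>\<^sub>F m in sequentially. (LINT t|lborel. (LINT x|lborel. u m (x, t)) powr (2 / p)) < B"
    using ui(1) B by (rule order_tendstoD(2))
  moreover have "\<forall>\<^sub>F m in sequentially. e m * (2 * C) < \<delta>"
    using tendsto_mult[OF e(3) tendsto_const[of "2 * C"]] \<delta> by (intro order_tendstoD(2)) auto
  moreover have "\<forall>\<^sub>F m in sequentially. e m * (LINT z|lborel. R z) < r - L"
    using tendsto_mult[OF e(3) tendsto_const[of "LINT z|lborel. R z"]] r(1) by (intro order_tendstoD(2)) auto
  ultimately have "\<forall>\<^sub>F m in sequentially. (LINT t|lborel. (LINT x|lborel. u m (x, t)) powr (2 / p)) < B \<and>
      e m * (2 * C) < \<delta> \<and> e m * (LINT z|lborel. R z) < r - L" by eventually_elim auto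
  then obtain m where m: "(LINT t|lborel. (LINT x|lborel. u m (x, t)) powr (2 / p)) < B"
      "e m * (2 * C) < \<delta>" "e m * (LINT z|lborel. R z) < r - L" by (auto simp: eventually_sequentially)
  define F where "F \<theta> = (\<integral>\<^sup>+z. ennreal \<bar>weak_form W A \<beta> (osc i g \<theta> (e m)) z\<bar> \<partial>lborel)" for \<theta>
  have [measurable]: "weak_form W A \<beta> (osc i g \<theta> (e m)) \<in> borel_measurable borel" for \<theta>
  proof -
    have so: "smooth (osc i g \<theta> (e m))" by (rule test_smooth_smooth[OF ts])
    have [measurable]: "osc i g \<theta> (e m) \<in> borel_measurable borel" "grad_x (osc i g \<theta> (e m)) \<in> borel_measurable borel"
       "deriv_t (osc i g \<theta> (e m)) \<in> borel_measurable borel"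
      using so by (auto intro!: borel_measurable_continuous_onI continuous_grad_x smooth_continuous smooth_deriv_t)
    show ?thesis unfolding weak_form_def[abs_def] by measurable
  qed
  have "J \<le> (\<integral>\<^sup>+z. (ennreal \<bar>weak_form W A \<beta> (osc i g 0 (e m)) z\<bar> + ennreal \<bar>weak_form W A \<beta> (osc i g (pi/2) (e m)) z\<bar>)
      + ennreal (e m * R z) \<partial>lborel)"
    unfolding J_def
    by (intro nn_integral_mono) (use osc_le[OF e(1)] R0 e(1) in \<open>auto simp flip: ennreal_plus intro!: ennreal_leI simp: less_imp_le\<close>)
  also have "\<dots> = F 0 + F (pi/2) + (\<integral>\<^sup>+z. ennreal (e m * R z) \<partial>lborel)"
    unfolding F_def using iR by (subst nn_integral_add, measurable, subst nn_integral_add) auto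
  also have "(\<integral>\<^sup>+z. ennreal (e m * R z) \<partial>lborel) = ennreal (e m * (LINT z|lborel. R z))"
    using iR R0 e(1) by (subst nn_integral_eq_integral) (auto simp: less_imp_le)
  finally have J: "J \<le> F 0 + F (pi/2) + ennreal (e m * (LINT z|lborel. R z))" .
  have "\<exists>\<theta>. ennreal (L / 2) < F \<theta>"
  proof (rule ccontr)
    assume "\<not> ?thesis"
    then have F: "F \<theta> \<le> ennreal (L / 2)" for \<theta> by (auto simp: not_less)
    have "J \<le> ennreal (L / 2) + ennreal (L / 2) + ennreal (r - L)"
      using m(3) by (intro order_trans[OF J] add_mono F ennreal_leI) auto
    also have "\<dots> = ennreal r" using L(1) r(1) by (simp flip: ennreal_plus)
    finally show False using r(2) by simp
  qed
  then obtain \<theta> where \<theta>: "ennreal (L / 2) < F \<theta>" by blast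
  have so: "smooth (osc i g \<theta> (e m))" by (rule test_smooth_smooth[OF ts])
  have [measurable]: "osc i g \<theta> (e m) \<in> borel_measurable borel" "grad_x (osc i g \<theta> (e m)) \<in> borel_measurable borel"
    using so by (auto intro!: smooth_measurable borel_measurable_continuous_onI continuous_grad_x)
  have [measurable]: "(\<lambda>t. W1p_norm_at p \<Omega> (osc i g \<theta> (e m)) (grad_x (osc i g \<theta> (e m))) t) \<in> borel_measurable borel"
    by (rule measurable_W1p_norm) measurable
  have int: "integrable lborel (\<lambda>t. (W1p_norm_at p \<Omega> (osc i g \<theta> (e m)) (grad_x (osc i g \<theta> (e m))) t)\<^sup>2)"
    by (rule Bochner_Integration.integrable_bound[OF ui(2)[of m]])
       (use Wle in \<open>auto intro!: AE_I2 intro: order_trans[OF _ abs_ge_self]\<close>)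
  show ?thesis
  proof (rule that[OF ts _ _ _ int])
    show "0 \<le> osc i g \<theta> (e m) z" "osc i g \<theta> (e m) z \<le> \<delta>" for z using osc0[OF e(1), of \<theta> m z] m(2) by auto
    show "\<bar>deriv_t (osc i g \<theta> (e m)) z\<bar> \<le> \<delta>" for z using oscdt[OF e(1), of \<theta> m z] m(2) by auto
    show "(LINT t|lborel. (W1p_norm_at p \<Omega> (osc i g \<theta> (e m)) (grad_x (osc i g \<theta> (e m))) t)\<^sup>2) < B"
      using integral_mono[OF int ui(2) Wle] m(1) by (rule le_less_trans)
    show "ennreal (L / 2) < (\<integral>\<^sup>+z. ennreal \<bar>weak_form W A \<beta> (osc i g \<theta> (e m)) z\<bar> \<partial>lborel)"
      using \<theta> by (simp add: F_def)
  qed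
qed

section \<open>Disjoint intervals carrying large mass\<close>

text \<open>Monotone convergence, as the interval is exhausted from the inside.\<close>

lemma interval_mass_exhaust:
  fixes f :: "real \<Rightarrow> ennreal"
  assumes [measurable]: "f \<in> borel_measurable borel"
    and inf: "(\<integral>\<^sup>+t\<in>{a<..<b}. f t \<partial>lborel) = \<infinity>"
  shows "\<exists>t. a < t \<and> t < b \<and> ennreal C < (\<integral>\<^sup>+t\<in>{t<..<b}. f t \<partial>lborel)"
    "\<exists>t. a < t \<and> t < b \<and> ennreal C < (\<integral>\<^sup>+t\<in>{a<..<t}. f t \<partial>lborel)"
proof -
  define e where "e n = inverse (real (Suc n))" for n
  have e: "\<And>n. 0 < e n" "decseq e" "e \<longlonglongrightarrow> 0"
    using LIMSEQ_inverse_real_of_nat by (auto simp: e_def[abs_def] decseq_def le_imp_inverse_le)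
  have small: "\<exists>n. e n < r" if "0 < r" for r
    using order_tendstoD(2)[OF e(3) that] by (auto simp: eventually_sequentially)
  have *: "\<exists>n. ennreal C < (\<integral>\<^sup>+t\<in>S n. f t \<partial>lborel)"
    if S: "\<And>n. S n \<in> sets borel" "incseq S" "(\<Union>n. S n) = {a<..<b}" for S
  proof -
    note [measurable] = S(1)
    have "(\<integral>\<^sup>+t\<in>{a<..<b}. f t \<partial>lborel) = (\<integral>\<^sup>+t. (SUP n. f t * indicator (S n) t) \<partial>lborel)"
    proof (intro nn_integral_cong)
      fix t
      show "f t * indicator {a<..<b} t = (SUP n. f t * indicator (S n) t)"
      proof (rule antisym)
        show "f t * indicator {a<..<b} t \<le> (SUP n. f t * indicator (S n) t)"
        proof (cases "t \<in> {a<..<b}")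
          case True
          then obtain n where "t \<in> S n" using S(3) by blast
          then have "f t * indicator {a<..<b} t = f t * indicator (S n) t" using True by simp
          then show ?thesis by (simp only:) (rule SUP_upper, simp)
        qed simp
        show "(SUP n. f t * indicator (S n) t) \<le> f t * indicator {a<..<b} t"
          by (intro SUP_least mult_left_mono) (use S(3) in \<open>auto simp: indicator_def\<close>)
      qed
    qed
    also have "\<dots> = (SUP n. \<integral>\<^sup>+t\<in>S n. f t \<partial>lborel)"
    proof (rule nn_integral_monotone_convergence_SUP)
      show "incseq (\<lambda>n t. f t * indicator (S n) t)"
        using S(2) by (auto simp: incseq_def le_fun_def indicator_def intro!: mult_left_mono dest: subsetD)
    qed measurable
    finally have "ennreal C < (SUP n. \<integral>\<^sup>+t\<in>S n. f t \<partial>lborel)" using inf by simp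
    then show ?thesis by (simp add: less_SUP_iff)
  qed
  have nonempty: "s < r" if "ennreal C < (\<integral>\<^sup>+t\<in>{s<..<r}. f t \<partial>lborel)" for s r
  proof (rule ccontr)
    assume "\<not> s < r"
    then have "{s<..<r} = {}" by auto
    then show False using that by simp
  qed
  have "\<exists>n. ennreal C < (\<integral>\<^sup>+t\<in>{a + e n<..<b}. f t \<partial>lborel)"
  proof (rule *)
    show "incseq (\<lambda>n. {a + e n<..<b})" using e(2) by (force simp: incseq_def decseq_def)
    show "(\<Union>n. {a + e n<..<b}) = {a<..<b}"
    proof (intro equalityI subsetI)
      fix x assume "x \<in> {a<..<b}"
      then obtain n where "e n < x - a" using small[of "x - a"] by auto
      then show "x \<in> (\<Union>n. {a + e n<..<b})" using \<open>x \<in> {a<..<b}\<close> by (auto intro!: exI[of _ n])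
    next
      fix x assume "x \<in> (\<Union>n. {a + e n<..<b})"
      then obtain n where "a + e n < x" "x < b" by auto
      then show "x \<in> {a<..<b}" using e(1)[of n] by auto
    qed
  qed auto
  then obtain n where n: "ennreal C < (\<integral>\<^sup>+t\<in>{a + e n<..<b}. f t \<partial>lborel)" by blast
  show "\<exists>t. a < t \<and> t < b \<and> ennreal C < (\<integral>\<^sup>+t\<in>{t<..<b}. f t \<partial>lborel)"
    using n nonempty[OF n] e(1)[of n] by (intro exI[of _ "a + e n"]) auto
  have "\<exists>n. ennreal C < (\<integral>\<^sup>+t\<in>{a<..<b - e n}. f t \<partial>lborel)"
  proof (rule *)
    show "incseq (\<lambda>n. {a<..<b - e n})" using e(2) by (force simp: incseq_def decseq_def)
    show "(\<Union>n. {a<..<b - e n}) = {a<..<b}"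
    proof (intro equalityI subsetI)
      fix x assume "x \<in> {a<..<b}"
      then obtain n where "e n < b - x" using small[of "b - x"] by auto
      then show "x \<in> (\<Union>n. {a<..<b - e n})" using \<open>x \<in> {a<..<b}\<close> by (auto intro!: exI[of _ n])
    next
      fix x assume "x \<in> (\<Union>n. {a<..<b - e n})"
      then obtain n where "a < x" "x < b - e n" by auto
      then show "x \<in> {a<..<b}" using e(1)[of n] by auto
    qed
  qed auto
  then obtain n where n: "ennreal C < (\<integral>\<^sup>+t\<in>{a<..<b - e n}. f t \<partial>lborel)" by blast
  show "\<exists>t. a < t \<and> t < b \<and> ennreal C < (\<integral>\<^sup>+t\<in>{a<..<t}. f t \<partial>lborel)"
    using n nonempty[OF n] e(1)[of n] by (intro exI[of _ "b - e n"]) auto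
qed

text \<open>Let \<open>t0\<close> be the infimum of the times \<open>t\<close> for which the integral over \<open>(a, t)\<close> diverges. It diverges on
  every neighbourhood of \<open>t0\<close> on the right or on every one on the left. An interval away from \<open>t0\<close> on
  that side then has mass \<open>C\<close>, and the rest keeps infinite mass.\<close>

lemma infinite_mass_split:
  fixes f :: "real \<Rightarrow> ennreal"
  assumes f[measurable]: "f \<in> borel_measurable borel"
    and inf: "(\<integral>\<^sup>+t\<in>{a<..<b}. f t \<partial>lborel) = \<infinity>"
  shows "\<exists>a' b' c d. {a'<..<b'} \<subseteq> {a<..<b} \<and> {c<..<d} \<subseteq> {a<..<b} \<and> {a'<..<b'} \<inter> {c<..<d} = {} \<and>
     (\<integral>\<^sup>+t\<in>{a'<..<b'}. f t \<partial>lborel) = \<infinity> \<and> ennreal C < (\<integral>\<^sup>+t\<in>{c<..<d}. f t \<partial>lborel)"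
proof -
  define \<nu> where "\<nu> s t = (\<integral>\<^sup>+r\<in>{s<..<t}. f r \<partial>lborel)" for s t
  have mono: "\<nu> s t \<le> \<nu> s' t'" if "s' \<le> s" "t \<le> t'" for s t s' t'
    unfolding \<nu>_def using that by (intro nn_integral_mono mult_left_mono) (auto simp: indicator_def)
  have add: "\<nu> s u = \<nu> s t + \<nu> t u" if "s \<le> t" "t \<le> u" for s t u
  proof -
    have "\<nu> s u = (\<integral>\<^sup>+r. f r * indicator {s<..<t} r + f r * indicator {t<..<u} r \<partial>lborel)"
      unfolding \<nu>_def
    proof (rule nn_integral_cong_AE)
      have "AE r in lborel. r \<noteq> t" by (rule AE_lborel_singleton)
      then show "AE r in lborel. f r * indicator {s<..<u} r = f r * indicator {s<..<t} r + f r * indicator {t<..<u} r"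
        by eventually_elim (use that in \<open>auto simp: indicator_def\<close>)
    qed
    also have "\<dots> = \<nu> s t + \<nu> t u" unfolding \<nu>_def by (rule nn_integral_add) measurable
    finally show ?thesis .
  qed
  have ab: "\<nu> a b = \<infinity>" using inf by (simp add: \<nu>_def)
  have empty: "\<nu> s t = 0" if "t \<le> s" for s t
  proof -
    have "{s<..<t} = {}" using that by auto
    then show ?thesis by (simp add: \<nu>_def)
  qed
  have "a < b" using ab empty[of b a] by (cases "a < b") auto
  define S where "S = {t. a \<le> t \<and> t \<le> b \<and> \<nu> a t = \<infinity>}"
  define t0 where "t0 = Inf S"
  have bS: "b \<in> S" using ab \<open>a < b\<close> by (simp add: S_def)
  have bdd: "bdd_below S" by (auto simp: S_def bdd_below_def)
  have t0: "a \<le> t0" "t0 \<le> b"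
    unfolding t0_def using bS bdd by (auto intro!: cInf_greatest cInf_lower simp: S_def)
  have below: "\<nu> a s \<noteq> \<infinity>" if "s < t0" "a \<le> s" for s
    using cInf_lower[OF _ bdd, of s] that t0 by (force simp: S_def t0_def)
  have above: "\<nu> a t = \<infinity>" if "t0 < t" "t \<le> b" for t
  proof -
    have "Inf S < t" using that(1) by (simp add: t0_def)
    then obtain s where "s \<in> S" "s < t" using cInf_lessD[of S t] bS by blast
    then have "\<nu> a s = \<infinity>" "\<nu> a s \<le> \<nu> a t" using mono[of a a s t] by (auto simp: S_def)
    then show ?thesis by (simp add: top_unique)
  qed
  show ?thesis
  proof (cases "t0 < b \<and> (\<forall>t. t0 < t \<and> t \<le> b \<longrightarrow> \<nu> t0 t = \<infinity>)")
    case True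
    then have "(\<integral>\<^sup>+t\<in>{t0<..<b}. f t \<partial>lborel) = \<infinity>" by (auto simp: \<nu>_def)
    from interval_mass_exhaust(1)[OF f this, of C]
    obtain t where t: "t0 < t" "t < b" "ennreal C < \<nu> t b" by (auto simp: \<nu>_def)
    show ?thesis
      using True t t0 unfolding \<nu>_def by (intro exI[of _ t0] exI[of _ t] exI[of _ t] exI[of _ b]) auto
  next
    case False
    have at0: "\<nu> a t0 = \<infinity>"
    proof (cases "t0 = b")
      case True then show ?thesis using ab by simp
    next
      case ne: False
      then obtain t where t: "t0 < t" "t \<le> b" "\<nu> t0 t \<noteq> \<infinity>" using False t0 by auto
      have "\<nu> a t = \<nu> a t0 + \<nu> t0 t" using t t0 by (intro add) auto
      then show ?thesis using above[OF t(1,2)] t(3) by (metis ennreal_add_eq_top infinity_ennreal_def)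
    qed
    then have "(\<integral>\<^sup>+t\<in>{a<..<t0}. f t \<partial>lborel) = \<infinity>" by (simp add: \<nu>_def)
    from interval_mass_exhaust(2)[OF f this, of C]
    obtain s where s: "a < s" "s < t0" "ennreal C < \<nu> a s" by (auto simp: \<nu>_def)
    have "\<nu> a t0 = \<nu> a s + \<nu> s t0" using s by (intro add) auto
    then have "\<nu> s t0 = \<infinity>" using at0 below[OF s(2)] s(1) by (metis ennreal_add_eq_top infinity_ennreal_def less_imp_le)
    then show ?thesis
      using s t0 unfolding \<nu>_def by (intro exI[of _ s] exI[of _ t0] exI[of _ a] exI[of _ s]) auto
  qed
qed

lemma disjoint_intervals_large_mass:
  fixes f :: "real \<Rightarrow> ennreal" and C :: "nat \<Rightarrow> real"
  assumes f: "f \<in> borel_measurable borel" and inf: "(\<integral>\<^sup>+t\<in>{a<..<b}. f t \<partial>lborel) = \<infinity>"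
  obtains c d where "disjoint_family (\<lambda>j. {c j<..<d j})" "\<And>j. {c j<..<d j} \<subseteq> {a<..<b}"
    "\<And>j. ennreal (C j) < (\<integral>\<^sup>+t\<in>{c j<..<d j}. f t \<partial>lborel)"
proof -
  define P where "P s \<longleftrightarrow> {fst (fst s)<..<snd (fst s)} \<subseteq> {a<..<b} \<and>
    (\<integral>\<^sup>+t\<in>{fst (fst s)<..<snd (fst s)}. f t \<partial>lborel) = \<infinity>" for s :: "(real \<times> real) \<times> (real \<times> real)"
  define Q where "Q n s s' \<longleftrightarrow> {fst (fst s')<..<snd (fst s')} \<subseteq> {fst (fst s)<..<snd (fst s)} \<and>
     {fst (snd s')<..<snd (snd s')} \<subseteq> {fst (fst s)<..<snd (fst s)} \<and>
     {fst (fst s')<..<snd (fst s')} \<inter> {fst (snd s')<..<snd (snd s')} = {} \<and>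
     ennreal (C n) < (\<integral>\<^sup>+t\<in>{fst (snd s')<..<snd (snd s')}. f t \<partial>lborel)"
    for n and s s' :: "(real \<times> real) \<times> (real \<times> real)"
  have "\<exists>s. \<forall>n. P (s n) \<and> Q n (s n) (s (Suc n))"
  proof (rule dependent_nat_choice)
    show "\<exists>s. P s" using inf by (intro exI[of _ "((a, b), (a, b))"]) (simp add: P_def)
    fix s :: "(real \<times> real) \<times> (real \<times> real)" and n assume s: "P s"
    have inf': "(\<integral>\<^sup>+t\<in>{fst (fst s)<..<snd (fst s)}. f t \<partial>lborel) = \<infinity>" using s by (simp add: P_def)
    obtain a' b' c d where "{a'<..<b'} \<subseteq> {fst (fst s)<..<snd (fst s)}" "{c<..<d} \<subseteq> {fst (fst s)<..<snd (fst s)}"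
       "{a'<..<b'} \<inter> {c<..<d} = {}" "(\<integral>\<^sup>+t\<in>{a'<..<b'}. f t \<partial>lborel) = \<infinity>" "ennreal (C n) < (\<integral>\<^sup>+t\<in>{c<..<d}. f t \<partial>lborel)"
      using infinite_mass_split[OF f inf', of "C n"] by blast
    then show "\<exists>s'. P s' \<and> Q n s s'"
      using s unfolding P_def Q_def by (intro exI[of _ "((a', b'), (c, d))"]) auto
  qed
  then obtain s where s: "\<And>n. P (s n)" "\<And>n. Q n (s n) (s (Suc n))" by blast
  define J where "J n = {fst (fst (s n))<..<snd (fst (s n))}" for n
  define I where "I n = {fst (snd (s (Suc n)))<..<snd (snd (s (Suc n)))}" for n
  have J: "J (Suc n) \<subseteq> J n" "I n \<subseteq> J n" "J (Suc n) \<inter> I n = {}" for n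
    using s(2)[of n] by (auto simp: Q_def J_def I_def)
  have "J m \<subseteq> J n" if "n \<le> m" for m n using that J(1) by (rule lift_Suc_antimono_le[rotated])
  then have disj: "I m \<inter> I n = {}" if "n < m" for m n
    using J(2)[of m] J(3)[of n] that by (metis (no_types, opaque_lifting) Suc_leI disjoint_iff subsetD)
  have "disjoint_family I"
    unfolding disjoint_family_on_def
  proof (intro ballI impI)
    fix m n :: nat assume "m \<noteq> n"
    then consider "n < m" | "m < n" by linarith
    then show "I m \<inter> I n = {}" using disj by cases auto
  qed
  moreover have "I n \<subseteq> {a<..<b}" for n using J(2)[of n] s(1)[of n] by (auto simp: P_def J_def)
  moreover have "ennreal (C n) < (\<integral>\<^sup>+t\<in>I n. f t \<partial>lborel)" for n using s(2)[of n] by (simp add: Q_def I_def)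
  ultimately show ?thesis
    using that[of "\<lambda>n. fst (snd (s (Suc n)))" "\<lambda>n. snd (snd (s (Suc n)))"] by (simp add: I_def[abs_def])
qed

section \<open>The flux\<close>

definition flux :: "real \<Rightarrow> 'a::euclidean_space \<Rightarrow> 'a" where
  "flux p \<xi> = (norm \<xi> powr (p - 2)) *\<^sub>R \<xi>"

lemma norm_flux: "norm (flux p \<xi>) = norm \<xi> powr (p - 1)"
proof (cases "\<xi> = 0")
  case False
  then have "norm \<xi> powr (p - 2) * norm \<xi> powr 1 = norm \<xi> powr (p - 1)"
    by (subst powr_add[symmetric]) simp
  then show ?thesis by (simp add: flux_def)
qed (simp add: flux_def)

lemma flux_measurable [measurable]: "flux p \<in> borel_measurable borel"
  unfolding flux_def[abs_def] by measurable

section \<open>Integrability of the gradient in time\<close>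

text \<open>The profile of an oscillating test function may be any bounded measurable function \<open>G\<close>: one of the
  components of \<open>A\<close> sees its share of the integral of \<open>norm A * G\<close>, and \<open>G\<close> is replaced by a smooth
  approximation that obeys the same bounds.\<close>

lemma test_with_large_weak_form:
  fixes \<Omega> :: "'a::euclidean_space set" and A :: "'a \<times> real \<Rightarrow> 'a" and W \<beta> G :: "'a \<times> real \<Rightarrow> real"
  assumes p: "1 < p" and \<Omega>: "bounded \<Omega>" "open \<Omega>" and I: "I = {c<..<d}"
    and mA[measurable]: "A \<in> borel_measurable borel" "\<beta> \<in> borel_measurable borel" and W: "integrable lborel W"
    and K: "0 \<le> K" "\<And>z. \<bar>\<beta> z\<bar> \<le> K * \<bar>W z\<bar>"
    and Aloc: "\<And>\<zeta>. test_smooth (\<Omega> \<times> I) \<zeta> \<Longrightarrow> (\<And>z. 0 \<le> \<zeta> z) \<Longrightarrow> integrable lborel (\<lambda>z. norm (A z) * \<zeta> z)"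
    and G[measurable]: "G \<in> borel_measurable borel" and G0: "\<And>z. 0 \<le> G z" "\<And>z. G z \<le> M" "\<And>z. z \<notin> \<Omega> \<times> I \<Longrightarrow> G z = 0"
    and B: "(LINT t|lborel. (LINT x|lborel. G (x, t) powr p) powr (2 / p)) < B"
    and L: "0 \<le> L" "ennreal (real DIM('a) * L) < (\<integral>\<^sup>+z. ennreal (norm (A z) * G z) \<partial>lborel)" and \<delta>: "0 < \<delta>"
  obtains \<phi> where "test_smooth (\<Omega> \<times> I) \<phi>" "\<And>z. 0 \<le> \<phi> z" "\<And>z. \<phi> z \<le> \<delta>" "\<And>z. \<bar>deriv_t \<phi> z\<bar> \<le> \<delta>"
    "integrable lborel (\<lambda>t. (W1p_norm_at p \<Omega> \<phi> (grad_x \<phi>) t)\<^sup>2)"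
    "(LINT t|lborel. (W1p_norm_at p \<Omega> \<phi> (grad_x \<phi>) t)\<^sup>2) < B"
    "ennreal (L / 2) < (\<integral>\<^sup>+z. ennreal \<bar>weak_form W A \<beta> \<phi> z\<bar> \<partial>lborel)"
proof -
  have [measurable]: "\<Omega> \<in> sets borel" "I \<in> sets borel" using \<Omega> by (auto simp: I)
  have bI: "bounded I" by (simp add: I)
  have U: "open (\<Omega> \<times> I)" "emeasure lborel (\<Omega> \<times> I) < \<infinity>"
    using \<Omega> emeasure_bounded_finite[OF bounded_Times[OF \<Omega>(1) bI]] by (auto simp: I intro!: open_Times)
  have "\<exists>i\<in>Basis. ennreal L < (\<integral>\<^sup>+z. ennreal (\<bar>A z \<bullet> i\<bar> * G z) \<partial>lborel)"
  proof (rule ccontr)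
    assume "\<not> ?thesis"
    then have le: "(\<integral>\<^sup>+z. ennreal (\<bar>A z \<bullet> i\<bar> * G z) \<partial>lborel) \<le> ennreal L" if "i \<in> Basis" for i
      using that by (auto simp: not_less)
    have "(\<integral>\<^sup>+z. ennreal (norm (A z) * G z) \<partial>lborel) \<le> (\<integral>\<^sup>+z. (\<Sum>i\<in>Basis. ennreal (\<bar>A z \<bullet> i\<bar> * G z)) \<partial>lborel)"
    proof (rule nn_integral_mono)
      fix z :: "'a \<times> real"
      have "norm (A z) * G z \<le> (\<Sum>i\<in>Basis. \<bar>A z \<bullet> i\<bar>) * G z" by (intro mult_right_mono norm_le_l1 G0)
      also have "\<dots> = (\<Sum>i\<in>Basis. \<bar>A z \<bullet> i\<bar> * G z)" by (simp add: sum_distrib_right)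
      finally show "ennreal (norm (A z) * G z) \<le> (\<Sum>i\<in>Basis. ennreal (\<bar>A z \<bullet> i\<bar> * G z))"
        using G0 by (subst sum_ennreal) (auto intro: ennreal_leI)
    qed
    also have "\<dots> = (\<Sum>i\<in>Basis. \<integral>\<^sup>+z. ennreal (\<bar>A z \<bullet> i\<bar> * G z) \<partial>lborel)" by (rule nn_integral_sum) measurable
    also have "\<dots> \<le> (\<Sum>i\<in>(Basis::'a set). ennreal L)" by (intro sum_mono le)
    also have "\<dots> = ennreal (real DIM('a) * L)" using L(1) by (simp add: ennreal_mult ennreal_of_nat_eq_real_of_nat)
    finally show False using L(2) by simp
  qed
  then obtain i where i: "i \<in> Basis" "ennreal L < (\<integral>\<^sup>+z. ennreal (\<bar>A z \<bullet> i\<bar> * G z) \<partial>lborel)" by blast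
  obtain g where g: "\<And>k. test_smooth (\<Omega> \<times> I) (g k)" "\<And>k z. 0 \<le> g k z" "\<And>k z. g k z \<le> M"
    "AE z in lborel. (\<lambda>k. g k z) \<longlonglongrightarrow> G z"
    using smooth_approx_bounded[OF U G G0] by blast
  have [measurable]: "g k \<in> borel_measurable borel" for k by (intro smooth_measurable test_smooth_smooth[OF g(1)])
  have "(\<lambda>k. LINT t|lborel. (LINT x|lborel. g k (x, t) powr p) powr (2 / p)) \<longlonglongrightarrow>
     (LINT t|lborel. (LINT x|lborel. G (x, t) powr p) powr (2 / p))"
  proof (rule mixed_dominated_convergence(1)[where h="\<lambda>k z. g k z powr p" and h'="\<lambda>z. G z powr p" and M="M powr p" and \<Omega>=\<Omega> and I=I])
    show "AE z in lborel. (\<lambda>k. g k z powr p) \<longlonglongrightarrow> G z powr p"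
      using g(4) by eventually_elim (use p g(2) in \<open>auto intro!: tendsto_powr2 always_eventually\<close>)
    show "g k (x, t) powr p = 0" if "x \<notin> \<Omega> \<or> t \<notin> I" for k x t
      using test_smooth_outside[OF g(1), of "(x, t)"] that p by auto
    show "g k z powr p \<le> M powr p" for k z using g(2,3) p by (intro powr_mono2) auto
  qed (use \<Omega> bI p in auto)
  then have "\<forall>\<^sub>F k in sequentially. (LINT t|lborel. (LINT x|lborel. g k (x, t) powr p) powr (2 / p)) < B"
    using B by (rule order_tendstoD(2))
  moreover have "\<forall>\<^sub>F k in sequentially. ennreal L < (\<integral>\<^sup>+z. ennreal (\<bar>A z \<bullet> i\<bar> * g k z) \<partial>lborel)"
  proof -
    have "(\<integral>\<^sup>+z. ennreal (\<bar>A z \<bullet> i\<bar> * G z) \<partial>lborel) = (\<integral>\<^sup>+z. liminf (\<lambda>k. ennreal (\<bar>A z \<bullet> i\<bar> * g k z)) \<partial>lborel)"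
    proof (rule nn_integral_cong_AE)
      show "AE z in lborel. ennreal (\<bar>A z \<bullet> i\<bar> * G z) = liminf (\<lambda>k. ennreal (\<bar>A z \<bullet> i\<bar> * g k z))"
        using g(4)
      proof eventually_elim
        case (elim z)
        have "(\<lambda>k. ennreal (\<bar>A z \<bullet> i\<bar> * g k z)) \<longlonglongrightarrow> ennreal (\<bar>A z \<bullet> i\<bar> * G z)"
          by (intro tendsto_ennrealI tendsto_intros elim)
        then show ?case by (simp add: lim_imp_Liminf)
      qed
    qed
    also have "\<dots> \<le> liminf (\<lambda>k. \<integral>\<^sup>+z. ennreal (\<bar>A z \<bullet> i\<bar> * g k z) \<partial>lborel)"
      by (rule nn_integral_liminf) measurable
    finally have "ennreal L < liminf (\<lambda>k. \<integral>\<^sup>+z. ennreal (\<bar>A z \<bullet> i\<bar> * g k z) \<partial>lborel)" using i(2) by (rule less_le_trans[rotated])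
    then show ?thesis by (rule less_LiminfD)
  qed
  ultimately have "\<forall>\<^sub>F k in sequentially. (LINT t|lborel. (LINT x|lborel. g k (x, t) powr p) powr (2 / p)) < B \<and>
     ennreal L < (\<integral>\<^sup>+z. ennreal (\<bar>A z \<bullet> i\<bar> * g k z) \<partial>lborel)" by eventually_elim simp
  then obtain k where k: "(LINT t|lborel. (LINT x|lborel. g k (x, t) powr p) powr (2 / p)) < B"
     "ennreal L < (\<integral>\<^sup>+z. ennreal (\<bar>A z \<bullet> i\<bar> * g k z) \<partial>lborel)" by (auto simp: eventually_sequentially)
  show ?thesis
    by (rule oscillating_test[OF p \<Omega> I mA W K Aloc i(1) g(1) g(2) k(1) L(1) k(2) \<delta>]) (blast, blast, rule that)
qed

lemma nn_integral_min_exhaust: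
  fixes f h :: "'b::euclidean_space \<Rightarrow> real"
  assumes [measurable]: "f \<in> borel_measurable borel" "h \<in> borel_measurable borel" and nn: "\<And>x. 0 \<le> f x" "\<And>x. 0 \<le> h x"
    and C: "ennreal C < (\<integral>\<^sup>+x. ennreal (h x * f x) \<partial>lborel)"
  shows "\<exists>m::nat. ennreal C < (\<integral>\<^sup>+x. ennreal (h x * min (f x) (real m)) \<partial>lborel)"
proof -
  have "(\<integral>\<^sup>+x. ennreal (h x * f x) \<partial>lborel) = (\<integral>\<^sup>+x. (SUP m::nat. ennreal (h x * min (f x) (real m))) \<partial>lborel)"
  proof (rule nn_integral_cong)
    fix x
    show "ennreal (h x * f x) = (SUP m::nat. ennreal (h x * min (f x) (real m)))"
    proof (rule antisym)
      obtain m :: nat where "f x \<le> real m" using real_arch_simple by blast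
      then have "ennreal (h x * f x) = ennreal (h x * min (f x) (real m))" by simp
      then show "ennreal (h x * f x) \<le> (SUP m::nat. ennreal (h x * min (f x) (real m)))"
        by (metis SUP_upper UNIV_I)
      show "(SUP m::nat. ennreal (h x * min (f x) (real m))) \<le> ennreal (h x * f x)"
        by (intro SUP_least ennreal_leI mult_left_mono nn) simp
    qed
  qed
  also have "\<dots> = (SUP m::nat. \<integral>\<^sup>+x. ennreal (h x * min (f x) (real m)) \<partial>lborel)"
  proof (rule nn_integral_monotone_convergence_SUP)
    show "incseq (\<lambda>m x. ennreal (h x * min (f x) (real m)))"
      by (auto simp: incseq_def le_fun_def intro!: ennreal_leI mult_left_mono nn)
  qed measurable
  finally show ?thesis using C by (simp add: less_SUP_iff)
qed

lemma integrable_mixed_test_smooth: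
  fixes \<Omega> :: "'a::euclidean_space set"
  assumes p: "1 < p" and \<Omega>: "bounded \<Omega>" "open \<Omega>" and I: "I = {c<..<d}" and g: "test_smooth (\<Omega> \<times> I) g"
  shows "integrable lborel (\<lambda>t. (W1p_norm_at p \<Omega> g (grad_x g) t)\<^sup>2)"
proof -
  have sm: "smooth g" by (rule test_smooth_smooth[OF g])
  have [measurable]: "g \<in> borel_measurable borel" "grad_x g \<in> borel_measurable borel" "\<Omega> \<in> sets borel" "I \<in> sets borel"
    using sm \<Omega> by (auto intro!: borel_measurable_continuous_onI continuous_grad_x smooth_continuous simp: I)
  have bI: "bounded I" by (simp add: I)
  obtain C where C: "0 \<le> C" "\<And>z. \<bar>g z\<bar> \<le> C" "\<And>z v. norm v \<le> 1 \<Longrightarrow> \<bar>frechet_derivative g (at z) v\<bar> \<le> C"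
    using test_smooth_bounded[OF g] by blast
  have grad: "norm (grad_x g z) \<le> C" for z by (rule norm_grad_x_le[OF sm C(3)])
  have [measurable]: "\<Omega> \<times> I \<in> sets borel" by (intro borel_Times) auto
  define h where "h z = (indicator (\<Omega> \<times> I) z * C) powr p + (indicator (\<Omega> \<times> I) z * C) powr p" for z
  have int: "integrable lborel (\<lambda>t. (LINT x|lborel. h (x, t)) powr (2 / p))"
  proof (rule mixed_dominated_convergence(2)[where h="\<lambda>_. h" and h'=h and \<Omega>=\<Omega> and I=I and M="2 * C powr p"])
    show "h \<in> borel_measurable borel" "h \<in> borel_measurable borel" unfolding h_def by measurable
  qed (use \<Omega> bI p C(1) in \<open>auto simp: h_def indicator_def\<close>)
  have le: "(W1p_norm_at p \<Omega> g (grad_x g) t)\<^sup>2 \<le> (LINT x|lborel. h (x, t)) powr (2 / p)" for t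
  proof -
    have i: "integrable lborel (\<lambda>x. (indicator (\<Omega> \<times> I) (x, t) * C) powr p)"
    proof (rule Bochner_Integration.integrable_bound[where f="\<lambda>x. C powr p * indicator \<Omega> x"])
      show "integrable lborel (\<lambda>x. C powr p * indicator \<Omega> x)"
        using emeasure_bounded_finite[OF \<Omega>(1)] by (intro integrable_mult_right integrable_real_indicator) auto
    qed (use C(1) in \<open>auto simp: indicator_def\<close>)
    have nz: "g (x, t) = 0" "grad_x g (x, t) = 0" if "t \<notin> I" for x
      using that test_smooth_outside[OF g] test_smooth_frechet_outside[OF g] by (auto simp: grad_x_def)
    show ?thesis
      unfolding h_def
    proof (rule W1p_norm_power2_le[OF p _ _ _ _ _ _ _ _ _ i i])
      show "\<bar>g (x, t)\<bar> \<le> indicator (\<Omega> \<times> I) (x, t) * C" "norm (grad_x g (x, t)) \<le> indicator (\<Omega> \<times> I) (x, t) * C"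
        if "x \<in> \<Omega>" for x
        using that C(2)[of "(x, t)"] grad[of "(x, t)"] nz by (cases "t \<in> I"; auto)+
    qed (use C(1) in auto)
  qed
  have [measurable]: "(\<lambda>t. W1p_norm_at p \<Omega> g (grad_x g) t) \<in> borel_measurable borel"
    by (rule measurable_W1p_norm) measurable
  show ?thesis
    by (rule Bochner_Integration.integrable_bound[OF int])
       (use le in \<open>auto intro!: AE_I2 intro: order_trans[OF _ abs_ge_self]\<close>)
qed

lemma borel_measurable_fst [measurable]: "(fst :: 'a::euclidean_space \<times> real \<Rightarrow> 'a) \<in> borel_measurable borel"
  and borel_measurable_snd [measurable]: "(snd :: 'a::euclidean_space \<times> real \<Rightarrow> real) \<in> borel_measurable borel"
  by (intro borel_measurable_continuous_onI continuous_intros)+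

text \<open>A gliding hump argument. With \<open>N t\<close> the integral of \<open>norm (D (x, t)) powr p\<close> over \<open>x\<close> and
  \<open>q = N powr ((p - 1) / p)\<close>, the claim is that \<open>q\<close> is square integrable. The flux at time \<open>t\<close> attains its
  dual norm \<open>q t\<close> on the profile \<open>norm D / N powr (1 / p)\<close> of norm \<open>1\<close>. If \<open>\<integral> q\<^sup>2 = \<infinity>\<close>, there are disjoint time
  intervals \<open>I j\<close> over which the integral of \<open>q\<^sup>2\<close> exceeds a multiple of \<open>2 ^ j\<close>. On \<open>I j\<close> this profile,
  weighted with a small multiple of \<open>q\<close>, has squared norm below \<open>(1/2) ^ j\<close> but a pairing with the flux
  that is bounded below. The oscillating test functions built from these profiles sum up
  to a test function with a weak integrand that is not integrable.\<close>

lemma gradient_time_integrability: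
  fixes \<Omega> :: "'a::euclidean_space set" and D :: "'a \<times> real \<Rightarrow> 'a" and W \<beta> :: "'a \<times> real \<Rightarrow> real"
  assumes p: "1 < p" and \<Omega>: "bounded \<Omega>" "open \<Omega>"
    and D[measurable]: "D \<in> borel_measurable borel" and D0: "\<And>x t. x \<notin> \<Omega> \<or> t \<notin> {0<..<T} \<Longrightarrow> D (x, t) = 0"
    and Dp: "AE t in lborel. integrable lborel (\<lambda>x. norm (D (x, t)) powr p)"
    and W: "integrable lborel W" and \<beta>[measurable]: "\<beta> \<in> borel_measurable borel"
    and K: "0 \<le> K" "\<And>z. \<bar>\<beta> z\<bar> \<le> K * \<bar>W z\<bar>"
    and test: "\<And>\<phi> D\<phi> \<phi>t. test_function p \<Omega> T \<phi> D\<phi> \<phi>t \<Longrightarrow> zero_on_boundary p \<Omega> T \<phi> D\<phi> \<Longrightarrow>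
       set_integrable lborel (\<Omega> \<times> {0<..<T}) (\<lambda>z. - W z * \<phi>t z + flux p (D z) \<bullet> D\<phi> z + \<beta> z * \<phi> z)"
  shows "(\<integral>\<^sup>+t. ennreal ((LINT x|lborel. norm (D (x, t)) powr p) powr (2 * (p - 1) / p)) \<partial>lborel) < \<infinity>"
proof -
  define A where "A z = flux p (D z)" for z
  have A[measurable]: "A \<in> borel_measurable borel" unfolding A_def[abs_def] by measurable
  have nA: "norm (A z) = norm (D z) powr (p - 1)" for z by (simp add: A_def norm_flux)
  have [measurable]: "W \<in> borel_measurable borel" "\<Omega> \<in> sets borel" using W \<Omega> by auto
  have sets[measurable]: "\<Omega> \<times> {0<..<T} \<in> sets borel" by (intro borel_Times) auto
  \<comment> \<open>Every single smooth function is a test function, as a series with one term.\<close>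
  have one: "integrable lborel (weak_form W A \<beta> g)"
    if g: "test_smooth (\<Omega> \<times> {0<..<T}) g" "\<And>z. 0 \<le> g z" for g
  proof -
    obtain C where C: "0 \<le> C" "\<And>z. \<bar>g z\<bar> \<le> C" "\<And>z v. norm v \<le> 1 \<Longrightarrow> \<bar>frechet_derivative g (at z) v\<bar> \<le> C"
      using test_smooth_bounded[OF g(1)] by blast
    define \<phi> where "\<phi> j = (if j = 0 then g else (\<lambda>z. 0))" for j :: nat
    define I where "I j = (if j = 0 then {0<..<T} else {})" for j :: nat
    have fd0: "frechet_derivative (\<lambda>z::'a \<times> real. 0::real) (at z) v = 0" for z v
      using frechet_derivative_at[OF has_derivative_const[of "0::real"]] by metis
    have N0: "(W1p_norm_at p \<Omega> (\<phi> j) (grad_x (\<phi> j)) t)\<^sup>2 = 0" if "j \<noteq> 0" for j t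
      using that p by (simp add: \<phi>_def grad_x_def fd0 W1p_norm_def set_lebesgue_integral_def)
    obtain \<Phi> D\<Phi> \<Phi>t where \<Phi>: "test_function p \<Omega> T \<Phi> D\<Phi> \<Phi>t" "zero_on_boundary p \<Omega> T \<Phi> D\<Phi>"
      "\<And>j x t. t \<in> I j \<Longrightarrow> \<Phi> (x, t) = \<phi> j (x, t)" "\<And>j x t. t \<in> I j \<Longrightarrow> D\<Phi> (x, t) = grad_x (\<phi> j) (x, t)"
      "\<And>j x t. t \<in> I j \<Longrightarrow> \<Phi>t (x, t) = deriv_t (\<phi> j) (x, t)"
    proof (rule test_function_series[OF p \<Omega>, of I T \<phi> C])
      show "disjoint_family I" by (auto simp: disjoint_family_on_def I_def)
      show "test_smooth (\<Omega> \<times> I j) (\<phi> j)" for j using g(1) test_smooth_zero by (auto simp: \<phi>_def I_def)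
      show "\<phi> j z \<le> C * (1/2) ^ j" for j z using C(1) C(2)[of z] by (auto simp: \<phi>_def)
      show "\<bar>deriv_t (\<phi> j) z\<bar> \<le> C * (1/2) ^ j" for j z
        using C(1) C(3)[of "(0, 1)" z] by (auto simp: \<phi>_def deriv_t_def fd0 norm_Pair)
      show "summable (\<lambda>j. LINT t|lborel. (W1p_norm_at p \<Omega> (\<phi> j) (grad_x (\<phi> j)) t)\<^sup>2)"
        by (rule summable_finite[of "{0}"]) (auto simp: N0)
      show "integrable lborel (\<lambda>t. (W1p_norm_at p \<Omega> (\<phi> j) (grad_x (\<phi> j)) t)\<^sup>2)" for j
      proof (cases "j = 0")
        case True
        then show ?thesis using integrable_mixed_test_smooth[OF p \<Omega> refl g(1)] by (simp add: \<phi>_def)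
      qed (simp add: N0)
    qed (use g(2) in \<open>auto simp: I_def \<phi>_def\<close>)
    have "set_integrable lborel (\<Omega> \<times> {0<..<T}) (\<lambda>z. - W z * \<Phi>t z + A z \<bullet> D\<Phi> z + \<beta> z * \<Phi> z)"
      using test[OF \<Phi>(1,2)] by (simp add: A_def)
    moreover have "indicator (\<Omega> \<times> {0<..<T}) z *\<^sub>R (- W z * \<Phi>t z + A z \<bullet> D\<Phi> z + \<beta> z * \<Phi> z) = weak_form W A \<beta> g z" for z
    proof (cases "z \<in> \<Omega> \<times> {0<..<T}")
      case True
      then have "snd z \<in> I 0" by (auto simp: I_def)
      from \<Phi>(3-5)[OF this, of "fst z"] True show ?thesis by (simp add: weak_form_def \<phi>_def)
    next
      case False
      then show ?thesis
        using test_smooth_outside[OF g(1)] test_smooth_frechet_outside[OF g(1)]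
        by (simp add: weak_form_def grad_x_def deriv_t_def)
    qed
    ultimately show ?thesis unfolding set_integrable_def by (simp cong: Bochner_Integration.integrable_cong)
  qed
  have Ag: "integrable lborel (\<lambda>z. A z \<bullet> grad_x g z)" if g: "test_smooth (\<Omega> \<times> {0<..<T}) g" "\<And>z. 0 \<le> g z" for g
  proof -
    obtain C where C: "0 \<le> C" "\<And>z. \<bar>g z\<bar> \<le> C" "\<And>z v. norm v \<le> 1 \<Longrightarrow> \<bar>frechet_derivative g (at z) v\<bar> \<le> C"
      using test_smooth_bounded[OF g(1)] by blast
    have sm: "smooth g" by (rule test_smooth_smooth[OF g(1)])
    have [measurable]: "g \<in> borel_measurable borel" "deriv_t g \<in> borel_measurable borel"
      using sm by (auto intro!: borel_measurable_continuous_onI smooth_continuous smooth_deriv_t)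
    have dt: "\<bar>deriv_t g z\<bar> \<le> C" for z unfolding deriv_t_def by (rule C(3)) (simp add: norm_Pair)
    have 1: "integrable lborel (\<lambda>z. W z * deriv_t g z)"
    proof (rule Bochner_Integration.integrable_bound)
      show "integrable lborel (\<lambda>z. W z * C)" using W by simp
      show "AE z in lborel. norm (W z * deriv_t g z) \<le> norm (W z * C)"
        using dt C(1) by (auto simp: abs_mult intro!: AE_I2 mult_left_mono)
    qed measurable
    have 2: "integrable lborel (\<lambda>z. \<beta> z * g z)"
    proof (rule Bochner_Integration.integrable_bound)
      show "integrable lborel (\<lambda>z. K * \<bar>W z\<bar> * C)" using W by simp
      show "AE z in lborel. norm (\<beta> z * g z) \<le> norm (K * \<bar>W z\<bar> * C)"
      proof (intro AE_I2)
        fix z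
        have "\<bar>\<beta> z\<bar> * \<bar>g z\<bar> \<le> (K * \<bar>W z\<bar>) * C" using K C by (intro mult_mono) auto
        also have "\<dots> \<le> \<bar>K * \<bar>W z\<bar> * C\<bar>" by (rule abs_ge_self)
        finally show "norm (\<beta> z * g z) \<le> norm (K * \<bar>W z\<bar> * C)" by (simp add: abs_mult)
      qed
    qed measurable
    have "integrable lborel (\<lambda>z. weak_form W A \<beta> g z + W z * deriv_t g z - \<beta> z * g z)"
      using one[OF g] 1 2 by auto
    then show ?thesis by (simp add: weak_form_def)
  qed
  \<comment> \<open>Testing with \<open>osc\<close> for the single value \<open>\<epsilon> = 1\<close> but for each component and both phases shows that the
    flux itself is locally integrable.\<close>
  have Aloc: "integrable lborel (\<lambda>z. norm (A z) * g z)" if g: "test_smooth (\<Omega> \<times> {0<..<T}) g" "\<And>z. 0 \<le> g z" for g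
  proof -
    have sm: "smooth g" by (rule test_smooth_smooth[OF g(1)])
    have [measurable]: "g \<in> borel_measurable borel" using sm by (intro borel_measurable_continuous_onI smooth_continuous)
    have c: "integrable lborel (\<lambda>z. cos ((fst z \<bullet> i) + \<theta>) * (g z * (A z \<bullet> i)))" if i: "i \<in> Basis" for i \<theta>
    proof -
      have ts: "test_smooth (\<Omega> \<times> {0<..<T}) (osc i g \<theta> 1)"
        unfolding osc_def[abs_def] by (rule test_smooth_mult_left[OF smooth_osc_factor g(1)])
      have "0 \<le> osc i g \<theta> 1 z" for z unfolding osc_def using one_plus_sin_bounds g(2) by auto
      then have 1: "integrable lborel (\<lambda>z. A z \<bullet> grad_x (osc i g \<theta> 1) z)" by (rule Ag[OF ts])
      have 2: "integrable lborel (\<lambda>z. (1 + sin ((fst z \<bullet> i) + \<theta>)) * (A z \<bullet> grad_x g z))"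
      proof (rule Bochner_Integration.integrable_bound)
        show "integrable lborel (\<lambda>z. 2 * (A z \<bullet> grad_x g z))" using Ag[OF g] by simp
        have [measurable]: "(\<lambda>z. A z \<bullet> grad_x g z) \<in> borel_measurable borel"
          using borel_measurable_integrable[OF Ag[OF g]] by simp
        show "(\<lambda>z. (1 + sin ((fst z \<bullet> i) + \<theta>)) * (A z \<bullet> grad_x g z)) \<in> borel_measurable lborel" by measurable
        show "AE z in lborel. norm ((1 + sin ((fst z \<bullet> i) + \<theta>)) * (A z \<bullet> grad_x g z)) \<le> norm (2 * (A z \<bullet> grad_x g z))"
          using one_plus_sin_bounds by (auto simp: abs_mult intro!: AE_I2 mult_right_mono)
      qed
      have "integrable lborel (\<lambda>z. A z \<bullet> grad_x (osc i g \<theta> 1) z - (1 + sin ((fst z \<bullet> i) + \<theta>)) * (A z \<bullet> grad_x g z))"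
        using 1 2 by auto
      then show ?thesis using i by (simp add: osc_grad_x[OF sm] inner_add_right mult.assoc)
    qed
    have "integrable lborel (\<lambda>z. (\<Sum>i\<in>Basis. \<bar>cos ((fst z \<bullet> i) + 0) * (g z * (A z \<bullet> i))\<bar> + \<bar>cos ((fst z \<bullet> i) + pi/2) * (g z * (A z \<bullet> i))\<bar>))"
      by (intro Bochner_Integration.integrable_sum Bochner_Integration.integrable_add integrable_abs c)
    then show ?thesis
    proof (rule Bochner_Integration.integrable_bound)
      show "AE z in lborel. norm (norm (A z) * g z) \<le> norm (\<Sum>i\<in>Basis. \<bar>cos ((fst z \<bullet> i) + 0) * (g z * (A z \<bullet> i))\<bar> + \<bar>cos ((fst z \<bullet> i) + pi/2) * (g z * (A z \<bullet> i))\<bar>)"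
      proof (intro AE_I2)
        fix z :: "'a \<times> real"
        have "norm (A z) * g z \<le> (\<Sum>i\<in>Basis. \<bar>A z \<bullet> i\<bar>) * g z" by (intro mult_right_mono norm_le_l1 g)
        also have "\<dots> = (\<Sum>i\<in>Basis. 1 * \<bar>g z * (A z \<bullet> i)\<bar>)" using g(2)[of z] by (simp add: sum_distrib_left abs_mult mult.commute)
        also have "\<dots> \<le> (\<Sum>i\<in>Basis. (\<bar>cos (fst z \<bullet> i)\<bar> + \<bar>sin (fst z \<bullet> i)\<bar>) * \<bar>g z * (A z \<bullet> i)\<bar>)"
          by (intro sum_mono mult_right_mono abs_cos_sin_ge) auto
        also have "\<dots> = (\<Sum>i\<in>Basis. \<bar>cos ((fst z \<bullet> i) + 0) * (g z * (A z \<bullet> i))\<bar> + \<bar>cos ((fst z \<bullet> i) + pi/2) * (g z * (A z \<bullet> i))\<bar>)"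
          by (intro sum.cong refl) (simp add: cos_add abs_mult distrib_right)
        finally show "norm (norm (A z) * g z) \<le> norm (\<Sum>i\<in>Basis. \<bar>cos ((fst z \<bullet> i) + 0) * (g z * (A z \<bullet> i))\<bar> + \<bar>cos ((fst z \<bullet> i) + pi/2) * (g z * (A z \<bullet> i))\<bar>)"
          using g(2)[of z] by (simp add: order_trans[OF _ abs_ge_self])
      qed
    qed measurable
  qed
  define N where "N t = (LINT x|lborel. norm (D (x, t)) powr p)" for t
  have N0: "0 \<le> N t" for t by (simp add: N_def)
  have N[measurable]: "N \<in> borel_measurable borel" unfolding N_def[abs_def] by measurable
  define q where "q t = N t powr ((p - 1) / p)" for t
  have q0: "0 \<le> q t" for t by (simp add: q_def)
  have [measurable]: "q \<in> borel_measurable borel" unfolding q_def[abs_def] by measurable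
  have q2: "N t powr (2 * (p - 1) / p) = q t * q t" for t
    by (simp add: q_def powr_add[symmetric] add_divide_distrib[symmetric])
  have qT: "q t = 0" if "t \<notin> {0<..<T}" for t
    using that D0 p by (simp add: q_def N_def)
  define n where "n = real DIM('a)"
  have n: "0 < n" by (simp add: n_def)
  show ?thesis
  proof (rule ccontr)
    assume "\<not> ?thesis"
    then have "\<not> (\<integral>\<^sup>+t. ennreal (q t * q t) \<partial>lborel) < \<infinity>" by (simp only: N_def[symmetric] q2) simp
    then have "(\<integral>\<^sup>+t. ennreal (q t * q t) \<partial>lborel) = \<infinity>" by (simp add: less_top[symmetric])
    moreover have "(\<integral>\<^sup>+t. ennreal (q t * q t) \<partial>lborel) = (\<integral>\<^sup>+t\<in>{0<..<T}. ennreal (q t * q t) \<partial>lborel)"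
      by (intro nn_integral_cong) (use qT in \<open>auto simp: indicator_def\<close>)
    ultimately have inf: "(\<integral>\<^sup>+t\<in>{0<..<T}. ennreal (q t * q t) \<partial>lborel) = \<infinity>" by simp
    \<comment> \<open>The factor \<open>2 n + 1\<close> compensates for the loss of the factors \<open>n\<close> (choice of a component) and \<open>2\<close>
      (choice of a phase), with a margin for the approximations.\<close>
    define C where "C j = (2 * n + 1)\<^sup>2 * 2 ^ j" for j :: nat
    have mq: "(\<lambda>t. ennreal (q t * q t)) \<in> borel_measurable borel" by measurable
    obtain c d where cd: "disjoint_family (\<lambda>j. {c j<..<d j})" "\<And>j. {c j<..<d j} \<subseteq> {0<..<T}"
      "\<And>j. ennreal (C j) < (\<integral>\<^sup>+t\<in>{c j<..<d j}. ennreal (q t * q t) \<partial>lborel)"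
      using disjoint_intervals_large_mass[OF mq inf, of C] by blast
    define good where "good j \<phi> \<longleftrightarrow> test_smooth (\<Omega> \<times> {c j<..<d j}) \<phi> \<and> (\<forall>z. 0 \<le> \<phi> z \<and> \<phi> z \<le> (1/2) ^ j \<and> \<bar>deriv_t \<phi> z\<bar> \<le> (1/2) ^ j) \<and>
       integrable lborel (\<lambda>t. (W1p_norm_at p \<Omega> \<phi> (grad_x \<phi>) t)\<^sup>2) \<and>
       (LINT t|lborel. (W1p_norm_at p \<Omega> \<phi> (grad_x \<phi>) t)\<^sup>2) < (1/2) ^ j \<and>
       1 < (\<integral>\<^sup>+z. ennreal \<bar>weak_form W A \<beta> \<phi> z\<bar> \<partial>lborel)" for j \<phi>
    have "\<exists>\<phi>. good j \<phi>" for j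
    proof -
      define I where "I = {c j<..<d j}"
      have IT: "I \<subseteq> {0<..<T}" using cd(2) by (simp add: I_def)
      have [measurable]: "I \<in> sets borel" "\<Omega> \<times> I \<in> sets borel" by (auto simp: I_def intro!: borel_Times)
      have bI: "bounded I" by (simp add: I_def)
      have "ennreal (C j) < (\<integral>\<^sup>+t. ennreal (indicator I t * (q t * q t)) \<partial>lborel)"
      proof -
        have "(\<integral>\<^sup>+t\<in>I. ennreal (q t * q t) \<partial>lborel) = (\<integral>\<^sup>+t. ennreal (indicator I t * (q t * q t)) \<partial>lborel)"
          by (intro nn_integral_cong) (auto simp: indicator_def)
        then show ?thesis using cd(3)[of j] by (simp add: I_def)
      qed
      then obtain l :: nat where l: "ennreal (C j) < (\<integral>\<^sup>+t. ennreal (indicator I t * min (q t * q t) (real l)) \<partial>lborel)"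
        using nn_integral_min_exhaust[of "\<lambda>t. q t * q t" "indicator I" "C j"] q0 by auto
      define m where "m = real l"
      have m0: "0 \<le> m" by (simp add: m_def)
      \<comment> \<open>The weight \<open>q\<close>, truncated so that its square is integrable but still has an integral above \<open>C j\<close>.\<close>
      define k where "k t = indicator I t * min (q t) m" for t
      have k[measurable]: "k \<in> borel_measurable borel" unfolding k_def[abs_def] by measurable
      have k0: "0 \<le> k t" "k t \<le> m * indicator I t" "k t \<le> q t" for t using q0[of t] m0 by (auto simp: k_def indicator_def)
      have kk: "integrable lborel (\<lambda>t. k t * k t)"
      proof (rule Bochner_Integration.integrable_bound[where f="\<lambda>t. (m * m) * indicator I t"])
        show "integrable lborel (\<lambda>t. (m * m) * indicator I t)"
          using emeasure_bounded_finite[OF bI] by (intro integrable_mult_right integrable_real_indicator) auto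
        show "AE t in lborel. norm (k t * k t) \<le> norm ((m * m) * indicator I t)"
        proof (intro AE_I2)
          fix t
          show "norm (k t * k t) \<le> norm ((m * m) * indicator I t)"
            using k0[of t] m0 by (cases "t \<in> I") (auto intro!: mult_mono)
        qed
      qed measurable
      define Z where "Z = (LINT t|lborel. k t * k t)"
      have "ennreal (C j) < (\<integral>\<^sup>+t. ennreal (k t * k t) \<partial>lborel)"
      proof (rule less_le_trans[OF l], rule nn_integral_mono, rule ennreal_leI)
        fix t
        have "m \<le> m * m" unfolding m_def by (metis le_square of_nat_le_iff of_nat_mult)
        then have "min (q t * q t) m \<le> min (q t) m * min (q t) m" by (auto simp: min_def)
        then show "indicator I t * min (q t * q t) (real l) \<le> k t * k t"
          by (cases "t \<in> I") (auto simp: k_def m_def)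
      qed
      also have "(\<integral>\<^sup>+t. ennreal (k t * k t) \<partial>lborel) = ennreal Z"
        unfolding Z_def using k0 by (intro nn_integral_eq_integral kk) auto
      finally have Z: "C j < Z" by (simp add: ennreal_less_iff C_def)
      have Zp: "0 < Z" using Z by (rule le_less_trans[rotated]) (simp add: C_def)
      define \<gamma> where "\<gamma> = (2 * n + 1) / Z"
      have \<gamma>: "0 < \<gamma>" using Zp n by (simp add: \<gamma>_def)
      have \<gamma>2: "\<gamma>\<^sup>2 * Z < (1/2) ^ j"
      proof -
        have "\<gamma>\<^sup>2 * Z = (2 * n + 1)\<^sup>2 / Z" using Zp by (simp add: \<gamma>_def power2_eq_square)
        also have "\<dots> < (1/2) ^ j" using Z Zp by (simp add: C_def divide_less_eq power_divide mult.commute field_simps)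
        finally show ?thesis .
      qed
      define k' where "k' z = k (snd z)" for z :: "'a \<times> real"
      define N' where "N' z = N (snd z)" for z :: "'a \<times> real"
      have [measurable]: "k' \<in> borel_measurable borel" "N' \<in> borel_measurable borel"
        unfolding k'_def[abs_def] N'_def[abs_def]
        by (rule measurable_compose[OF borel_measurable_snd k] measurable_compose[OF borel_measurable_snd N])+
      \<comment> \<open>The dual profile with the weight \<open>\<gamma> k\<close>. Its squared norm at time \<open>t\<close> is at most \<open>(\<gamma> k t)\<^sup>2\<close> and its pairing
        with the flux is \<open>\<gamma> (k t) (q t)\<close>, at least \<open>\<gamma> (k t)\<^sup>2\<close>.\<close>
      define F where "F z = \<gamma> * k' z * norm (D z) / N' z powr (1 / p)" for z
      have F_eq: "F z = \<gamma> * k (snd z) * norm (D z) / N (snd z) powr (1 / p)" for z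
        by (simp add: F_def k'_def N'_def)
      have F[measurable]: "F \<in> borel_measurable borel" unfolding F_def[abs_def] by measurable
      have F0: "0 \<le> F z" for z using \<gamma> k0 by (simp add: F_eq)
      have "ennreal (2 * n) < (\<integral>\<^sup>+z. ennreal (norm (A z) * F z) \<partial>lborel)"
      proof -
        have "ennreal (2 * n) < ennreal (\<gamma> * Z)" using Zp n by (simp add: \<gamma>_def ennreal_less_iff)
        also have "\<dots> = (\<integral>\<^sup>+t. ennreal (\<gamma> * (k t * k t)) \<partial>lborel)"
          unfolding Z_def using kk \<gamma> k0 by (subst nn_integral_eq_integral) auto
        also have "\<dots> \<le> (\<integral>\<^sup>+t. \<integral>\<^sup>+x. ennreal (norm (A (x, t)) * F (x, t)) \<partial>lborel \<partial>lborel)"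
        proof (rule nn_integral_mono_AE)
          show "AE t in lborel. ennreal (\<gamma> * (k t * k t)) \<le> (\<integral>\<^sup>+x. ennreal (norm (A (x, t)) * F (x, t)) \<partial>lborel)"
            using Dp
          proof eventually_elim
            case (elim t)
            define s where "s = \<gamma> * k t / N t powr (1 / p)"
            have s0: "0 \<le> s" using \<gamma> k0 by (simp add: s_def)
            have "norm (A (x, t)) * F (x, t) = s * norm (D (x, t)) powr p" for x
            proof (cases "D (x, t) = 0")
              case False
              then have "norm (D (x, t)) powr (p - 1) * norm (D (x, t)) powr 1 = norm (D (x, t)) powr p"
                by (subst powr_add[symmetric]) simp
              then show ?thesis by (simp add: nA F_eq s_def field_simps)
            qed (simp add: nA F_eq)
            then have "(\<integral>\<^sup>+x. ennreal (norm (A (x, t)) * F (x, t)) \<partial>lborel) = ennreal (s * N t)"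
              unfolding N_def using elim s0 by (simp add: nn_integral_eq_integral)
            moreover have "s * N t = \<gamma> * k t * q t"
            proof (cases "N t = 0")
              case True then show ?thesis by (simp add: q_def)
            next
              case False
              then have "N t powr 1 / N t powr (1 / p) = N t powr (1 - 1 / p)" by (subst powr_diff) simp
              moreover have "1 - 1 / p = (p - 1) / p" using p by (simp add: field_simps)
              ultimately have e: "N t / N t powr (1 / p) = q t" using N0[of t] by (simp add: q_def)
              have "s * N t = \<gamma> * k t * (N t / N t powr (1 / p))" by (simp add: s_def)
              then show ?thesis unfolding e .
            qed
            moreover have "\<gamma> * (k t * k t) \<le> \<gamma> * k t * q t"
              using \<gamma> k0[of t] by (simp add: mult_left_mono mult.assoc)
            ultimately show ?case by (simp add: ennreal_leI)
          qed
        qed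
        also have "\<dots> = (\<integral>\<^sup>+z. ennreal (norm (A z) * F z) \<partial>lborel)"
          by (rule nn_integral_slices[symmetric]) measurable
        finally show ?thesis .
      qed
      then obtain M :: nat where M: "ennreal (2 * n) < (\<integral>\<^sup>+z. ennreal (norm (A z) * min (F z) (real M)) \<partial>lborel)"
        using nn_integral_min_exhaust[of F "\<lambda>z. norm (A z)" "2 * n"] F0 by auto
      define G where "G z = min (F z) (real M)" for z
      have G[measurable]: "G \<in> borel_measurable borel" unfolding G_def[abs_def] by measurable
      have G0: "0 \<le> G z" "G z \<le> real M" for z using F0 by (auto simp: G_def)
      have GU: "G z = 0" if "z \<notin> \<Omega> \<times> I" for z
      proof -
        have "F z = 0"
        proof (cases "snd z \<in> I")
          case True
          then have "D z = 0" using D0[of "fst z" "snd z"] that by (cases z) auto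
          then show ?thesis by (simp add: F_eq)
        qed (simp add: F_eq k_def)
        then show "G z = 0" by (simp add: G_def)
      qed
      have "(LINT t|lborel. (LINT x|lborel. G (x, t) powr p) powr (2 / p)) \<le> (LINT t|lborel. \<gamma>\<^sup>2 * (k t * k t))"
      proof (rule integral_mono_AE')
        show "integrable lborel (\<lambda>t. \<gamma>\<^sup>2 * (k t * k t))" using kk by simp
        show "AE t in lborel. (LINT x|lborel. G (x, t) powr p) powr (2 / p) \<le> \<gamma>\<^sup>2 * (k t * k t)"
          using Dp
        proof eventually_elim
          case (elim t)
          define s where "s = \<gamma> * k t / N t powr (1 / p)"
          have s0: "0 \<le> s" using \<gamma> k0 by (simp add: s_def)
          have "(LINT x|lborel. G (x, t) powr p) \<le> (LINT x|lborel. s powr p * norm (D (x, t)) powr p)"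
          proof (rule integral_mono')
            show "integrable lborel (\<lambda>x. s powr p * norm (D (x, t)) powr p)" using elim by simp
            show "G (x, t) powr p \<le> s powr p * norm (D (x, t)) powr p" for x
            proof -
              have "G (x, t) \<le> s * norm (D (x, t))" by (simp add: G_def F_eq s_def)
              then have "G (x, t) powr p \<le> (s * norm (D (x, t))) powr p"
                using p F0 by (intro powr_mono2) (auto simp: G_def)
              then show ?thesis using s0 by (simp add: powr_mult)
            qed
          qed simp
          also have "\<dots> = s powr p * N t" by (simp add: N_def)
          also have "\<dots> \<le> (\<gamma> * k t) powr p"
            using p \<gamma> k0[of t] N0[of t] by (cases "N t = 0") (auto simp: s_def powr_divide powr_powr powr_mult)
          finally have "(LINT x|lborel. G (x, t) powr p) powr (2 / p) \<le> ((\<gamma> * k t) powr p) powr (2 / p)"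
            using p by (intro powr_mono2) auto
          also have "\<dots> = \<gamma>\<^sup>2 * (k t * k t)"
            using p \<gamma> k0[of t] by (simp add: powr_powr powr_numeral power_mult_distrib power2_eq_square mult_ac)
          finally show ?case .
        qed
      qed simp
      also have "\<dots> = \<gamma>\<^sup>2 * Z" by (simp add: Z_def)
      finally have GB: "(LINT t|lborel. (LINT x|lborel. G (x, t) powr p) powr (2 / p)) < (1/2) ^ j" using \<gamma>2 by simp
      have GA: "ennreal (real DIM('a) * 2) < (\<integral>\<^sup>+z. ennreal (norm (A z) * G z) \<partial>lborel)"
        using M by (simp add: G_def n_def mult.commute)
      have AI: "integrable lborel (\<lambda>z. norm (A z) * \<zeta> z)" if "test_smooth (\<Omega> \<times> I) \<zeta>" "\<And>z. 0 \<le> \<zeta> z" for \<zeta>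
        using IT by (intro Aloc test_smooth_mono[OF that(1)] that(2)) auto
      obtain \<phi> where "test_smooth (\<Omega> \<times> I) \<phi>" "\<And>z. 0 \<le> \<phi> z" "\<And>z. \<phi> z \<le> (1/2) ^ j" "\<And>z. \<bar>deriv_t \<phi> z\<bar> \<le> (1/2) ^ j"
        "integrable lborel (\<lambda>t. (W1p_norm_at p \<Omega> \<phi> (grad_x \<phi>) t)\<^sup>2)"
        "(LINT t|lborel. (W1p_norm_at p \<Omega> \<phi> (grad_x \<phi>) t)\<^sup>2) < (1/2) ^ j"
        "ennreal (2 / 2) < (\<integral>\<^sup>+z. ennreal \<bar>weak_form W A \<beta> \<phi> z\<bar> \<partial>lborel)"
        by (rule test_with_large_weak_form[where \<delta>="(1/2) ^ j", OF p \<Omega> I_def A \<beta> W K AI G G0 GU GB _ GA]) (blast | simp)+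
      then show ?thesis by (intro exI[of _ \<phi>]) (auto simp: I_def good_def)
    qed
    then obtain \<phi> where good: "\<And>j. good j (\<phi> j)" by metis
    have \<phi>: "\<And>j. test_smooth (\<Omega> \<times> {c j<..<d j}) (\<phi> j)"
       "\<And>j z. 0 \<le> \<phi> j z \<and> \<phi> j z \<le> (1/2) ^ j \<and> \<bar>deriv_t (\<phi> j) z\<bar> \<le> (1/2) ^ j"
       "\<And>j. integrable lborel (\<lambda>t. (W1p_norm_at p \<Omega> (\<phi> j) (grad_x (\<phi> j)) t)\<^sup>2)"
       "\<And>j. (LINT t|lborel. (W1p_norm_at p \<Omega> (\<phi> j) (grad_x (\<phi> j)) t)\<^sup>2) < (1/2) ^ j"
       "\<And>j. 1 < (\<integral>\<^sup>+z. ennreal \<bar>weak_form W A \<beta> (\<phi> j) z\<bar> \<partial>lborel)"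
      using good unfolding good_def by blast+
    obtain \<Phi> D\<Phi> \<Phi>t where \<Phi>: "test_function p \<Omega> T \<Phi> D\<Phi> \<Phi>t" "zero_on_boundary p \<Omega> T \<Phi> D\<Phi>"
      "\<And>j x t. t \<in> {c j<..<d j} \<Longrightarrow> \<Phi> (x, t) = \<phi> j (x, t)"
      "\<And>j x t. t \<in> {c j<..<d j} \<Longrightarrow> D\<Phi> (x, t) = grad_x (\<phi> j) (x, t)"
      "\<And>j x t. t \<in> {c j<..<d j} \<Longrightarrow> \<Phi>t (x, t) = deriv_t (\<phi> j) (x, t)"
    proof (rule test_function_series[OF p \<Omega> cd(1,2) \<phi>(1), of 1])
      show "summable (\<lambda>j. LINT t|lborel. (W1p_norm_at p \<Omega> (\<phi> j) (grad_x (\<phi> j)) t)\<^sup>2)"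
      proof (rule summable_comparison_test')
        show "summable (\<lambda>j. (1/2::real) ^ j)" by (rule summable_geometric) simp
        show "norm (LINT t|lborel. (W1p_norm_at p \<Omega> (\<phi> j) (grad_x (\<phi> j)) t)\<^sup>2) \<le> (1/2) ^ j" for j
          using \<phi>(4)[of j] by (simp add: abs_of_nonneg Bochner_Integration.integral_nonneg less_imp_le)
      qed
    qed (use \<phi>(2,3) in auto)
    define E where "E z = indicator (\<Omega> \<times> {0<..<T}) z *\<^sub>R (- W z * \<Phi>t z + A z \<bullet> D\<Phi> z + \<beta> z * \<Phi> z)" for z
    have iE: "integrable lborel E"
      using test[OF \<Phi>(1,2)] by (simp add: A_def E_def[abs_def] set_integrable_def)
    have [measurable]: "weak_form W A \<beta> (\<phi> j) \<in> borel_measurable borel" for j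
    proof -
      have so: "smooth (\<phi> j)" by (rule test_smooth_smooth[OF \<phi>(1)])
      have [measurable]: "\<phi> j \<in> borel_measurable borel" "grad_x (\<phi> j) \<in> borel_measurable borel"
         "deriv_t (\<phi> j) \<in> borel_measurable borel"
        using so by (auto intro!: borel_measurable_continuous_onI continuous_grad_x smooth_continuous smooth_deriv_t)
      show ?thesis unfolding weak_form_def[abs_def] by measurable
    qed
    have wf0: "weak_form W A \<beta> (\<phi> j) z = 0" if "z \<notin> \<Omega> \<times> {c j<..<d j}" for j z
      using that test_smooth_outside[OF \<phi>(1)] test_smooth_frechet_outside[OF \<phi>(1)]
      by (simp add: weak_form_def grad_x_def deriv_t_def)
    have "(\<Sum>j. ennreal \<bar>weak_form W A \<beta> (\<phi> j) z\<bar>) \<le> ennreal (norm (E z))" for z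
    proof (cases "\<exists>j. z \<in> \<Omega> \<times> {c j<..<d j}")
      case True
      then obtain j where j: "z \<in> \<Omega> \<times> {c j<..<d j}" by blast
      have "weak_form W A \<beta> (\<phi> i) z = 0" if "i \<noteq> j" for i
        using wf0[of z i] cd(1) that j unfolding disjoint_family_on_def by blast
      then have "(\<Sum>j. ennreal \<bar>weak_form W A \<beta> (\<phi> j) z\<bar>) = ennreal \<bar>weak_form W A \<beta> (\<phi> j) z\<bar>"
        by (subst suminf_finite[of "{j}"]) auto
      moreover have "E z = weak_form W A \<beta> (\<phi> j) z"
        using j cd(2)[of j] \<Phi>(3-5)[of "snd z" j "fst z"] by (auto simp: E_def weak_form_def indicator_def)
      ultimately show ?thesis by simp
    next
      case False
      then show ?thesis using wf0 by simp
    qed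
    then have "(\<integral>\<^sup>+z. (\<Sum>j. ennreal \<bar>weak_form W A \<beta> (\<phi> j) z\<bar>) \<partial>lborel) \<le> (\<integral>\<^sup>+z. ennreal (norm (E z)) \<partial>lborel)"
      by (intro nn_integral_mono)
    also have "\<dots> < \<infinity>" using iE by (simp add: integrable_iff_bounded)
    also have "(\<integral>\<^sup>+z. (\<Sum>j. ennreal \<bar>weak_form W A \<beta> (\<phi> j) z\<bar>) \<partial>lborel) = (\<Sum>j. \<integral>\<^sup>+z. ennreal \<bar>weak_form W A \<beta> (\<phi> j) z\<bar> \<partial>lborel)"
      by (rule nn_integral_suminf) measurable
    finally have fin: "(\<Sum>j. \<integral>\<^sup>+z. ennreal \<bar>weak_form W A \<beta> (\<phi> j) z\<bar> \<partial>lborel) < \<infinity>" .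
    \<comment> \<open>Each hump contributes at least \<open>1\<close> to an integral that is finite.\<close>
    have "(\<Sum>j::nat. 1::ennreal) \<le> (\<Sum>j. \<integral>\<^sup>+z. ennreal \<bar>weak_form W A \<beta> (\<phi> j) z\<bar> \<partial>lborel)"
      by (intro suminf_le) (use \<phi>(5) in \<open>auto intro: less_imp_le\<close>)
    moreover have "(\<Sum>j::nat. 1::ennreal) = \<infinity>"
    proof -
      have le: "ennreal (real m) \<le> (\<Sum>j::nat. 1::ennreal)" for m
        using sum_le_suminf[of "\<lambda>_. 1::ennreal" "{..<m}"] by (simp add: ennreal_of_nat_eq_real_of_nat)
      show ?thesis
      proof (rule ccontr)
        assume "(\<Sum>j::nat. 1::ennreal) \<noteq> \<infinity>"
        then obtain r where r: "0 \<le> r" "(\<Sum>j::nat. 1::ennreal) = ennreal r"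
          by (cases "\<Sum>j::nat. 1::ennreal") auto
        obtain m :: nat where "r < real m" using reals_Archimedean2 by blast
        then show False using le[of m] r by (simp add: ennreal_le_iff)
      qed
    qed
    ultimately show False using fin by (simp add: top_unique)
  qed
qed

section \<open>Consequences of the weak inequality\<close>

text \<open>The local weak inequality is posed on connected open sets. Finitely many balls cover the compact
  set; paths from the centres to a common point connect them.\<close>

lemma connected_neighbourhood_of_compact:
  fixes \<Omega> K :: "'a::euclidean_space set"
  assumes \<Omega>: "open \<Omega>" "connected \<Omega>" and K: "compact K" "K \<subseteq> \<Omega>"
  obtains V where "open V" "connected V" "compact (closure V)" "closure V \<subseteq> \<Omega>" "K \<subseteq> V"
proof (cases "K = {}")
  case True
  then show ?thesis using that[of "{}"] by auto
next
  case False
  have "\<exists>r>0. cball x r \<subseteq> \<Omega>" if "x \<in> K" for x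
    using that K(2) \<Omega>(1) open_contains_cball by blast
  then obtain r where r: "\<And>x. x \<in> K \<Longrightarrow> 0 < r x \<and> cball x (r x) \<subseteq> \<Omega>" by metis
  obtain C where C: "C \<subseteq> K" "finite C" "K \<subseteq> (\<Union>x\<in>C. ball x (r x))"
    by (rule compactE_image[OF K(1), of K "\<lambda>x. ball x (r x)"]) (use r in auto)
  obtain c0 where c0: "c0 \<in> C" using C(3) False by auto
  have pc: "path_connected \<Omega>" using \<Omega> connected_open_path_connected by blast
  have "\<exists>g. path g \<and> path_image g \<subseteq> \<Omega> \<and> pathstart g = c0 \<and> pathfinish g = c" if "c \<in> C" for c
    using pc that C(1) K(2) c0 unfolding path_connected_def by blast
  then obtain g where g: "\<And>c. c \<in> C \<Longrightarrow> path (g c) \<and> path_image (g c) \<subseteq> \<Omega> \<and> pathstart (g c) = c0 \<and> pathfinish (g c) = c"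
    by metis
  define piece where "piece c = path_image (g c) \<union> cball c (r c)" for c
  define L where "L = (\<Union>c\<in>C. piece c)"
  have c0p: "c0 \<in> piece c" if "c \<in> C" for c
    using g[OF that] unfolding piece_def by (metis UnI1 pathstart_in_path_image)
  have conp: "connected (piece c)" if c: "c \<in> C" for c
    unfolding piece_def
  proof (rule connected_Un)
    have "c \<in> path_image (g c)" using g[OF c] by (metis pathfinish_in_path_image)
    moreover have "c \<in> cball c (r c)" using r[of c] c C(1) by auto
    ultimately show "path_image (g c) \<inter> cball c (r c) \<noteq> {}" by blast
  qed (use g[OF c] in \<open>auto intro: connected_path_image convex_connected\<close>)
  have "c0 \<in> \<Inter>(piece ` C)" using c0p by blast
  then have conL: "connected L" unfolding L_def using conp by (intro connected_Union) auto
  have "compact L" unfolding L_def piece_def using C(2) g by (intro compact_UN) (auto intro!: compact_Un compact_path_image)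
  have LO: "L \<subseteq> \<Omega>" using g r C(1) by (auto simp: L_def piece_def)
  have KL: "K \<subseteq> L" using C(3) by (force simp: L_def piece_def)
  obtain e where e: "e > 0" "(\<Union>x\<in>L. ball x e) \<subseteq> \<Omega>"
    using compact_subset_open_imp_ball_epsilon_subset[OF \<open>compact L\<close> \<Omega>(1) LO] by blast
  define V where "V = (\<Union>x\<in>L. L \<union> ball x (e/2))"
  have Vb: "V = (\<Union>x\<in>L. ball x (e/2))" using e(1) by (auto simp: V_def)
  have Lne: "L \<noteq> {}" using KL False by auto
  have "connected (L \<union> ball x (e/2))" if "x \<in> L" for x
    using that e(1) by (intro connected_Un conL) auto
  moreover have "L \<subseteq> \<Inter>((\<lambda>x. L \<union> ball x (e/2)) ` L)" by blast
  ultimately have "connected V" unfolding V_def using Lne by (intro connected_Union) auto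
  moreover have "open V" unfolding Vb by auto
  moreover have M: "compact {x + y |x y. x \<in> L \<and> y \<in> cball 0 (e/2)}"
    by (rule compact_sums[OF \<open>compact L\<close> compact_cball])
  have MV: "V \<subseteq> {x + y |x y. x \<in> L \<and> y \<in> cball 0 (e/2)}"
  proof
    fix z assume "z \<in> V"
    then obtain x where "x \<in> L" "dist x z < e/2" by (auto simp: Vb)
    then show "z \<in> {x + y |x y. x \<in> L \<and> y \<in> cball 0 (e/2)}"
      by (intro CollectI exI[of _ x] exI[of _ "z - x"]) (auto simp: dist_norm norm_minus_commute)
  qed
  have cV: "closure V \<subseteq> {x + y |x y. x \<in> L \<and> y \<in> cball 0 (e/2)}"
    using MV M by (intro closure_minimal compact_imp_closed) auto
  have "{x + y |x y. x \<in> L \<and> y \<in> cball 0 (e/2)} \<subseteq> \<Omega>"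
  proof
    fix z assume "z \<in> {x + y |x y. x \<in> L \<and> y \<in> cball 0 (e/2)}"
    then obtain x y where "x \<in> L" "norm y \<le> e/2" "z = x + y" by auto
    then have "z \<in> ball x e" using e(1) by (auto simp: dist_norm)
    then show "z \<in> \<Omega>" using e(2) \<open>x \<in> L\<close> by blast
  qed
  then have "closure V \<subseteq> \<Omega>" using cV by blast
  moreover have "compact (closure V)"
    using bounded_subset[OF compact_imp_bounded[OF M] MV] by (simp add: compact_closure)
  moreover have "K \<subseteq> V" using KL e(1) by (force simp: Vb)
  ultimately show ?thesis using that by blast
qed

text \<open>Stationary test functions. They are only once continuously differentiable because \<open>trunc\<close>, which will
  be composed with smooth functions, is no smoother than that.\<close>

definition C1_test :: "'a::euclidean_space set \<Rightarrow> ('a \<Rightarrow> real) \<Rightarrow> ('a \<Rightarrow> 'a) \<Rightarrow> bool" where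
  "C1_test \<Omega> \<psi> D\<psi> \<longleftrightarrow> (\<forall>x. 0 \<le> \<psi> x) \<and> (\<forall>x. (\<psi> has_derivative (\<lambda>v. D\<psi> x \<bullet> v)) (at x)) \<and> continuous_on UNIV D\<psi> \<and>
     (\<exists>K. compact K \<and> K \<subseteq> \<Omega> \<and> (\<forall>x. x \<notin> K \<longrightarrow> \<psi> x = 0))"

lemma C1_test_continuous: "C1_test \<Omega> \<psi> D\<psi> \<Longrightarrow> continuous_on UNIV \<psi>"
  unfolding C1_test_def by (meson continuous_at_imp_continuous_on has_derivative_continuous)

lemma C1_test_support:
  assumes "C1_test \<Omega> \<psi> D\<psi>"
  obtains K where "compact K" "K \<subseteq> \<Omega>" "\<And>x. x \<notin> K \<Longrightarrow> \<psi> x = 0" "\<And>x. x \<notin> K \<Longrightarrow> D\<psi> x = 0"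
proof -
  obtain K where K: "compact K" "K \<subseteq> \<Omega>" "\<And>x. x \<notin> K \<Longrightarrow> \<psi> x = 0"
    using assms unfolding C1_test_def by blast
  have "D\<psi> x = 0" if "x \<notin> K" for x
  proof -
    have "(\<psi> has_derivative (\<lambda>v. D\<psi> x \<bullet> v)) (at x)" using assms by (simp add: C1_test_def)
    then have "frechet_derivative \<psi> (at x) = (\<lambda>v. D\<psi> x \<bullet> v)" using frechet_derivative_at by metis
    moreover have "frechet_derivative \<psi> (at x) (D\<psi> x) = 0"
      by (rule frechet_derivative_zero_outside[OF compact_imp_closed[OF K(1)] K(3) that])
    ultimately show ?thesis by simp
  qed
  then show ?thesis using that K by blast
qed

lemma C1_test_bounded:
  assumes "C1_test \<Omega> \<psi> D\<psi>"
  obtains B where "0 \<le> B" "\<And>x. \<bar>\<psi> x\<bar> \<le> B" "\<And>x. norm (D\<psi> x) \<le> B"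
proof -
  obtain K where K: "compact K" "K \<subseteq> \<Omega>" "\<And>x. x \<notin> K \<Longrightarrow> \<psi> x = 0" "\<And>x. x \<notin> K \<Longrightarrow> D\<psi> x = 0"
    using C1_test_support[OF assms] by blast
  have "continuous_on UNIV D\<psi>" using assms by (simp add: C1_test_def)
  then have "bounded (\<psi> ` K)" "bounded (D\<psi> ` K)"
    using continuous_on_subset[OF C1_test_continuous[OF assms], of K] continuous_on_subset[of UNIV D\<psi> K] K(1)
    by (auto intro!: compact_imp_bounded compact_continuous_image)
  then obtain B1 B2 where B: "\<And>x. x \<in> K \<Longrightarrow> \<bar>\<psi> x\<bar> \<le> B1" "\<And>x. x \<in> K \<Longrightarrow> norm (D\<psi> x) \<le> B2"
    unfolding bounded_iff by (metis image_eqI real_norm_def)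
  show ?thesis
  proof (rule that[of "\<bar>B1\<bar> + \<bar>B2\<bar>"])
    show "\<bar>\<psi> x\<bar> \<le> \<bar>B1\<bar> + \<bar>B2\<bar>" "norm (D\<psi> x) \<le> \<bar>B1\<bar> + \<bar>B2\<bar>" for x
      using B[of x] K(3,4)[of x] by (cases "x \<in> K"; auto)+
  qed simp
qed

text \<open>Stationary functions need not vanish at the initial and the final time, so that they are test
  functions of the local weak inequality only.\<close>

lemma stationary_test_function:
  fixes \<Omega> :: "'a::euclidean_space set"
  assumes p: "1 < p" and \<Omega>: "bounded \<Omega>" "open \<Omega>" and \<psi>: "C1_test \<Omega> \<psi> D\<psi>"
  shows "test_function p \<Omega> T (\<lambda>z. \<psi> (fst z)) (\<lambda>z. D\<psi> (fst z)) (\<lambda>z. 0)"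
proof -
  have c: "continuous_on UNIV \<psi>" "continuous_on UNIV D\<psi>"
    using C1_test_continuous[OF \<psi>] \<psi> by (auto simp: C1_test_def)
  obtain K where K: "compact K" "K \<subseteq> \<Omega>" "\<And>x. x \<notin> K \<Longrightarrow> \<psi> x = 0" "\<And>x. x \<notin> K \<Longrightarrow> D\<psi> x = 0"
    using C1_test_support[OF \<psi>] by blast
  obtain B where B: "0 \<le> B" "\<And>x. \<bar>\<psi> x\<bar> \<le> B" "\<And>x. norm (D\<psi> x) \<le> B"
    using C1_test_bounded[OF \<psi>] by blast
  have cz: "continuous_on UNIV (\<lambda>z::'a \<times> real. \<psi> (fst z))" "continuous_on UNIV (\<lambda>z::'a \<times> real. D\<psi> (fst z))"
    by (auto intro!: continuous_on_compose2[OF c(1)] continuous_on_compose2[OF c(2)] continuous_intros)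
  have O: "\<Omega> \<times> {0..T} \<in> sets borel" "\<Omega> \<times> {0<..<T} \<in> sets borel" "\<Omega> \<in> sets borel"
    using \<Omega> by (auto intro!: borel_Times)
  have [measurable]: "\<psi> \<in> borel_measurable borel" using c by (intro borel_measurable_continuous_onI)
  have W: "W1p p \<Omega> \<psi> D\<psi>"
    by (rule W1p_C1[OF \<Omega> _ _ c(2) K(1,3)]) (use p \<psi> in \<open>auto simp: C1_test_def\<close>)
  show ?thesis
    unfolding test_function_def L2_W1p_def
  proof (intro conjI ballI)
    show "set_borel_measurable lborel (\<Omega> \<times> {0..T}) (\<lambda>z. \<psi> (fst z))"
      "set_borel_measurable lborel (\<Omega> \<times> {0<..<T}) (\<lambda>z. D\<psi> (fst z))"
      using cz by (auto intro!: set_borel_measurable_borel O borel_measurable_continuous_onI)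
    show "AE t in lborel. t \<in> {0<..<T} \<longrightarrow> W1p p \<Omega> (\<lambda>x. \<psi> (fst (x, t))) (\<lambda>x. D\<psi> (fst (x, t)))"
      using W by simp
    show "set_integrable lborel {0<..<T} (\<lambda>t. (W1p_norm p \<Omega> (\<lambda>x. \<psi> (fst (x, t))) (\<lambda>x. D\<psi> (fst (x, t))))\<^sup>2)"
      by (rule set_integrable_bounded[where B="(W1p_norm p \<Omega> \<psi> D\<psi>)\<^sup>2"]) auto
    show "weak_deriv (\<Omega> \<times> {0<..<T}) (0, 1) (\<lambda>z. \<psi> (fst z)) (\<lambda>z. 0)"
      by (rule weak_deriv_classical[OF cz(1)]) auto
    show "Lp_on 2 (\<Omega> \<times> {0<..<T}) (\<lambda>z. 0::real)"
      unfolding Lp_on_def by (auto simp: set_integrable_def set_borel_measurable_def)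
    show "0 \<le> \<psi> (fst (x, t))" for x t using \<psi> by (simp add: C1_test_def)
    show "set_integrable lborel \<Omega> (\<lambda>x. \<psi> (fst (x, t)))" for t
      by (rule set_integrable_bounded[OF \<Omega>(1) O(3), where B=B]) (use B in auto)
    show "((\<lambda>t. LINT x:\<Omega>|lborel. \<bar>\<psi> (fst (x, t)) - \<psi> (fst (x, s))\<bar>) \<longlongrightarrow> 0) (at s within {0..T})" for s
      by (simp add: set_lebesgue_integral_def)
  qed
qed

lemma W1p_cong:
  assumes "\<And>x. x \<in> \<Omega> \<Longrightarrow> u x = u' x" "\<And>x. x \<in> \<Omega> \<Longrightarrow> Du x = Du' x"
  shows "W1p p \<Omega> u Du \<longleftrightarrow> W1p p \<Omega> u' Du'"
proof -
  have 1: "indicator \<Omega> x *\<^sub>R f x = indicator \<Omega> x *\<^sub>R g x" if "\<And>x. x \<in> \<Omega> \<Longrightarrow> f x = g x"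
    for f g :: "'a \<Rightarrow> 'b::real_vector" and x using that by (cases "x \<in> \<Omega>") auto
  have 2: "set_integrable lborel C f \<longleftrightarrow> set_integrable lborel C g" if "C \<subseteq> \<Omega>" "\<And>x. x \<in> \<Omega> \<Longrightarrow> f x = g x"
    for f g :: "'a \<Rightarrow> real" and C using that by (intro set_integrable_cong) auto
  have 3: "(LINT x:\<Omega>|lborel. f x) = (LINT x:\<Omega>|lborel. g x)" if "\<And>x. x \<in> \<Omega> \<Longrightarrow> f x = g x" for f g :: "'a \<Rightarrow> real"
    unfolding set_lebesgue_integral_def by (intro Bochner_Integration.integral_cong refl 1 that)
  have "(\<lambda>x. indicator \<Omega> x *\<^sub>R u x) = (\<lambda>x. indicator \<Omega> x *\<^sub>R u' x)"
    "(\<lambda>x. indicator \<Omega> x *\<^sub>R Du x) = (\<lambda>x. indicator \<Omega> x *\<^sub>R Du' x)"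
    using assms by (intro ext 1; simp)+
  moreover have "set_integrable lborel \<Omega> (\<lambda>x. norm (u x) powr p) = set_integrable lborel \<Omega> (\<lambda>x. norm (u' x) powr p)"
    "set_integrable lborel \<Omega> (\<lambda>x. norm (Du x) powr p) = set_integrable lborel \<Omega> (\<lambda>x. norm (Du' x) powr p)"
    using assms by (auto intro!: 2)
  ultimately have ab: "Lp_on p \<Omega> u \<longleftrightarrow> Lp_on p \<Omega> u'" "Lp_on p \<Omega> Du \<longleftrightarrow> Lp_on p \<Omega> Du'"
    unfolding Lp_on_def set_borel_measurable_def by (simp_all only:)
  have c: "weak_deriv \<Omega> i u (\<lambda>x. Du x \<bullet> i) \<longleftrightarrow> weak_deriv \<Omega> i u' (\<lambda>x. Du' x \<bullet> i)" for i
  proof -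
    have A: "set_integrable lborel C u \<longleftrightarrow> set_integrable lborel C u'"
      "set_integrable lborel C (\<lambda>x. Du x \<bullet> i) \<longleftrightarrow> set_integrable lborel C (\<lambda>x. Du' x \<bullet> i)" if "C \<subseteq> \<Omega>" for C
      using assms that by (intro 2; simp)+
    have B: "(LINT x:\<Omega>|lborel. u x * frechet_derivative \<zeta> (at x) i) = (LINT x:\<Omega>|lborel. u' x * frechet_derivative \<zeta> (at x) i)"
      "(LINT x:\<Omega>|lborel. Du x \<bullet> i * \<zeta> x) = (LINT x:\<Omega>|lborel. Du' x \<bullet> i * \<zeta> x)" for \<zeta>
      using assms by (intro 3; simp)+
    show ?thesis unfolding weak_deriv_def B using A by blast
  qed
  show ?thesis unfolding W1p_def using ab c by auto
qed

text \<open>What the comparison argument uses of a weak sub- or super-solution \<open>W\<close> with weak gradient \<open>D\<close> and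
  zeroth-order term \<open>\<beta>\<close>, all extended by zero. The two bounds on the gradient norm in time have
  exponents \<open>2\<close> and \<open>2 (p - 1)\<close>; the second one comes from
  \<open>gradient_time_integrability\<close>.\<close>

definition solution_data :: "(real \<Rightarrow> real \<Rightarrow> bool) \<Rightarrow> real \<Rightarrow> 'a::euclidean_space set \<Rightarrow> real \<Rightarrow> real \<Rightarrow>
    ('a \<times> real \<Rightarrow> real) \<Rightarrow> ('a \<times> real \<Rightarrow> 'a) \<Rightarrow> ('a \<times> real \<Rightarrow> real) \<Rightarrow> bool" where
  "solution_data R p \<Omega> T K W D \<beta> \<longleftrightarrow>
    (W \<in> borel_measurable borel \<and> D \<in> borel_measurable borel \<and> \<beta> \<in> borel_measurable borel) \<and>
    (\<forall>x t. x \<notin> \<Omega> \<or> t \<notin> {0..T} \<longrightarrow> W (x, t) = 0) \<and>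
    (\<forall>x t. x \<notin> \<Omega> \<or> t \<notin> {0<..<T} \<longrightarrow> D (x, t) = 0 \<and> \<beta> (x, t) = 0) \<and>
    (\<forall>z. \<bar>\<beta> z\<bar> \<le> K * \<bar>W z\<bar>) \<and>
    integrable lborel W \<and>
    (AE t in lborel. t \<in> {0<..<T} \<longrightarrow> W1p p \<Omega> (\<lambda>x. W (x, t)) (\<lambda>x. D (x, t))) \<and>
    (AE t in lborel. integrable lborel (\<lambda>x. norm (D (x, t)) powr p)) \<and>
    (\<integral>\<^sup>+t. ennreal ((LINT x|lborel. norm (D (x, t)) powr p) powr (2 / p)) \<partial>lborel) < \<infinity> \<and>
    (\<integral>\<^sup>+t. ennreal ((LINT x|lborel. norm (D (x, t)) powr p) powr (2 * (p - 1) / p)) \<partial>lborel) < \<infinity> \<and>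
    (\<forall>\<psi> D\<psi> s t. C1_test \<Omega> \<psi> D\<psi> \<longrightarrow> 0 \<le> s \<longrightarrow> s < t \<longrightarrow> t \<le> T \<longrightarrow>
       integrable lborel (\<lambda>x. W (x, s) * \<psi> x) \<and> integrable lborel (\<lambda>x. W (x, t) * \<psi> x) \<and>
       integrable lborel (\<lambda>z. indicator {s<..<t} (snd z) * (flux p (D z) \<bullet> D\<psi> (fst z) + \<beta> z * \<psi> (fst z))) \<and>
       R ((LINT x|lborel. W (x, t) * \<psi> x) - (LINT x|lborel. W (x, s) * \<psi> x)
         + (LINT z|lborel. indicator {s<..<t} (snd z) * (flux p (D z) \<bullet> D\<psi> (fst z) + \<beta> z * \<psi> (fst z)))) 0)"

text \<open>All functions are extended by zero to Borel functions on the whole space-time. The test functions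
  of the global weak inequality yield the integrability of the gradient in time, those of the local
  one the inequality for stationary test functions.\<close>

lemma solution_data_of_weak_ineq:
  fixes \<Omega> :: "'a::euclidean_space set" and \<alpha> :: "'a \<Rightarrow> real \<Rightarrow> real" and w :: "'a \<times> real \<Rightarrow> real"
  assumes p: "1 < p" and \<Omega>: "bounded \<Omega>" "open \<Omega>" "connected \<Omega>"
    and \<alpha>: "continuous_on (\<Omega> \<times> UNIV) (\<lambda>(x, r). \<alpha> x r)"
    and K: "0 \<le> K" "\<And>x r. x \<in> \<Omega> \<Longrightarrow> \<bar>\<alpha> x r\<bar> \<le> K * \<bar>r\<bar>"
    and T: "0 < T" and w: "weak_ineq R p \<alpha> \<Omega> T w"
  obtains W D \<beta> where "solution_data R p \<Omega> T K W D \<beta>"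
    "\<And>x t. x \<in> \<Omega> \<Longrightarrow> t \<in> {0..T} \<Longrightarrow> W (x, t) = w (x, t)"
    "\<And>x t. x \<in> \<Omega> \<Longrightarrow> t \<in> {0<..<T} \<Longrightarrow> \<beta> (x, t) = \<alpha> x (W (x, t))"
proof -
  obtain Dw where L2: "L2_W1p p \<Omega> T w Dw" and loc': "\<forall>V t\<^sub>1 t\<^sub>2 \<phi> D\<phi> \<phi>t.
          open V \<and> connected V \<and> compact (closure V) \<and> closure V \<subseteq> \<Omega> \<and>
          0 \<le> t\<^sub>1 \<and> t\<^sub>1 < t\<^sub>2 \<and> t\<^sub>2 \<le> T \<and>
          test_function p \<Omega> T \<phi> D\<phi> \<phi>t \<and> (\<forall>x\<in>\<Omega> - V. \<forall>t\<in>{0..T}. \<phi> (x, t) = 0) \<longrightarrow>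
          set_integrable lborel V (\<lambda>x. w (x, t\<^sub>1) * \<phi> (x, t\<^sub>1)) \<and>
          set_integrable lborel V (\<lambda>x. w (x, t\<^sub>2) * \<phi> (x, t\<^sub>2)) \<and>
          set_integrable lborel (V \<times> {t\<^sub>1<..<t\<^sub>2}) (weak_integrand p \<alpha> w Dw \<phi> D\<phi> \<phi>t) \<and>
          R ((LINT x:V|lborel. w (x, t\<^sub>2) * \<phi> (x, t\<^sub>2)) - (LINT x:V|lborel. w (x, t\<^sub>1) * \<phi> (x, t\<^sub>1))
             + (LINT z:V \<times> {t\<^sub>1<..<t\<^sub>2}|lborel. weak_integrand p \<alpha> w Dw \<phi> D\<phi> \<phi>t z)) 0"
    and glob': "\<forall>\<phi> D\<phi> \<phi>t.
          test_function p \<Omega> T \<phi> D\<phi> \<phi>t \<and> zero_on_boundary p \<Omega> T \<phi> D\<phi> \<longrightarrow>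
          set_integrable lborel (\<Omega> \<times> {0<..<T}) (weak_integrand p \<alpha> w Dw \<phi> D\<phi> \<phi>t) \<and>
          R (LINT z:\<Omega> \<times> {0<..<T}|lborel. weak_integrand p \<alpha> w Dw \<phi> D\<phi> \<phi>t z) 0"
    using w unfolding weak_ineq_def by (elim exE conjE) (rule that)
  note loc = loc'[rule_format]
  have glob: "set_integrable lborel (\<Omega> \<times> {0<..<T}) (weak_integrand p \<alpha> w Dw \<phi> D\<phi> \<phi>t)"
    if "test_function p \<Omega> T \<phi> D\<phi> \<phi>t" "zero_on_boundary p \<Omega> T \<phi> D\<phi>" for \<phi> D\<phi> \<phi>t
    using glob'[rule_format, OF conjI[OF that]] by (rule conjunct1)
  have [measurable]: "\<Omega> \<in> sets borel" using \<Omega> by auto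
  define W where "W z = indicator (\<Omega> \<times> {0..T}) z * w z" for z
  define D where "D z = indicator (\<Omega> \<times> {0<..<T}) z *\<^sub>R Dw z" for z
  define \<beta> where "\<beta> z = indicator (\<Omega> \<times> {0<..<T}) z * \<alpha> (fst z) (W z)" for z
  have U[measurable]: "\<Omega> \<times> {0<..<T} \<in> sets borel" by (intro borel_Times) auto
  have W[measurable]: "W \<in> borel_measurable borel"
    using L2 by (simp add: W_def[abs_def] L2_W1p_def set_borel_measurable_def)
  have D[measurable]: "D \<in> borel_measurable borel"
    using L2 by (simp add: D_def[abs_def] L2_W1p_def set_borel_measurable_def)
  have \<beta>: "\<beta> \<in> borel_measurable borel"
  proof -
    have "\<Omega> \<times> (UNIV :: real set) \<in> sets borel" by (intro borel_Times) auto
    then have "(\<lambda>y. indicator (\<Omega> \<times> UNIV) y *\<^sub>R (case y of (x, r) \<Rightarrow> \<alpha> x r)) \<in> borel_measurable borel"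
      by (rule borel_measurable_continuous_on_indicator[OF _ \<alpha>])
    moreover have "(\<lambda>z. (fst z, W z)) \<in> borel_measurable borel"
      by (intro borel_measurable_Pair borel_measurable_fst W)
    ultimately have "(\<lambda>z. indicator (\<Omega> \<times> UNIV) (fst z, W z) *\<^sub>R (case (fst z, W z) of (x, r) \<Rightarrow> \<alpha> x r)) \<in> borel_measurable borel"
      by (rule measurable_compose[rotated])
    then have "(\<lambda>z. indicator (\<Omega> \<times> {0<..<T}) z * (indicator (\<Omega> \<times> UNIV) (fst z, W z) *\<^sub>R (case (fst z, W z) of (x, r) \<Rightarrow> \<alpha> x r))) \<in> borel_measurable borel"
      by (intro borel_measurable_times borel_measurable_indicator U)
    also have "(\<lambda>z. indicator (\<Omega> \<times> {0<..<T}) z * (indicator (\<Omega> \<times> UNIV) (fst z, W z) *\<^sub>R (case (fst z, W z) of (x, r) \<Rightarrow> \<alpha> x r))) = \<beta>"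
      by (auto simp: \<beta>_def indicator_def fun_eq_iff)
    finally show ?thesis .
  qed
  have Ww: "W (x, t) = w (x, t)" if "x \<in> \<Omega>" "t \<in> {0..T}" for x t using that by (simp add: W_def)
  have W0: "W (x, t) = 0" if "x \<notin> \<Omega> \<or> t \<notin> {0..T}" for x t using that by (auto simp: W_def)
  have D0: "D (x, t) = 0" if "x \<notin> \<Omega> \<or> t \<notin> {0<..<T}" for x t using that by (auto simp: D_def)
  have Dw: "D (x, t) = Dw (x, t)" if "x \<in> \<Omega>" "t \<in> {0<..<T}" for x t using that by (simp add: D_def)
  have \<beta>1: "\<beta> (x, t) = \<alpha> x (W (x, t))" if "x \<in> \<Omega>" "t \<in> {0<..<T}" for x t using that by (simp add: \<beta>_def)
  have \<beta>0: "\<beta> (x, t) = 0" if "x \<notin> \<Omega> \<or> t \<notin> {0<..<T}" for x t using that by (auto simp: \<beta>_def)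
  have \<beta>K: "\<bar>\<beta> z\<bar> \<le> K * \<bar>W z\<bar>" for z
    using K(1) K(2)[of "fst z" "W z"] by (cases z) (auto simp: \<beta>_def indicator_def)
  have W1: "AE t in lborel. t \<in> {0<..<T} \<longrightarrow> W1p p \<Omega> (\<lambda>x. W (x, t)) (\<lambda>x. D (x, t))"
  proof -
    have "AE t in lborel. t \<in> {0<..<T} \<longrightarrow> W1p p \<Omega> (\<lambda>x. w (x, t)) (\<lambda>x. Dw (x, t))"
      using L2 by (simp add: L2_W1p_def)
    then show ?thesis
    proof eventually_elim
      case (elim t)
      show ?case
      proof
        assume t: "t \<in> {0<..<T}"
        then have "W1p p \<Omega> (\<lambda>x. W (x, t)) (\<lambda>x. D (x, t)) \<longleftrightarrow> W1p p \<Omega> (\<lambda>x. w (x, t)) (\<lambda>x. Dw (x, t))"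
          by (intro W1p_cong) (auto simp: Ww Dw)
        then show "W1p p \<Omega> (\<lambda>x. W (x, t)) (\<lambda>x. D (x, t))" using elim t by simp
      qed
    qed
  qed
  have ind: "indicator \<Omega> x *\<^sub>R (norm (f (x, t)) powr p) = norm (f (x, t)) powr p"
    if "\<And>x. x \<notin> \<Omega> \<Longrightarrow> f (x, t) = 0" for f :: "'a \<times> real \<Rightarrow> 'b::euclidean_space" and x t
    using that by (auto simp: indicator_def)
  have iD: "AE t in lborel. integrable lborel (\<lambda>x. norm (D (x, t)) powr p)"
    using W1
  proof eventually_elim
    case (elim t)
    show ?case
    proof (cases "t \<in> {0<..<T}")
      case True
      then have "set_integrable lborel \<Omega> (\<lambda>x. norm (D (x, t)) powr p)" using elim by (simp add: W1p_def Lp_on_def)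
      then show ?thesis unfolding set_integrable_def by (subst (asm) ind) (auto simp: D0)
    qed (simp add: D0)
  qed
  have iW: "AE t in lborel. integrable lborel (\<lambda>x. \<bar>W (x, t)\<bar> powr p)"
  proof -
    have "AE t in lborel. t \<noteq> 0" "AE t in lborel. t \<noteq> T" by (rule AE_lborel_singleton)+
    then show ?thesis using W1
    proof eventually_elim
      case (elim t)
      show ?case
      proof (cases "t \<in> {0<..<T}")
        case True
        then have "set_integrable lborel \<Omega> (\<lambda>x. norm (W (x, t)) powr p)" using elim by (simp add: W1p_def Lp_on_def)
        then show ?thesis unfolding set_integrable_def by (subst (asm) ind) (auto simp: W0)
      next
        case False
        then have "t \<notin> {0..T}" using elim by auto
        then show ?thesis by (simp add: W0)
      qed
    qed
  qed
  have nle: "(LINT x|lborel. \<bar>W (x, t)\<bar> powr p) + (LINT x|lborel. norm (D (x, t)) powr p) =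
      (LINT x:\<Omega>|lborel. \<bar>w (x, t)\<bar> powr p) + (LINT x:\<Omega>|lborel. norm (Dw (x, t)) powr p)" if "t \<in> {0<..<T}" for t
    unfolding set_lebesgue_integral_def
    by (intro arg_cong2[where f="(+)"] Bochner_Integration.integral_cong refl)
       (use that in \<open>auto simp: W_def D_def indicator_def\<close>)
  have N2: "(\<integral>\<^sup>+t\<in>{0<..<T}. ennreal ((W1p_norm_at p \<Omega> w Dw t)\<^sup>2) \<partial>lborel) < \<infinity>"
  proof -
    have "set_integrable lborel {0<..<T} (\<lambda>t. (W1p_norm_at p \<Omega> w Dw t)\<^sup>2)"
      using L2 by (simp add: L2_W1p_def)
    then have "(\<integral>\<^sup>+t. ennreal (norm (indicator {0<..<T} t *\<^sub>R (W1p_norm_at p \<Omega> w Dw t)\<^sup>2)) \<partial>lborel) < \<infinity>"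
      by (simp add: set_integrable_def integrable_iff_bounded)
    also have "(\<integral>\<^sup>+t. ennreal (norm (indicator {0<..<T} t *\<^sub>R (W1p_norm_at p \<Omega> w Dw t)\<^sup>2)) \<partial>lborel)
      = (\<integral>\<^sup>+t\<in>{0<..<T}. ennreal ((W1p_norm_at p \<Omega> w Dw t)\<^sup>2) \<partial>lborel)"
      by (intro nn_integral_cong) (auto simp: indicator_def)
    finally show ?thesis .
  qed
  have D2: "(\<integral>\<^sup>+t. ennreal ((LINT x|lborel. norm (D (x, t)) powr p) powr (2 / p)) \<partial>lborel) < \<infinity>"
  proof (rule le_less_trans[OF _ N2], rule nn_integral_mono)
    fix t
    show "ennreal ((LINT x|lborel. norm (D (x, t)) powr p) powr (2 / p))
       \<le> ennreal ((W1p_norm_at p \<Omega> w Dw t)\<^sup>2) * indicator {0<..<T} t"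
    proof (cases "t \<in> {0<..<T}")
      case True
      have "(LINT x|lborel. norm (D (x, t)) powr p) powr (2 / p) \<le> ((LINT x|lborel. \<bar>W (x, t)\<bar> powr p) + (LINT x|lborel. norm (D (x, t)) powr p)) powr (2 / p)"
        using p by (intro powr_mono2) auto
      then show ?thesis using True by (simp add: W1p_norm_power2 nle ennreal_leI)
    qed (use p in \<open>simp add: D0\<close>)
  qed
  have IW: "integrable lborel W"
  proof (rule integrableI_bounded)
    define c where "c = measure lborel \<Omega> powr ((p - 1) / p)"
    have "(\<integral>\<^sup>+z. ennreal (norm (W z)) \<partial>lborel) = (\<integral>\<^sup>+t. \<integral>\<^sup>+x. ennreal (norm (W (x, t))) \<partial>lborel \<partial>lborel)"
      by (rule nn_integral_slices) measurable
    also have "\<dots> \<le> (\<integral>\<^sup>+t. ennreal c * ((1 + ennreal ((W1p_norm_at p \<Omega> w Dw t)\<^sup>2)) * indicator {0<..<T} t) \<partial>lborel)"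
    proof (rule nn_integral_mono_AE)
      have "AE t in lborel. t \<noteq> 0" "AE t in lborel. t \<noteq> T" by (rule AE_lborel_singleton)+
      then show "AE t in lborel. (\<integral>\<^sup>+x. ennreal (norm (W (x, t))) \<partial>lborel) \<le>
         ennreal c * ((1 + ennreal ((W1p_norm_at p \<Omega> w Dw t)\<^sup>2)) * indicator {0<..<T} t)"
        using iW
      proof eventually_elim
        case (elim t)
        show ?case
        proof (cases "t \<in> {0<..<T}")
          case True
          have e: "indicator \<Omega> x powr (p - 1) * \<bar>W (x, t)\<bar> = \<bar>W (x, t)\<bar>" for x
            using W0[of x t] p by (cases "x \<in> \<Omega>") auto
          have i1: "integrable lborel (\<lambda>x. indicator \<Omega> x powr p)"
          proof -
            have "integrable lborel (\<lambda>x. indicator \<Omega> x :: real)"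
              using emeasure_bounded_finite[OF \<Omega>(1)] by (intro integrable_real_indicator) auto
            also have "(\<lambda>x. indicator \<Omega> x) = (\<lambda>x. indicator \<Omega> x powr p)" by (auto simp: indicator_def)
            finally show ?thesis .
          qed
          have m1: "(LINT x|lborel. indicator \<Omega> x powr p) = measure lborel \<Omega>"
          proof -
            have "(LINT x|lborel. indicator \<Omega> x powr p) = (LINT x|lborel. indicator \<Omega> x)"
              by (intro Bochner_Integration.integral_cong) (auto simp: indicator_def)
            then show ?thesis by simp
          qed
          have H: "integrable lborel (\<lambda>x. \<bar>W (x, t)\<bar>)" "(LINT x|lborel. \<bar>W (x, t)\<bar>) \<le> c * (LINT x|lborel. \<bar>W (x, t)\<bar> powr p) powr (1 / p)"
            using Holder_integrable[OF p, of "indicator \<Omega>" lborel "\<lambda>x. \<bar>W (x, t)\<bar>"] Holder_powr[OF p, of "indicator \<Omega>" lborel "\<lambda>x. \<bar>W (x, t)\<bar>"] i1 elim(3)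
            by (simp_all add: e m1 c_def)
          have "(LINT x|lborel. \<bar>W (x, t)\<bar> powr p) powr (1 / p) \<le> W1p_norm_at p \<Omega> w Dw t"
            unfolding W1p_norm_def nle[OF True, symmetric] using p by (intro powr_mono2) auto
          also have "\<dots> \<le> 1 + (W1p_norm_at p \<Omega> w Dw t)\<^sup>2"
            using zero_le_power2[of "W1p_norm_at p \<Omega> w Dw t - 1/2"]
            by (simp add: power2_eq_square algebra_simps)
          finally have 1: "(LINT x|lborel. \<bar>W (x, t)\<bar> powr p) powr (1 / p) \<le> 1 + (W1p_norm_at p \<Omega> w Dw t)\<^sup>2" .
          have "0 \<le> c" by (simp add: c_def)
          from order_trans[OF H(2) mult_left_mono[OF 1 this]]
          have "(LINT x|lborel. \<bar>W (x, t)\<bar>) \<le> c * (1 + (W1p_norm_at p \<Omega> w Dw t)\<^sup>2)" .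
          then have "(\<integral>\<^sup>+x. ennreal (norm (W (x, t))) \<partial>lborel) \<le> ennreal (c * (1 + (W1p_norm_at p \<Omega> w Dw t)\<^sup>2))"
            using H(1) by (simp add: nn_integral_eq_integral ennreal_leI)
          also have "\<dots> = ennreal c * (1 + ennreal ((W1p_norm_at p \<Omega> w Dw t)\<^sup>2))"
            by (simp add: ennreal_mult c_def flip: ennreal_1 ennreal_plus)
          finally show ?thesis using True by simp
        next
          case False
          then have "t \<notin> {0..T}" using elim by auto
          then show ?thesis by (simp add: W0)
        qed
      qed
    qed
    also have "\<dots> = ennreal c * (\<integral>\<^sup>+t. (1 + ennreal ((W1p_norm_at p \<Omega> w Dw t)\<^sup>2)) * indicator {0<..<T} t \<partial>lborel)"
    proof (rule nn_integral_cmult)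
      have 1: "(\<lambda>t. (1 + ennreal (indicator {0<..<T} t *\<^sub>R (W1p_norm_at p \<Omega> w Dw t)\<^sup>2)) * indicator {0<..<T} t) \<in> borel_measurable lborel"
      proof -
        have "(\<lambda>t. indicator {0<..<T} t *\<^sub>R (W1p_norm_at p \<Omega> w Dw t)\<^sup>2) \<in> borel_measurable lborel"
          using L2 by (auto simp: L2_W1p_def set_integrable_def dest: borel_measurable_integrable)
        then show ?thesis by measurable
      qed
      also have "(\<lambda>t. (1 + ennreal (indicator {0<..<T} t *\<^sub>R (W1p_norm_at p \<Omega> w Dw t)\<^sup>2)) * indicator {0<..<T} t)
         = (\<lambda>t. (1 + ennreal ((W1p_norm_at p \<Omega> w Dw t)\<^sup>2)) * indicator {0<..<T} t)"
        by (auto simp: indicator_def fun_eq_iff)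
      finally show "(\<lambda>t. (1 + ennreal ((W1p_norm_at p \<Omega> w Dw t)\<^sup>2)) * indicator {0<..<T} t) \<in> borel_measurable lborel" .
    qed
    also have "(\<integral>\<^sup>+t. (1 + ennreal ((W1p_norm_at p \<Omega> w Dw t)\<^sup>2)) * indicator {0<..<T} t \<partial>lborel)
      = (\<integral>\<^sup>+t. indicator {0<..<T} t + ennreal (indicator {0<..<T} t *\<^sub>R (W1p_norm_at p \<Omega> w Dw t)\<^sup>2) \<partial>lborel)"
      by (intro nn_integral_cong) (auto simp: indicator_def)
    also have "\<dots> = (\<integral>\<^sup>+t. indicator {0<..<T} t \<partial>lborel) + (\<integral>\<^sup>+t. ennreal (indicator {0<..<T} t *\<^sub>R (W1p_norm_at p \<Omega> w Dw t)\<^sup>2) \<partial>lborel)"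
    proof (rule nn_integral_add)
      have "(\<lambda>t. indicator {0<..<T} t *\<^sub>R (W1p_norm_at p \<Omega> w Dw t)\<^sup>2) \<in> borel_measurable lborel"
        using L2 by (auto simp: L2_W1p_def set_integrable_def dest: borel_measurable_integrable)
      then show "(\<lambda>t. ennreal (indicator {0<..<T} t *\<^sub>R (W1p_norm_at p \<Omega> w Dw t)\<^sup>2)) \<in> borel_measurable lborel" by measurable
    qed measurable
    also have "(\<integral>\<^sup>+t. ennreal (indicator {0<..<T} t *\<^sub>R (W1p_norm_at p \<Omega> w Dw t)\<^sup>2) \<partial>lborel)
       = (\<integral>\<^sup>+t\<in>{0<..<T}. ennreal ((W1p_norm_at p \<Omega> w Dw t)\<^sup>2) \<partial>lborel)"
      by (intro nn_integral_cong) (auto simp: indicator_def)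
    finally have le: "(\<integral>\<^sup>+z. ennreal (norm (W z)) \<partial>lborel) \<le> ennreal c * ((\<integral>\<^sup>+t. indicator {0<..<T} t \<partial>lborel)
       + (\<integral>\<^sup>+t\<in>{0<..<T}. ennreal ((W1p_norm_at p \<Omega> w Dw t)\<^sup>2) \<partial>lborel))" .
    have "(\<integral>\<^sup>+t. indicator {0<..<T} t \<partial>lborel) < \<infinity>" using T by simp
    with N2 have "ennreal c * ((\<integral>\<^sup>+t. indicator {0<..<T} t \<partial>lborel)
       + (\<integral>\<^sup>+t\<in>{0<..<T}. ennreal ((W1p_norm_at p \<Omega> w Dw t)\<^sup>2) \<partial>lborel)) < \<infinity>"
      by (simp add: ennreal_mult_less_top)
    with le show "(\<integral>\<^sup>+z. ennreal (norm (W z)) \<partial>lborel) < \<infinity>" by (rule le_less_trans)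
  qed measurable
  have q2: "(\<integral>\<^sup>+t. ennreal ((LINT x|lborel. norm (D (x, t)) powr p) powr (2 * (p - 1) / p)) \<partial>lborel) < \<infinity>"
  proof (rule gradient_time_integrability[OF p \<Omega>(1,2) D D0 iD IW \<beta> K(1) \<beta>K])
    fix \<phi> D\<phi> \<phi>t assume "test_function p \<Omega> T \<phi> D\<phi> \<phi>t" "zero_on_boundary p \<Omega> T \<phi> D\<phi>"
    then have "set_integrable lborel (\<Omega> \<times> {0<..<T}) (weak_integrand p \<alpha> w Dw \<phi> D\<phi> \<phi>t)" using glob by blast
    also have "set_integrable lborel (\<Omega> \<times> {0<..<T}) (weak_integrand p \<alpha> w Dw \<phi> D\<phi> \<phi>t) \<longleftrightarrow> set_integrable lborel (\<Omega> \<times> {0<..<T})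
       (\<lambda>z. - W z * \<phi>t z + flux p (D z) \<bullet> D\<phi> z + \<beta> z * \<phi> z)"
      by (rule set_integrable_cong) (auto simp: weak_integrand_def Ww Dw \<beta>1 flux_def)
    finally show "set_integrable lborel (\<Omega> \<times> {0<..<T})
       (\<lambda>z. - W z * \<phi>t z + flux p (D z) \<bullet> D\<phi> z + \<beta> z * \<phi> z)" .
  qed
  have stat: "integrable lborel (\<lambda>x. W (x, s) * \<psi> x) \<and> integrable lborel (\<lambda>x. W (x, t) * \<psi> x) \<and>
       integrable lborel (\<lambda>z. indicator {s<..<t} (snd z) *
          (flux p (D z) \<bullet> D\<psi> (fst z) + \<beta> z * \<psi> (fst z))) \<and>
       R ((LINT x|lborel. W (x, t) * \<psi> x) - (LINT x|lborel. W (x, s) * \<psi> x)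
         + (LINT z|lborel. indicator {s<..<t} (snd z) *
          (flux p (D z) \<bullet> D\<psi> (fst z) + \<beta> z * \<psi> (fst z)))) 0"
    if \<psi>: "C1_test \<Omega> \<psi> D\<psi>" and st: "0 \<le> s" "s < t" "t \<le> T" for \<psi> D\<psi> s t
  proof -
    obtain K where K: "compact K" "K \<subseteq> \<Omega>" "\<And>x. x \<notin> K \<Longrightarrow> \<psi> x = 0" "\<And>x. x \<notin> K \<Longrightarrow> D\<psi> x = 0"
      using C1_test_support[OF \<psi>] by blast
    obtain V where V: "open V" "connected V" "compact (closure V)" "closure V \<subseteq> \<Omega>" "K \<subseteq> V"
      using connected_neighbourhood_of_compact[OF \<Omega>(2,3) K(1,2)] by blast
    have V\<Omega>: "V \<subseteq> \<Omega>" using V(4) closure_subset by blast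
    have tf: "test_function p \<Omega> T (\<lambda>z. \<psi> (fst z)) (\<lambda>z. D\<psi> (fst z)) (\<lambda>z. 0)"
      by (rule stationary_test_function[OF p \<Omega>(1,2) \<psi>])
    have "\<forall>x\<in>\<Omega> - V. \<forall>t\<in>{0..T}. \<psi> (fst (x, t)) = 0" using K(3) V(5) by auto
    note L = loc[of V s t "\<lambda>z. \<psi> (fst z)" "\<lambda>z. D\<psi> (fst z)" "\<lambda>z. 0"]
    have eW: "indicator V x *\<^sub>R (w (x, r) * \<psi> (fst (x, r))) = W (x, r) * \<psi> x" if "r \<in> {0..T}" for x r
      using that K(3)[of x] V(5) V\<Omega> by (cases "x \<in> K") (auto simp: Ww subset_iff)
    have eI: "indicator (V \<times> {s<..<t}) z *\<^sub>R weak_integrand p \<alpha> w Dw (\<lambda>z. \<psi> (fst z)) (\<lambda>z. D\<psi> (fst z)) (\<lambda>z. 0) z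
      = indicator {s<..<t} (snd z) * (flux p (D z) \<bullet> D\<psi> (fst z) + \<beta> z * \<psi> (fst z))" for z
    proof (cases "fst z \<in> K \<and> snd z \<in> {s<..<t}")
      case True
      then have "fst z \<in> V" "fst z \<in> \<Omega>" "snd z \<in> {0<..<T}" using V(5) V\<Omega> st by auto
      then show ?thesis
        using True Dw[of "fst z" "snd z"] \<beta>1[of "fst z" "snd z"] Ww[of "fst z" "snd z"]
        by (cases z) (auto simp: weak_integrand_def flux_def)
    next
      case False
      then show ?thesis
        using K(3,4)[of "fst z"] by (cases z) (auto simp: weak_integrand_def flux_def indicator_def)
    qed
    have s01: "s \<in> {0..T}" "t \<in> {0..T}" using st by auto
    show ?thesis
      using L V st tf \<open>\<forall>x\<in>\<Omega> - V. \<forall>t\<in>{0..T}. \<psi> (fst (x, t)) = 0\<close>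
      unfolding set_integrable_def set_lebesgue_integral_def eI eW[OF s01(1)] eW[OF s01(2)] by blast
  qed
  have "solution_data R p \<Omega> T K W D \<beta>"
    unfolding solution_data_def
    by (intro conjI allI impI W D \<beta> W0 D0 \<beta>0 \<beta>K IW W1 iD D2 q2; (rule stat[THEN conjunct1] stat[THEN conjunct2, THEN conjunct1]
        stat[THEN conjunct2, THEN conjunct2, THEN conjunct1] stat[THEN conjunct2, THEN conjunct2, THEN conjunct2])?; assumption)
  then show ?thesis using Ww \<beta>1 by (rule that)
qed

section \<open>The truncation and its primitive\<close>

text \<open>This choice has a continuous derivative, as the chain rule for test functions requires, and an
  elementary primitive.\<close>

definition trunc :: "real \<Rightarrow> real" where
  "trunc s = (if s \<le> 0 then 0 else s\<^sup>2 / (1 + s\<^sup>2))"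

definition trunc' :: "real \<Rightarrow> real" where
  "trunc' s = (if s \<le> 0 then 0 else 2 * s / (1 + s\<^sup>2)\<^sup>2)"

definition prim :: "real \<Rightarrow> real" where
  "prim s = (if s \<le> 0 then 0 else s - arctan s)"

lemma one_plus_square_pos: "0 < 1 + (s::real)\<^sup>2"
  by (simp add: add_pos_nonneg)

lemma real_derivative_glue:
  fixes f g :: "real \<Rightarrow> real"
  assumes g: "\<And>s. (g has_real_derivative g' s) (at s)" and 0: "g 0 = 0" "g' 0 = 0"
  shows "((\<lambda>s. if s \<le> 0 then 0 else g s) has_real_derivative (if s \<le> 0 then 0 else g' s)) (at s)"
proof -
  have "((\<lambda>s. if s \<in> {..0} then 0 else g s) has_real_derivative (if s \<in> {..0} then 0 else g' s)) (at s within {..0} \<union> {0..})"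
    unfolding has_field_derivative_def if_distrib[where f="(*)"]
  proof (rule has_derivative_If_within_closures[where f'="\<lambda>_ _. 0" and g'="\<lambda>s v. g' s * v", THEN has_derivative_eq_rhs])
  qed (use 0 g in \<open>auto simp: has_field_derivative_def intro: has_derivative_at_withinI\<close>)
  moreover have "{..0::real} \<union> {0..} = UNIV" by auto
  ultimately show ?thesis by (simp cong: if_cong)
qed

lemma trunc_deriv: "(trunc has_real_derivative trunc' s) (at s)"
proof -
  have "((\<lambda>s. s\<^sup>2 / (1 + s\<^sup>2)) has_real_derivative 2 * s / (1 + s\<^sup>2)\<^sup>2) (at s)" for s :: real
    using one_plus_square_pos[of s]
    by (auto intro!: derivative_eq_intros simp: field_simps power2_eq_square)
  from real_derivative_glue[OF this] show ?thesis
    unfolding trunc_def[abs_def] trunc'_def by simp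
qed

lemma prim_deriv: "(prim has_real_derivative trunc s) (at s)"
proof -
  have "((\<lambda>s. s - arctan s) has_real_derivative s\<^sup>2 / (1 + s\<^sup>2)) (at s)" for s :: real
    using one_plus_square_pos[of s]
    by (auto intro!: derivative_eq_intros simp: field_simps)
  from real_derivative_glue[OF this] show ?thesis
    unfolding prim_def[abs_def] trunc_def by simp
qed

lemma trunc_bounds: "0 \<le> trunc s" "trunc s \<le> 1"
  using one_plus_square_pos[of s] by (auto simp: trunc_def)

lemma trunc'_bounds: "0 \<le> trunc' s" "trunc' s \<le> 1"
proof -
  show "0 \<le> trunc' s" by (simp add: trunc'_def)
  have "2 * s \<le> 1 + s\<^sup>2" using zero_le_power2[of "s - 1"] by (simp add: power2_diff)
  also have "\<dots> = (1 + s\<^sup>2) * 1" by simp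
  also have "\<dots> \<le> (1 + s\<^sup>2) * (1 + s\<^sup>2)" by (intro mult_left_mono) auto
  also have "\<dots> = (1 + s\<^sup>2)\<^sup>2" by (simp add: power2_eq_square)
  finally show "trunc' s \<le> 1" using one_plus_square_pos[of s] by (simp add: trunc'_def divide_le_eq)
qed

lemma trunc_max: "trunc (max s 0) = trunc s" "trunc' (max s 0) = trunc' s"
  by (auto simp: trunc_def trunc'_def max_def)

lemma trunc_mono: "s \<le> t \<Longrightarrow> trunc s \<le> trunc t"
  by (rule DERIV_nonneg_imp_nondecreasing) (use trunc_deriv trunc'_bounds in blast)+

text \<open>The tangent inequality of a convex function, at the later time when it is applied.\<close>

lemma prim_convex: "prim t - prim s \<le> (t - s) * trunc t"
proof (rule linorder_cases[of s t])
  assume "s < t"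
  then obtain z where "s < z" "z < t" "prim t - prim s = (t - s) * trunc z"
    using MVT2[of s t prim trunc] prim_deriv by blast
  then show ?thesis using \<open>s < t\<close> trunc_mono[of z t] by (simp add: mult_left_mono)
next
  assume "t < s"
  then obtain z where z: "t < z" "z < s" "prim s - prim t = (s - t) * trunc z"
    using MVT2[of t s prim trunc] prim_deriv by blast
  then have "(s - t) * trunc t \<le> (s - t) * trunc z" using \<open>t < s\<close> trunc_mono[of t z] by (simp add: mult_left_mono)
  then show ?thesis using z(3) by (simp add: algebra_simps)
qed simp

lemma prim_bounds: "0 \<le> prim s" "prim s \<le> \<bar>s\<bar>" "prim s \<le> 0 \<Longrightarrow> s \<le> 0"
proof -
  have m: "prim s \<le> prim t" if "s \<le> t" for s t
    by (rule DERIV_nonneg_imp_nondecreasing[OF that]) (use prim_deriv trunc_bounds in blast)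
  have "prim 0 = 0" by (simp add: prim_def)
  then show "0 \<le> prim s" using m[of 0 s] by (cases "s \<le> 0") (auto simp: prim_def)
  show "prim s \<le> \<bar>s\<bar>" by (auto simp: prim_def)
  show "s \<le> 0" if "prim s \<le> 0"
  proof (rule ccontr)
    assume "\<not> s \<le> 0"
    then have "0 < s" by simp
    then have "prim 0 < prim s"
    proof (rule DERIV_pos_imp_increasing_open)
      show "\<exists>y. (prim has_real_derivative y) (at x) \<and> 0 < y" if "0 < x" "x < s" for x
        using prim_deriv[of x] that one_plus_square_pos[of x] by (intro exI[of _ "trunc x"]) (auto simp: trunc_def)
      show "continuous_on {0..s} prim"
        using prim_deriv by (meson DERIV_isCont continuous_at_imp_continuous_on)
    qed
    then show False using that \<open>prim 0 = 0\<close> by simp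
  qed
qed

text \<open>The factor \<open>3\<close> is the ratio at the origin, where \<open>s * trunc s\<close> behaves like \<open>s ^ 3\<close> and
  \<open>prim s\<close> like \<open>s ^ 3 / 3\<close>.\<close>

lemma trunc_le_prim: "s * trunc s \<le> 3 * prim s"
proof (cases "s \<le> 0")
  case True then show ?thesis by (simp add: trunc_def prim_def)
next
  case False
  define f where "f s = 3 * (s - arctan s) - s * (s\<^sup>2 / (1 + s\<^sup>2))" for s :: real
  have "f 0 \<le> f s"
  proof (rule DERIV_nonneg_imp_nondecreasing[of 0 s f])
    show "0 \<le> s" using False by simp
    show "\<exists>y. (f has_real_derivative y) (at x) \<and> 0 \<le> y" for x
    proof (intro exI conjI)
      have n: "1 + x\<^sup>2 \<noteq> 0" using one_plus_square_pos[of x] by simp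
      show "(f has_real_derivative 2 * x ^ 4 / (1 + x\<^sup>2)\<^sup>2) (at x)"
      proof -
        have d: "((\<lambda>s. s\<^sup>2 / (1 + s\<^sup>2)) has_real_derivative 2 * x / (1 + x\<^sup>2)\<^sup>2) (at x)"
          using n by (auto intro!: derivative_eq_intros simp: field_simps power2_eq_square)
        have "((\<lambda>s. 3 * (s - arctan s) - s * (s\<^sup>2 / (1 + s\<^sup>2))) has_real_derivative
            3 * (1 - inverse (1 + x\<^sup>2)) - (1 * (x\<^sup>2 / (1 + x\<^sup>2)) + 2 * x / (1 + x\<^sup>2)\<^sup>2 * x)) (at x)"
          by (intro DERIV_diff DERIV_cmult DERIV_ident DERIV_arctan DERIV_mult d)
        moreover have "3 * (1 - inverse (1 + x\<^sup>2)) - (1 * (x\<^sup>2 / (1 + x\<^sup>2)) + 2 * x / (1 + x\<^sup>2)\<^sup>2 * x) = 2 * x ^ 4 / (1 + x\<^sup>2)\<^sup>2"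
          using n by (simp add: divide_simps) (simp add: algebra_simps power2_eq_square power4_eq_xxxx)
        ultimately show ?thesis unfolding f_def[abs_def] by simp
      qed
      show "0 \<le> 2 * x ^ 4 / (1 + x\<^sup>2)\<^sup>2" by simp
    qed
  qed
  then show ?thesis using False by (simp add: f_def trunc_def prim_def)
qed

lemma trunc_continuous: "continuous_on A trunc" "continuous_on A prim" "continuous_on A trunc'"
proof -
  show "continuous_on A trunc" "continuous_on A prim"
    using trunc_deriv prim_deriv by (meson DERIV_isCont continuous_at_imp_continuous_on)+
  have eq: "trunc' = (\<lambda>s. 2 * max s 0 / (1 + (max s 0)\<^sup>2)\<^sup>2)" by (auto simp: trunc'_def max_def fun_eq_iff)
  have "continuous_on A (\<lambda>s. 2 * max s 0 / (1 + (max s 0)\<^sup>2)\<^sup>2)"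
    using one_plus_square_pos by (intro continuous_intros) (metis less_irrefl power_eq_0_iff)
  then show "continuous_on A trunc'" unfolding eq .
qed

lemma trunc_measurable [measurable]: "trunc \<in> borel_measurable borel" "prim \<in> borel_measurable borel" "trunc' \<in> borel_measurable borel"
  by (intro borel_measurable_continuous_onI trunc_continuous)+

lemma C1_test_trunc:
  assumes "test_smooth \<Omega> \<zeta>" shows "C1_test \<Omega> (\<lambda>x. trunc (\<zeta> x)) (\<lambda>x. trunc' (\<zeta> x) *\<^sub>R gradient \<zeta> x)"
  unfolding C1_test_def
proof (intro conjI allI)
  have sm: "smooth \<zeta>" by (rule test_smooth_smooth[OF assms])
  show "0 \<le> trunc (\<zeta> x)" for x by (rule trunc_bounds)
  show "((\<lambda>x. trunc (\<zeta> x)) has_derivative (\<lambda>v. (trunc' (\<zeta> x) *\<^sub>R gradient \<zeta> x) \<bullet> v)) (at x)" for x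
    by (rule has_derivative_eq_rhs[OF DERIV_compose_FDERIV[OF trunc_deriv smooth_gradient_derivative[OF sm]]])
       (auto simp: mult.commute)
  show "continuous_on UNIV (\<lambda>x. trunc' (\<zeta> x) *\<^sub>R gradient \<zeta> x)"
    by (intro continuous_on_scaleR continuous_gradient[OF sm] continuous_on_compose2[OF trunc_continuous(3) smooth_continuous[OF sm]]) auto
  show "\<exists>K. compact K \<and> K \<subseteq> \<Omega> \<and> (\<forall>x. x \<notin> K \<longrightarrow> trunc (\<zeta> x) = 0)"
    using test_smooth_support[OF assms] by (metis order_refl trunc_def)
qed

lemma powr_add_le: "(a + b) powr p \<le> 2 powr p * (a powr p + b powr p)" if "0 \<le> a" "0 \<le> b" "0 \<le> p" for a b p :: real
proof -
  have "(a + b) powr p \<le> (2 * max a b) powr p" using that by (intro powr_mono2) auto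
  also have "\<dots> = 2 powr p * (max a b) powr p" using that by (simp add: powr_mult)
  also have "\<dots> \<le> 2 powr p * (a powr p + b powr p)" by (intro mult_left_mono) (auto simp: max_def)
  finally show ?thesis .
qed

text \<open>A truncated element of the Sobolev space with zero boundary values is approximated by
  admissible stationary test functions. The limit of the gradients is identified by dominated
  convergence along a subsequence that converges almost everywhere.\<close>

lemma W1p_0_trunc_approx:
  fixes \<Omega> :: "'a::euclidean_space set"
  assumes p: "1 < p" and \<Omega>: "bounded \<Omega>" "open \<Omega>" and v: "W1p_0 p \<Omega> v Dv"
  obtains \<zeta> :: "nat \<Rightarrow> 'a \<Rightarrow> real" where "\<And>k. test_smooth \<Omega> (\<zeta> k)"
    "AE x in lborel. x \<in> \<Omega> \<longrightarrow> (\<lambda>k. trunc (\<zeta> k x)) \<longlonglongrightarrow> trunc (v x)"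
    "\<And>k. integrable lborel (\<lambda>x. norm (trunc' (\<zeta> k x) *\<^sub>R gradient (\<zeta> k) x - indicator \<Omega> x *\<^sub>R (trunc' (v x) *\<^sub>R Dv x)) powr p)"
    "(\<lambda>k. LINT x|lborel. norm (trunc' (\<zeta> k x) *\<^sub>R gradient (\<zeta> k) x - indicator \<Omega> x *\<^sub>R (trunc' (v x) *\<^sub>R Dv x)) powr p) \<longlonglongrightarrow> 0"
proof -
  have [measurable]: "\<Omega> \<in> sets borel" using \<Omega> by auto
  obtain \<zeta> where \<zeta>: "\<And>k. test_smooth \<Omega> (\<zeta> k)"
    "(\<lambda>k. W1p_norm p \<Omega> (\<lambda>x. v x - \<zeta> k x) (\<lambda>x. Dv x - gradient (\<zeta> k) x)) \<longlonglongrightarrow> 0"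
    using v unfolding W1p_0_def by blast
  define v' where "v' x = indicator \<Omega> x *\<^sub>R v x" for x
  define d where "d x = indicator \<Omega> x *\<^sub>R Dv x" for x
  have m[measurable]: "v' \<in> borel_measurable borel" "d \<in> borel_measurable borel"
    using v by (simp_all add: v'_def[abs_def] d_def[abs_def] W1p_0_def W1p_def Lp_on_def set_borel_measurable_def)
  have sm: "smooth (\<zeta> k)" for k by (rule test_smooth_smooth[OF \<zeta>(1)])
  have mz[measurable]: "\<zeta> k \<in> borel_measurable borel" "gradient (\<zeta> k) \<in> borel_measurable borel" for k
    using sm by (auto intro!: borel_measurable_continuous_onI smooth_continuous continuous_gradient)
  have z0: "\<zeta> k x = 0" "gradient (\<zeta> k) x = 0" if "x \<notin> \<Omega>" for k x
    using that test_smooth_outside[OF \<zeta>(1)] test_smooth_frechet_outside[OF \<zeta>(1)] by (auto simp: gradient_def)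
  have ext: "integrable lborel (\<lambda>x. norm (indicator \<Omega> x *\<^sub>R f x) powr p)" if "Lp_on p \<Omega> f" for f :: "'a \<Rightarrow> 'b::euclidean_space"
  proof -
    have "(\<lambda>x. norm (indicator \<Omega> x *\<^sub>R f x) powr p) = (\<lambda>x. indicator \<Omega> x *\<^sub>R (norm (f x) powr p))"
      by (auto simp: indicator_def)
    then show ?thesis using that by (simp add: Lp_on_def set_integrable_def)
  qed
  have iv: "integrable lborel (\<lambda>x. \<bar>v' x\<bar> powr p)" "integrable lborel (\<lambda>x. norm (d x) powr p)"
    using ext[of v] ext[of Dv] v unfolding v'_def d_def W1p_0_def W1p_def by auto
  have iz: "integrable lborel (\<lambda>x. \<bar>\<zeta> k x\<bar> powr p)" "integrable lborel (\<lambda>x. norm (gradient (\<zeta> k) x) powr p)" for k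
  proof -
    have "W1p p \<Omega> (\<zeta> k) (gradient (\<zeta> k))" using p by (intro W1p_0_test_smooth(2)[OF \<Omega> _ \<zeta>(1)]) simp
    then have Lp: "Lp_on p \<Omega> (\<zeta> k)" "Lp_on p \<Omega> (gradient (\<zeta> k))" by (simp_all add: W1p_def)
    have e: "indicator \<Omega> x *\<^sub>R \<zeta> k x = \<zeta> k x" "indicator \<Omega> x *\<^sub>R gradient (\<zeta> k) x = gradient (\<zeta> k) x" for x
      using z0[of x k] by (auto simp: indicator_def)
    show "integrable lborel (\<lambda>x. \<bar>\<zeta> k x\<bar> powr p)" "integrable lborel (\<lambda>x. norm (gradient (\<zeta> k) x) powr p)"
      using ext[OF Lp(1), unfolded e] ext[OF Lp(2), unfolded e] by simp_all
  qed
  have diff: "integrable lborel (\<lambda>x. norm (f x - g x) powr p)"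
    if "integrable lborel (\<lambda>x. norm (f x) powr p)" "integrable lborel (\<lambda>x. norm (g x) powr p)"
      and [measurable]: "f \<in> borel_measurable borel" "g \<in> borel_measurable borel"
    for f g :: "'a \<Rightarrow> 'b::euclidean_space"
  proof (rule Bochner_Integration.integrable_bound)
    show "integrable lborel (\<lambda>x. 2 powr p * (norm (f x) powr p + norm (g x) powr p))" using that by simp
    show "AE x in lborel. norm (norm (f x - g x) powr p) \<le> norm (2 powr p * (norm (f x) powr p + norm (g x) powr p))"
    proof (intro AE_I2)
      fix x
      have "norm (f x - g x) powr p \<le> (norm (f x) + norm (g x)) powr p"
        using p by (intro powr_mono2 norm_triangle_ineq4) auto
      also have "\<dots> \<le> 2 powr p * (norm (f x) powr p + norm (g x) powr p)" using p by (intro powr_add_le) auto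
      finally show "norm (norm (f x - g x) powr p) \<le> norm (2 powr p * (norm (f x) powr p + norm (g x) powr p))" by simp
    qed
  qed measurable
  have i1: "integrable lborel (\<lambda>x. norm (v' x - \<zeta> k x) powr p)" for k
    using iv(1) iz(1) by (intro diff) auto
  have i2: "integrable lborel (\<lambda>x. norm (d x - gradient (\<zeta> k) x) powr p)" for k
    using iv(2) iz(2) by (intro diff) auto
  define a where "a k = (LINT x|lborel. norm (v' x - \<zeta> k x) powr p)" for k
  define b where "b k = (LINT x|lborel. norm (d x - gradient (\<zeta> k) x) powr p)" for k
  have ab0: "0 \<le> a k" "0 \<le> b k" for k by (auto simp: a_def b_def)
  have "W1p_norm p \<Omega> (\<lambda>x. v x - \<zeta> k x) (\<lambda>x. Dv x - gradient (\<zeta> k) x) powr p = a k + b k" for k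
  proof -
    have "(LINT x:\<Omega>|lborel. \<bar>v x - \<zeta> k x\<bar> powr p) = a k" "(LINT x:\<Omega>|lborel. norm (Dv x - gradient (\<zeta> k) x) powr p) = b k"
      unfolding set_lebesgue_integral_def a_def b_def
      by (intro Bochner_Integration.integral_cong refl; use z0 in \<open>auto simp: v'_def d_def indicator_def\<close>)+
    then show ?thesis using ab0[of k] p by (simp add: W1p_norm_def powr_powr)
  qed
  moreover have "(\<lambda>k. W1p_norm p \<Omega> (\<lambda>x. v x - \<zeta> k x) (\<lambda>x. Dv x - gradient (\<zeta> k) x) powr p) \<longlonglongrightarrow> 0 powr p"
    using p \<zeta>(2) by (intro tendsto_powr2 tendsto_const) (auto simp: W1p_norm_def)
  ultimately have ab: "(\<lambda>k. a k + b k) \<longlonglongrightarrow> 0" using p by simp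
  have a0: "a \<longlonglongrightarrow> 0" by (rule tendsto_sandwich[OF _ _ tendsto_const ab]) (use ab0 in auto)
  have b0: "b \<longlonglongrightarrow> 0" by (rule tendsto_sandwich[OF _ _ tendsto_const ab]) (use ab0 in auto)
  have "(\<lambda>k. LINT x|lborel. norm (norm (v' x - \<zeta> k x) powr p)) \<longlonglongrightarrow> 0" using a0 by (simp add: a_def[abs_def])
  from tendsto_L1_AE_subseq[OF i1 this] obtain r where r: "strict_mono r"
    "AE x in lborel. (\<lambda>n. norm (v' x - \<zeta> (r n) x) powr p) \<longlonglongrightarrow> 0" by blast
  have lim: "AE x in lborel. (\<lambda>n. \<zeta> (r n) x) \<longlonglongrightarrow> v' x"
    using r(2)
  proof eventually_elim
    case (elim x)
    have "(\<lambda>n. (norm (v' x - \<zeta> (r n) x) powr p) powr (1 / p)) \<longlonglongrightarrow> 0 powr (1 / p)"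
      using p by (intro tendsto_powr2 elim tendsto_const) auto
    then have "(\<lambda>n. norm (v' x - \<zeta> (r n) x)) \<longlonglongrightarrow> 0" using p by (simp add: powr_powr)
    then have "(\<lambda>n. v' x - \<zeta> (r n) x) \<longlonglongrightarrow> 0" by (rule tendsto_norm_zero_cancel)
    from tendsto_diff[OF tendsto_const[of "v' x"] this] show ?case by simp
  qed
  \<comment> \<open>By the product rule estimate, \<open>q\<close> is bounded by the error of the gradients, as \<open>trunc'\<close> is at most \<open>1\<close>,
    plus the change of \<open>trunc'\<close> times the limit gradient, which dominated convergence handles.\<close>
  define q where "q n x = trunc' (\<zeta> (r n) x) *\<^sub>R gradient (\<zeta> (r n)) x - trunc' (v' x) *\<^sub>R d x" for n x
  have mq[measurable]: "q n \<in> borel_measurable borel" for n unfolding q_def by measurable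
  define c where "c n = (LINT x|lborel. (\<bar>trunc' (\<zeta> (r n) x) - trunc' (v' x)\<bar> * norm (d x)) powr p)" for n
  have tr1: "\<bar>trunc' s\<bar> \<le> 1" "\<bar>trunc' s - trunc' t\<bar> \<le> 1" for s t using trunc'_bounds[of s] trunc'_bounds[of t] by auto
  have cb: "(\<bar>trunc' (\<zeta> (r n) x) - trunc' (v' x)\<bar> * norm (d x)) powr p \<le> norm (d x) powr p" for n x
    using p tr1(2) by (intro powr_mono2) (auto simp: mult_left_le_one_le)
  have c0: "c \<longlonglongrightarrow> 0"
  proof -
    have "c \<longlonglongrightarrow> (LINT (x::'a)|lborel. (0::real))"
      unfolding c_def[abs_def]
    proof (rule integral_dominated_convergence[OF _ _ iv(2)])
      show "AE x in lborel. (\<lambda>n. (\<bar>trunc' (\<zeta> (r n) x) - trunc' (v' x)\<bar> * norm (d x)) powr p) \<longlonglongrightarrow> 0"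
        using lim
      proof eventually_elim
        case (elim x)
        have "isCont trunc' (v' x)" using trunc_continuous(3)[of UNIV] by (simp add: continuous_on_eq_continuous_at)
        then have "(\<lambda>n. trunc' (\<zeta> (r n) x)) \<longlonglongrightarrow> trunc' (v' x)" using elim by (rule isCont_tendsto_compose)
        then have "(\<lambda>n. (\<bar>trunc' (\<zeta> (r n) x) - trunc' (v' x)\<bar> * norm (d x)) powr p) \<longlonglongrightarrow> (\<bar>trunc' (v' x) - trunc' (v' x)\<bar> * norm (d x)) powr p"
          using p by (intro tendsto_powr2 tendsto_intros) auto
        then show ?case using p by simp
      qed
      show "AE x in lborel. norm ((\<bar>trunc' (\<zeta> (r n) x) - trunc' (v' x)\<bar> * norm (d x)) powr p) \<le> norm (d x) powr p" for n
        using cb by simp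
    qed measurable
    then show ?thesis by simp
  qed
  have ic: "integrable lborel (\<lambda>x. (\<bar>trunc' (\<zeta> (r n) x) - trunc' (v' x)\<bar> * norm (d x)) powr p)" for n
    by (rule Bochner_Integration.integrable_bound[OF iv(2)]) (use cb in auto)
  have qle: "norm (q n x) powr p \<le> 2 powr p * (norm (d x - gradient (\<zeta> (r n)) x) powr p + (\<bar>trunc' (\<zeta> (r n) x) - trunc' (v' x)\<bar> * norm (d x)) powr p)" for n x
  proof -
    have "q n x = trunc' (\<zeta> (r n) x) *\<^sub>R (gradient (\<zeta> (r n)) x - d x) + (trunc' (\<zeta> (r n) x) - trunc' (v' x)) *\<^sub>R d x"
      by (simp add: q_def algebra_simps)
    then have "norm (q n x) \<le> \<bar>trunc' (\<zeta> (r n) x)\<bar> * norm (gradient (\<zeta> (r n)) x - d x) + \<bar>trunc' (\<zeta> (r n) x) - trunc' (v' x)\<bar> * norm (d x)"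
      by (metis norm_scaleR norm_triangle_ineq)
    also have "\<dots> \<le> norm (d x - gradient (\<zeta> (r n)) x) + \<bar>trunc' (\<zeta> (r n) x) - trunc' (v' x)\<bar> * norm (d x)"
      using tr1(1) by (simp add: norm_minus_commute mult_left_le_one_le)
    finally have "norm (q n x) powr p \<le> (norm (d x - gradient (\<zeta> (r n)) x) + \<bar>trunc' (\<zeta> (r n) x) - trunc' (v' x)\<bar> * norm (d x)) powr p"
      using p by (intro powr_mono2) auto
    also have "\<dots> \<le> 2 powr p * (norm (d x - gradient (\<zeta> (r n)) x) powr p + (\<bar>trunc' (\<zeta> (r n) x) - trunc' (v' x)\<bar> * norm (d x)) powr p)"
      using p by (intro powr_add_le) auto
    finally show ?thesis .
  qed
  have iq: "integrable lborel (\<lambda>x. norm (q n x) powr p)" for n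
    by (rule Bochner_Integration.integrable_bound[where f="\<lambda>x. 2 powr p * (norm (d x - gradient (\<zeta> (r n)) x) powr p + (\<bar>trunc' (\<zeta> (r n) x) - trunc' (v' x)\<bar> * norm (d x)) powr p)"])
       (use qle i2 ic in \<open>auto intro!: AE_I2 intro: order_trans[OF _ abs_ge_self]\<close>)
  have qc: "(LINT x|lborel. norm (q n x) powr p) \<le> 2 powr p * (b (r n) + c n)" for n
  proof -
    have "(LINT x|lborel. norm (q n x) powr p) \<le> (LINT x|lborel. 2 powr p * (norm (d x - gradient (\<zeta> (r n)) x) powr p + (\<bar>trunc' (\<zeta> (r n) x) - trunc' (v' x)\<bar> * norm (d x)) powr p))"
      using qle iq i2 ic by (intro integral_mono) auto
    also have "\<dots> = 2 powr p * (b (r n) + c n)" using i2 ic by (simp add: b_def c_def)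
    finally show ?thesis .
  qed
  have "(\<lambda>n. b (r n)) \<longlonglongrightarrow> 0" using LIMSEQ_subseq_LIMSEQ[OF b0 r(1)] by (simp add: comp_def)
  then have up: "(\<lambda>n. 2 powr p * (b (r n) + c n)) \<longlonglongrightarrow> 0"
    using tendsto_mult[OF tendsto_const[of "2 powr p"] tendsto_add[OF _ c0]] by fastforce
  have q0: "(\<lambda>n. LINT x|lborel. norm (q n x) powr p) \<longlonglongrightarrow> 0"
    by (rule tendsto_sandwich[OF _ _ tendsto_const up]) (use qc in auto)
  have qeq: "q n x = trunc' (\<zeta> (r n) x) *\<^sub>R gradient (\<zeta> (r n)) x - indicator \<Omega> x *\<^sub>R (trunc' (v x) *\<^sub>R Dv x)" for n x
    by (cases "x \<in> \<Omega>") (auto simp: q_def v'_def d_def)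
  show ?thesis
  proof (rule that[of "\<lambda>n. \<zeta> (r n)"])
    show "AE x in lborel. x \<in> \<Omega> \<longrightarrow> (\<lambda>k. trunc (\<zeta> (r k) x)) \<longlonglongrightarrow> trunc (v x)"
      using lim
    proof eventually_elim
      case (elim x)
      have "isCont trunc (v' x)" using trunc_continuous(1)[of UNIV] by (simp add: continuous_on_eq_continuous_at)
      then have "(\<lambda>n. trunc (\<zeta> (r n) x)) \<longlonglongrightarrow> trunc (v' x)" using elim by (rule isCont_tendsto_compose)
      then show ?case by (auto simp: v'_def)
    qed
  qed (use \<zeta>(1) iq q0 in \<open>auto simp: qeq\<close>)
qed

section \<open>Estimates for the flux\<close>

text \<open>The flux is the gradient of the convex function \<open>norm \<xi> powr p / p\<close>. Its monotonicity follows directly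
  from the Cauchy-Schwarz inequality and the monotonicity of \<open>s powr (p - 1)\<close>.\<close>

lemma flux_monotone:
  assumes "1 < p" shows "0 \<le> (flux p a - flux p b) \<bullet> (a - b)"
proof -
  have self: "flux p a \<bullet> a = norm (flux p a) * norm a" for a :: 'a
    by (simp add: flux_def dot_square_norm power2_eq_square)
  have "(flux p a - flux p b) \<bullet> (a - b) = flux p a \<bullet> a + flux p b \<bullet> b - (flux p a \<bullet> b + flux p b \<bullet> a)"
    by (simp add: inner_diff_left inner_diff_right algebra_simps)
  also have "\<dots> \<ge> norm (flux p a) * norm a + norm (flux p b) * norm b - (norm (flux p a) * norm b + norm (flux p b) * norm a)"
    using norm_cauchy_schwarz[of "flux p a" b] norm_cauchy_schwarz[of "flux p b" a] by (simp add: self)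
  moreover have "norm (flux p a) * norm a + norm (flux p b) * norm b - (norm (flux p a) * norm b + norm (flux p b) * norm a)
      = (norm (flux p a) - norm (flux p b)) * (norm a - norm b)" by (simp add: algebra_simps)
  moreover have "0 \<le> (norm (flux p a) - norm (flux p b)) * (norm a - norm b)"
  proof (cases "norm a \<le> norm b")
    case True
    then show ?thesis using assms unfolding norm_flux by (intro mult_nonpos_nonpos) (auto intro: powr_mono2)
  next
    case False
    then show ?thesis using assms unfolding norm_flux by (intro mult_nonneg_nonneg) (auto intro: powr_mono2)
  qed
  ultimately show ?thesis by linarith
qed

lemma AE_translate:
  fixes P :: "'a::euclidean_space \<Rightarrow> bool"
  assumes "AE x in lborel. P x" shows "AE x in lborel. P (x + h)"
proof -
  have "AE x in distr lborel borel ((+) h). P x" unfolding lborel_distr_plus by (rule assms)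
  then have "AE x in lborel. P (h + x)" by (rule AE_distrD[rotated]) simp
  then show ?thesis by (simp add: add.commute)
qed

text \<open>The norm of the flux in the dual exponent is the power \<open>p - 1\<close> of the norm of \<open>D\<close>.\<close>

lemma slice_pairing:
  fixes D :: "'a::euclidean_space \<Rightarrow> 'a" and r :: "'a \<Rightarrow> real"
  assumes p: "1 < p" and [measurable]: "D \<in> borel_measurable borel" "r \<in> borel_measurable borel" and r: "\<And>x. 0 \<le> r x"
    and i: "integrable lborel (\<lambda>x. norm (D x) powr p)" "integrable lborel (\<lambda>x. r x powr p)"
  shows "(\<integral>\<^sup>+x. ennreal (norm (flux p (D x)) * r x) \<partial>lborel) \<le>
    ennreal ((LINT x|lborel. norm (D x) powr p) powr ((p - 1) / p) * (LINT x|lborel. r x powr p) powr (1 / p))"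
proof -
  have "(\<integral>\<^sup>+x. ennreal (norm (flux p (D x)) * r x) \<partial>lborel) = ennreal (LINT x|lborel. norm (D x) powr (p - 1) * r x)"
    unfolding norm_flux
    by (intro nn_integral_eq_integral Holder_integrable[OF p]) (use i r in auto)
  also have "\<dots> \<le> ennreal ((LINT x|lborel. norm (D x) powr p) powr ((p - 1) / p) * (LINT x|lborel. r x powr p) powr (1 / p))"
    by (intro ennreal_leI Holder_powr[OF p]) (use i r in auto)
  finally show ?thesis .
qed

lemma flux_time_integrable:
  fixes D :: "'a::euclidean_space \<times> real \<Rightarrow> 'a"
  assumes p: "1 < p" and [measurable]: "D \<in> borel_measurable borel" and D0: "\<And>x t. t \<notin> {0<..<T} \<Longrightarrow> D (x, t) = 0"
    and q2: "(\<integral>\<^sup>+t. ennreal ((LINT x|lborel. norm (D (x, t)) powr p) powr (2 * (p - 1) / p)) \<partial>lborel) < \<infinity>"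
  shows "(\<integral>\<^sup>+t. ennreal ((LINT x|lborel. norm (D (x, t)) powr p) powr ((p - 1) / p)) \<partial>lborel) < \<infinity>"
proof -
  define N where "N t = (LINT x|lborel. norm (D (x, t)) powr p)" for t
  have [measurable]: "N \<in> borel_measurable borel" unfolding N_def[abs_def] by measurable
  have "(\<integral>\<^sup>+t. ennreal (N t powr ((p - 1) / p)) \<partial>lborel) \<le> (\<integral>\<^sup>+t. indicator {0<..<T} t + ennreal (N t powr (2 * (p - 1) / p)) \<partial>lborel)"
  proof (rule nn_integral_mono)
    fix t
    show "ennreal (N t powr ((p - 1) / p)) \<le> indicator {0<..<T} t + ennreal (N t powr (2 * (p - 1) / p))"
    proof (cases "t \<in> {0<..<T}")
      case True
      define y where "y = N t powr ((p - 1) / p)"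
      have "N t powr (2 * (p - 1) / p) = y * y"
        by (simp add: y_def powr_add[symmetric] add_divide_distrib[symmetric])
      moreover have "y \<le> 1 + y * y" using zero_le_power2[of "y - 1/2"] by (simp add: power2_eq_square algebra_simps)
      ultimately have "ennreal y \<le> ennreal (1 + N t powr (2 * (p - 1) / p))" by (intro ennreal_leI) simp
      then show ?thesis using True by (simp add: y_def)
    next
      case False
      then show ?thesis using p by (simp add: N_def D0)
    qed
  qed
  also have "\<dots> = (\<integral>\<^sup>+t. indicator {0<..<T} t \<partial>lborel) + (\<integral>\<^sup>+t. ennreal (N t powr (2 * (p - 1) / p)) \<partial>lborel)"
    by (rule nn_integral_add) measurable
  also have "\<dots> < \<infinity>" using q2 by (cases "0 \<le> T") (auto simp: N_def)
  finally show ?thesis by (simp add: N_def)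
qed

text \<open>Pairing with a function that does not depend on time requires the flux norm only to be integrable in
  time.\<close>

lemma flux_pairing:
  fixes D :: "'a::euclidean_space \<times> real \<Rightarrow> 'a" and r :: "'a \<Rightarrow> real"
  assumes p: "1 < p" and D[measurable]: "D \<in> borel_measurable borel" and iD: "AE t in lborel. integrable lborel (\<lambda>x. norm (D (x, t)) powr p)"
    and r[measurable]: "r \<in> borel_measurable borel" and r0: "\<And>x. 0 \<le> r x" and ir: "integrable lborel (\<lambda>x. r x powr p)"
  shows "(\<integral>\<^sup>+z. ennreal (norm (flux p (D z)) * r (fst z)) \<partial>lborel) \<le>
    (\<integral>\<^sup>+t. ennreal ((LINT x|lborel. norm (D (x, t)) powr p) powr ((p - 1) / p)) \<partial>lborel) * ennreal ((LINT x|lborel. r x powr p) powr (1 / p))"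
proof -
  have [measurable]: "(\<lambda>z::'a \<times> real. r (fst z)) \<in> borel_measurable borel"
    by (rule measurable_compose[OF borel_measurable_fst r])
  have "(\<integral>\<^sup>+z. ennreal (norm (flux p (D z)) * r (fst z)) \<partial>lborel)
      = (\<integral>\<^sup>+t. \<integral>\<^sup>+x. ennreal (norm (flux p (D (x, t))) * r x) \<partial>lborel \<partial>lborel)"
    by (subst nn_integral_slices) auto
  also have "\<dots> \<le> (\<integral>\<^sup>+t. ennreal ((LINT x|lborel. norm (D (x, t)) powr p) powr ((p - 1) / p)) * ennreal ((LINT x|lborel. r x powr p) powr (1 / p)) \<partial>lborel)"
  proof (rule nn_integral_mono_AE)
    show "AE t in lborel. (\<integral>\<^sup>+x. ennreal (norm (flux p (D (x, t))) * r x) \<partial>lborel) \<le>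
      ennreal ((LINT x|lborel. norm (D (x, t)) powr p) powr ((p - 1) / p)) * ennreal ((LINT x|lborel. r x powr p) powr (1 / p))"
      using iD
    proof eventually_elim
      case (elim t)
      have "(\<lambda>x. D (x, t)) \<in> borel_measurable borel" by measurable
      from slice_pairing[OF p this r r0 elim ir] show ?case by (simp add: ennreal_mult)
    qed
  qed
  also have "\<dots> = (\<integral>\<^sup>+t. ennreal ((LINT x|lborel. norm (D (x, t)) powr p) powr ((p - 1) / p)) \<partial>lborel) * ennreal ((LINT x|lborel. r x powr p) powr (1 / p))"
    by (rule nn_integral_multc) measurable
  finally show ?thesis .
qed

text \<open>Continuity of translations in time, paired with a function that is only known to be square
  integrable in time with values in $L^p$. The large values of that function are
  absorbed by the square integrability of the flux norm, the bounded part by the continuity of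
  translations in the space of integrable functions.\<close>

lemma flux_translation:
  fixes D :: "'a::euclidean_space \<times> real \<Rightarrow> 'a" and b :: "'a \<times> real \<Rightarrow> real"
  assumes p: "1 < p" and \<Omega>: "bounded \<Omega>" "open \<Omega>"
    and D[measurable]: "D \<in> borel_measurable borel" and D0: "\<And>x t. x \<notin> \<Omega> \<or> t \<notin> {0<..<T} \<Longrightarrow> D (x, t) = 0"
    and iD: "AE t in lborel. integrable lborel (\<lambda>x. norm (D (x, t)) powr p)"
    and q2: "(\<integral>\<^sup>+t. ennreal ((LINT x|lborel. norm (D (x, t)) powr p) powr (2 * (p - 1) / p)) \<partial>lborel) < \<infinity>"
    and b[measurable]: "b \<in> borel_measurable borel" and b0: "\<And>z. 0 \<le> b z"
    and ib: "AE t in lborel. integrable lborel (\<lambda>x. b (x, t) powr p)"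
    and b2: "(\<integral>\<^sup>+t. ennreal ((LINT x|lborel. b (x, t) powr p) powr (2 / p)) \<partial>lborel) < \<infinity>"
    and \<epsilon>: "0 < \<epsilon>"
  shows "\<exists>d>0. \<forall>\<theta>. \<bar>\<theta>\<bar> < d \<longrightarrow> (\<integral>\<^sup>+z. ennreal (norm (flux p (D (z + (0, \<theta>))) - flux p (D z)) * b z) \<partial>lborel) < ennreal \<epsilon>"
proof -
  have [measurable]: "\<Omega> \<in> sets borel" using \<Omega> by auto
  define N where "N t = (LINT x|lborel. norm (D (x, t)) powr p)" for t
  define q where "q t = N t powr ((p - 1) / p)" for t
  have [measurable]: "N \<in> borel_measurable borel" unfolding N_def[abs_def] by measurable
  have q[measurable]: "q \<in> borel_measurable borel" unfolding q_def[abs_def] by measurable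
  have q0: "0 \<le> q t" for t by (simp add: q_def)
  have qq: "N t powr (2 * (p - 1) / p) = (q t)\<^sup>2" for t
    by (simp add: q_def power2_eq_square powr_add[symmetric] add_divide_distrib[symmetric])
  have Qfin: "(\<integral>\<^sup>+t. ennreal ((q t)\<^sup>2) \<partial>lborel) < \<infinity>" using q2 by (simp only: N_def[symmetric] qq)
  then obtain Q where Q: "0 \<le> Q" "(\<integral>\<^sup>+t. ennreal ((q t)\<^sup>2) \<partial>lborel) = ennreal Q"
    by (cases "\<integral>\<^sup>+t. ennreal ((q t)\<^sup>2) \<partial>lborel") auto
  have iF: "integrable lborel (\<lambda>z. flux p (D z))"
  proof (rule integrableI_bounded)
    have i1: "integrable lborel (\<lambda>x. (indicator \<Omega> x :: real) powr p)"
    proof -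
      have "integrable lborel (\<lambda>x. indicator \<Omega> x :: real)"
        using emeasure_bounded_finite[OF \<Omega>(1)] by (intro integrable_real_indicator) auto
      also have "(\<lambda>x. indicator \<Omega> x) = (\<lambda>x. (indicator \<Omega> x :: real) powr p)" by (auto simp: indicator_def)
      finally show ?thesis .
    qed
    have "norm (flux p (D z)) = norm (flux p (D z)) * indicator \<Omega> (fst z)" for z
      using D0[of "fst z" "snd z"] by (cases "fst z \<in> \<Omega>") (auto simp: flux_def)
    then have "(\<integral>\<^sup>+z. ennreal (norm (flux p (D z))) \<partial>lborel) = (\<integral>\<^sup>+z. ennreal (norm (flux p (D z)) * indicator \<Omega> (fst z)) \<partial>lborel)"
      by (intro nn_integral_cong) simp
    also have "\<dots> \<le> (\<integral>\<^sup>+t. ennreal ((LINT x|lborel. norm (D (x, t)) powr p) powr ((p - 1) / p)) \<partial>lborel) * ennreal ((LINT x|lborel. (indicator \<Omega> x :: real) powr p) powr (1 / p))"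
      by (rule flux_pairing[OF p D iD _ _ i1]) auto
    also have "\<dots> < \<infinity>"
      using flux_time_integrable[OF p D _ q2, of T] D0 by (auto simp: ennreal_mult_less_top)
    finally show "(\<integral>\<^sup>+z. ennreal (norm (flux p (D z))) \<partial>lborel) < \<infinity>" .
  qed measurable
  define c where "c M z = b z - min (b z) (real M)" for M :: nat and z
  have c[measurable]: "c M \<in> borel_measurable borel" for M unfolding c_def[abs_def] by measurable
  have c0: "0 \<le> c M z" "c M z \<le> b z" for M z using b0[of z] by (auto simp: c_def min_def)
  have ic: "AE t in lborel. \<forall>M. integrable lborel (\<lambda>x. c M (x, t) powr p)"
    using ib
  proof eventually_elim
    case (elim t)
    show ?case
    proof
      fix M
      show "integrable lborel (\<lambda>x. c M (x, t) powr p)"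
        by (rule Bochner_Integration.integrable_bound[OF elim]) (use c0 p in \<open>auto intro!: AE_I2 powr_mono2\<close>)
    qed
  qed
  define S where "S M t = (LINT x|lborel. c M (x, t) powr p) powr (2 / p)" for M t
  have [measurable]: "S M \<in> borel_measurable borel" for M unfolding S_def[abs_def] by measurable
  have "(\<lambda>M. \<integral>\<^sup>+t. ennreal (S M t) \<partial>lborel) \<longlonglongrightarrow> (\<integral>\<^sup>+t. 0 \<partial>(lborel :: real measure))"
  proof (rule nn_integral_dominated_convergence[OF _ _ _ _ b2])
    show "AE t in lborel. ennreal (S M t) \<le> ennreal ((LINT x|lborel. b (x, t) powr p) powr (2 / p))" for M
      using ib ic
    proof eventually_elim
      case (elim t)
      have "(LINT x|lborel. c M (x, t) powr p) \<le> (LINT x|lborel. b (x, t) powr p)"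
        using elim p c0 by (intro integral_mono powr_mono2) auto
      then show ?case unfolding S_def using p by (intro ennreal_leI powr_mono2) auto
    qed
    show "AE t in lborel. (\<lambda>M. ennreal (S M t)) \<longlonglongrightarrow> 0"
      using ib
    proof eventually_elim
      case (elim t)
      have "(\<lambda>M. LINT x|lborel. c M (x, t) powr p) \<longlonglongrightarrow> (LINT (x::'a)|lborel. (0::real))"
      proof (rule integral_dominated_convergence[OF _ _ elim])
        show "AE x in lborel. (\<lambda>M. c M (x, t) powr p) \<longlonglongrightarrow> 0"
        proof (intro AE_I2)
          fix x
          obtain M0 :: nat where "b (x, t) \<le> real M0" using real_arch_simple by blast
          then have "\<forall>\<^sub>F M in sequentially. c M (x, t) powr p = 0"
            unfolding eventually_sequentially by (intro exI[of _ M0]) (auto simp: c_def min_def)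
          then show "(\<lambda>M. c M (x, t) powr p) \<longlonglongrightarrow> 0" by (rule tendsto_eventually)
        qed
        show "AE x in lborel. norm (c M (x, t) powr p) \<le> b (x, t) powr p" for M
          using c0 p by (auto intro!: AE_I2 powr_mono2)
      qed measurable
      then have "(\<lambda>M. S M t) \<longlonglongrightarrow> 0 powr (2 / p)"
        unfolding S_def using p by (intro tendsto_powr2 tendsto_const) auto
      then have "(\<lambda>M. ennreal (S M t)) \<longlonglongrightarrow> ennreal (0 powr (2 / p))" by (rule tendsto_ennrealI)
      then show ?case by simp
    qed
  qed measurable
  then have Slim: "(\<lambda>M. \<integral>\<^sup>+t. ennreal (S M t) \<partial>lborel) \<longlonglongrightarrow> 0" by simp
  \<comment> \<open>The choice of \<open>\<delta>\<close> makes the contribution of \<open>q\<close> in Young's inequality at most \<open>\<epsilon> / 8\<close> for each of the two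
    times; \<open>M\<close> is then chosen in terms of \<open>\<delta>\<close>.\<close>
  define \<delta> where "\<delta> = \<epsilon> / (8 * (Q + 1))"
  have \<delta>: "0 < \<delta>" "2 * \<delta> * Q \<le> \<epsilon> / 4"
  proof -
    show "0 < \<delta>" using \<epsilon> Q(1) by (simp add: \<delta>_def)
    have "2 * \<delta> * Q = \<epsilon> / 4 * (Q / (Q + 1))" using Q(1) by (simp add: \<delta>_def field_simps)
    also have "\<dots> \<le> \<epsilon> / 4 * 1" using Q(1) \<epsilon> by (intro mult_left_mono) auto
    finally show "2 * \<delta> * Q \<le> \<epsilon> / 4" by simp
  qed
  have "\<forall>\<^sub>F M in sequentially. (\<integral>\<^sup>+t. ennreal (S M t) \<partial>lborel) < ennreal (\<epsilon> * \<delta> / 8)"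
    using \<epsilon> \<delta> by (intro order_tendstoD(2)[OF Slim]) simp
  then obtain M where M: "(\<integral>\<^sup>+t. ennreal (S M t) \<partial>lborel) < ennreal (\<epsilon> * \<delta> / 8)" by (auto simp: eventually_sequentially)
  obtain d where d: "d > 0" "\<And>h. norm h < d \<Longrightarrow> (LINT z|lborel. norm (flux p (D (z + h)) - flux p (D z))) < \<epsilon> / (4 * (real M + 1))"
    using L1_translation[OF iF, of "\<epsilon> / (4 * (real M + 1))"] \<epsilon> by auto
  have pair: "(\<integral>\<^sup>+z. ennreal (norm (flux p (D (z + (0, \<theta>)))) * c M z) \<partial>lborel) \<le> ennreal (\<delta> * Q + \<epsilon> / 8)" for \<theta>
  proof -
    have [measurable]: "(\<lambda>z::'a \<times> real. D (z + (0, \<theta>))) \<in> borel_measurable borel" by measurable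
    have "(\<integral>\<^sup>+z. ennreal (norm (flux p (D (z + (0, \<theta>)))) * c M z) \<partial>lborel)
        = (\<integral>\<^sup>+t. \<integral>\<^sup>+x. ennreal (norm (flux p (D (x, t + \<theta>))) * c M (x, t)) \<partial>lborel \<partial>lborel)"
      by (subst nn_integral_slices) auto
    also have "\<dots> \<le> (\<integral>\<^sup>+t. ennreal (\<delta> * (q (t + \<theta>))\<^sup>2) + ennreal (S M t / \<delta>) \<partial>lborel)"
    proof (rule nn_integral_mono_AE)
      show "AE t in lborel. (\<integral>\<^sup>+x. ennreal (norm (flux p (D (x, t + \<theta>))) * c M (x, t)) \<partial>lborel) \<le> ennreal (\<delta> * (q (t + \<theta>))\<^sup>2) + ennreal (S M t / \<delta>)"
        using AE_translate[OF iD, of \<theta>] ic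
      proof eventually_elim
        case (elim t)
        have m: "(\<lambda>x. D (x, t + \<theta>)) \<in> borel_measurable borel" "(\<lambda>x. c M (x, t)) \<in> borel_measurable borel" by measurable
        define y where "y = (LINT x|lborel. c M (x, t) powr p) powr (1 / p)"
        have y: "y\<^sup>2 = S M t"
          using p by (simp add: y_def S_def power2_eq_square powr_add[symmetric] add_divide_distrib[symmetric])
        have "(\<integral>\<^sup>+x. ennreal (norm (flux p (D (x, t + \<theta>))) * c M (x, t)) \<partial>lborel) \<le> ennreal (q (t + \<theta>) * y)"
          using slice_pairing[OF p m c0(1)] elim by (simp add: q_def N_def y_def)
        also have "q (t + \<theta>) * y \<le> \<delta> * (q (t + \<theta>))\<^sup>2 + y\<^sup>2 / \<delta>"
        proof -
          have "0 \<le> (\<delta> * q (t + \<theta>) - y / 2)\<^sup>2" by simp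
          then have "\<delta> * (q (t + \<theta>) * y) \<le> \<delta> * (\<delta> * (q (t + \<theta>))\<^sup>2) + y\<^sup>2 / 4"
            by (simp add: power2_diff power_mult_distrib power2_eq_square algebra_simps)
          also have "\<dots> \<le> \<delta> * (\<delta> * (q (t + \<theta>))\<^sup>2 + y\<^sup>2 / \<delta>)" using \<delta>(1) by (simp add: algebra_simps)
          finally show ?thesis using \<delta>(1) by (simp add: mult_le_cancel_left_pos)
        qed
        finally have "(\<integral>\<^sup>+x. ennreal (norm (flux p (D (x, t + \<theta>))) * c M (x, t)) \<partial>lborel) \<le> ennreal (\<delta> * (q (t + \<theta>))\<^sup>2 + S M t / \<delta>)"
          by (simp add: ennreal_leI y)
        moreover have "0 \<le> S M t" by (simp add: S_def)
        ultimately show ?case using \<delta>(1) by (subst ennreal_plus[symmetric]) auto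
      qed
    qed
    also have "\<dots> = (\<integral>\<^sup>+t. ennreal (\<delta> * (q (t + \<theta>))\<^sup>2) \<partial>lborel) + (\<integral>\<^sup>+t. ennreal (S M t / \<delta>) \<partial>lborel)"
      by (rule nn_integral_add) measurable
    also have "(\<integral>\<^sup>+t. ennreal (\<delta> * (q (t + \<theta>))\<^sup>2) \<partial>lborel) = (\<integral>\<^sup>+t. ennreal (\<delta> * (q t)\<^sup>2) \<partial>lborel)"
      by (rule nn_integral_translate[of "\<lambda>t. ennreal (\<delta> * (q t)\<^sup>2)"]) measurable
    also have "\<dots> = ennreal \<delta> * (\<integral>\<^sup>+t. ennreal ((q t)\<^sup>2) \<partial>lborel)"
      using \<delta>(1) by (subst nn_integral_cmult[symmetric]) (auto simp: ennreal_mult)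
    also have "\<dots> = ennreal (\<delta> * Q)" using \<delta>(1) Q by (simp add: ennreal_mult)
    also have "(\<integral>\<^sup>+t. ennreal (S M t / \<delta>) \<partial>lborel) = ennreal (1 / \<delta>) * (\<integral>\<^sup>+t. ennreal (S M t) \<partial>lborel)"
      using \<delta>(1) by (subst nn_integral_cmult[symmetric]) (auto simp: S_def simp flip: ennreal_mult)
    also have "\<dots> \<le> ennreal (1 / \<delta>) * ennreal (\<epsilon> * \<delta> / 8)" using M by (intro mult_left_mono) auto
    also have "\<dots> = ennreal (\<epsilon> / 8)" using \<delta>(1) \<epsilon> by (simp flip: ennreal_mult)
    finally show ?thesis using \<delta>(1) Q(1) \<epsilon> by (simp add: add_left_mono flip: ennreal_plus)
  qed
  have "(\<integral>\<^sup>+z. ennreal (norm (flux p (D (z + (0, \<theta>))) - flux p (D z)) * b z) \<partial>lborel) < ennreal \<epsilon>" if \<theta>: "\<bar>\<theta>\<bar> < d" for \<theta>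
  proof -
    have [measurable]: "(\<lambda>z::'a \<times> real. D (z + (0, \<theta>))) \<in> borel_measurable borel" by measurable
    have iFt: "integrable lborel (\<lambda>z. flux p (D (z + (0, \<theta>))))" by (rule integrable_translate[OF iF])
    have "(\<integral>\<^sup>+z. ennreal (norm (flux p (D (z + (0, \<theta>))) - flux p (D z)) * b z) \<partial>lborel)
      \<le> (\<integral>\<^sup>+z. (ennreal (norm (flux p (D (z + (0, \<theta>)))) * c M z) + ennreal (norm (flux p (D (z + (0, 0)))) * c M z))
          + ennreal (norm (flux p (D (z + (0, \<theta>))) - flux p (D z)) * real M) \<partial>lborel)"
    proof (rule nn_integral_mono)
      fix z :: "'a \<times> real"
      let ?n = "norm (flux p (D (z + (0, \<theta>))) - flux p (D z))"
      have "?n * b z = ?n * c M z + ?n * min (b z) (real M)" by (simp add: c_def algebra_simps)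
      also have "\<dots> \<le> (norm (flux p (D (z + (0, \<theta>)))) + norm (flux p (D z))) * c M z + ?n * real M"
        using c0 by (intro add_mono mult_right_mono mult_left_mono norm_triangle_ineq4) auto
      also have "\<dots> = (norm (flux p (D (z + (0, \<theta>)))) * c M z + norm (flux p (D (z + (0, 0)))) * c M z) + ?n * real M"
        by (simp add: distrib_right flip: zero_prod_def)
      finally have "ennreal (?n * b z) \<le> ennreal ((norm (flux p (D (z + (0, \<theta>)))) * c M z + norm (flux p (D (z + (0, 0)))) * c M z) + ?n * real M)"
        by (rule ennreal_leI)
      also have "\<dots> = (ennreal (norm (flux p (D (z + (0, \<theta>)))) * c M z) + ennreal (norm (flux p (D (z + (0, 0)))) * c M z)) + ennreal (?n * real M)"
        using c0 by (subst ennreal_plus; (subst ennreal_plus)?) auto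
      finally show "ennreal (?n * b z) \<le> (ennreal (norm (flux p (D (z + (0, \<theta>)))) * c M z) + ennreal (norm (flux p (D (z + (0, 0)))) * c M z)) + ennreal (?n * real M)" .
    qed
    also have "\<dots> = ((\<integral>\<^sup>+z. ennreal (norm (flux p (D (z + (0, \<theta>)))) * c M z) \<partial>lborel) + (\<integral>\<^sup>+z. ennreal (norm (flux p (D (z + (0, 0)))) * c M z) \<partial>lborel))
       + (\<integral>\<^sup>+z. ennreal (norm (flux p (D (z + (0, \<theta>))) - flux p (D z)) * real M) \<partial>lborel)"
      by (subst nn_integral_add, measurable, subst nn_integral_add, measurable)
    also have "(\<integral>\<^sup>+z. ennreal (norm (flux p (D (z + (0, \<theta>))) - flux p (D z)) * real M) \<partial>lborel)
       = ennreal ((LINT z|lborel. norm (flux p (D (z + (0, \<theta>))) - flux p (D z))) * real M)"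
      using iF iFt by (subst nn_integral_eq_integral) auto
    also have "\<dots> \<le> ennreal (\<epsilon> / 4)"
    proof (rule ennreal_leI)
      have "(LINT z|lborel. norm (flux p (D (z + (0, \<theta>))) - flux p (D z))) * real M \<le> \<epsilon> / (4 * (real M + 1)) * real M"
        using d(2)[of "(0, \<theta>)"] \<theta> by (intro mult_right_mono) (auto simp: norm_Pair)
      also have "\<dots> = \<epsilon> / 4 * (real M / (real M + 1))" by simp
      also have "\<dots> \<le> \<epsilon> / 4 * 1" using \<epsilon> by (intro mult_left_mono) auto
      finally show "(LINT z|lborel. norm (flux p (D (z + (0, \<theta>))) - flux p (D z))) * real M \<le> \<epsilon> / 4" by simp
    qed
    finally have "(\<integral>\<^sup>+z. ennreal (norm (flux p (D (z + (0, \<theta>))) - flux p (D z)) * b z) \<partial>lborel)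
       \<le> (ennreal (\<delta> * Q + \<epsilon> / 8) + ennreal (\<delta> * Q + \<epsilon> / 8)) + ennreal (\<epsilon> / 4)"
      using pair[of \<theta>] pair[of 0] by (meson add_mono order_refl order_trans)
    also have "\<dots> = ennreal (2 * \<delta> * Q + \<epsilon> / 2)" using \<delta>(1) Q(1) \<epsilon> by (simp flip: ennreal_plus)
    also have "\<dots> < ennreal \<epsilon>" using \<delta>(1,2) Q(1) \<epsilon> by (intro ennreal_lessI) auto
    finally show ?thesis .
  qed
  then show ?thesis using d(1) by blast
qed

section \<open>The comparison principle\<close>

lemma weak_deriv_diff:
  fixes f g :: "'a::euclidean_space \<Rightarrow> real"
  assumes f: "weak_deriv U v f f'" and g: "weak_deriv U v g g'"
  shows "weak_deriv U v (\<lambda>x. f x - g x) (\<lambda>x. f' x - g' x)"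
  unfolding weak_deriv_def
proof (intro conjI allI impI)
  fix C assume "compact C \<and> C \<subseteq> U"
  then show "set_integrable lborel C (\<lambda>x. f x - g x)" "set_integrable lborel C (\<lambda>x. f' x - g' x)"
    using f g unfolding weak_deriv_def by (auto intro: set_integral_diff)
next
  fix \<zeta> assume z: "test_smooth U \<zeta>"
  obtain K where K: "compact K" "K \<subseteq> U" "\<And>x. x \<notin> K \<Longrightarrow> \<zeta> x = 0"
    using test_smooth_support[OF z] by blast
  obtain B where B: "0 \<le> B" "\<And>x. \<bar>\<zeta> x\<bar> \<le> B" "\<And>x w. norm w \<le> 1 \<Longrightarrow> \<bar>frechet_derivative \<zeta> (at x) w\<bar> \<le> B"
    using test_smooth_bounded[OF z] by blast
  have sm: "smooth \<zeta>" by (rule test_smooth_smooth[OF z])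
  let ?D = "\<lambda>x. frechet_derivative \<zeta> (at x) v"
  have D0: "?D x = 0" if "x \<notin> K" for x
    by (rule frechet_derivative_zero_outside[OF compact_imp_closed[OF K(1)] K(3) that])
  have cD: "continuous_on UNIV \<zeta>" "continuous_on UNIV ?D"
    using sm by (auto intro: smooth_continuous smooth_deriv)
  have int: "set_integrable lborel U (\<lambda>x. h x * k x)"
    if h: "set_integrable lborel K h" and k: "continuous_on UNIV k" "\<And>x. x \<notin> K \<Longrightarrow> k x = 0" for h k :: "'a \<Rightarrow> real"
  proof -
    have "bounded (k ` K)" using continuous_on_subset[OF k(1)] K(1) by (auto intro!: compact_imp_bounded compact_continuous_image)
    then obtain M where M: "\<And>x. x \<in> K \<Longrightarrow> \<bar>k x\<bar> \<le> M" unfolding bounded_iff by auto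
    have [measurable]: "k \<in> borel_measurable borel" using k(1) by (rule borel_measurable_continuous_onI)
    have "integrable lborel (\<lambda>x. (indicator K x *\<^sub>R h x) * k x)"
    proof (rule Bochner_Integration.integrable_bound)
      show "integrable lborel (\<lambda>x. (indicator K x *\<^sub>R h x) * \<bar>M\<bar>)" using h by (simp add: set_integrable_def)
      show "(\<lambda>x. (indicator K x *\<^sub>R h x) * k x) \<in> borel_measurable lborel"
        using h unfolding set_integrable_def by (intro borel_measurable_times) auto
      show "AE x in lborel. norm ((indicator K x *\<^sub>R h x) * k x) \<le> norm ((indicator K x *\<^sub>R h x) * \<bar>M\<bar>)"
      proof (intro AE_I2)
        fix x show "norm ((indicator K x *\<^sub>R h x) * k x) \<le> norm ((indicator K x *\<^sub>R h x) * \<bar>M\<bar>)"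
          using M[of x] by (cases "x \<in> K") (auto simp: abs_mult intro!: mult_left_mono)
      qed
    qed
    also have "(\<lambda>x. (indicator K x *\<^sub>R h x) * k x) = (\<lambda>x. indicator U x *\<^sub>R (h x * k x))"
      using K(2) k(2) by (auto simp: fun_eq_iff indicator_def)
    finally show ?thesis by (simp add: set_integrable_def)
  qed
  have iK: "set_integrable lborel K f" "set_integrable lborel K g" "set_integrable lborel K f'" "set_integrable lborel K g'"
    using f g K(1,2) unfolding weak_deriv_def by auto
  have "(LINT x:U|lborel. (f x - g x) * ?D x) = (LINT x:U|lborel. f x * ?D x) - (LINT x:U|lborel. g x * ?D x)"
    using set_integral_diff(2)[OF int[OF iK(1) cD(2) D0] int[OF iK(2) cD(2) D0]] by (simp add: left_diff_distrib)
  moreover have "(LINT x:U|lborel. (f' x - g' x) * \<zeta> x) = (LINT x:U|lborel. f' x * \<zeta> x) - (LINT x:U|lborel. g' x * \<zeta> x)"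
    using set_integral_diff(2)[OF int[OF iK(3) cD(1) K(3)] int[OF iK(4) cD(1) K(3)]] by (simp add: left_diff_distrib)
  moreover have "(LINT x:U|lborel. f x * ?D x) = - (LINT x:U|lborel. f' x * \<zeta> x)"
    "(LINT x:U|lborel. g x * ?D x) = - (LINT x:U|lborel. g' x * \<zeta> x)"
    using f g z unfolding weak_deriv_def by blast+
  ultimately show "(LINT x:U|lborel. (f x - g x) * ?D x) = - (LINT x:U|lborel. (f' x - g' x) * \<zeta> x)" by simp
qed

text \<open>The zero-boundary condition on the positive part speaks of an unspecified weak gradient \<open>D\<close>; this
  identifies it where it matters.\<close>

lemma W1p_0_positive_part_gradient:
  fixes \<Omega> :: "'a::euclidean_space set"
  assumes \<Omega>: "open \<Omega>" and 1: "W1p p \<Omega> w1 D1" and 2: "W1p p \<Omega> w2 D2"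
    and v: "W1p_0 p \<Omega> (\<lambda>x. max (w1 x - w2 x) 0) D"
  shows "AE x in lborel. x \<in> \<Omega> \<longrightarrow> 0 < w1 x - w2 x \<longrightarrow> D x = D1 x - D2 x"
proof -
  have "AE x in lborel. x \<in> \<Omega> \<longrightarrow> 0 < w1 x - w2 x \<longrightarrow> D x \<bullet> i = D1 x \<bullet> i - D2 x \<bullet> i" if i: "i \<in> Basis" for i
  proof (rule weak_deriv_positive_part[OF \<Omega>])
    show "weak_deriv \<Omega> i (\<lambda>x. w1 x - w2 x) (\<lambda>x. D1 x \<bullet> i - D2 x \<bullet> i)"
      using 1 2 i by (intro weak_deriv_diff) (auto simp: W1p_def)
    show "weak_deriv \<Omega> i (\<lambda>x. max (w1 x - w2 x) 0) (\<lambda>x. D x \<bullet> i)"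
      using v i by (auto simp: W1p_0_def W1p_def)
  qed
  then have "AE x in lborel. \<forall>i\<in>Basis. x \<in> \<Omega> \<longrightarrow> 0 < w1 x - w2 x \<longrightarrow> D x \<bullet> i = D1 x \<bullet> i - D2 x \<bullet> i"
    by (intro AE_finite_allI finite_Basis)
  then show ?thesis
    by eventually_elim (auto intro: euclidean_eqI simp: inner_diff_left)
qed

lemma AE_fst:
  fixes P :: "'a::euclidean_space \<Rightarrow> bool"
  assumes "AE x in lborel. P x" shows "AE z in (lborel :: ('a \<times> real) measure). P (fst z)"
proof -
  obtain N where N: "N \<in> null_sets lborel" "{x. \<not> P x} \<subseteq> N"
    using assms by (auto elim!: AE_E simp: null_sets_def)
  have "emeasure (lborel \<Otimes>\<^sub>M lborel) (N \<times> (UNIV :: real set)) = emeasure lborel N * emeasure lborel (UNIV :: real set)"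
    using N(1) by (intro lborel.emeasure_pair_measure_Times) auto
  then have "emeasure (lborel :: ('a \<times> real) measure) (N \<times> UNIV) = 0" using N(1) unfolding lborel_prod by auto
  moreover have "N \<times> (UNIV :: real set) \<in> sets borel" using N(1) by (intro borel_Times) auto
  ultimately have "N \<times> (UNIV :: real set) \<in> null_sets lborel" by (simp add: null_sets_def)
  then have "AE z in lborel. z \<notin> N \<times> (UNIV :: real set)" by (rule AE_not_in)
  then show ?thesis by eventually_elim (use N(2) in \<open>auto simp: mem_Times_iff\<close>)
qed

lemma AE_slice_integrable:
  fixes f :: "'a::euclidean_space \<times> real \<Rightarrow> real"
  assumes "integrable lborel f" shows "AE t in lborel. integrable lborel (\<lambda>x. f (x, t))"
proof -
  have [measurable]: "f \<in> borel_measurable borel" using assms by auto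
  have "(\<integral>\<^sup>+t. \<integral>\<^sup>+x. ennreal (norm (f (x, t))) \<partial>lborel \<partial>lborel) = (\<integral>\<^sup>+z. ennreal (norm (f z)) \<partial>lborel)"
    by (rule nn_integral_slices[symmetric]) measurable
  also have "\<dots> \<noteq> \<infinity>" using assms by (auto simp: integrable_iff_bounded)
  finally have "AE t in lborel. (\<integral>\<^sup>+x. ennreal (norm (f (x, t))) \<partial>lborel) \<noteq> \<infinity>"
    by (intro nn_integral_PInf_AE) measurable
  then show ?thesis
    by eventually_elim (auto intro!: integrableI_bounded simp: less_top[symmetric])
qed

text \<open>\<open>ennreal\<close> discards the negative parts on both sides.\<close>

lemma integral_le_nn_integral:
  assumes "integrable M (g :: _ \<Rightarrow> real)" shows "ennreal (LINT x|M. g x) \<le> (\<integral>\<^sup>+x. ennreal (g x) \<partial>M)"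
proof -
  have i: "integrable M (\<lambda>x. max (g x) 0)" using assms by auto
  have "ennreal (LINT x|M. g x) \<le> ennreal (LINT x|M. max (g x) 0)"
    using assms i by (intro ennreal_leI integral_mono) auto
  also have "\<dots> = (\<integral>\<^sup>+x. ennreal (max (g x) 0) \<partial>M)" by (rule nn_integral_eq_integral[symmetric, OF i]) simp
  also have "\<dots> = (\<integral>\<^sup>+x. ennreal (g x) \<partial>M)" by (intro nn_integral_cong) (auto simp: max_def ennreal_neg)
  finally show ?thesis .
qed

lemma difference_inequality:
  fixes \<Omega> :: "'a::euclidean_space set" and W1 W2 \<beta>1 \<beta>2 :: "'a \<times> real \<Rightarrow> real" and D1 D2 :: "'a \<times> real \<Rightarrow> 'a"
  assumes S1: "solution_data (\<le>) p \<Omega> T K W1 D1 \<beta>1" and S2: "solution_data (\<ge>) p \<Omega> T K W2 D2 \<beta>2"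
    and \<psi>: "C1_test \<Omega> \<psi> D\<psi>" and st: "0 \<le> s" "s < t" "t \<le> T"
  defines "H \<equiv> \<lambda>z. indicator {s<..<t} (snd z) * ((flux p (D1 z) - flux p (D2 z)) \<bullet> D\<psi> (fst z) + (\<beta>1 z - \<beta>2 z) * \<psi> (fst z))"
  shows "integrable lborel (\<lambda>x. (W1 (x, s) - W2 (x, s)) * \<psi> x)" "integrable lborel (\<lambda>x. (W1 (x, t) - W2 (x, t)) * \<psi> x)"
    "integrable lborel H"
    "(LINT x|lborel. (W1 (x, t) - W2 (x, t)) * \<psi> x) - (LINT x|lborel. (W1 (x, s) - W2 (x, s)) * \<psi> x) + (LINT z|lborel. H z) \<le> 0"
proof -
  have a: "integrable lborel (\<lambda>x. W1 (x, s) * \<psi> x) \<and> integrable lborel (\<lambda>x. W1 (x, t) * \<psi> x) \<and>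
       integrable lborel (\<lambda>z. indicator {s<..<t} (snd z) * (flux p (D1 z) \<bullet> D\<psi> (fst z) + \<beta>1 z * \<psi> (fst z))) \<and>
       (LINT x|lborel. W1 (x, t) * \<psi> x) - (LINT x|lborel. W1 (x, s) * \<psi> x)
         + (LINT z|lborel. indicator {s<..<t} (snd z) * (flux p (D1 z) \<bullet> D\<psi> (fst z) + \<beta>1 z * \<psi> (fst z))) \<le> 0"
    using S1 \<psi> st unfolding solution_data_def by blast
  have c: "integrable lborel (\<lambda>x. W2 (x, s) * \<psi> x) \<and> integrable lborel (\<lambda>x. W2 (x, t) * \<psi> x) \<and>
       integrable lborel (\<lambda>z. indicator {s<..<t} (snd z) * (flux p (D2 z) \<bullet> D\<psi> (fst z) + \<beta>2 z * \<psi> (fst z))) \<and>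
       (LINT x|lborel. W2 (x, t) * \<psi> x) - (LINT x|lborel. W2 (x, s) * \<psi> x)
         + (LINT z|lborel. indicator {s<..<t} (snd z) * (flux p (D2 z) \<bullet> D\<psi> (fst z) + \<beta>2 z * \<psi> (fst z))) \<ge> 0"
    using S2 \<psi> st unfolding solution_data_def by blast
  have Heq: "H z = indicator {s<..<t} (snd z) * (flux p (D1 z) \<bullet> D\<psi> (fst z) + \<beta>1 z * \<psi> (fst z))
       - indicator {s<..<t} (snd z) * (flux p (D2 z) \<bullet> D\<psi> (fst z) + \<beta>2 z * \<psi> (fst z))" for z
    by (simp add: H_def inner_diff_left algebra_simps)
  show "integrable lborel H" unfolding Heq[abs_def] using a c by (intro Bochner_Integration.integrable_diff) auto
  have H: "(LINT z|lborel. H z) = (LINT z|lborel. indicator {s<..<t} (snd z) * (flux p (D1 z) \<bullet> D\<psi> (fst z) + \<beta>1 z * \<psi> (fst z)))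
       - (LINT z|lborel. indicator {s<..<t} (snd z) * (flux p (D2 z) \<bullet> D\<psi> (fst z) + \<beta>2 z * \<psi> (fst z)))"
    unfolding Heq using a c by (intro Bochner_Integration.integral_diff) auto
  have ut: "(LINT x|lborel. (W1 (x, t) - W2 (x, t)) * \<psi> x) = (LINT x|lborel. W1 (x, t) * \<psi> x) - (LINT x|lborel. W2 (x, t) * \<psi> x)"
    unfolding left_diff_distrib using a c by (intro Bochner_Integration.integral_diff) auto
  have us: "(LINT x|lborel. (W1 (x, s) - W2 (x, s)) * \<psi> x) = (LINT x|lborel. W1 (x, s) * \<psi> x) - (LINT x|lborel. W2 (x, s) * \<psi> x)"
    unfolding left_diff_distrib using a c by (intro Bochner_Integration.integral_diff) auto
  show "integrable lborel (\<lambda>x. (W1 (x, s) - W2 (x, s)) * \<psi> x)" "integrable lborel (\<lambda>x. (W1 (x, t) - W2 (x, t)) * \<psi> x)"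
    unfolding left_diff_distrib using a c by auto
  show "(LINT x|lborel. (W1 (x, t) - W2 (x, t)) * \<psi> x) - (LINT x|lborel. (W1 (x, s) - W2 (x, s)) * \<psi> x) + (LINT z|lborel. H z) \<le> 0"
    unfolding H ut us using a c by linarith
qed

lemma reaction_difference_integrable:
  assumes "solution_data R1 p \<Omega> T K W1 D1 \<beta>1" "solution_data R2 p \<Omega> T K W2 D2 \<beta>2"
  shows "integrable lborel (\<lambda>z. \<beta>1 z - \<beta>2 z)"
proof -
  have [measurable]: "\<beta>1 \<in> borel_measurable borel" "\<beta>2 \<in> borel_measurable borel"
    and iW: "integrable lborel W1" "integrable lborel W2"
    and bK: "\<And>z. \<bar>\<beta>1 z\<bar> \<le> K * \<bar>W1 z\<bar>" "\<And>z. \<bar>\<beta>2 z\<bar> \<le> K * \<bar>W2 z\<bar>"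
    using assms unfolding solution_data_def by blast+
  show ?thesis
  proof (rule Bochner_Integration.integrable_bound)
    show "integrable lborel (\<lambda>z. K * \<bar>W1 z\<bar> + K * \<bar>W2 z\<bar>)" using iW by simp
    show "AE z in lborel. norm (\<beta>1 z - \<beta>2 z) \<le> norm (K * \<bar>W1 z\<bar> + K * \<bar>W2 z\<bar>)"
    proof (intro AE_I2)
      fix z show "norm (\<beta>1 z - \<beta>2 z) \<le> norm (K * \<bar>W1 z\<bar> + K * \<bar>W2 z\<bar>)" using bK[of z] by simp
    qed
  qed measurable
qed

text \<open>The difference \<open>W1 - W2\<close> is tested with \<open>trunc (W1 - W2)\<close> frozen at the later time of a short
  interval. Convexity of \<open>prim\<close> turns the time difference into a difference of energies.\<close>

lemma frozen_test_inequality: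
  fixes \<Omega> :: "'a::euclidean_space set" and W1 W2 \<beta>1 \<beta>2 :: "'a \<times> real \<Rightarrow> real" and D1 D2 :: "'a \<times> real \<Rightarrow> 'a"
  assumes p: "1 < p" and \<Omega>: "bounded \<Omega>" "open \<Omega>"
    and S1: "solution_data (\<le>) p \<Omega> T K W1 D1 \<beta>1" and S2: "solution_data (\<ge>) p \<Omega> T K W2 D2 \<beta>2"
    and init: "AE x in lborel. x \<in> \<Omega> \<longrightarrow> W1 (x, 0) \<le> W2 (x, 0)"
    and s: "0 \<le> s" "s < t" "t \<le> T" "0 < s \<Longrightarrow> integrable lborel (\<lambda>x. W1 (x, s) - W2 (x, s))"
    and it: "integrable lborel (\<lambda>x. W1 (x, t) - W2 (x, t))"
    and Wt: "W1p p \<Omega> (\<lambda>x. W1 (x, t)) (\<lambda>x. D1 (x, t))" "W1p p \<Omega> (\<lambda>x. W2 (x, t)) (\<lambda>x. D2 (x, t))"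
    and v: "W1p_0 p \<Omega> (\<lambda>x. max (W1 (x, t) - W2 (x, t)) 0) Dv"
  defines "u \<equiv> \<lambda>z. W1 z - W2 z"
    and "L \<equiv> \<lambda>z. (flux p (D1 z) - flux p (D2 z)) \<bullet> (trunc' (W1 (fst z, t) - W2 (fst z, t)) *\<^sub>R (D1 (fst z, t) - D2 (fst z, t)))
               + (\<beta>1 z - \<beta>2 z) * trunc (W1 (fst z, t) - W2 (fst z, t))"
  shows "integrable lborel (\<lambda>z. indicator {s<..<t} (snd z) * L z)"
    "(LINT x|lborel. prim (u (x, t))) - (if s = 0 then 0 else LINT x|lborel. prim (u (x, s)))
      + (LINT z|lborel. indicator {s<..<t} (snd z) * L z) \<le> 0"
proof -
  have m[measurable]: "W1 \<in> borel_measurable borel" "D1 \<in> borel_measurable borel" "\<beta>1 \<in> borel_measurable borel"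
     "W2 \<in> borel_measurable borel" "D2 \<in> borel_measurable borel" "\<beta>2 \<in> borel_measurable borel"
     and z1: "\<And>x t. x \<notin> \<Omega> \<or> t \<notin> {0..T} \<Longrightarrow> W1 (x, t) = 0" "\<And>x t. x \<notin> \<Omega> \<or> t \<notin> {0<..<T} \<Longrightarrow> D1 (x, t) = 0 \<and> \<beta>1 (x, t) = 0"
     and z2: "\<And>x t. x \<notin> \<Omega> \<or> t \<notin> {0..T} \<Longrightarrow> W2 (x, t) = 0" "\<And>x t. x \<notin> \<Omega> \<or> t \<notin> {0<..<T} \<Longrightarrow> D2 (x, t) = 0 \<and> \<beta>2 (x, t) = 0"
     and iD: "AE t in lborel. integrable lborel (\<lambda>x. norm (D1 (x, t)) powr p)" "AE t in lborel. integrable lborel (\<lambda>x. norm (D2 (x, t)) powr p)"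
     and q2: "(\<integral>\<^sup>+t. ennreal ((LINT x|lborel. norm (D1 (x, t)) powr p) powr (2 * (p - 1) / p)) \<partial>lborel) < \<infinity>"
        "(\<integral>\<^sup>+t. ennreal ((LINT x|lborel. norm (D2 (x, t)) powr p) powr (2 * (p - 1) / p)) \<partial>lborel) < \<infinity>"
    using S1 S2 unfolding solution_data_def by blast+
  have um[measurable]: "u \<in> borel_measurable borel" unfolding u_def by measurable
  define A where "A z = flux p (D1 z) - flux p (D2 z)" for z
  define \<beta> where "\<beta> z = \<beta>1 z - \<beta>2 z" for z
  have [measurable]: "A \<in> borel_measurable borel" "\<beta> \<in> borel_measurable borel"
    unfolding A_def[abs_def] \<beta>_def[abs_def] by measurable
  have u0: "u (x, r) = 0" if "x \<notin> \<Omega>" for x r using that z1 z2 by (simp add: u_def)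
  have \<beta>0: "\<beta> z = 0" if "fst z \<notin> \<Omega>" for z using that z1(2)[of "fst z" "snd z"] z2(2)[of "fst z" "snd z"] by (simp add: \<beta>_def)
  have i\<beta>: "integrable lborel \<beta>"
    unfolding \<beta>_def[abs_def] by (rule reaction_difference_integrable[OF S1 S2])
  define h where "h x = trunc (u (x, t))" for x
  define b where "b x = trunc' (u (x, t)) *\<^sub>R (D1 (x, t) - D2 (x, t))" for x
  have hb[measurable]: "h \<in> borel_measurable borel" "b \<in> borel_measurable borel"
    unfolding h_def[abs_def] b_def[abs_def] by measurable
  have hbz[measurable]: "(\<lambda>z::'a \<times> real. h (fst z)) \<in> borel_measurable borel" "(\<lambda>z::'a \<times> real. b (fst z)) \<in> borel_measurable borel"
    by (rule measurable_compose[OF borel_measurable_fst hb(1)] measurable_compose[OF borel_measurable_fst hb(2)])+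
  have ind[measurable]: "(\<lambda>z::'a \<times> real. indicator {s<..<t} (snd z) :: real) \<in> borel_measurable borel"
    by (rule measurable_compose[OF borel_measurable_snd]) measurable
  have Leq: "L z = A z \<bullet> b (fst z) + \<beta> z * h (fst z)" for z
    by (simp add: L_def A_def \<beta>_def b_def h_def u_def)
  obtain \<zeta> where \<zeta>: "\<And>k. test_smooth \<Omega> (\<zeta> k)"
    "AE x in lborel. x \<in> \<Omega> \<longrightarrow> (\<lambda>k. trunc (\<zeta> k x)) \<longlonglongrightarrow> trunc (max (W1 (x, t) - W2 (x, t)) 0)"
    "\<And>k. integrable lborel (\<lambda>x. norm (trunc' (\<zeta> k x) *\<^sub>R gradient (\<zeta> k) x - indicator \<Omega> x *\<^sub>R (trunc' (max (W1 (x, t) - W2 (x, t)) 0) *\<^sub>R Dv x)) powr p)"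
    "(\<lambda>k. LINT x|lborel. norm (trunc' (\<zeta> k x) *\<^sub>R gradient (\<zeta> k) x - indicator \<Omega> x *\<^sub>R (trunc' (max (W1 (x, t) - W2 (x, t)) 0) *\<^sub>R Dv x)) powr p) \<longlonglongrightarrow> 0"
    using W1p_0_trunc_approx[OF p \<Omega> v] by blast
  define \<psi> where "\<psi> k x = trunc (\<zeta> k x)" for k x
  define D\<psi> where "D\<psi> k x = trunc' (\<zeta> k x) *\<^sub>R gradient (\<zeta> k) x" for k x
  have C1: "C1_test \<Omega> (\<psi> k) (D\<psi> k)" for k
    unfolding \<psi>_def[abs_def] D\<psi>_def[abs_def] by (rule C1_test_trunc[OF \<zeta>(1)])
  have \<psi>b: "0 \<le> \<psi> k x" "\<psi> k x \<le> 1" for k x by (auto simp: \<psi>_def trunc_bounds)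
  have [measurable]: "\<psi> k \<in> borel_measurable borel" "D\<psi> k \<in> borel_measurable borel" for k
    using C1_test_continuous[OF C1] C1[of k] by (auto simp: C1_test_def intro: borel_measurable_continuous_onI)
  have \<psi>z[measurable]: "(\<lambda>z::'a \<times> real. \<psi> k (fst z)) \<in> borel_measurable borel" "(\<lambda>z::'a \<times> real. D\<psi> k (fst z)) \<in> borel_measurable borel" for k
    by (rule measurable_compose[OF borel_measurable_fst]; measurable)+
  have \<psi>h: "AE x in lborel. x \<in> \<Omega> \<longrightarrow> (\<lambda>k. \<psi> k x) \<longlonglongrightarrow> h x"
    using \<zeta>(2) by (simp add: \<psi>_def h_def u_def trunc_max)
  \<comment> \<open>Where the difference is not positive, both sides vanish with \<open>trunc'\<close>.\<close>
  have bAE: "AE x in lborel. indicator \<Omega> x *\<^sub>R (trunc' (max (W1 (x, t) - W2 (x, t)) 0) *\<^sub>R Dv x) = b x"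
    using W1p_0_positive_part_gradient[OF \<Omega>(2) Wt v]
  proof eventually_elim
    case (elim x)
    show ?case
    proof (cases "x \<in> \<Omega> \<and> 0 < W1 (x, t) - W2 (x, t)")
      case True
      then show ?thesis using elim by (simp add: b_def u_def trunc_max)
    next
      case False
      then show ?thesis using z1(2)[of x t] z2(2)[of x t] by (cases "x \<in> \<Omega>") (auto simp: b_def u_def trunc_max trunc'_def)
    qed
  qed
  define r where "r k x = norm (D\<psi> k x - b x)" for k x
  have [measurable]: "r k \<in> borel_measurable borel" for k unfolding r_def[abs_def] by measurable
  have req: "AE x in lborel. norm (trunc' (\<zeta> k x) *\<^sub>R gradient (\<zeta> k) x - indicator \<Omega> x *\<^sub>R (trunc' (max (W1 (x, t) - W2 (x, t)) 0) *\<^sub>R Dv x)) powr p = r k x powr p" for k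
    using bAE by eventually_elim (simp add: r_def D\<psi>_def)
  have ir: "integrable lborel (\<lambda>x. r k x powr p)" for k
    using \<zeta>(3)[of k] by (rule integrable_cong_AE_imp) (use req[of k] in \<open>auto\<close>)
  have rlim: "(\<lambda>k. LINT x|lborel. r k x powr p) \<longlonglongrightarrow> 0"
  proof -
    have "(LINT x|lborel. norm (trunc' (\<zeta> k x) *\<^sub>R gradient (\<zeta> k) x - indicator \<Omega> x *\<^sub>R (trunc' (max (W1 (x, t) - W2 (x, t)) 0) *\<^sub>R Dv x)) powr p)
       = (LINT x|lborel. r k x powr p)" for k
      using req[of k] borel_measurable_integrable[OF \<zeta>(3)[of k]] by (intro integral_cong_AE) auto
    then show ?thesis using \<zeta>(4) by simp
  qed
  define C where "C = (\<integral>\<^sup>+t. ennreal ((LINT x|lborel. norm (D1 (x, t)) powr p) powr ((p - 1) / p)) \<partial>lborel)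
     + (\<integral>\<^sup>+t. ennreal ((LINT x|lborel. norm (D2 (x, t)) powr p) powr ((p - 1) / p)) \<partial>lborel)"
  have C: "C < \<infinity>"
    using flux_time_integrable[OF p m(2) _ q2(1), of T] flux_time_integrable[OF p m(5) _ q2(2), of T] z1(2) z2(2)
    by (simp add: C_def)
  have AR: "(\<integral>\<^sup>+z. ennreal (norm (A z) * r k (fst z)) \<partial>lborel) \<le> C * ennreal ((LINT x|lborel. r k x powr p) powr (1 / p))" for k
  proof -
    have [measurable]: "(\<lambda>z::'a \<times> real. r k (fst z)) \<in> borel_measurable borel"
      by (rule measurable_compose[OF borel_measurable_fst]) measurable
    have "(\<integral>\<^sup>+z. ennreal (norm (A z) * r k (fst z)) \<partial>lborel) \<le>
      (\<integral>\<^sup>+z. ennreal (norm (flux p (D1 z)) * r k (fst z)) + ennreal (norm (flux p (D2 z)) * r k (fst z)) \<partial>lborel)"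
    proof (rule nn_integral_mono)
      fix z :: "'a \<times> real"
      have "norm (A z) * r k (fst z) \<le> (norm (flux p (D1 z)) + norm (flux p (D2 z))) * r k (fst z)"
        unfolding A_def by (intro mult_right_mono norm_triangle_ineq4) (simp add: r_def)
      then show "ennreal (norm (A z) * r k (fst z)) \<le> ennreal (norm (flux p (D1 z)) * r k (fst z)) + ennreal (norm (flux p (D2 z)) * r k (fst z))"
        by (simp add: distrib_right r_def ennreal_leI flip: ennreal_plus)
    qed
    also have "\<dots> = (\<integral>\<^sup>+z. ennreal (norm (flux p (D1 z)) * r k (fst z)) \<partial>lborel) + (\<integral>\<^sup>+z. ennreal (norm (flux p (D2 z)) * r k (fst z)) \<partial>lborel)"
      by (rule nn_integral_add) measurable
    also have "\<dots> \<le> C * ennreal ((LINT x|lborel. r k x powr p) powr (1 / p))"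
      unfolding C_def distrib_right
      by (intro add_mono flux_pairing[OF p m(2) iD(1) _ _ ir] flux_pairing[OF p m(5) iD(2) _ _ ir]) (auto simp: r_def)
    finally show ?thesis .
  qed
  \<comment> \<open>The weak inequality holds for \<open>\<psi> k\<close> with the integrand \<open>H k\<close>. The gradient part of its deviation from
    the limit is \<open>F k\<close>, the zeroth-order part is \<open>G k - G0\<close>.\<close>
  define F where "F k z = indicator {s<..<t} (snd z) * (A z \<bullet> (D\<psi> k (fst z) - b (fst z)))" for k and z :: "'a \<times> real"
  have Fm[measurable]: "F k \<in> borel_measurable borel" for k unfolding F_def[abs_def] by measurable
  have FR: "(\<integral>\<^sup>+z. ennreal (norm (F k z)) \<partial>lborel) \<le> C * ennreal ((LINT x|lborel. r k x powr p) powr (1 / p))" for k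
  proof (rule order_trans[OF nn_integral_mono AR])
    fix z :: "'a \<times> real"
    have "norm (F k z) \<le> norm (A z) * r k (fst z)"
      unfolding F_def r_def using Cauchy_Schwarz_ineq2[of "A z" "D\<psi> k (fst z) - b (fst z)"] by (auto simp: indicator_def)
    then show "ennreal (norm (F k z)) \<le> ennreal (norm (A z) * r k (fst z))" by (rule ennreal_leI)
  qed
  have iF: "integrable lborel (F k)" for k
  proof (rule integrableI_bounded)
    show "(\<integral>\<^sup>+z. ennreal (norm (F k z)) \<partial>lborel) < \<infinity>"
      using le_less_trans[OF FR[of k]] C by (auto simp: ennreal_mult_less_top)
  qed measurable
  have Flim: "(\<lambda>k. LINT z|lborel. F k z) \<longlonglongrightarrow> 0"
  proof -
    have "(\<lambda>k. C * ennreal ((LINT x|lborel. r k x powr p) powr (1 / p))) \<longlonglongrightarrow> C * ennreal (0 powr (1 / p))"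
      using p C by (intro ennreal_tendsto_cmult tendsto_ennrealI tendsto_powr2 rlim tendsto_const) auto
    then have up: "(\<lambda>k. C * ennreal ((LINT x|lborel. r k x powr p) powr (1 / p))) \<longlonglongrightarrow> 0" by simp
    have "(\<lambda>k. \<integral>\<^sup>+z. ennreal (norm (F k z)) \<partial>lborel) \<longlonglongrightarrow> 0"
      by (rule tendsto_sandwich[OF _ _ tendsto_const up]) (use FR in auto)
    then have "(\<lambda>k. ennreal (LINT z|lborel. norm (F k z))) \<longlonglongrightarrow> ennreal 0"
      using iF by (simp add: nn_integral_eq_integral)
    then have "(\<lambda>k. LINT z|lborel. norm (F k z)) \<longlonglongrightarrow> 0" by (subst (asm) tendsto_ennreal_iff) auto
    then show ?thesis by (rule Lim_null_comparison[rotated]) (auto intro!: always_eventually integral_norm_bound)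
  qed
  define G where "G k z = indicator {s<..<t} (snd z) * (\<beta> z * \<psi> k (fst z))" for k and z :: "'a \<times> real"
  define G0 where "G0 z = indicator {s<..<t} (snd z) * (\<beta> z * h (fst z))" for z :: "'a \<times> real"
  have Gm[measurable]: "G k \<in> borel_measurable borel" "G0 \<in> borel_measurable borel" for k
    unfolding G_def[abs_def] G0_def[abs_def] by measurable
  have Gb: "norm (indicator {s<..<t} (snd z) * (\<beta> z * c)) \<le> \<bar>\<beta> z\<bar>" if "0 \<le> c" "c \<le> 1" for z :: "'a \<times> real" and c
    using that by (auto simp: indicator_def abs_mult mult_left_le)
  have AEz: "AE z in (lborel :: ('a \<times> real) measure). fst z \<in> \<Omega> \<longrightarrow> (\<lambda>k. \<psi> k (fst z)) \<longlonglongrightarrow> h (fst z)"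
    by (rule AE_fst[OF \<psi>h])
  have Glim: "(\<lambda>k. LINT z|lborel. G k z) \<longlonglongrightarrow> (LINT z|lborel. G0 z)"
  proof (rule integral_dominated_convergence[where w="\<lambda>z. \<bar>\<beta> z\<bar>"])
    show "AE z in lborel. (\<lambda>k. G k z) \<longlonglongrightarrow> G0 z"
      using AEz
    proof eventually_elim
      case (elim z)
      show ?case
      proof (cases "fst z \<in> \<Omega>")
        case True
        then show ?thesis unfolding G_def G0_def using elim by (intro tendsto_intros) auto
      next
        case False
        then show ?thesis by (simp add: G_def G0_def \<beta>0)
      qed
    qed
    show "AE z in lborel. norm (G k z) \<le> \<bar>\<beta> z\<bar>" for k
      unfolding G_def using Gb[OF \<psi>b] by simp
  qed (use i\<beta> in auto)
  have iG: "integrable lborel (G k)" "integrable lborel G0" for k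
  proof -
    show "integrable lborel (G k)"
      by (rule Bochner_Integration.integrable_bound[OF i\<beta>]) (use Gb[OF \<psi>b] in \<open>auto simp: G_def\<close>)
    have "norm (G0 z) \<le> \<bar>\<beta> z\<bar>" for z unfolding G0_def h_def by (rule Gb) (auto simp: trunc_bounds)
    then show "integrable lborel G0"
      by (intro Bochner_Integration.integrable_bound[OF i\<beta>]) auto
  qed
  define H where "H k z = indicator {s<..<t} (snd z) * (A z \<bullet> D\<psi> k (fst z) + \<beta> z * \<psi> k (fst z))" for k and z :: "'a \<times> real"
  have Hsplit: "indicator {s<..<t} (snd z) * L z = H k z - F k z - G k z + G0 z" for k z
    by (simp add: Leq H_def F_def G_def G0_def inner_diff_right algebra_simps)
  have iH: "integrable lborel (H k)" and Hle: "(LINT x|lborel. u (x, t) * \<psi> k x) - (LINT x|lborel. u (x, s) * \<psi> k x) + (LINT z|lborel. H k z) \<le> 0" for k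
  proof -
    note d = difference_inequality[OF S1 S2 C1[of k] s(1-3)]
    show "integrable lborel (H k)"
      "(LINT x|lborel. u (x, t) * \<psi> k x) - (LINT x|lborel. u (x, s) * \<psi> k x) + (LINT z|lborel. H k z) \<le> 0"
      using d by (simp_all add: H_def[abs_def] A_def \<beta>_def u_def)
  qed
  show iL: "integrable lborel (\<lambda>z. indicator {s<..<t} (snd z) * L z)"
    unfolding Hsplit[of _ 0] using iH iF iG by auto
  have HL: "(LINT z|lborel. H k z) = (LINT z|lborel. indicator {s<..<t} (snd z) * L z) + (LINT z|lborel. F k z) + (LINT z|lborel. G k z) - (LINT z|lborel. G0 z)" for k
    unfolding Hsplit[of _ k] using iH[of k] iF[of k] iG by simp
  have Hlim: "(\<lambda>k. LINT z|lborel. H k z) \<longlonglongrightarrow> (LINT z|lborel. indicator {s<..<t} (snd z) * L z)"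
    using tendsto_diff[OF tendsto_add[OF tendsto_add[OF tendsto_const[of "LINT z|lborel. indicator {s<..<t} (snd z) * L z"] Flim] Glim] tendsto_const[of "LINT z|lborel. G0 z"]]
    by (simp add: HL)
  have ulim: "(\<lambda>k. LINT x|lborel. u (x, \<tau>) * \<psi> k x) \<longlonglongrightarrow> (LINT x|lborel. u (x, \<tau>) * h x)" if "integrable lborel (\<lambda>x. u (x, \<tau>))" for \<tau>
  proof (rule integral_dominated_convergence[where w="\<lambda>x. \<bar>u (x, \<tau>)\<bar>"])
    show "AE x in lborel. (\<lambda>k. u (x, \<tau>) * \<psi> k x) \<longlonglongrightarrow> u (x, \<tau>) * h x"
      using \<psi>h
    proof eventually_elim
      case (elim x)
      show ?case
      proof (cases "x \<in> \<Omega>")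
        case True then show ?thesis using elim by (intro tendsto_intros) auto
      next
        case False then show ?thesis by (simp add: u0)
      qed
    qed
    show "AE x in lborel. norm (u (x, \<tau>) * \<psi> k x) \<le> \<bar>u (x, \<tau>)\<bar>" for k
      using \<psi>b by (auto simp: abs_mult mult_left_le)
  qed (use that in auto)
  have iut: "integrable lborel (\<lambda>x. u (x, t))" using it by (simp add: u_def)
  have ih: "integrable lborel (\<lambda>x. u (x, \<tau>) * h x)" if "integrable lborel (\<lambda>x. u (x, \<tau>))" for \<tau>
    by (rule Bochner_Integration.integrable_bound[OF that]) (auto simp: abs_mult mult_left_le h_def trunc_bounds)
  have ip: "integrable lborel (\<lambda>x. prim (u (x, \<tau>)))" if "integrable lborel (\<lambda>x. u (x, \<tau>))" for \<tau>
    by (rule Bochner_Integration.integrable_bound[OF that]) (auto simp: prim_bounds)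
  show "(LINT x|lborel. prim (u (x, t))) - (if s = 0 then 0 else LINT x|lborel. prim (u (x, s)))
      + (LINT z|lborel. indicator {s<..<t} (snd z) * L z) \<le> 0"
  proof (cases "s = 0")
    case True
    have u0le: "(LINT x|lborel. u (x, 0) * \<psi> k x) \<le> 0" for k
    proof -
      have "AE x in lborel. u (x, 0) * \<psi> k x \<le> 0"
        using init
      proof eventually_elim
        case (elim x)
        show ?case
        proof (cases "x \<in> \<Omega>")
          case True then show ?thesis using elim \<psi>b[of k x] by (simp add: u_def mult_nonpos_nonneg)
        next
          case False then show ?thesis by (simp add: u0)
        qed
      qed
      then have "AE x in lborel. 0 \<le> - (u (x, 0) * \<psi> k x)" by simp
      then have "0 \<le> (LINT x|lborel. - (u (x, 0) * \<psi> k x))" by (rule integral_nonneg_AE)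
      then show ?thesis by simp
    qed
    have "(LINT x|lborel. u (x, t) * \<psi> k x) + (LINT z|lborel. H k z) \<le> 0" for k
      using Hle[of k] u0le[of k] True by simp
    then have "(LINT x|lborel. u (x, t) * h x) + (LINT z|lborel. indicator {s<..<t} (snd z) * L z) \<le> 0"
      by (intro LIMSEQ_le_const2[OF tendsto_add[OF ulim[OF iut] Hlim]]) auto
    moreover have "(LINT x|lborel. prim (u (x, t))) \<le> (LINT x|lborel. u (x, t) * h x)"
    proof (intro integral_mono ip ih iut)
      fix x show "prim (u (x, t)) \<le> u (x, t) * h x"
        using prim_convex[of "u (x, t)" 0] by (simp add: h_def prim_def)
    qed
    ultimately show ?thesis using True by simp
  next
    case False
    then have ius: "integrable lborel (\<lambda>x. u (x, s))" using s by (simp add: u_def)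
    have "(LINT x|lborel. u (x, t) * h x) - (LINT x|lborel. u (x, s) * h x) + (LINT z|lborel. indicator {s<..<t} (snd z) * L z) \<le> 0"
      by (intro LIMSEQ_le_const2[OF tendsto_add[OF tendsto_diff[OF ulim[OF iut] ulim[OF ius]] Hlim]]) (use Hle in auto)
    moreover have "(LINT x|lborel. prim (u (x, t))) - (LINT x|lborel. prim (u (x, s))) \<le> (LINT x|lborel. u (x, t) * h x) - (LINT x|lborel. u (x, s) * h x)"
    proof -
      have "(LINT x|lborel. prim (u (x, t)) - prim (u (x, s))) \<le> (LINT x|lborel. u (x, t) * h x - u (x, s) * h x)"
      proof (intro integral_mono Bochner_Integration.integrable_diff ip ih iut ius)
        fix x show "prim (u (x, t)) - prim (u (x, s)) \<le> u (x, t) * h x - u (x, s) * h x"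
          using prim_convex[of "u (x, t)" "u (x, s)"] by (simp add: h_def left_diff_distrib)
      qed
      then show ?thesis using ip[OF iut] ip[OF ius] ih[OF iut] ih[OF ius] by simp
    qed
    ultimately show ?thesis using False by simp
  qed
qed

lemma AE_interval_witness:
  fixes a b :: real
  assumes "AE t in lborel. a < t \<and> t < b \<longrightarrow> P t" "a < b"
  obtains s where "a < s" "s < b" "P s"
proof -
  have "\<exists>s. a < s \<and> s < b \<and> P s"
  proof (rule ccontr)
    assume no: "\<not> ?thesis"
    have "AE t in lborel. t \<notin> {a<..<b}" using assms(1) by eventually_elim (use no in auto)
    then have "{a<..<b} \<in> null_sets lborel" by (subst AE_iff_null_sets) auto
    then show False using assms(2) by (simp add: null_sets_def)
  qed
  then show ?thesis using that by blast
qed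

text \<open>A discrete Gronwall inequality with an error that is \<open>o(h)\<close> after integration. Multiplied by
  \<open>exp (- (c + 1) t)\<close> and integrated, the hypothesis reads \<open>(1 - exp (- (c + 1) h) - c h) X \<le> h \<epsilon>\<close> for the
  weighted integral \<open>X\<close> of \<open>e\<close>. The factor is at least \<open>h / 2\<close> for small \<open>h\<close>, so that \<open>X \<le> 2 \<epsilon>\<close>.\<close>

lemma weighted_gronwall:
  fixes e :: "real \<Rightarrow> ennreal"
  assumes e[measurable]: "e \<in> borel_measurable borel" and neg: "\<And>t. t < 0 \<Longrightarrow> e t = 0"
    and fin: "(\<integral>\<^sup>+t. e t \<partial>lborel) < \<infinity>" and c: "0 \<le> c"
    and step: "\<And>\<epsilon>. 0 < \<epsilon> \<Longrightarrow> \<exists>d>0. \<forall>h. 0 < h \<longrightarrow> h < d \<longrightarrow> (\<exists>\<rho>. \<rho> \<in> borel_measurable borel \<and>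
       (\<integral>\<^sup>+t. \<rho> t \<partial>lborel) \<le> ennreal (h * \<epsilon>) \<and> (AE t in lborel. 0 < t \<longrightarrow> e t \<le> e (t - h) + ennreal (c * h) * e t + \<rho> t))"
  shows "AE t in lborel. e t = 0"
proof -
  define \<mu> where "\<mu> = c + 1"
  have \<mu>: "1 \<le> \<mu>" using c by (simp add: \<mu>_def)
  define w where "w t = ennreal (exp (- \<mu> * t))" for t
  have [measurable]: "w \<in> borel_measurable borel" unfolding w_def[abs_def] by measurable
  have w1: "w t \<le> 1" if "0 \<le> t" for t using that \<mu> by (simp add: w_def ennreal_le_1)
  have we: "w t * e t \<le> e t" for t
    using neg[of t] mult_right_mono[OF w1[of t], of "e t"] by (cases "t < 0") auto
  have "(\<integral>\<^sup>+t. w t * e t \<partial>lborel) < \<infinity>"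
    by (rule le_less_trans[OF nn_integral_mono fin]) (rule we)
  then obtain x where x: "0 \<le> x" "(\<integral>\<^sup>+t. w t * e t \<partial>lborel) = ennreal x"
    by (cases "\<integral>\<^sup>+t. w t * e t \<partial>lborel") auto
  have "x \<le> 2 * \<epsilon>" if \<epsilon>: "0 < \<epsilon>" for \<epsilon>
  proof -
    obtain d where d: "d > 0" "\<And>h. 0 < h \<Longrightarrow> h < d \<Longrightarrow> (\<exists>\<rho>. \<rho> \<in> borel_measurable borel \<and>
       (\<integral>\<^sup>+t. \<rho> t \<partial>lborel) \<le> ennreal (h * \<epsilon>) \<and> (AE t in lborel. 0 < t \<longrightarrow> e t \<le> e (t - h) + ennreal (c * h) * e t + \<rho> t))"
      using step[OF \<epsilon>] by blast
    define h where "h = min (d / 2) (1 / (2 * \<mu>\<^sup>2))"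
    have h: "0 < h" "h < d" "h \<le> 1 / (2 * \<mu>\<^sup>2)" using d(1) \<mu> by (auto simp: h_def)
    obtain \<rho> where \<rho>[measurable]: "\<rho> \<in> borel_measurable borel" and \<rho>1: "(\<integral>\<^sup>+t. \<rho> t \<partial>lborel) \<le> ennreal (h * \<epsilon>)"
      and \<rho>2: "AE t in lborel. 0 < t \<longrightarrow> e t \<le> e (t - h) + ennreal (c * h) * e t + \<rho> t"
      using d(2)[OF h(1,2)] by blast
    have shift: "(\<integral>\<^sup>+t. w t * e (t - h) \<partial>lborel) = ennreal (exp (- \<mu> * h)) * ennreal x"
    proof -
      have "(\<integral>\<^sup>+t. w t * e (t - h) \<partial>lborel) = (\<integral>\<^sup>+t. w (t + h) * e (t + h - h) \<partial>lborel)"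
        by (rule nn_integral_translate[symmetric]) measurable
      also have "\<dots> = (\<integral>\<^sup>+t. ennreal (exp (- \<mu> * h)) * (w t * e t) \<partial>lborel)"
        by (intro nn_integral_cong) (simp add: w_def algebra_simps exp_add[symmetric] flip: ennreal_mult mult.assoc)
      also have "\<dots> = ennreal (exp (- \<mu> * h)) * ennreal x" unfolding x(2)[symmetric] by (rule nn_integral_cmult) measurable
      finally show ?thesis .
    qed
    have "ennreal x \<le> (\<integral>\<^sup>+t. (w t * e (t - h) + ennreal (c * h) * (w t * e t)) + \<rho> t \<partial>lborel)"
      unfolding x(2)[symmetric]
    proof (rule nn_integral_mono_AE)
      have "AE t in lborel. t \<noteq> (0::real)" by (rule AE_lborel_singleton)
      with \<rho>2 show "AE t in lborel. w t * e t \<le> (w t * e (t - h) + ennreal (c * h) * (w t * e t)) + \<rho> t"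
      proof eventually_elim
        case (elim t)
        show ?case
        proof (cases "t < 0")
          case True then show ?thesis by (simp add: neg)
        next
          case False
          then have "w t * e t \<le> w t * (e (t - h) + ennreal (c * h) * e t + \<rho> t)"
            using elim by (intro mult_left_mono) auto
          also have "\<dots> = (w t * e (t - h) + ennreal (c * h) * (w t * e t)) + w t * \<rho> t"
            by (simp add: distrib_left mult.left_commute)
          also have "w t * \<rho> t \<le> \<rho> t" using mult_right_mono[OF w1[of t], of "\<rho> t"] False by simp
          finally show ?thesis by (simp add: add_left_mono)
        qed
      qed
    qed
    also have "\<dots> = (\<integral>\<^sup>+t. w t * e (t - h) \<partial>lborel) + (\<integral>\<^sup>+t. ennreal (c * h) * (w t * e t) \<partial>lborel) + (\<integral>\<^sup>+t. \<rho> t \<partial>lborel)"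
      by (subst nn_integral_add, measurable)+
    also have "(\<integral>\<^sup>+t. ennreal (c * h) * (w t * e t) \<partial>lborel) = ennreal (c * h) * ennreal x"
      unfolding x(2)[symmetric] by (rule nn_integral_cmult) measurable
    also have "(\<integral>\<^sup>+t. w t * e (t - h) \<partial>lborel) + ennreal (c * h) * ennreal x + (\<integral>\<^sup>+t. \<rho> t \<partial>lborel)
        \<le> ennreal (exp (- \<mu> * h)) * ennreal x + ennreal (c * h) * ennreal x + ennreal (h * \<epsilon>)"
      unfolding shift by (intro add_left_mono \<rho>1)
    also have "\<dots> = ennreal (exp (- \<mu> * h) * x + c * h * x + h * \<epsilon>)"
      using x(1) c h(1) \<epsilon> by (simp flip: ennreal_mult ennreal_plus)
    finally have le: "x \<le> exp (- \<mu> * h) * x + c * h * x + h * \<epsilon>"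
      using x(1) c h(1) \<epsilon> by (subst (asm) ennreal_le_iff) auto
    have y: "exp (- \<mu> * h) \<le> 1 - \<mu> * h + (\<mu> * h)\<^sup>2"
    proof -
      have pos: "0 \<le> \<mu> * h" using \<mu> h by simp
      have "1 \<le> (1 + \<mu> * h) * (1 - \<mu> * h + (\<mu> * h)\<^sup>2)"
        using zero_le_power[OF pos, of 3] by (simp add: algebra_simps power2_eq_square power3_eq_cube)
      also have "\<dots> \<le> exp (\<mu> * h) * (1 - \<mu> * h + (\<mu> * h)\<^sup>2)"
      proof (rule mult_right_mono)
        show "1 + \<mu> * h \<le> exp (\<mu> * h)" by (rule exp_ge_add_one_self)
        have "0 \<le> (\<mu> * h - 1 / 2)\<^sup>2" by simp
        then show "0 \<le> 1 - \<mu> * h + (\<mu> * h)\<^sup>2" by (simp add: power2_diff power_divide)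
      qed
      finally show ?thesis by (simp add: exp_minus field_simps)
    qed
    have "\<mu>\<^sup>2 * h \<le> 1 / 2" using h(3) \<mu> by (simp add: field_simps)
    then have "(\<mu> * h)\<^sup>2 \<le> h / 2"
      using mult_right_mono[of "\<mu>\<^sup>2 * h" "1 / 2" h] h(1) by (simp add: power_mult_distrib power2_eq_square algebra_simps)
    with y have "exp (- \<mu> * h) + c * h \<le> 1 - h / 2" by (simp add: \<mu>_def algebra_simps)
    then have "(exp (- \<mu> * h) + c * h) * x \<le> (1 - h / 2) * x" using x(1) by (rule mult_right_mono)
    with le have "h * x \<le> h * (2 * \<epsilon>)" by (simp add: algebra_simps)
    then show ?thesis using h(1) by (simp add: mult_le_cancel_left_pos)
  qed
  then have "x \<le> 0" by (metis field_le_epsilon add_0 half_gt_zero mult.commute nonzero_mult_div_cancel_left times_divide_eq_left zero_neq_numeral)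
  then have "(\<integral>\<^sup>+t. w t * e t \<partial>lborel) = 0" using x by simp
  then have "AE t in lborel. w t * e t = 0" by (subst (asm) nn_integral_0_iff_AE) auto
  then show ?thesis by eventually_elim (simp add: w_def)
qed

text \<open>There are times \<open>s < t\<close> arbitrarily close to \<open>t\<close> at which the comparison already holds. The weak inequality
  between \<open>s\<close> and \<open>t\<close> for a stationary test function \<open>\<zeta> \<ge> 0\<close> bounds \<open>\<integral> (W1 - W2)(\<cdot>,t) \<zeta>\<close> by an integral over
  \<open>(s, t)\<close> that tends to \<open>0\<close>.\<close>

lemma comparison_every_time:
  fixes \<Omega> :: "'a::euclidean_space set" and W1 W2 \<beta>1 \<beta>2 :: "'a \<times> real \<Rightarrow> real" and D1 D2 :: "'a \<times> real \<Rightarrow> 'a"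
  assumes \<Omega>: "open \<Omega>"
    and S1: "solution_data (\<le>) p \<Omega> T K W1 D1 \<beta>1" and S2: "solution_data (\<ge>) p \<Omega> T K W2 D2 \<beta>2"
    and ae: "AE t in lborel. t \<in> {0<..<T} \<longrightarrow> (AE x in lborel. x \<in> \<Omega> \<longrightarrow> W1 (x, t) \<le> W2 (x, t))"
    and t: "0 < t" "t \<le> T"
  shows "AE x in lborel. x \<in> \<Omega> \<longrightarrow> W1 (x, t) \<le> W2 (x, t)"
proof -
  define u where "u z = W1 z - W2 z" for z
  have [measurable]: "W1 \<in> borel_measurable borel" "W2 \<in> borel_measurable borel"
    and u0: "\<And>x r. x \<notin> \<Omega> \<Longrightarrow> u (x, r) = 0"
    using S1 S2 unfolding solution_data_def u_def by (blast, blast, metis diff_zero)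
  have [measurable]: "u \<in> borel_measurable borel" unfolding u_def[abs_def] by measurable
  have C1: "C1_test \<Omega> \<zeta> (gradient \<zeta>)" if z: "test_smooth \<Omega> \<zeta>" "\<And>x. 0 \<le> \<zeta> x" for \<zeta>
  proof -
    have sm: "smooth \<zeta>" by (rule test_smooth_smooth[OF z(1)])
    obtain k where "compact k" "k \<subseteq> \<Omega>" "\<And>x. x \<notin> k \<Longrightarrow> \<zeta> x = 0" using test_smooth_support[OF z(1)] by blast
    then show ?thesis unfolding C1_test_def
      using z(2) smooth_gradient_derivative[OF sm] continuous_gradient[OF sm] by blast
  qed
  have "AE x in lborel. x \<in> \<Omega> \<longrightarrow> u (x, t) \<le> 0"
  proof (rule AE_nonpos_of_test[OF \<Omega>])
    fix a b :: 'a assume ab: "cbox a b \<subseteq> \<Omega>"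
    obtain \<zeta> where \<zeta>: "test_smooth \<Omega> \<zeta>" "\<And>x. 0 \<le> \<zeta> x" "\<And>x. x \<in> cbox a b \<Longrightarrow> 1 \<le> \<zeta> x"
      using compact_cutoff[OF compact_cbox ab \<Omega>] by blast
    have i: "integrable lborel (\<lambda>x. u (x, t) * \<zeta> x)"
      using difference_inequality(2)[OF S1 S2 C1[OF \<zeta>(1,2)], of 0 t] t by (simp add: u_def)
    show "set_integrable lborel (cbox a b) (\<lambda>x. u (x, t))"
      unfolding set_integrable_def
    proof (rule Bochner_Integration.integrable_bound[OF i])
      show "AE x in lborel. norm (indicat_real (cbox a b) x *\<^sub>R u (x, t)) \<le> norm (u (x, t) * \<zeta> x)"
      proof (intro AE_I2)
        fix x show "norm (indicat_real (cbox a b) x *\<^sub>R u (x, t)) \<le> norm (u (x, t) * \<zeta> x)"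
          using \<zeta>(3)[of x] mult_left_mono[of 1 "\<zeta> x" "\<bar>u (x, t)\<bar>"] by (cases "x \<in> cbox a b") (auto simp: abs_mult)
      qed
    qed measurable
  next
    fix \<zeta> assume \<zeta>: "test_smooth \<Omega> \<zeta>" "\<And>x. 0 \<le> \<zeta> x"
    define F where "F z = (flux p (D1 z) - flux p (D2 z)) \<bullet> gradient \<zeta> (fst z) + (\<beta>1 z - \<beta>2 z) * \<zeta> (fst z)" for z
    have "\<exists>s. t - t / real (Suc n) < s \<and> s < t \<and> (AE x in lborel. x \<in> \<Omega> \<longrightarrow> u (x, s) \<le> 0)" for n
    proof -
      have "t / real (Suc n) \<le> t" using t by (simp add: divide_le_eq)
      moreover have "AE s in lborel. t - t / real (Suc n) < s \<and> s < t \<longrightarrow> (AE x in lborel. x \<in> \<Omega> \<longrightarrow> u (x, s) \<le> 0)"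
        using ae by eventually_elim (use calculation t in \<open>auto simp: u_def\<close>)
      moreover have "t - t / real (Suc n) < t" using t by simp
      ultimately obtain s where "t - t / real (Suc n) < s" "s < t" "AE x in lborel. x \<in> \<Omega> \<longrightarrow> u (x, s) \<le> 0"
        using AE_interval_witness[of "t - t / real (Suc n)" t "\<lambda>s. AE x in lborel. x \<in> \<Omega> \<longrightarrow> u (x, s) \<le> 0"] by auto
      then show ?thesis by blast
    qed
    then obtain s where s: "\<And>n. t - t / real (Suc n) < s n" "\<And>n. s n < t" "\<And>n. AE x in lborel. x \<in> \<Omega> \<longrightarrow> u (x, s n) \<le> 0"
      by metis
    have s0: "0 \<le> s n" for n
    proof -
      have "t / real (Suc n) \<le> t" using t by (simp add: divide_le_eq)
      then show ?thesis using s(1)[of n] by linarith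
    qed
    have slim: "s \<longlonglongrightarrow> t"
    proof (rule real_tendsto_sandwich[OF _ _ _ tendsto_const])
      have "(\<lambda>n. t - t * inverse (real (Suc n))) \<longlonglongrightarrow> t - t * 0"
        by (intro tendsto_intros LIMSEQ_inverse_real_of_nat)
      then show "(\<lambda>n. t - t / real (Suc n)) \<longlonglongrightarrow> t" by (simp add: divide_inverse)
    qed (use s in \<open>auto intro!: always_eventually less_imp_le\<close>)
    have iF: "integrable lborel (\<lambda>z. indicator {0<..<t} (snd z) * F z)"
      and im: "integrable lborel (\<lambda>z. indicator {s n<..<t} (snd z) * F z)" for n
      using difference_inequality(3)[OF S1 S2 C1[OF \<zeta>], of 0 t] difference_inequality(3)[OF S1 S2 C1[OF \<zeta>] s0 s(2) t(2)] t
      by (simp_all add: F_def)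
    have Flim: "(\<lambda>n. LINT z|lborel. indicator {s n<..<t} (snd z) * F z) \<longlonglongrightarrow> (LINT (z::'a \<times> real)|lborel. 0)"
    proof (rule integral_dominated_convergence[where w="\<lambda>z. norm (indicator {0<..<t} (snd z) * F z)"])
      show "AE z in lborel. (\<lambda>n. indicator {s n<..<t} (snd z) * F z) \<longlonglongrightarrow> 0"
      proof (intro AE_I2)
        fix z :: "'a \<times> real"
        have "\<forall>\<^sub>F n in sequentially. indicator {s n<..<t} (snd z) * F z = 0"
        proof (cases "snd z < t")
          case True
          show ?thesis using order_tendstoD(1)[OF slim True] by eventually_elim simp
        qed simp
        then show "(\<lambda>n. indicator {s n<..<t} (snd z) * F z) \<longlonglongrightarrow> 0" by (rule tendsto_eventually)
      qed
      show "AE z in lborel. norm (indicator {s n<..<t} (snd z) * F z) \<le> norm (indicator {0<..<t} (snd z) * F z)" for n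
        using s0[of n] by (auto simp: indicator_def)
    qed (use iF im in auto)
    have "(LINT x|lborel. u (x, t) * \<zeta> x) \<le> - (LINT z|lborel. indicator {s n<..<t} (snd z) * F z)" for n
    proof -
      have "AE x in lborel. 0 \<le> - (u (x, s n) * \<zeta> x)"
        using s(3)[of n]
      proof eventually_elim
        case (elim x)
        then show ?case using u0[of x] \<zeta>(2)[of x] by (cases "x \<in> \<Omega>") (auto simp: mult_nonpos_nonneg)
      qed
      then have "0 \<le> (LINT x|lborel. - (u (x, s n) * \<zeta> x))" by (rule integral_nonneg_AE)
      then show ?thesis
        using difference_inequality(4)[OF S1 S2 C1[OF \<zeta>] s0[of n] s(2)[of n] t(2)] by (simp add: F_def u_def)
    qed
    then have "(LINT x|lborel. u (x, t) * \<zeta> x) \<le> 0"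
      using LIMSEQ_le_const[OF tendsto_minus[OF Flim], of "LINT x|lborel. u (x, t) * \<zeta> x"] by auto
    moreover have "(LINT x:\<Omega>|lborel. u (x, t) * \<zeta> x) = (LINT x|lborel. u (x, t) * \<zeta> x)"
      unfolding set_lebesgue_integral_def using u0 by (intro Bochner_Integration.integral_cong) (auto simp: indicator_def)
    ultimately show "(LINT x:\<Omega>|lborel. u (x, t) * \<zeta> x) \<le> 0" by simp
  qed
  then show ?thesis by (simp add: u_def)
qed

text \<open>Both fluxes are square integrable in time with values in the dual Lebesgue space, and \<open>b\<close>, a bound for
  the gradient of the test function, in the space itself.\<close>

lemma difference_time_modulus:
  fixes \<Omega> :: "'a::euclidean_space set" and W1 W2 \<beta>1 \<beta>2 :: "'a \<times> real \<Rightarrow> real" and D1 D2 :: "'a \<times> real \<Rightarrow> 'a"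
  assumes p: "1 < p" and \<Omega>: "bounded \<Omega>" "open \<Omega>"
    and S1: "solution_data R1 p \<Omega> T K W1 D1 \<beta>1" and S2: "solution_data R2 p \<Omega> T K W2 D2 \<beta>2"
    and b[measurable]: "b \<in> borel_measurable borel" and bD: "\<And>z. 0 \<le> b z \<and> b z \<le> norm (D1 z) + norm (D2 z)"
    and \<epsilon>: "0 < \<epsilon>"
  defines "A \<equiv> \<lambda>z. flux p (D1 z) - flux p (D2 z)" and "\<beta> \<equiv> \<lambda>z. \<beta>1 z - \<beta>2 z"
  shows "\<exists>d>0. \<forall>\<theta>. \<bar>\<theta>\<bar> < d \<longrightarrow>
    (\<integral>\<^sup>+z. ennreal (norm (A (z + (0, \<theta>)) - A z) * b z + \<bar>\<beta> (z + (0, \<theta>)) - \<beta> z\<bar>) \<partial>lborel) < ennreal \<epsilon>"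
proof -
  have m[measurable]: "D1 \<in> borel_measurable borel" "\<beta>1 \<in> borel_measurable borel"
     "D2 \<in> borel_measurable borel" "\<beta>2 \<in> borel_measurable borel"
     and z1: "\<And>x t. x \<notin> \<Omega> \<or> t \<notin> {0<..<T} \<Longrightarrow> D1 (x, t) = 0 \<and> \<beta>1 (x, t) = 0"
     and z2: "\<And>x t. x \<notin> \<Omega> \<or> t \<notin> {0<..<T} \<Longrightarrow> D2 (x, t) = 0 \<and> \<beta>2 (x, t) = 0"
     and iD: "AE t in lborel. integrable lborel (\<lambda>x. norm (D1 (x, t)) powr p)" "AE t in lborel. integrable lborel (\<lambda>x. norm (D2 (x, t)) powr p)"
     and n2: "(\<integral>\<^sup>+t. ennreal ((LINT x|lborel. norm (D1 (x, t)) powr p) powr (2 / p)) \<partial>lborel) < \<infinity>"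
        "(\<integral>\<^sup>+t. ennreal ((LINT x|lborel. norm (D2 (x, t)) powr p) powr (2 / p)) \<partial>lborel) < \<infinity>"
     and q2: "(\<integral>\<^sup>+t. ennreal ((LINT x|lborel. norm (D1 (x, t)) powr p) powr (2 * (p - 1) / p)) \<partial>lborel) < \<infinity>"
        "(\<integral>\<^sup>+t. ennreal ((LINT x|lborel. norm (D2 (x, t)) powr p) powr (2 * (p - 1) / p)) \<partial>lborel) < \<infinity>"
    using S1 S2 unfolding solution_data_def by blast+
  have [measurable]: "A \<in> borel_measurable borel" "\<beta> \<in> borel_measurable borel"
    unfolding A_def \<beta>_def by measurable
  define N1 where "N1 t = (LINT x|lborel. norm (D1 (x, t)) powr p)" for t
  define N2 where "N2 t = (LINT x|lborel. norm (D2 (x, t)) powr p)" for t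
  have [measurable]: "N1 \<in> borel_measurable borel" "N2 \<in> borel_measurable borel"
    unfolding N1_def[abs_def] N2_def[abs_def] by measurable
  have N0: "0 \<le> N1 t" "0 \<le> N2 t" for t by (auto simp: N1_def N2_def)
  have bp: "b z powr p \<le> 2 powr p * (norm (D1 z) powr p + norm (D2 z) powr p)" for z
  proof -
    have "b z powr p \<le> (norm (D1 z) + norm (D2 z)) powr p" using bD[of z] p by (intro powr_mono2) auto
    also have "\<dots> \<le> 2 powr p * (norm (D1 z) powr p + norm (D2 z) powr p)" using p by (intro powr_add_le) auto
    finally show ?thesis .
  qed
  have bi: "AE t in lborel. integrable lborel (\<lambda>x. b (x, t) powr p) \<and> (LINT x|lborel. b (x, t) powr p) \<le> 2 powr p * (N1 t + N2 t)"
    using iD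
  proof eventually_elim
    case (elim t)
    have i: "integrable lborel (\<lambda>x. 2 powr p * (norm (D1 (x, t)) powr p + norm (D2 (x, t)) powr p))" using elim by auto
    have ib: "integrable lborel (\<lambda>x. b (x, t) powr p)"
      by (rule Bochner_Integration.integrable_bound[OF i]) (use bp in \<open>auto simp: abs_of_nonneg\<close>)
    have "(LINT x|lborel. b (x, t) powr p) \<le> (LINT x|lborel. 2 powr p * (norm (D1 (x, t)) powr p + norm (D2 (x, t)) powr p))"
      using bp by (intro integral_mono ib i) auto
    also have "\<dots> = 2 powr p * (N1 t + N2 t)" using elim by (simp add: N1_def N2_def)
    finally show ?case using ib by simp
  qed
  then have ib: "AE t in lborel. integrable lborel (\<lambda>x. b (x, t) powr p)" by eventually_elim simp
  define c where "c = (2 powr p) powr (2 / p) * 2 powr (2 / p)"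
  have b2: "(\<integral>\<^sup>+t. ennreal ((LINT x|lborel. b (x, t) powr p) powr (2 / p)) \<partial>lborel) < \<infinity>"
  proof -
    have "(\<integral>\<^sup>+t. ennreal ((LINT x|lborel. b (x, t) powr p) powr (2 / p)) \<partial>lborel)
        \<le> (\<integral>\<^sup>+t. ennreal c * (ennreal (N1 t powr (2 / p)) + ennreal (N2 t powr (2 / p))) \<partial>lborel)"
    proof (rule nn_integral_mono_AE)
      show "AE t in lborel. ennreal ((LINT x|lborel. b (x, t) powr p) powr (2 / p)) \<le> ennreal c * (ennreal (N1 t powr (2 / p)) + ennreal (N2 t powr (2 / p)))"
        using bi
      proof eventually_elim
        case (elim t)
        have "(LINT x|lborel. b (x, t) powr p) powr (2 / p) \<le> (2 powr p * (N1 t + N2 t)) powr (2 / p)"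
          using elim p by (intro powr_mono2) auto
        also have "\<dots> = (2 powr p) powr (2 / p) * (N1 t + N2 t) powr (2 / p)" using N0[of t] by (simp add: powr_mult)
        also have "\<dots> \<le> (2 powr p) powr (2 / p) * (2 powr (2 / p) * (N1 t powr (2 / p) + N2 t powr (2 / p)))"
          using N0[of t] p by (intro mult_left_mono powr_add_le) auto
        also have "\<dots> = c * (N1 t powr (2 / p) + N2 t powr (2 / p))" by (simp add: c_def)
        finally show ?case by (simp add: c_def ennreal_leI flip: ennreal_mult ennreal_plus)
      qed
    qed
    also have "\<dots> = ennreal c * ((\<integral>\<^sup>+t. ennreal (N1 t powr (2 / p)) \<partial>lborel) + (\<integral>\<^sup>+t. ennreal (N2 t powr (2 / p)) \<partial>lborel))"
      by (subst nn_integral_cmult, measurable, subst nn_integral_add, measurable)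
    also have "\<dots> < \<infinity>" using n2 by (simp add: N1_def N2_def ennreal_mult_less_top)
    finally show ?thesis .
  qed
  have e3: "0 < \<epsilon> / 3" using \<epsilon> by simp
  obtain d1 where d1: "d1 > 0" "\<And>\<theta>. \<bar>\<theta>\<bar> < d1 \<Longrightarrow> (\<integral>\<^sup>+z. ennreal (norm (flux p (D1 (z + (0, \<theta>))) - flux p (D1 z)) * b z) \<partial>lborel) < ennreal (\<epsilon> / 3)"
    using flux_translation[OF p \<Omega> m(1) _ iD(1) q2(1) b _ ib b2 e3] z1 bD by blast
  obtain d2 where d2: "d2 > 0" "\<And>\<theta>. \<bar>\<theta>\<bar> < d2 \<Longrightarrow> (\<integral>\<^sup>+z. ennreal (norm (flux p (D2 (z + (0, \<theta>))) - flux p (D2 z)) * b z) \<partial>lborel) < ennreal (\<epsilon> / 3)"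
    using flux_translation[OF p \<Omega> m(3) _ iD(2) q2(2) b _ ib b2 e3] z2 bD by blast
  have i\<beta>: "integrable lborel \<beta>" unfolding \<beta>_def by (rule reaction_difference_integrable[OF S1 S2])
  obtain d3 where d3: "d3 > 0" "\<And>h. norm h < d3 \<Longrightarrow> (LINT z|lborel. norm (\<beta> (z + h) - \<beta> z)) < \<epsilon> / 3"
    using L1_translation[OF i\<beta> e3] by blast
  define d where "d = min d1 (min d2 d3)"
  have "(\<integral>\<^sup>+z. ennreal (norm (A (z + (0, \<theta>)) - A z) * b z + \<bar>\<beta> (z + (0, \<theta>)) - \<beta> z\<bar>) \<partial>lborel) < ennreal \<epsilon>" if \<theta>: "\<bar>\<theta>\<bar> < d" for \<theta>
  proof -
    have [measurable]: "(\<lambda>z::'a \<times> real. D1 (z + (0, \<theta>))) \<in> borel_measurable borel" "(\<lambda>z::'a \<times> real. D2 (z + (0, \<theta>))) \<in> borel_measurable borel"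
      "(\<lambda>z::'a \<times> real. \<beta> (z + (0, \<theta>))) \<in> borel_measurable borel" by measurable
    let ?f1 = "\<lambda>z. norm (flux p (D1 (z + (0, \<theta>))) - flux p (D1 z)) * b z"
    let ?f2 = "\<lambda>z. norm (flux p (D2 (z + (0, \<theta>))) - flux p (D2 z)) * b z"
    let ?f3 = "\<lambda>z. norm (\<beta> (z + (0, \<theta>)) - \<beta> z)"
    have "(\<integral>\<^sup>+z. ennreal (norm (A (z + (0, \<theta>)) - A z) * b z + \<bar>\<beta> (z + (0, \<theta>)) - \<beta> z\<bar>) \<partial>lborel)
      \<le> (\<integral>\<^sup>+z. (ennreal (?f1 z) + ennreal (?f2 z)) + ennreal (?f3 z) \<partial>lborel)"
    proof (rule nn_integral_mono)
      fix z :: "'a \<times> real"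
      have "A (z + (0, \<theta>)) - A z = (flux p (D1 (z + (0, \<theta>))) - flux p (D1 z)) - (flux p (D2 (z + (0, \<theta>))) - flux p (D2 z))"
        by (simp add: A_def)
      then have "norm (A (z + (0, \<theta>)) - A z) * b z \<le> ?f1 z + ?f2 z"
        using bD[of z] norm_triangle_ineq4[of "flux p (D1 (z + (0, \<theta>))) - flux p (D1 z)" "flux p (D2 (z + (0, \<theta>))) - flux p (D2 z)"]
        by (simp add: mult_right_mono flip: distrib_right)
      then have "ennreal (norm (A (z + (0, \<theta>)) - A z) * b z + \<bar>\<beta> (z + (0, \<theta>)) - \<beta> z\<bar>) \<le> ennreal ((?f1 z + ?f2 z) + ?f3 z)"
        by (intro ennreal_leI) simp
      also have "\<dots> = (ennreal (?f1 z) + ennreal (?f2 z)) + ennreal (?f3 z)"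
        using bD[of z] by (subst ennreal_plus; (subst ennreal_plus)?) auto
      finally show "ennreal (norm (A (z + (0, \<theta>)) - A z) * b z + \<bar>\<beta> (z + (0, \<theta>)) - \<beta> z\<bar>) \<le> (ennreal (?f1 z) + ennreal (?f2 z)) + ennreal (?f3 z)" .
    qed
    also have "\<dots> = (\<integral>\<^sup>+z. ennreal (?f1 z) \<partial>lborel) + (\<integral>\<^sup>+z. ennreal (?f2 z) \<partial>lborel) + (\<integral>\<^sup>+z. ennreal (?f3 z) \<partial>lborel)"
      by (subst nn_integral_add, measurable)+
    also have "\<dots> < ennreal (\<epsilon> / 3) + ennreal (\<epsilon> / 3) + ennreal (\<epsilon> / 3)"
    proof (intro add_strict_mono)
      show "(\<integral>\<^sup>+z. ennreal (?f1 z) \<partial>lborel) < ennreal (\<epsilon> / 3)" "(\<integral>\<^sup>+z. ennreal (?f2 z) \<partial>lborel) < ennreal (\<epsilon> / 3)"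
        using d1(2) d2(2) \<theta> by (auto simp: d_def)
      have "(\<integral>\<^sup>+z. ennreal (?f3 z) \<partial>lborel) = ennreal (LINT z|lborel. ?f3 z)"
        using i\<beta> integrable_translate[OF i\<beta>] by (intro nn_integral_eq_integral) auto
      also have "\<dots> < ennreal (\<epsilon> / 3)" using d3(2)[of "(0, \<theta>)"] \<theta> e3 by (intro ennreal_lessI) (auto simp: d_def norm_Pair)
      finally show "(\<integral>\<^sup>+z. ennreal (?f3 z) \<partial>lborel) < ennreal (\<epsilon> / 3)" .
    qed
    also have "\<dots> = ennreal \<epsilon>" using \<epsilon> by (simp flip: ennreal_plus)
    finally show ?thesis .
  qed
  then show ?thesis using d1(1) d2(1) d3(1) by (intro exI[of _ d]) (auto simp: d_def)
qed

text \<open>The energy \<open>e(t) = \<integral> prim (W1 - W2)(x,t) dx\<close> satisfies the hypothesis of \<open>weighted_gronwall\<close> with \<open>c = 3 K\<close>.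
  In the frozen inequality, the integrand \<open>L\<close> at time \<open>\<tau>\<close> differs from its value at time \<open>t\<close> by at most the
  integrand of \<open>G t (\<tau> - t)\<close>. At time \<open>t\<close> the flux contributes a nonnegative term and the zeroth-order
  term is at least \<open>- K \<bar>u\<bar> trunc u\<close>, hence at least \<open>- 3 K prim u\<close>.\<close>

lemma comparison_almost_every_time:
  fixes \<Omega> :: "'a::euclidean_space set" and W1 W2 \<beta>1 \<beta>2 :: "'a \<times> real \<Rightarrow> real" and D1 D2 :: "'a \<times> real \<Rightarrow> 'a"
  assumes p: "1 < p" and \<Omega>: "bounded \<Omega>" "open \<Omega>" and K: "0 \<le> K"
    and S1: "solution_data (\<le>) p \<Omega> T K W1 D1 \<beta>1" and S2: "solution_data (\<ge>) p \<Omega> T K W2 D2 \<beta>2"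
    and \<beta>K: "\<And>z. \<bar>\<beta>1 z - \<beta>2 z\<bar> \<le> K * \<bar>W1 z - W2 z\<bar>"
    and init: "AE x in lborel. x \<in> \<Omega> \<longrightarrow> W1 (x, 0) \<le> W2 (x, 0)"
    and lat: "AE t in lborel. t \<in> {0<..<T} \<longrightarrow> (\<exists>D. W1p_0 p \<Omega> (\<lambda>x. max (W1 (x, t) - W2 (x, t)) 0) D)"
  shows "AE t in lborel. t \<in> {0<..<T} \<longrightarrow> (AE x in lborel. x \<in> \<Omega> \<longrightarrow> W1 (x, t) \<le> W2 (x, t))"
proof -
  define u where "u z = W1 z - W2 z" for z
  define A where "A z = flux p (D1 z) - flux p (D2 z)" for z
  define \<beta> where "\<beta> z = \<beta>1 z - \<beta>2 z" for z
  define b where "b z = trunc' (u z) *\<^sub>R (D1 z - D2 z)" for z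
  have m[measurable]: "W1 \<in> borel_measurable borel" "D1 \<in> borel_measurable borel" "\<beta>1 \<in> borel_measurable borel"
     "W2 \<in> borel_measurable borel" "D2 \<in> borel_measurable borel" "\<beta>2 \<in> borel_measurable borel"
     and z1: "\<And>x t. x \<notin> \<Omega> \<or> t \<notin> {0..T} \<Longrightarrow> W1 (x, t) = 0" and z2: "\<And>x t. x \<notin> \<Omega> \<or> t \<notin> {0..T} \<Longrightarrow> W2 (x, t) = 0"
     and iW: "integrable lborel W1" "integrable lborel W2"
     and Wt: "AE t in lborel. t \<in> {0<..<T} \<longrightarrow> W1p p \<Omega> (\<lambda>x. W1 (x, t)) (\<lambda>x. D1 (x, t))"
        "AE t in lborel. t \<in> {0<..<T} \<longrightarrow> W1p p \<Omega> (\<lambda>x. W2 (x, t)) (\<lambda>x. D2 (x, t))"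
    using S1 S2 unfolding solution_data_def by blast+
  have [measurable]: "u \<in> borel_measurable borel" unfolding u_def[abs_def] by measurable
  have [measurable]: "A \<in> borel_measurable borel" "\<beta> \<in> borel_measurable borel" "b \<in> borel_measurable borel"
    unfolding A_def[abs_def] \<beta>_def[abs_def] b_def[abs_def] by measurable
  have u0: "u (x, t) = 0" if "t \<notin> {0..T}" for x t using that z1 z2 by (simp add: u_def)
  have bD: "0 \<le> norm (b z) \<and> norm (b z) \<le> norm (D1 z) + norm (D2 z)" for z
  proof -
    have "norm (b z) = trunc' (u z) * norm (D1 z - D2 z)" using trunc'_bounds by (simp add: b_def)
    also have "\<dots> \<le> 1 * norm (D1 z - D2 z)" using trunc'_bounds by (intro mult_right_mono) auto
    finally show ?thesis using norm_triangle_ineq4[of "D1 z" "D2 z"] by simp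
  qed
  have iu: "integrable lborel u" unfolding u_def[abs_def] using iW by auto
  have iut: "AE t in lborel. integrable lborel (\<lambda>x. u (x, t))" by (rule AE_slice_integrable[OF iu])
  define e where "e t = (\<integral>\<^sup>+x. ennreal (prim (u (x, t))) \<partial>lborel)" for t
  have em[measurable]: "e \<in> borel_measurable borel" unfolding e_def[abs_def] by measurable
  have e0: "e t = 0" if "t \<notin> {0..T}" for t using u0[OF that] by (simp add: e_def prim_def)
  have eI: "e t = ennreal (LINT x|lborel. prim (u (x, t)))" if "integrable lborel (\<lambda>x. u (x, t))" for t
    unfolding e_def
    by (intro nn_integral_eq_integral Bochner_Integration.integrable_bound[OF that]) (auto simp: prim_bounds)
  define G where "G t \<theta> = (\<integral>\<^sup>+x. ennreal (norm (A (x, t + \<theta>) - A (x, t)) * norm (b (x, t)) + \<bar>\<beta> (x, t + \<theta>) - \<beta> (x, t)\<bar>) \<partial>lborel)" for t \<theta>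
  have Gm[measurable]: "(\<lambda>(t, \<theta>). G t \<theta>) \<in> borel_measurable (lborel \<Otimes>\<^sub>M lborel)"
    unfolding G_def[abs_def] split_beta' by measurable
  have Gz: "(\<integral>\<^sup>+t. G t \<theta> \<partial>lborel) = (\<integral>\<^sup>+z. ennreal (norm (A (z + (0, \<theta>)) - A z) * norm (b z) + \<bar>\<beta> (z + (0, \<theta>)) - \<beta> z\<bar>) \<partial>lborel)" for \<theta>
  proof -
    have [measurable]: "(\<lambda>z::'a \<times> real. A (z + (0, \<theta>))) \<in> borel_measurable borel" "(\<lambda>z::'a \<times> real. \<beta> (z + (0, \<theta>))) \<in> borel_measurable borel" by measurable
    have "(\<lambda>z. ennreal (norm (A (z + (0, \<theta>)) - A z) * norm (b z) + \<bar>\<beta> (z + (0, \<theta>)) - \<beta> z\<bar>)) \<in> borel_measurable borel" by measurable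
    from nn_integral_slices[OF this] show ?thesis unfolding G_def by simp
  qed
  have "AE t in lborel. e t = 0"
  proof (rule weighted_gronwall[OF em])
    show "e t = 0" if "t < 0" for t using that by (intro e0) auto
    have "(\<integral>\<^sup>+t. e t \<partial>lborel) = (\<integral>\<^sup>+z. ennreal (prim (u z)) \<partial>lborel)"
      unfolding e_def by (rule nn_integral_slices[symmetric]) measurable
    also have "\<dots> \<le> (\<integral>\<^sup>+z. ennreal (norm (u z)) \<partial>lborel)"
      by (intro nn_integral_mono ennreal_leI) (simp add: prim_bounds)
    also have "\<dots> < \<infinity>" using iu by (simp add: integrable_iff_bounded)
    finally show "(\<integral>\<^sup>+t. e t \<partial>lborel) < \<infinity>" .
    show "0 \<le> 3 * K" using K by simp
    fix \<epsilon> :: real assume \<epsilon>: "0 < \<epsilon>"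
    obtain d where d: "d > 0" "\<And>\<theta>. \<bar>\<theta>\<bar> < d \<Longrightarrow> (\<integral>\<^sup>+t. G t \<theta> \<partial>lborel) < ennreal \<epsilon>"
      using difference_time_modulus[OF p \<Omega> S1 S2 _ bD \<epsilon>] unfolding Gz A_def \<beta>_def by auto
    show "\<exists>d>0. \<forall>h. 0 < h \<longrightarrow> h < d \<longrightarrow> (\<exists>\<rho>. \<rho> \<in> borel_measurable borel \<and>
       (\<integral>\<^sup>+t. \<rho> t \<partial>lborel) \<le> ennreal (h * \<epsilon>) \<and> (AE t in lborel. 0 < t \<longrightarrow> e t \<le> e (t - h) + ennreal (3 * K * h) * e t + \<rho> t))"
    proof (intro exI[of _ d] conjI allI impI d(1))
      fix h assume h: "0 < h" "h < d"
      define \<rho> where "\<rho> t = (\<integral>\<^sup>+\<theta>. indicator {-h<..<0} \<theta> * G t \<theta> \<partial>lborel)" for t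
      have [measurable]: "\<rho> \<in> borel_measurable borel" unfolding \<rho>_def[abs_def] by measurable
      have \<rho>1: "(\<integral>\<^sup>+t. \<rho> t \<partial>lborel) \<le> ennreal (h * \<epsilon>)"
      proof -
        have "(\<integral>\<^sup>+t. \<rho> t \<partial>lborel) = (\<integral>\<^sup>+\<theta>. \<integral>\<^sup>+t. indicator {-h<..<0} \<theta> * G t \<theta> \<partial>lborel \<partial>lborel)"
          unfolding \<rho>_def by (rule lborel_pair.Fubini'[symmetric]) measurable
        also have "\<dots> \<le> (\<integral>\<^sup>+\<theta>. ennreal \<epsilon> * indicator {-h<..<0} \<theta> \<partial>lborel)"
        proof (rule nn_integral_mono)
          fix \<theta> :: real
          show "(\<integral>\<^sup>+t. indicator {-h<..<0} \<theta> * G t \<theta> \<partial>lborel) \<le> ennreal \<epsilon> * indicator {-h<..<0} \<theta>"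
            using d(2)[of \<theta>] h by (cases "\<theta> \<in> {-h<..<0}") auto
        qed
        also have "\<dots> = ennreal (h * \<epsilon>)"
          using h \<epsilon> by (simp add: nn_integral_cmult_indicator ennreal_mult mult.commute)
        finally show ?thesis .
      qed
      have \<rho>2: "AE t in lborel. 0 < t \<longrightarrow> e t \<le> e (t - h) + ennreal (3 * K * h) * e t + \<rho> t"
        using iut AE_translate[OF iut, of "- h"] Wt lat AE_lborel_singleton[of T] AE_lborel_singleton[of h]
      proof eventually_elim
        case (elim t)
        show ?case
        proof (intro impI, cases "T < t")
          case True
          then show "e t \<le> e (t - h) + ennreal (3 * K * h) * e t + \<rho> t" by (simp add: e0)
        next
          case False
          assume "0 < t"
          then have t: "0 < t" "t < T" using elim False by auto
          \<comment> \<open>For \<open>t < h\<close> the interval starts at the initial time, where the energy is zero by the initial condition.\<close>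
          define s where "s = max (t - h) 0"
          have s: "0 \<le> s" "s < t" "t \<le> T" using t h by (auto simp: s_def)
          have ints: "integrable lborel (\<lambda>x. W1 (x, s) - W2 (x, s))" if "0 < s"
            using elim(2) that by (auto simp: s_def u_def max_def split: if_splits)
          obtain Dv where Dv: "W1p_0 p \<Omega> (\<lambda>x. max (W1 (x, t) - W2 (x, t)) 0) Dv" using elim t by auto
          define L where "L z = A z \<bullet> b (fst z, t) + \<beta> z * trunc (u (fst z, t))" for z
          have it: "integrable lborel (\<lambda>x. W1 (x, t) - W2 (x, t))" using elim(1) by (simp add: u_def)
          have w: "W1p p \<Omega> (\<lambda>x. W1 (x, t)) (\<lambda>x. D1 (x, t))" "W1p p \<Omega> (\<lambda>x. W2 (x, t)) (\<lambda>x. D2 (x, t))" using elim t by auto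
          have Lint: "integrable lborel (\<lambda>z. indicator {s<..<t} (snd z) * L z)"
            and Lle: "(LINT x|lborel. prim (u (x, t))) - (if s = 0 then 0 else LINT x|lborel. prim (u (x, s)))
               + (LINT z|lborel. indicator {s<..<t} (snd z) * L z) \<le> 0"
            unfolding L_def A_def \<beta>_def b_def u_def by (rule frozen_test_inequality[OF p \<Omega> S1 S2 init s ints it w Dv]; assumption)+
          define g where "g z = norm (A z - A (fst z, t)) * norm (b (fst z, t)) + \<bar>\<beta> z - \<beta> (fst z, t)\<bar>" for z
          have Lg: "- L z \<le> 3 * K * prim (u (fst z, t)) + g z" for z
          proof -
            define y where "y = (fst z, t)"
            have 1: "0 \<le> A y \<bullet> b y"
              using flux_monotone[OF p, of "D1 y" "D2 y"] trunc'_bounds(1)[of "u y"] by (simp add: A_def b_def)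
            have 2: "- (A z \<bullet> b y) \<le> norm (A z - A y) * norm (b y) - A y \<bullet> b y"
              using Cauchy_Schwarz_ineq2[of "A z - A y" "b y"] by (simp add: inner_diff_left)
            have "- (\<beta> z * trunc (u y)) \<le> \<bar>\<beta> z\<bar> * trunc (u y)"
              using trunc_bounds(1)[of "u y"] by (metis abs_ge_minus_self minus_mult_left mult_right_mono)
            also have "\<dots> \<le> (\<bar>\<beta> z - \<beta> y\<bar> + \<bar>\<beta> y\<bar>) * trunc (u y)"
              using trunc_bounds(1)[of "u y"] by (intro mult_right_mono) auto
            also have "\<dots> \<le> \<bar>\<beta> z - \<beta> y\<bar> + K * (\<bar>u y\<bar> * trunc (u y))"
              using trunc_bounds[of "u y"] \<beta>K[of y] mult_right_mono[of "\<bar>\<beta> y\<bar>" "K * \<bar>u y\<bar>" "trunc (u y)"]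
              by (simp add: distrib_right mult_left_le \<beta>_def u_def add_mono mult.assoc)
            also have "\<bar>u y\<bar> * trunc (u y) = u y * trunc (u y)" by (simp add: trunc_def)
            also have "K * (u y * trunc (u y)) \<le> K * (3 * prim (u y))" by (intro mult_left_mono trunc_le_prim K)
            finally have 3: "- (\<beta> z * trunc (u y)) \<le> \<bar>\<beta> z - \<beta> y\<bar> + 3 * K * prim (u y)" by (simp add: mult_ac)
            show ?thesis using 1 2 3 unfolding L_def g_def y_def[symmetric] by simp
          qed
          have [measurable]: "(\<lambda>z::'a \<times> real. A (fst z, t)) \<in> borel_measurable borel" "(\<lambda>z::'a \<times> real. b (fst z, t)) \<in> borel_measurable borel"
             "(\<lambda>z::'a \<times> real. \<beta> (fst z, t)) \<in> borel_measurable borel" "(\<lambda>z::'a \<times> real. u (fst z, t)) \<in> borel_measurable borel"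
            by (rule measurable_compose[OF borel_measurable_fst]; measurable)+
          have Im: "(\<lambda>z::'a \<times> real. indicator {t - h<..<t} (snd z) :: ennreal) \<in> borel_measurable borel"
            by (rule measurable_compose[OF borel_measurable_snd]) measurable
          have [measurable]: "g \<in> borel_measurable borel" unfolding g_def[abs_def] by measurable
          have "ennreal (LINT z|lborel. - (indicator {s<..<t} (snd z) * L z)) \<le> (\<integral>\<^sup>+z. ennreal (- (indicator {s<..<t} (snd z) * L z)) \<partial>lborel)"
            using Lint by (intro integral_le_nn_integral) auto
          also have "\<dots> \<le> (\<integral>\<^sup>+z. indicator {t - h<..<t} (snd z) * (ennreal (3 * K) * ennreal (prim (u (fst z, t))) + ennreal (g z)) \<partial>lborel)"
          proof (rule nn_integral_mono)
            fix z :: "'a \<times> real"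
            show "ennreal (- (indicator {s<..<t} (snd z) * L z)) \<le> indicator {t - h<..<t} (snd z) * (ennreal (3 * K) * ennreal (prim (u (fst z, t))) + ennreal (g z))"
            proof (cases "snd z \<in> {s<..<t}")
              case True
              then have "snd z \<in> {t - h<..<t}" by (auto simp: s_def)
              moreover have "ennreal (- L z) \<le> ennreal (3 * K * prim (u (fst z, t)) + g z)" by (intro ennreal_leI Lg)
              moreover have "0 \<le> g z" by (simp add: g_def)
              ultimately show ?thesis using True K by (simp add: prim_bounds ennreal_mult)
            qed simp
          qed
          also have "\<dots> = (\<integral>\<^sup>+\<tau>. \<integral>\<^sup>+x. indicator {t - h<..<t} \<tau> * (ennreal (3 * K) * ennreal (prim (u (x, t))) + ennreal (g (x, \<tau>))) \<partial>lborel \<partial>lborel)"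
          proof -
            have "(\<lambda>z. ennreal (3 * K) * ennreal (prim (u (fst z, t))) + ennreal (g z)) \<in> borel_measurable borel" by measurable
            from nn_integral_slices[OF borel_measurable_times_ennreal[OF Im this]] show ?thesis by simp
          qed
          also have "\<dots> = (\<integral>\<^sup>+\<tau>. (ennreal (3 * K) * e t) * indicator {t - h<..<t} \<tau> + indicator {t - h<..<t} \<tau> * G t (\<tau> - t) \<partial>lborel)"
          proof (rule nn_integral_cong)
            fix \<tau> :: real
            have "(\<integral>\<^sup>+x. indicator {t - h<..<t} \<tau> * (ennreal (3 * K) * ennreal (prim (u (x, t))) + ennreal (g (x, \<tau>))) \<partial>lborel)
               = indicator {t - h<..<t} \<tau> * (ennreal (3 * K) * (\<integral>\<^sup>+x. ennreal (prim (u (x, t))) \<partial>lborel) + (\<integral>\<^sup>+x. ennreal (g (x, \<tau>)) \<partial>lborel))"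
              by (subst nn_integral_cmult, measurable, subst nn_integral_add, measurable, subst nn_integral_cmult, measurable)
            also have "(\<integral>\<^sup>+x. ennreal (g (x, \<tau>)) \<partial>lborel) = G t (\<tau> - t)" by (simp add: G_def g_def)
            finally show "(\<integral>\<^sup>+x. indicator {t - h<..<t} \<tau> * (ennreal (3 * K) * ennreal (prim (u (x, t))) + ennreal (g (x, \<tau>))) \<partial>lborel)
               = (ennreal (3 * K) * e t) * indicator {t - h<..<t} \<tau> + indicator {t - h<..<t} \<tau> * G t (\<tau> - t)"
              by (simp add: e_def distrib_left mult_ac)
          qed
          also have "\<dots> = (\<integral>\<^sup>+\<tau>. (ennreal (3 * K) * e t) * indicator {t - h<..<t} \<tau> \<partial>lborel) + (\<integral>\<^sup>+\<tau>. indicator {t - h<..<t} \<tau> * G t (\<tau> - t) \<partial>lborel)"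
            by (rule nn_integral_add) measurable
          also have "(\<integral>\<^sup>+\<tau>. (ennreal (3 * K) * e t) * indicator {t - h<..<t} \<tau> \<partial>lborel) = ennreal (3 * K * h) * e t"
          proof -
            have "(\<integral>\<^sup>+\<tau>. (ennreal (3 * K) * e t) * indicator {t - h<..<t} \<tau> \<partial>lborel) = ennreal (3 * K) * e t * ennreal h"
              using h by (subst nn_integral_cmult_indicator) auto
            then show ?thesis using h K by (simp add: ennreal_mult mult_ac)
          qed
          also have "(\<integral>\<^sup>+\<tau>. indicator {t - h<..<t} \<tau> * G t (\<tau> - t) \<partial>lborel) = (\<integral>\<^sup>+\<theta>. indicator {t - h<..<t} (\<theta> + t) * G t (\<theta> + t - t) \<partial>lborel)"
            by (rule nn_integral_translate[symmetric]) measurable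
          also have "\<dots> = \<rho> t"
            unfolding \<rho>_def by (intro nn_integral_cong) (auto simp: indicator_def)
          finally have rest: "ennreal (LINT z|lborel. - (indicator {s<..<t} (snd z) * L z)) \<le> ennreal (3 * K * h) * e t + \<rho> t" .
          have prev: "ennreal (if s = 0 then 0 else LINT x|lborel. prim (u (x, s))) \<le> e (t - h)"
            using eI[of "t - h"] elim(2) by (auto simp: s_def max_def)
          have "e t = ennreal (LINT x|lborel. prim (u (x, t)))" by (rule eI[OF elim(1)])
          also have "\<dots> \<le> ennreal ((if s = 0 then 0 else LINT x|lborel. prim (u (x, s))) + (LINT z|lborel. - (indicator {s<..<t} (snd z) * L z)))"
            using Lle by (intro ennreal_leI) simp
          also have "\<dots> \<le> ennreal (if s = 0 then 0 else LINT x|lborel. prim (u (x, s))) + ennreal (LINT z|lborel. - (indicator {s<..<t} (snd z) * L z))"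
            by (auto simp: ennreal_plus_if intro!: ennreal_leI)
          also have "\<dots> \<le> e (t - h) + (ennreal (3 * K * h) * e t + \<rho> t)" by (intro add_mono prev rest)
          finally show "e t \<le> e (t - h) + ennreal (3 * K * h) * e t + \<rho> t" by (simp add: add.assoc)
        qed
      qed
      show "\<exists>\<rho>. \<rho> \<in> borel_measurable borel \<and>
         (\<integral>\<^sup>+t. \<rho> t \<partial>lborel) \<le> ennreal (h * \<epsilon>) \<and> (AE t in lborel. 0 < t \<longrightarrow> e t \<le> e (t - h) + ennreal (3 * K * h) * e t + \<rho> t)"
        using \<rho>1 \<rho>2 by (intro exI[of _ \<rho>] conjI) auto
    qed
  qed
  then show ?thesis
  proof eventually_elim
    case (elim t)
    then have "AE x in lborel. ennreal (prim (u (x, t))) = 0"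
      unfolding e_def by (subst (asm) nn_integral_0_iff_AE) auto
    then have "AE x in lborel. x \<in> \<Omega> \<longrightarrow> W1 (x, t) \<le> W2 (x, t)"
    proof eventually_elim
      case (elim x)
      then have "prim (u (x, t)) \<le> 0" by (simp add: ennreal_eq_0_iff)
      then show ?case using prim_bounds(3)[of "u (x, t)"] by (simp add: u_def)
    qed
    then show ?case by simp
  qed
qed

lemma W1p_0_cong:
  assumes "\<And>x. x \<in> \<Omega> \<Longrightarrow> u x = u' x" and "W1p_0 p \<Omega> u Du"
  shows "W1p_0 p \<Omega> u' Du"
proof -
  have "W1p p \<Omega> u' Du" using assms W1p_cong[of \<Omega> u u' Du Du p] by (simp add: W1p_0_def)
  moreover have "W1p_norm p \<Omega> (\<lambda>x. u x - \<zeta> x) D = W1p_norm p \<Omega> (\<lambda>x. u' x - \<zeta> x) D" for \<zeta> D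
  proof -
    have "(LINT x:\<Omega>|lborel. \<bar>u x - \<zeta> x\<bar> powr p) = (LINT x:\<Omega>|lborel. \<bar>u' x - \<zeta> x\<bar> powr p)"
      unfolding set_lebesgue_integral_def using assms(1)
      by (intro Bochner_Integration.integral_cong) (auto simp: indicator_def)
    then show ?thesis by (simp add: W1p_norm_def)
  qed
  ultimately show ?thesis using assms(2) by (simp add: W1p_0_def)
qed

theorem theorem3p1:
  fixes \<Omega> :: "'a::euclidean_space set"
    and \<alpha> :: "'a \<Rightarrow> real \<Rightarrow> real"
    and w\<^sub>1 w\<^sub>2 :: "'a \<times> real \<Rightarrow> real"
    and p K :: real
    and T :: ereal
  assumes "1 < p"
    and "bounded_smooth_domain \<Omega>"
    and "continuous_on (\<Omega> \<times> UNIV) (\<lambda>(x, r). \<alpha> x r)"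
    and "0 \<le> K"
    and "\<forall>x\<in>\<Omega>. \<forall>r\<ge>0. 0 \<le> \<alpha> x r \<and> \<alpha> x r \<le> K * r"
    and "\<forall>x\<in>\<Omega>. \<forall>r\<^sub>1 r\<^sub>2. \<bar>\<alpha> x r\<^sub>2 - \<alpha> x r\<^sub>1\<bar> \<le> K * \<bar>r\<^sub>2 - r\<^sub>1\<bar>"
    and "0 < T"
    and "weak_subsolution p \<alpha> \<Omega> T w\<^sub>1"
    and "weak_supersolution p \<alpha> \<Omega> T w\<^sub>2"
    and "le_on_parabolic_boundary p \<Omega> T w\<^sub>1 w\<^sub>2"
  shows "\<forall>t. 0 < t \<and> ereal t < T \<longrightarrow> (AE x in lborel. x \<in> \<Omega> \<longrightarrow> w\<^sub>1 (x, t) \<le> w\<^sub>2 (x, t))"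
proof (intro allI impI)
  fix t assume t: "0 < t \<and> ereal t < T"
  have dom: "bounded \<Omega>" "open \<Omega>" "connected \<Omega>" using assms(2) by (auto simp: bounded_smooth_domain_def)
  obtain S where S: "t < S" "ereal S \<le> T" "weak_ineq (\<le>) p \<alpha> \<Omega> S w\<^sub>1" "weak_ineq (\<ge>) p \<alpha> \<Omega> S w\<^sub>2"
  proof (cases "T = \<infinity>")
    case True
    have "0 < t + 1" using t by simp
    then show ?thesis using that[of "t + 1"] assms(8,9) True by (simp add: weak_subsolution_def weak_supersolution_def)
  next
    case False
    then have T: "T = ereal (real_of_ereal T)" using assms(7) by (cases T) auto
    have "t < real_of_ereal T" using t by (subst (asm) T) simp
    moreover have "ereal (real_of_ereal T) \<le> T" using T by simp
    ultimately show ?thesis using that[of "real_of_ereal T"] assms(8,9) False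
      by (simp add: weak_subsolution_def weak_supersolution_def)
  qed
  have S0: "0 < S" using t S by simp
  have \<alpha>K: "\<bar>\<alpha> x r\<bar> \<le> K * \<bar>r\<bar>" if "x \<in> \<Omega>" for x r
  proof -
    have "\<alpha> x 0 = 0" using assms(5) that by force
    then show ?thesis using assms(6)[rule_format, OF that, of r 0] by simp
  qed
  obtain W1 D1 \<beta>1 where 1: "solution_data (\<le>) p \<Omega> S K W1 D1 \<beta>1" "\<And>x t. x \<in> \<Omega> \<Longrightarrow> t \<in> {0..S} \<Longrightarrow> W1 (x, t) = w\<^sub>1 (x, t)"
    "\<And>x t. x \<in> \<Omega> \<Longrightarrow> t \<in> {0<..<S} \<Longrightarrow> \<beta>1 (x, t) = \<alpha> x (W1 (x, t))"
    using solution_data_of_weak_ineq[OF assms(1) dom assms(3,4) \<alpha>K S0 S(3)] by blast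
  obtain W2 D2 \<beta>2 where 2: "solution_data (\<ge>) p \<Omega> S K W2 D2 \<beta>2" "\<And>x t. x \<in> \<Omega> \<Longrightarrow> t \<in> {0..S} \<Longrightarrow> W2 (x, t) = w\<^sub>2 (x, t)"
    "\<And>x t. x \<in> \<Omega> \<Longrightarrow> t \<in> {0<..<S} \<Longrightarrow> \<beta>2 (x, t) = \<alpha> x (W2 (x, t))"
    using solution_data_of_weak_ineq[OF assms(1) dom assms(3,4) \<alpha>K S0 S(4)] by blast
  have \<beta>0: "\<beta>1 (x, t) = 0 \<and> \<beta>2 (x, t) = 0" if "x \<notin> \<Omega> \<or> t \<notin> {0<..<S}" for x t
    using 1(1) 2(1) that unfolding solution_data_def by blast
  have \<beta>K: "\<bar>\<beta>1 z - \<beta>2 z\<bar> \<le> K * \<bar>W1 z - W2 z\<bar>" for z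
  proof (cases "fst z \<in> \<Omega> \<and> snd z \<in> {0<..<S}")
    case True
    then show ?thesis using 1(3)[of "fst z" "snd z"] 2(3)[of "fst z" "snd z"] assms(6) by simp
  next
    case False
    then show ?thesis using \<beta>0[of "fst z" "snd z"] assms(4) by auto
  qed
  have cl: "AE x in lborel. x \<in> closure \<Omega> \<longrightarrow> w\<^sub>1 (x, 0) \<le> w\<^sub>2 (x, 0)"
    and lat: "AE t in lborel. 0 < t \<and> ereal t < T \<longrightarrow> (\<exists>D. W1p_0 p \<Omega> (\<lambda>x. max (w\<^sub>1 (x, t) - w\<^sub>2 (x, t)) 0) D)"
    using assms(10) by (auto simp: le_on_parabolic_boundary_def)
  have init: "AE x in lborel. x \<in> \<Omega> \<longrightarrow> W1 (x, 0) \<le> W2 (x, 0)"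
    using cl
  proof eventually_elim
    case (elim x)
    then show ?case using 1(2)[of x 0] 2(2)[of x 0] S0 closure_subset[of \<Omega>] by auto
  qed
  have "AE t in lborel. t \<in> {0<..<S} \<longrightarrow> (\<exists>D. W1p_0 p \<Omega> (\<lambda>x. max (W1 (x, t) - W2 (x, t)) 0) D)"
    using lat
  proof eventually_elim
    case (elim t)
    show ?case
    proof
      assume t: "t \<in> {0<..<S}"
      then have "ereal t < T" using S(2) by (auto intro: less_le_trans[of _ "ereal S"])
      then obtain D where D: "W1p_0 p \<Omega> (\<lambda>x. max (w\<^sub>1 (x, t) - w\<^sub>2 (x, t)) 0) D" using elim t by auto
      have "W1p_0 p \<Omega> (\<lambda>x. max (W1 (x, t) - W2 (x, t)) 0) D"
        by (rule W1p_0_cong[OF _ D]) (use 1(2) 2(2) t in auto)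
      then show "\<exists>D. W1p_0 p \<Omega> (\<lambda>x. max (W1 (x, t) - W2 (x, t)) 0) D" by blast
    qed
  qed
  then have "AE t in lborel. t \<in> {0<..<S} \<longrightarrow> (AE x in lborel. x \<in> \<Omega> \<longrightarrow> W1 (x, t) \<le> W2 (x, t))"
    by (rule comparison_almost_every_time[OF assms(1) dom(1,2) assms(4) 1(1) 2(1) \<beta>K init])
  then have "AE x in lborel. x \<in> \<Omega> \<longrightarrow> W1 (x, t) \<le> W2 (x, t)"
    by (rule comparison_every_time[OF dom(2) 1(1) 2(1)]) (use t S in auto)
  then show "AE x in lborel. x \<in> \<Omega> \<longrightarrow> w\<^sub>1 (x, t) \<le> w\<^sub>2 (x, t)"
  proof eventually_elim
    case (elim x)
    then show ?case using 1(2)[of x t] 2(2)[of x t] t S by auto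
  qed
qed

end
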